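(* Let $d\in\mathbb{N}$ and $\beta>0$. Let $\mu$ be a probability distribution supported on $[0,1]^d$, let $\nu$ be an absolutely continuous probability distribution on $\mathbb{R}$, and let the evaluation class be $\mathcal{H}=\mathcal{H}^\beta(\mathbb{R}^d)$. Then there exist a generator class $\mathcal{G}=\{g\in \mathcal{NN}(W_1,L_1): g(\mathbb{R})\subseteq[0,1]^d\}$ (networks $\mathbb{R}\to\mathbb{R}^d$) with $$W_1^2L_1\lesssim n,$$ and a discriminator class $\mathcal{F}=\mathcal{NN}(W_2,L_2)\cap \mathrm{Lip}(\mathbb{R}^d,K,1)$ (networks $\mathbb{R}^d\to\mathbb{R}$) with $$W_2L_2\lesssim n^{1/2}\log^2 n,\qquad K\lesssim (\widetilde W_2\widetilde L_2)^{2+\max(4\beta-4,0)/d}\,\widetilde L_2\, 2^{\widetilde L_2^2},$$ where $\widetilde W_2=W_2/\log_2W_2$ and $\widetilde L_2=L_2/\log_2 L_2$, such that for every $\epsilon_{opt}\ge 0$, every GAN estimator $g_n^*$ (defined below) satisfies $$\mathbb{E}[d_{\mathcal{H}}(\mu,(g_n^* )_\#\nu)]-\epsilon_{opt}\lesssim n^{-\beta/d}\lor n^{-1/2}\log^{c(\beta,d)}n,$$ where $c(\beta,d)=1$ if $2\beta=d$ and $c(\beta,d)=0$ otherwise. If furthermore $m\gtrsim n^{2+2\beta/d}\log^6 n$, then every GAN estimator $g_{n,m}^*$ satisfies $$\mathbb{E}[d_{\mathcal{H}}(\mu,(g_{n,m}^* )_\#\nu)]-\epsilon_{opt}\lesssim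 n^{-\beta/d}\lor n^{-1/2}\log^{c(\beta,d)}n.$$
   Context: Notation: $A\lesssim B$ (resp. $A\gtrsim B$) means $A\le CB$ (resp. $A\ge CB$) for a constant $C>0$ not depending on $n$, $m$ or $\epsilon_{opt}$; $a\lor b=\max(a,b)$. $\sigma(x)=\max(x,0)$ is the ReLU. $\mathcal{NN}(W,L)$ denotes the set of functions $\phi(x)=T_L(\sigma(T_{L-1}(\cdots\sigma(T_0(x))\cdots)))$ with affine maps $T_l(x)=A_lx+b_l$, $A_l\in\mathbb{R}^{N_{l+1}\times N_l}$, ReLU applied componentwise, with width $\max\{N_1,\dots,N_L\}\le W$ and depth at most $L$ (input/output dimensions as specified). For $\mathcal{X}\subseteq\mathbb{R}^d$, $\mathrm{Lip}(\mathcal{X},K,B)$ is the set of $h:\mathcal{X}\to\mathbb{R}$ with $|h(x)-h(y)|\le K\|x-y\|_2$ for all $x,y$ and $\sup_{\mathcal{X}}|h|\le B$. For $\beta=s+r$ with $s\in\mathbb{N}_0$, $r\in(0,1]$, the Hölder class $\mathcal{H}^\beta(\mathbb{R}^d)$ is the set of $h:\mathbb{R}^d\to\mathbb{R}$ with $\max_{\|\alpha\|_1\le s}\|\partial^\alpha h\|_\infty\le1$ and $\max_{\|\alpha\|_1=s}\sup_{x\ne y}|\partial^\alpha h(x)-\partial^\alpha h(y)|/\|x-y\|_2^r\le1$. For a class $\mathcal{F}$ of functions, the integral probability metric is $d_{\mathcal{F}}(\mu,\gamma)=\sup_{f\in\mathcal{F}}\mathbb{E}_{\mu}[f]-\mathbb{E}_{\gamma}[f]$.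 For $g:\mathbb{R}\to\mathbb{R}^d$, $g_\#\nu(A)=\nu(g^{-1}(A))$. Data: $X_1,\dots,X_n$ i.i.d. from $\mu$, $Z_1,\dots,Z_m$ i.i.d. from $\nu$ (independent), $\widehat\mu_n=\frac1n\sum_i\delta_{X_i}$, $\widehat\nu_m=\frac1m\sum_j\delta_{Z_j}$. For $\epsilon_{opt}\ge0$, a GAN estimator $g_n^*$ is any $g\in\mathcal{G}$ with $d_{\mathcal{F}}(\widehat\mu_n,g_\#\nu)\le\inf_{\phi\in\mathcal{G}}d_{\mathcal{F}}(\widehat\mu_n,\phi_\#\nu)+\epsilon_{opt}$, and $g_{n,m}^*$ is any $g\in\mathcal{G}$ with $d_{\mathcal{F}}(\widehat\mu_n,g_\#\widehat\nu_m)\le\inf_{\phi\in\mathcal{G}}d_{\mathcal{F}}(\widehat\mu_n,\phi_\#\widehat\nu_m)+\epsilon_{opt}$. Expectations are over the samples. *)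

theory Defs
  imports "HOL-Probability.Probability"
begin

definition relu :: "real \<Rightarrow> real" where
  "relu x = max x 0"

definition relu_vec :: "(nat \<Rightarrow> real) \<Rightarrow> (nat \<Rightarrow> real)" where
  "relu_vec v = (\<lambda>j. relu (v j))"

text \<open>Hidden part of a network. The list of widths [N_1,...,N_L] is paired with the
  hidden affine maps T_1,...,T_(L-1); T_l maps R^(N_l) to R^(N_(l+1)) and is given by a
  matrix A and a bias b (entries outside the relevant index ranges are never read).\<close>
fun nn_hid :: "nat list \<Rightarrow> ((nat \<Rightarrow> nat \<Rightarrow> real) \<times> (nat \<Rightarrow> real)) list
                 \<Rightarrow> (nat \<Rightarrow> real) \<Rightarrow> (nat \<Rightarrow> real)" where
  "nn_hid (n # ns) ((A, b) # Ts) v =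
     nn_hid ns Ts (relu_vec (\<lambda>j. (\<Sum>i<n. A j i * v i) + b j))"
| "nn_hid _ _ v = v"

text \<open>NN(W,L): functions T_L o sigma o T_(L-1) o ... o sigma o T_0 with at most L
  ReLU layers, all hidden widths at most W. T_0 x = (a_j . x + c_j)_j (general affine map
  from the input space to R^(N_1)), T_L v = sum_(i<N_L) v_i w_i + e (general affine map
  from R^(N_L) to the output space). Depth 0 means a single affine map.\<close>
definition nn_class :: "nat \<Rightarrow> nat \<Rightarrow> ('a::real_inner \<Rightarrow> 'b::real_vector) set" where
  "nn_class W L = {\<phi>.
     (\<exists>f e. linear f \<and> \<phi> = (\<lambda>x. f x + e)) \<or>
     (\<exists>(N::nat list) Ts (a::nat \<Rightarrow> 'a) c (w::nat \<Rightarrow> 'b) e.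
        N \<noteq> [] \<and> length N \<le> L \<and> length Ts + 1 = length N \<and> (\<forall>n\<in>set N. n \<le> W) \<and>
        \<phi> = (\<lambda>x. (\<Sum>i<last N. nn_hid N Ts (relu_vec (\<lambda>j. inner (a j) x + c j)) i *\<^sub>R w i) + e))}"

definition lip_class :: "real \<Rightarrow> real \<Rightarrow> ('a::metric_space \<Rightarrow> real) set" where
  "lip_class K B = {h. (\<forall>x y. \<bar>h x - h y\<bar> \<le> K * dist x y) \<and> (\<forall>x. \<bar>h x\<bar> \<le> B)}"

definition pd :: "'d::finite \<Rightarrow> (real^'d \<Rightarrow> real) \<Rightarrow> real^'d \<Rightarrow> real" where
  "pd i f x = deriv (\<lambda>t. f (x + t *\<^sub>R axis i 1)) 0"

fun pdl :: "'d::finite list \<Rightarrow> (real^'d \<Rightarrow> real) \<Rightarrow> real^'d \<Rightarrow> real" where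
  "pdl [] f = f"
| "pdl (i # js) f = pd i (pdl js f)"

text \<open>beta = s + r with s in N_0, r in (0,1].\<close>
definition holder_s :: "real \<Rightarrow> nat" where
  "holder_s \<beta> = nat (\<lceil>\<beta>\<rceil> - 1)"

definition holder_r :: "real \<Rightarrow> real" where
  "holder_r \<beta> = \<beta> - real (holder_s \<beta>)"

definition holder_class :: "real \<Rightarrow> (real^'d::finite \<Rightarrow> real) set" where
  "holder_class \<beta> = {h.
     (\<forall>js i x. length js < holder_s \<beta> \<longrightarrow>
        (\<lambda>t. pdl js h (x + t *\<^sub>R axis i 1)) differentiable (at 0)) \<and>
     (\<forall>js x. length js \<le> holder_s \<beta> \<longrightarrow> \<bar>pdl js h x\<bar> \<le> 1) \<and>
     (\<forall>js x y. length js = holder_s \<beta> \<longrightarrow> x \<noteq> y \<longrightarrow>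
        \<bar>pdl js h x - pdl js h y\<bar> / norm (x - y) powr holder_r \<beta> \<le> 1)}"

definition ipm :: "('a \<Rightarrow> real) set \<Rightarrow> 'a measure \<Rightarrow> 'a measure \<Rightarrow> ereal" where
  "ipm F P Q = (SUP f\<in>F. ereal ((\<integral>x. f x \<partial>P) - (\<integral>x. f x \<partial>Q)))"

definition emp :: "(nat \<Rightarrow> 'a) \<Rightarrow> nat \<Rightarrow> 'a measure" where
  "emp X n = measure_pmf (map_pmf X (pmf_of_set {0..<n}))"

text \<open>Expectation over the samples, taken as outer expectation so that it is defined
  for arbitrary (possibly non-measurable) estimator selections; it coincides with the
  usual expectation for measurable ones.\<close>
definition outer_exp :: "'a measure \<Rightarrow> ('a \<Rightarrow> ereal) \<Rightarrow> ennreal" where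
  "outer_exp M f = (INF h\<in>{h \<in> borel_measurable M. \<forall>x\<in>space M. e2ennreal (f x) \<le> h x}.
                      \<integral>\<^sup>+x. h x \<partial>M)"

definition rate :: "real \<Rightarrow> nat \<Rightarrow> nat \<Rightarrow> real" where
  "rate \<beta> d n = max (real n powr (- \<beta> / real d))
                     (real n powr (-1/2) * ln (real n) ^ (if 2 * \<beta> = real d then 1 else 0))"

end

theory Submission imports Defs "HOL-Computational_Algebra.Polynomial" begin

text \<open>
  Generators: two ReLU layers of width of order \<open>sqrt n\<close> can send disjoint quantile intervals of \<open>\<nu>\<close>, of total mass
  close to 1, to the \<open>n\<close> sample points, so the empirical measure is matched up to any tolerance.
  Discriminators: a two-scale tensor Lagrange interpolation, with the cells of the coarse scale folded onto each other,
  approximates every Hoelder function within \<open>n powr (- \<beta> / d)\<close> and is Lipschitz with a constant of order \<open>n\<close>.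
  Sampling from \<open>\<mu>\<close>: expanding a Hoelder function in dyadic interpolation corrections bounds its deviation by an
  explicit measurable function of the sample, and the variances of the corrections sum up to the rate.
  Sampling from \<open>\<nu>\<close>: a generator is piecewise affine on the line with \<open>O(n)\<close> pieces, so a discriminator composed with it
  has variation \<open>O(n\<^sup>2)\<close>; a telescoping along dyadic quantiles of \<open>\<nu>\<close> then controls the deviation uniformly.
\<close>

section \<open>ReLU networks\<close>

text \<open>The risk splits along the empirical measure: sampling error of \<mu>, twice the
  approximation error of the discriminators, the fit of the best generator, \<epsilon>, and for the
  sampled estimator two deviations under \<nu>. The obstacle is the size of the discriminators.
  Accuracy \<open>n powr (- \<beta> / d)\<close> takes about n nodal values, while width times depth
  may only be of order sqrt n; so nearly all values have to sit in one dense weight matrix. Their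
  slope must stay polynomial as well: a generator may depend on the latent sample, and the only
  uniform control over such compositions is their variation V. The requirement on m is what makes
  \<open>sqrt (V / m)\<close>, times the number of levels, fall below
  \<open>n powr (- \<beta> / d)\<close> when V is of order n squared. A continuous generator cannot
  in general push a law without atoms to n atoms exactly, so some mass is reserved for moving
  between sample points; it can be as small as desired without enlarging the network. Estimators are
  arbitrary selections, so every risk is first bounded pointwise by a measurable function and only
  then integrated.\<close>

definition aff_span :: "('a \<Rightarrow> real) set \<Rightarrow> ('a \<Rightarrow> real) set" where
  "aff_span S = {\<lambda>x. (\<Sum>g\<in>S. A g * g x) + b | A b. True}"

lemma aff_spanI: "f = (\<lambda>x. (\<Sum>g\<in>S. A g * g x) + b) \<Longrightarrow> f \<in> aff_span S"
  unfolding aff_span_def by (rule CollectI, rule exI[of _ A], rule exI[of _ b]) simp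

lemma aff_span_const: "(\<lambda>x. c) \<in> aff_span S"
  unfolding aff_span_def by (rule CollectI, rule exI[of _ "\<lambda>_. 0"], rule exI[of _ c]) auto

lemma aff_span_incl:
  assumes "finite S" "f \<in> S" shows "f \<in> aff_span S"
proof -
  have "(\<Sum>g\<in>S. (if g = f then 1 else 0) * g x) + 0 = f x" for x
    using assms by (simp add: if_distrib[of "\<lambda>t. t * _"] cong: if_cong)
  then have "f = (\<lambda>x. (\<Sum>g\<in>S. (if g = f then 1 else 0) * g x) + 0)" by auto
  then show ?thesis by (rule aff_spanI)
qed

lemma aff_span_add:
  assumes "f \<in> aff_span S" "g \<in> aff_span S" shows "(\<lambda>x. f x + g x) \<in> aff_span S"
proof -
  obtain A b A' b' where "f = (\<lambda>x. (\<Sum>g\<in>S. A g * g x) + b)" "g = (\<lambda>x. (\<Sum>g\<in>S. A' g * g x) + b')"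
    using assms unfolding aff_span_def by auto
  then have "(\<lambda>x. f x + g x) = (\<lambda>x. (\<Sum>g\<in>S. (A g + A' g) * g x) + (b + b'))"
    by (auto simp: sum.distrib algebra_simps)
  then show ?thesis by (rule aff_spanI)
qed

lemma aff_span_scale:
  assumes "f \<in> aff_span S" shows "(\<lambda>x. c * f x) \<in> aff_span S"
proof -
  obtain A b where "f = (\<lambda>x. (\<Sum>g\<in>S. A g * g x) + b)"
    using assms unfolding aff_span_def by auto
  then have "(\<lambda>x. c * f x) = (\<lambda>x. (\<Sum>g\<in>S. (c * A g) * g x) + (c * b))"
    by (auto simp: sum_distrib_left algebra_simps)
  then show ?thesis by (rule aff_spanI)
qed

lemma aff_span_sum:
  assumes "\<And>i. i \<in> I \<Longrightarrow> f i \<in> aff_span S" shows "(\<lambda>x. \<Sum>i\<in>I. f i x) \<in> aff_span S"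
  using assms
proof (induction I rule: infinite_finite_induct)
  case (insert i I)
  then show ?case using aff_span_add[of "f i" S "\<lambda>x. \<Sum>i\<in>I. f i x"] by simp
qed (auto simp: aff_span_const)

lemma aff_span_diff:
  assumes "f \<in> aff_span S" "g \<in> aff_span S" shows "(\<lambda>x. f x - g x) \<in> aff_span S"
  using aff_span_add[OF assms(1) aff_span_scale[OF assms(2), of "-1"]] by simp

lemma aff_span_trans:
  assumes "U \<subseteq> aff_span S" "v \<in> aff_span U" shows "v \<in> aff_span S"
proof -
  obtain A b where v: "v = (\<lambda>x. (\<Sum>g\<in>U. A g * g x) + b)"
    using assms unfolding aff_span_def by auto
  show ?thesis unfolding v
    by (intro aff_span_add aff_span_sum aff_span_scale aff_span_const) (use assms in auto)
qed

lemma aff_span_mono: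
  assumes "S \<subseteq> S'" "finite S'" shows "aff_span S \<subseteq> aff_span S'"
  using aff_span_trans[of S S'] aff_span_incl[OF assms(2)] assms by blast

text \<open>\<open>S\<close> collects the functions computed by the neurons of layer
  \<open>L\<close>. Weights stay hidden behind existentials, so networks are combined through
  closure rules of \<open>aff_span\<close> instead of index bookkeeping in matrices; equal neurons
  merge and only the cardinality is bounded.\<close>

inductive relu_layer :: "nat \<Rightarrow> nat \<Rightarrow> ('a::real_inner \<Rightarrow> real) set \<Rightarrow> bool" for W where
  first: "finite S \<Longrightarrow> card S \<le> W \<Longrightarrow> (\<And>f. f \<in> S \<Longrightarrow> \<exists>a c. f = (\<lambda>x. relu (inner a x + c)))
    \<Longrightarrow> relu_layer W (Suc 0) S"
| next_layer: "relu_layer W L S \<Longrightarrow> finite S' \<Longrightarrow> card S' \<le> W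
    \<Longrightarrow> (\<And>f. f \<in> S' \<Longrightarrow> \<exists>g\<in>aff_span S. f = (\<lambda>x. relu (g x))) \<Longrightarrow> relu_layer W (Suc L) S'"

lemma relu_layer_finite: "relu_layer W L S \<Longrightarrow> finite S"
  by (induction rule: relu_layer.induct) auto

text \<open>\<open>nn_hid\<close> peels off the first layer, while networks here grow at the output
  end; this links the two recursions.\<close>

lemma nn_hid_snoc:
  assumes "length Ts + 1 = length N"
  shows "nn_hid (N @ [k]) (Ts @ [(A, b)]) v
    = relu_vec (\<lambda>j. (\<Sum>i<last N. A j i * nn_hid N Ts v i) + b j)"
  using assms
proof (induction N Ts v rule: nn_hid.induct)
  case (1 n ns A' b' Ts v)
  then show ?case by (cases ns) auto
next
  case ("2_1" v0 v)
  then show ?case by simp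
next
  case ("2_2" v v0)
  then show ?case by (cases v) (auto simp: neq_Nil_conv length_Suc_conv)
qed

text \<open>Matrices are recovered by enumerating each layer: \<open>idx\<close> numbers its
  neurons, and the coefficients of the affine combinations become matrix entries.\<close>

lemma relu_layer_realize:
  fixes S :: "('a::real_inner \<Rightarrow> real) set"
  assumes "relu_layer W L S"
  shows "\<exists>N Ts (a::nat \<Rightarrow> 'a) c idx. N \<noteq> [] \<and> length N = L \<and> length Ts + 1 = length N
    \<and> (\<forall>n\<in>set N. n \<le> W) \<and> last N = card S \<and> bij_betw idx {..<card S} S
    \<and> (\<forall>x. \<forall>i<card S. nn_hid N Ts (relu_vec (\<lambda>j. inner (a j) x + c j)) i = idx i x)"
  using assms
proof (induction rule: relu_layer.induct)
  case (first S)
  obtain idx where idx: "bij_betw idx {..<card S} S"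
    using ex_bij_betw_nat_finite[OF first(1)] by (auto simp: atLeast0LessThan)
  have "\<exists>a c. idx i = (\<lambda>x. relu (inner a x + c))" if "i < card S" for i
    using first(3)[of "idx i"] idx that by (auto simp: bij_betw_def)
  then obtain a c where ac: "\<And>i. i < card S \<Longrightarrow> idx i = (\<lambda>x. relu (inner (a i) x + c i))"
    by metis
  show ?case
    by (rule exI[of _ "[card S]"], rule exI[of _ "[]"], rule exI[of _ a], rule exI[of _ c], rule exI[of _ idx])
       (use idx ac first(2) in \<open>auto simp: relu_vec_def\<close>)
next
  case (next_layer L S S')
  then obtain N Ts and a :: "nat \<Rightarrow> 'a" and c idx where IH: "N \<noteq> []" "length N = L" "length Ts + 1 = length N"
    "\<forall>n\<in>set N. n \<le> W" "last N = card S" "bij_betw idx {..<card S} S"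
    and val: "\<And>x i. i < card S \<Longrightarrow> nn_hid N Ts (relu_vec (\<lambda>j. inner (a j) x + c j)) i = idx i x"
    by blast
  obtain idx' where idx': "bij_betw idx' {..<card S'} S'"
    using ex_bij_betw_nat_finite[OF next_layer(2)] by (auto simp: atLeast0LessThan)
  have "\<exists>A b. idx' i = (\<lambda>x. relu ((\<Sum>g\<in>S. A g * g x) + b))" if "i < card S'" for i
  proof -
    have "idx' i \<in> S'" using idx' that by (auto simp: bij_betw_def)
    from next_layer(4)[OF this] show ?thesis unfolding aff_span_def by fastforce
  qed
  then obtain A b where Ab: "\<And>i. i < card S' \<Longrightarrow> idx' i = (\<lambda>x. relu ((\<Sum>g\<in>S. A i g * g x) + b i))"
    by metis
  have sum: "(\<Sum>i<card S. A j (idx i) * idx i x) = (\<Sum>g\<in>S. A j g * g x)" for j x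
    by (rule sum.reindex_bij_betw[OF IH(6)])
  show ?case
  proof (rule exI[of _ "N @ [card S']"], rule exI[of _ "Ts @ [((\<lambda>j i. A j (idx i)), b)]"],
      rule exI[of _ a], rule exI[of _ c], rule exI[of _ idx'], intro conjI)
    show "\<forall>x. \<forall>i<card S'. nn_hid (N @ [card S']) (Ts @ [(\<lambda>j i. A j (idx i), b)])
          (relu_vec (\<lambda>j. inner (a j) x + c j)) i = idx' i x"
      unfolding nn_hid_snoc[OF IH(3)] IH(5)
      by (auto simp: relu_vec_def val[unfolded relu_vec_def] sum Ab)
  qed (use IH next_layer idx' in auto)
qed

lemma relu_layer_nn_class:
  fixes S :: "('a::real_inner \<Rightarrow> real) set" and w :: "('a \<Rightarrow> real) \<Rightarrow> 'b::real_vector"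
  assumes "relu_layer W L S" "L \<le> L'"
  shows "(\<lambda>x. (\<Sum>g\<in>S. g x *\<^sub>R w g) + e) \<in> nn_class W L'"
proof -
  obtain N Ts and a :: "nat \<Rightarrow> 'a" and c idx where R: "N \<noteq> []" "length N = L" "length Ts + 1 = length N"
    "\<forall>n\<in>set N. n \<le> W" "last N = card S" "bij_betw idx {..<card S} S"
    and val: "\<And>x i. i < card S \<Longrightarrow> nn_hid N Ts (relu_vec (\<lambda>j. inner (a j) x + c j)) i = idx i x"
    using relu_layer_realize[OF assms(1)] by blast
  have "(\<lambda>x. (\<Sum>g\<in>S. g x *\<^sub>R w g) + e) = (\<lambda>x. (\<Sum>i<last N. nn_hid N Ts (relu_vec (\<lambda>j. inner (a j) x + c j)) i *\<^sub>R w (idx i)) + e)"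
    unfolding R(5) by (rule ext) (simp add: val flip: sum.reindex_bij_betw[OF R(6)])
  then show ?thesis
    unfolding nn_class_def using R assms(2)
    by (intro CollectI disjI2 exI[of _ N] exI[of _ Ts] exI[of _ a] exI[of _ c] exI[of _ "\<lambda>i. w (idx i)"] exI[of _ e]) auto
qed

text \<open>Members of \<open>U\<close> need not be neurons, only affine combinations of the last
  layer. Such combinations are absorbed by the next affine map, so sums, rescalings and readouts
  cost no layer.\<close>

definition net :: "nat \<Rightarrow> nat \<Rightarrow> ('a::real_inner \<Rightarrow> real) set \<Rightarrow> bool" where
  "net W L U \<longleftrightarrow> (\<exists>S. relu_layer W L S \<and> U \<subseteq> aff_span S)"

lemma relu_layer_mono: "relu_layer W L S \<Longrightarrow> W \<le> W' \<Longrightarrow> relu_layer W' L S"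
  by (induction rule: relu_layer.induct) (auto intro: relu_layer.intros)

text \<open>Networks run side by side: widths add, but only at equal depth. Shallower parts are
  brought to the common depth with \<open>net_pass\<close>.\<close>

lemma relu_layer_Un:
  "relu_layer W L S \<Longrightarrow> relu_layer W' L S' \<Longrightarrow> relu_layer (W + W') L (S \<union> S')"
proof (induction arbitrary: S' rule: relu_layer.induct)
  case (first S)
  from first.prems have "finite S'" "card S' \<le> W'" "\<And>f. f \<in> S' \<Longrightarrow> \<exists>a c. f = (\<lambda>x. relu (inner a x + c))"
    by (auto elim: relu_layer.cases)
  with first show ?case
    by (intro relu_layer.first) (auto intro: order.trans[OF card_Un_le] add_mono)
next
  case (next_layer L S T)
  have "L > 0" using next_layer(1) by (auto elim: relu_layer.cases)
  with next_layer.prems obtain S0 where S0: "relu_layer W' L S0" "finite S'" "card S' \<le> W'"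
    "\<And>f. f \<in> S' \<Longrightarrow> \<exists>g\<in>aff_span S0. f = (\<lambda>x. relu (g x))"
    by (auto elim: relu_layer.cases)
  have "aff_span S \<subseteq> aff_span (S \<union> S0)" "aff_span S0 \<subseteq> aff_span (S \<union> S0)"
    using relu_layer_finite[OF S0(1)] relu_layer_finite[OF next_layer(1)] by (rule_tac aff_span_mono; simp)+
  with next_layer S0 show ?case
    by (intro relu_layer.next_layer[OF next_layer(5)[OF S0(1)]])
       (auto intro: order.trans[OF card_Un_le] add_mono, blast+)
qed

lemma net_mono:
  assumes "net W L U" "W \<le> W'" "U' \<subseteq> U" shows "net W' L U'"
  using assms relu_layer_mono unfolding net_def by blast

lemma net_Un:
  assumes "net W L U" "net W' L U'" shows "net (W + W') L (U \<union> U')"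
proof -
  obtain S S' where S: "relu_layer W L S" "U \<subseteq> aff_span S" "relu_layer W' L S'" "U' \<subseteq> aff_span S'"
    using assms unfolding net_def by blast
  have "aff_span S \<subseteq> aff_span (S \<union> S')" "aff_span S' \<subseteq> aff_span (S \<union> S')"
    using relu_layer_finite[OF S(1)] relu_layer_finite[OF S(3)] by (rule_tac aff_span_mono; simp)+
  then show ?thesis unfolding net_def using relu_layer_Un[OF S(1,3)] S by blast
qed

lemma net_aff:
  assumes "net W L U" "\<And>v. v \<in> V \<Longrightarrow> v \<in> aff_span U" shows "net W L V"
  using assms aff_span_trans unfolding net_def by blast

lemma net_relu:
  assumes "net W L U" "finite V" "card V \<le> W'" "\<And>v. v \<in> V \<Longrightarrow> \<exists>u\<in>aff_span U. v = (\<lambda>x. relu (u x))"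
  shows "net (max W W') (Suc L) V"
proof -
  obtain S where S: "relu_layer W L S" "U \<subseteq> aff_span S" using assms unfolding net_def by blast
  have "relu_layer (max W W') (Suc L) V"
    using assms aff_span_trans[OF S(2)]
    by (intro relu_layer.next_layer[OF relu_layer_mono[OF S(1)]]) fastforce+
  then show ?thesis unfolding net_def using aff_span_incl assms(2) by blast
qed

lemma net_first:
  assumes "finite V" "card V \<le> W" "\<And>v. v \<in> V \<Longrightarrow> \<exists>a c. v = (\<lambda>x. relu (inner a x + c))"
  shows "net W (Suc 0) V"
  unfolding net_def using relu_layer.first[OF assms] aff_span_incl[OF assms(1)] by blast

text \<open>The rule for building a layer by hand: the neurons are the ReLUs of the
  \<open>f i\<close>, and everything affine in their outputs is available afterwards.\<close>

lemma net_aff_relu: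
  assumes "net W L U" "finite I" "card I \<le> W'" "\<And>i. i \<in> I \<Longrightarrow> f i \<in> aff_span U"
    and "\<And>v. v \<in> V \<Longrightarrow> v \<in> aff_span ((\<lambda>i x. relu (f i x)) ` I)"
  shows "net (max W W') (Suc L) V"
  by (rule net_aff[OF net_relu[OF assms(1), of "(\<lambda>i x. relu (f i x)) ` I"]])
     (use assms in \<open>auto intro: order.trans[OF card_image_le]\<close>)

lemma relu_diff: "relu x - relu (- x) = x" by (auto simp: relu_def)

lemma net_pass1:
  assumes "net W L U" "finite U" "2 * card U \<le> W'"
  shows "net (max W W') (Suc L) U"
proof (rule net_aff_relu[OF assms(1), of "U \<times> {1, -1}" _ "\<lambda>(u, s) x. s * u x"])
  fix v assume v: "v \<in> U"
  let ?B = "(\<lambda>i x. relu ((\<lambda>(u, s) x. s * u x) i x)) ` (U \<times> {1, -1::real})"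
  have pos: "(\<lambda>x. relu (1 * v x)) \<in> aff_span ?B"
    by (rule aff_span_incl, use assms in simp, rule image_eqI[where x = "(v, 1)"]) (use v in auto)
  have neg: "(\<lambda>x. relu (-1 * v x)) \<in> aff_span ?B"
    by (rule aff_span_incl, use assms in simp, rule image_eqI[where x = "(v, -1)"]) (use v in auto)
  from aff_span_diff[OF pos neg] show "v \<in> aff_span ?B"
    by (simp add: relu_diff)
qed (use assms in \<open>auto intro!: aff_span_scale aff_span_incl simp: card_cartesian_product
   aff_span_scale[where c = "-1", simplified]\<close>)

lemma net_pass:
  assumes "net W L U" "finite U" "2 * card U \<le> W'"
  shows "net (max W W') (L + t) U"
proof (induction t)
  case 0 then show ?case using net_mono[OF assms(1), of "max W W'" U] by simp
next
  case (Suc t)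
  from net_pass1[OF this assms(2,3)] show ?case by simp
qed

text \<open>Yarotsky's multiplication: \<open>esq r\<close> sums the sawtooth series of \<open>x - x\<^sup>2\<close>, and the product is read off
  from the two squares. It is Lipschitz and vanishes with either factor, which keeps products of bumps local.\<close>

definition tent :: "real \<Rightarrow> real" where "tent x = 2 * relu x - 4 * relu (x - 1/2)"

fun esq :: "nat \<Rightarrow> real \<Rightarrow> real" where
  "esq 0 x = 0"
| "esq (Suc r) x = tent x / 4 + esq r (tent x) / 4"

lemma tent_le_half: "0 \<le> x \<Longrightarrow> x \<le> 1/2 \<Longrightarrow> tent x = 2 * x"
  and tent_ge_half: "1/2 \<le> x \<Longrightarrow> tent x = 2 - 2 * x"
  by (auto simp: tent_def relu_def)

lemma tent_range: "0 \<le> x \<Longrightarrow> x \<le> 1 \<Longrightarrow> 0 \<le> tent x \<and> tent x \<le> 1"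
  by (cases "x \<le> 1/2") (auto simp: tent_le_half tent_ge_half)

lemma tent_lip: "0 \<le> x \<Longrightarrow> 0 \<le> y \<Longrightarrow> \<bar>tent x - tent y\<bar> \<le> 2 * \<bar>x - y\<bar>"
  by (cases "x \<le> 1/2"; cases "y \<le> 1/2") (auto simp: tent_le_half tent_ge_half abs_if)

text \<open>The function \<open>x - x\<^sup>2\<close> satisfies exactly the recursion that defines
  \<open>esq\<close>, so each further step divides the remaining error by 4.\<close>

lemma tent_sq: "0 \<le> x \<Longrightarrow> x \<le> 1 \<Longrightarrow> (tent x + (tent x - (tent x)\<^sup>2)) / 4 = x - x\<^sup>2"
  by (cases "x \<le> 1/2") (auto simp: tent_le_half tent_ge_half power2_eq_square field_simps)

lemma esq_err:
  "0 \<le> x \<Longrightarrow> x \<le> 1 \<Longrightarrow> 0 \<le> esq r x \<and> esq r x \<le> x - x\<^sup>2 \<and> x - x\<^sup>2 - esq r x \<le> (1/4) ^ r"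
proof (induction r arbitrary: x)
  case 0
  have "x\<^sup>2 \<le> x" using 0 by (simp add: power2_eq_square mult_left_le)
  with 0 zero_le_power2[of x] show ?case unfolding esq.simps power_0 by - (intro conjI; linarith)
next
  case (Suc r)
  have t: "0 \<le> tent x" "tent x \<le> 1" using tent_range[OF Suc.prems] by auto
  from Suc.IH[of "tent x"] t have *: "0 \<le> esq r (tent x)" "esq r (tent x) \<le> tent x - (tent x)\<^sup>2"
    "tent x - (tent x)\<^sup>2 - esq r (tent x) \<le> (1/4) ^ r" by auto
  have e: "esq (Suc r) x = tent x / 4 + esq r (tent x) / 4" by simp
  have p: "(1/4::real) ^ Suc r = (1/4) ^ r / 4" by simp
  have "0 \<le> t / 4 + e / 4 \<and> t / 4 + e / 4 \<le> X \<and> X - (t / 4 + e / 4) \<le> P / 4"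
    if "0 \<le> e" "e \<le> t - t2" "t - t2 - e \<le> P" "0 \<le> t" "(t + (t - t2)) / 4 = X" for t e t2 X P :: real
  proof -
    have "X * 4 = t + (t - t2)" using that by simp
    with that(1-4) show ?thesis by linarith
  qed
  from this[OF * t(1) tent_sq[OF Suc.prems]] show ?case unfolding e p .
qed

text \<open>The factor 1/4 compensates the slope 2 of \<open>tent\<close>: the two summands
  contribute 1/2 each, so the constant is 1 for every \<open>r\<close>.\<close>

lemma esq_lip:
  "0 \<le> x \<Longrightarrow> x \<le> 1 \<Longrightarrow> 0 \<le> y \<Longrightarrow> y \<le> 1 \<Longrightarrow> \<bar>esq r x - esq r y\<bar> \<le> \<bar>x - y\<bar>"
proof (induction r arbitrary: x y)
  case (Suc r)
  have "\<bar>esq r (tent x) - esq r (tent y)\<bar> \<le> \<bar>tent x - tent y\<bar>"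
    using Suc tent_range by auto
  moreover have "\<bar>(t / 4 + e / 4) - (t' / 4 + e' / 4)\<bar> \<le> c"
    if "\<bar>t - t'\<bar> \<le> 2 * c" "\<bar>e - e'\<bar> \<le> \<bar>t - t'\<bar>" for t e t' e' c :: real
  proof -
    have "\<bar>e - e'\<bar> \<le> 2 * c" using that by simp
    with that(1) show ?thesis unfolding abs_le_iff by simp
  qed
  ultimately show ?case using tent_lip[OF Suc.prems(1,3)] unfolding esq.simps by blast
qed simp

text \<open>Polarization: \<open>x * y\<close> is the difference of the squares of
  \<open>(x + y) / 2\<close> and \<open>(x - y) / 2\<close>, and \<open>t - esq r t\<close> stands
  for the square of \<open>t\<close>. If one factor is 0 the two absolute values agree and the
  result is exactly 0.\<close>

definition amult :: "nat \<Rightarrow> real \<Rightarrow> real \<Rightarrow> real" where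
  "amult r x y = (\<bar>x + y\<bar> / 2 - esq r (\<bar>x + y\<bar> / 2)) - (\<bar>x - y\<bar> / 2 - esq r (\<bar>x - y\<bar> / 2))"

lemma amult_0 [simp]: "amult r 0 y = 0" "amult r x 0 = 0"
  by (auto simp: amult_def)

lemma amult_err:
  assumes "\<bar>x\<bar> \<le> 1" "\<bar>y\<bar> \<le> 1" shows "\<bar>amult r x y - x * y\<bar> \<le> (1/4) ^ r"
proof -
  have a: "0 \<le> \<bar>x + y\<bar> / 2" "\<bar>x + y\<bar> / 2 \<le> 1" "0 \<le> \<bar>x - y\<bar> / 2" "\<bar>x - y\<bar> / 2 \<le> 1"
    using assms by auto
  have "x * y = (\<bar>x + y\<bar> / 2)\<^sup>2 - (\<bar>x - y\<bar> / 2)\<^sup>2"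
    by (auto simp: power_divide power2_eq_square algebra_simps abs_if split: if_splits)
  with esq_err[OF a(1,2), of r] esq_err[OF a(3,4), of r] show ?thesis
    unfolding amult_def by linarith
qed

lemma amult_range:
  assumes "\<bar>x\<bar> \<le> 1" "\<bar>y\<bar> \<le> 1" shows "\<bar>amult r x y\<bar> \<le> 1"
proof -
  have a: "0 \<le> \<bar>x + y\<bar> / 2" "\<bar>x + y\<bar> / 2 \<le> 1" "0 \<le> \<bar>x - y\<bar> / 2" "\<bar>x - y\<bar> / 2 \<le> 1"
    using assms by auto
  show ?thesis using esq_err[OF a(1,2), of r] esq_err[OF a(3,4), of r] a
      zero_le_power2[of "\<bar>x + y\<bar> / 2"] zero_le_power2[of "\<bar>x - y\<bar> / 2"]
    unfolding amult_def by linarith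
qed

text \<open>The constant does not depend on \<open>r\<close>: each approximate square is
  2-Lipschitz, and its argument moves by half of the total change in \<open>x\<close> and
  \<open>y\<close>.\<close>

lemma amult_lip:
  assumes "\<bar>x\<bar> \<le> 1" "\<bar>y\<bar> \<le> 1" "\<bar>x'\<bar> \<le> 1" "\<bar>y'\<bar> \<le> 1"
  shows "\<bar>amult r x y - amult r x' y'\<bar> \<le> 2 * (\<bar>x - x'\<bar> + \<bar>y - y'\<bar>)"
proof -
  have "\<bar>esq r (\<bar>x + y\<bar> / 2) - esq r (\<bar>x' + y'\<bar> / 2)\<bar> \<le> \<bar>\<bar>x + y\<bar> / 2 - \<bar>x' + y'\<bar> / 2\<bar>"
       "\<bar>esq r (\<bar>x - y\<bar> / 2) - esq r (\<bar>x' - y'\<bar> / 2)\<bar> \<le> \<bar>\<bar>x - y\<bar> / 2 - \<bar>x' - y'\<bar> / 2\<bar>"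
    using assms by (auto intro!: esq_lip)
  moreover have "\<bar>\<bar>a\<bar> / 2 - \<bar>b\<bar> / 2\<bar> \<le> c / 2 + d / 2" if "\<bar>a - b\<bar> \<le> c + d" for a b c d :: real
    using that by linarith
  note half = this
  have "\<bar>\<bar>x + y\<bar> / 2 - \<bar>x' + y'\<bar> / 2\<bar> \<le> \<bar>x - x'\<bar> / 2 + \<bar>y - y'\<bar> / 2"
    by (rule half) linarith
  moreover have "\<bar>\<bar>x - y\<bar> / 2 - \<bar>x' - y'\<bar> / 2\<bar> \<le> \<bar>x - x'\<bar> / 2 + \<bar>y - y'\<bar> / 2"
    by (rule half) linarith
  moreover have "\<bar>(z - e) - (w - g) - ((z' - e') - (w' - g'))\<bar> \<le> 2 * (c + d)"
    if "\<bar>e - e'\<bar> \<le> \<bar>z - z'\<bar>" "\<bar>g - g'\<bar> \<le> \<bar>w - w'\<bar>" "\<bar>z - z'\<bar> \<le> c / 2 + d / 2" "\<bar>w - w'\<bar> \<le> c / 2 + d / 2"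
    for z e w g z' e' w' g' c d :: real
  proof -
    have "\<bar>e - e'\<bar> \<le> c / 2 + d / 2" "\<bar>g - g'\<bar> \<le> c / 2 + d / 2" using that by linarith+
    with that(3,4) show ?thesis unfolding abs_le_iff by auto
  qed
  ultimately show ?thesis unfolding amult_def by blast
qed

section \<open>Iterated approximate multiplication\<close>

fun aprod :: "nat \<Rightarrow> real list \<Rightarrow> real" where
  "aprod r [] = 1"
| "aprod r (x # xs) = amult r x (aprod r xs)"

lemma aprod_range: "(\<forall>x\<in>set xs. \<bar>x\<bar> \<le> 1) \<Longrightarrow> \<bar>aprod r xs\<bar> \<le> 1"
  by (induction xs) (auto intro: amult_range)

lemma aprod_0: "0 \<in> set xs \<Longrightarrow> aprod r xs = 0"
  by (induction xs) auto

lemma aprod_err: "(\<forall>x\<in>set xs. \<bar>x\<bar> \<le> 1) \<Longrightarrow> \<bar>aprod r xs - prod_list xs\<bar> \<le> length xs * (1/4) ^ r"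
proof (induction xs)
  case (Cons x xs)
  have "\<bar>amult r x (aprod r xs) - x * aprod r xs\<bar> \<le> (1/4) ^ r"
    using Cons by (intro amult_err aprod_range) auto
  moreover have "\<bar>x * aprod r xs - x * prod_list xs\<bar> \<le> \<bar>aprod r xs - prod_list xs\<bar>"
    using Cons by (simp flip: right_diff_distrib add: abs_mult mult_left_le_one_le)
  ultimately have "\<bar>aprod r (x # xs) - prod_list (x # xs)\<bar> \<le> (1/4) ^ r + length xs * (1/4) ^ r"
    using Cons by fastforce
  then show ?case by (simp add: algebra_simps)
qed simp

text \<open>If the tail has constant \<open>a\<close>, one more factor gives
  \<open>2 * (1 + a)\<close>; the sequence \<open>4 ^ k - 1\<close> dominates this recursion and is
  again free of \<open>r\<close>.\<close>

lemma aprod_lip: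
  assumes "\<And>f. f \<in> set fs \<Longrightarrow> \<bar>f x\<bar> \<le> 1 \<and> \<bar>f y\<bar> \<le> 1 \<and> \<bar>f x - f y\<bar> \<le> l" "0 \<le> (l::real)"
  shows "\<bar>aprod r (map (\<lambda>f. f x) fs) - aprod r (map (\<lambda>f. f y) fs)\<bar> \<le> (4 ^ length fs - 1) * l"
  using assms(1)
proof (induction fs)
  case (Cons f fs)
  let ?p = "aprod r (map (\<lambda>f. f x) fs)" and ?q = "aprod r (map (\<lambda>f. f y) fs)"
  have IH: "\<bar>?p - ?q\<bar> \<le> (4 ^ length fs - 1) * l" using Cons by auto
  have "\<bar>amult r (f x) ?p - amult r (f y) ?q\<bar> \<le> 2 * (\<bar>f x - f y\<bar> + \<bar>?p - ?q\<bar>)"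
    using Cons by (intro amult_lip aprod_range) auto
  also have "\<dots> \<le> 2 * (l + (4 ^ length fs - 1) * l)" using IH Cons by (intro mult_left_mono add_mono) auto
  also have "\<dots> = (2 * 4 ^ length fs) * l" by (simp add: algebra_simps)
  also have "\<dots> \<le> (4 ^ length (f # fs) - 1) * l"
  proof (intro mult_right_mono assms(2))
    have "(1::real) \<le> 4 ^ length fs" by simp
    moreover have "(4::real) ^ length (f # fs) = 4 * 4 ^ length fs" by simp
    ultimately show "2 * 4 ^ length fs \<le> (4::real) ^ length (f # fs) - 1" by linarith
  qed
  finally show ?case by simp
qed simp

text \<open>One layer advances a pair of current iterate and accumulator: \<open>u\<close> becomes
  \<open>tent u\<close>, and \<open>v\<close> absorbs \<open>c / 4 * tent u\<close> with
  \<open>c / 4\<close> as the next weight. The four neurons per index take \<open>u\<close>,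
  \<open>u - 1/2\<close>, \<open>v\<close> and \<open>- v\<close>.\<close>

lemma net_esq:
  assumes "net W L U" "finite I" "\<And>i. i \<in> I \<Longrightarrow> u i \<in> aff_span U" "\<And>i. i \<in> I \<Longrightarrow> v i \<in> aff_span U"
    and "4 * card I \<le> W"
  shows "net W (L + r) ((\<lambda>i x. v i x + c * esq r (u i x)) ` I)"
  using assms(1,3,4)
proof (induction r arbitrary: L U u v c)
  case 0
  then show ?case by (auto intro!: net_aff[OF 0(1)])
next
  case (Suc r)
  let ?u' = "\<lambda>i x. tent (u i x)" and ?v' = "\<lambda>i x. v i x + c / 4 * tent (u i x)"
  let ?g = "\<lambda>(i, k::nat) x. if k = 0 then u i x else if k = 1 then u i x - 1/2 else if k = 2 then v i x else -1 * v i x"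
  let ?J = "I \<times> {..<4::nat}" let ?B = "(\<lambda>i x. relu (?g i x)) ` ?J"
  have "net (max W W) (Suc L) (?u' ` I \<union> ?v' ` I)"
  proof (rule net_aff_relu[OF Suc(2), of ?J _ ?g])
    show "finite ?J" "card ?J \<le> W" using assms by (auto simp: card_cartesian_product)
    show "?g i \<in> aff_span U" if iJ: "i \<in> ?J" for i
    proof -
      obtain j k where i: "i = (j, k)" "j \<in> I" "k < 4" using iJ by auto
      have "(\<lambda>x. -1 * v j x) \<in> aff_span U" "(\<lambda>x. u j x - 1/2) \<in> aff_span U"
        by (intro aff_span_scale aff_span_diff aff_span_const Suc i)+
      with i Suc(3,4) show ?thesis by (cases "k = 0"; cases "k = 1"; cases "k = 2") auto
    qed
    fix w assume "w \<in> ?u' ` I \<union> ?v' ` I"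
    then obtain i where i: "i \<in> I" "w = ?u' i \<or> w = ?v' i" by auto
    have B: "(\<lambda>x. relu (?g (i, k) x)) \<in> aff_span ?B" if "k < 4" for k
      by (rule aff_span_incl, use assms in simp, rule image_eqI[where x = "(i, k)"]) (use i that in simp_all)
    have 1: "?u' i \<in> aff_span ?B" unfolding tent_def
      using aff_span_diff[OF aff_span_scale[OF B[of 0], of 2] aff_span_scale[OF B[of 1], of 4]] by simp
    have 2: "v i \<in> aff_span ?B"
      using aff_span_diff[OF B[of 2] B[of 3]] by (simp add: relu_diff)
    have "?v' i \<in> aff_span ?B" by (intro aff_span_add aff_span_scale 1 2)
    with 1 i show "w \<in> aff_span ?B" by auto
  qed
  then have N: "net W (Suc L) (?u' ` I \<union> ?v' ` I)" by simp
  have "net W (Suc L + r) ((\<lambda>i x. ?v' i x + c / 4 * esq r (?u' i x)) ` I)"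
    by (rule Suc.IH[OF N]) (use assms in \<open>auto intro!: aff_span_incl\<close>)
  moreover have "(\<lambda>i x. ?v' i x + c / 4 * esq r (?u' i x)) = (\<lambda>i x. v i x + c * esq (Suc r) (u i x))"
    by (auto simp: field_simps)
  ultimately show ?case by (simp only: add_Suc_right add_Suc)
qed

text \<open>One layer forms the two absolute values, \<open>r\<close> layers run \<open>esq\<close>.
  A product needs two squares of four neurons each, hence the factor 8.\<close>

lemma net_amult:
  assumes "net W L U" "finite I" "\<And>i. i \<in> I \<Longrightarrow> f i \<in> aff_span U" "\<And>i. i \<in> I \<Longrightarrow> g i \<in> aff_span U"
    and "8 * card I \<le> W"
  shows "net W (L + Suc r) ((\<lambda>i x. amult r (f i x) (g i x)) ` I)"
proof -
  let ?z = "\<lambda>(i, k::nat) x. if k = 0 then \<bar>f i x + g i x\<bar> / 2 else \<bar>f i x - g i x\<bar> / 2"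
  let ?h = "\<lambda>(i, k::nat) x. if k = 0 then (1/2) * (f i x + g i x) else if k = 1 then (-1/2) * (f i x + g i x)
    else if k = 2 then (1/2) * (f i x - g i x) else (-1/2) * (f i x - g i x)"
  let ?J = "I \<times> {..<4::nat}" let ?B = "(\<lambda>i x. relu (?h i x)) ` ?J"
  have "net (max W W) (Suc L) (?z ` (I \<times> {..<2::nat}))"
  proof (rule net_aff_relu[OF assms(1), of ?J _ ?h])
    show "finite ?J" "card ?J \<le> W" using assms by (auto simp: card_cartesian_product)
    show "?h i \<in> aff_span U" if iJ: "i \<in> ?J" for i
    proof -
      obtain j k where i: "i = (j, k)" "j \<in> I" "k < 4" using iJ by auto
      have fg: "f j \<in> aff_span U" "g j \<in> aff_span U" using assms i by auto
      have "(\<lambda>x. (1/2) * (f j x + g j x)) \<in> aff_span U" "(\<lambda>x. (-1/2) * (f j x + g j x)) \<in> aff_span U"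
        "(\<lambda>x. (1/2) * (f j x - g j x)) \<in> aff_span U" "(\<lambda>x. (-1/2) * (f j x - g j x)) \<in> aff_span U"
        by (intro aff_span_scale aff_span_diff aff_span_add fg)+
      with i show ?thesis by (cases "k = 0"; cases "k = 1"; cases "k = 2") auto
    qed
    fix w assume "w \<in> ?z ` (I \<times> {..<2::nat})"
    then obtain i k where i: "i \<in> I" "k < 2" "w = ?z (i, k)" by auto
    define A where "A = aff_span ?B"
    have B: "(\<lambda>x. relu (?h (i, k) x)) \<in> A" if "k < 4" for k unfolding A_def
      by (rule aff_span_incl, use assms in simp, rule image_eqI[where x = "(i, k)"]) (use i that in simp_all)
    have add: "(\<lambda>x. p x + q x) \<in> A" if "p \<in> A" "q \<in> A" for p q
      using that unfolding A_def by (rule aff_span_add)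
    have h: "relu ((1/2) * a) + relu ((-1/2) * a) = \<bar>a\<bar> / 2" for a by (auto simp: relu_def)
    have "(\<lambda>x. relu ((1/2) * (f i x + g i x)) + relu ((-1/2) * (f i x + g i x))) \<in> A"
      using add[OF B[of 0] B[of 1]] by simp
    then have "?z (i, 0) \<in> A" unfolding h by simp
    moreover have "(\<lambda>x. relu ((1/2) * (f i x - g i x)) + relu ((-1/2) * (f i x - g i x))) \<in> A"
      using add[OF B[of 2] B[of 3]] by simp
    then have "?z (i, 1) \<in> A" unfolding h by simp
    ultimately show "w \<in> aff_span ?B" unfolding A_def[symmetric] using i by (cases "k = 0") (auto simp: less_2_cases_iff)
  qed
  then have N: "net W (Suc L) (?z ` (I \<times> {..<2::nat}))" unfolding max.idem .
  let ?q = "\<lambda>i x. ?z i x + (-1) * esq r (?z i x)"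
  have N2: "net W (Suc L + r) (?q ` (I \<times> {..<2::nat}))"
  proof (rule net_esq[OF N])
    show "finite (I \<times> {..<2::nat})" "4 * card (I \<times> {..<2::nat}) \<le> W"
      using assms by (simp_all add: card_cartesian_product)
    show "?z i \<in> aff_span (?z ` (I \<times> {..<2::nat}))" if "i \<in> I \<times> {..<2::nat}" for i
      by (rule aff_span_incl, simp add: assms, rule imageI, rule that)
    then show "?z i \<in> aff_span (?z ` (I \<times> {..<2::nat}))" if "i \<in> I \<times> {..<2::nat}" for i using that .
  qed
  have "net W (Suc L + r) ((\<lambda>i x. amult r (f i x) (g i x)) ` I)"
  proof (rule net_aff[OF N2])
    fix v assume "v \<in> (\<lambda>i x. amult r (f i x) (g i x)) ` I"
    then obtain i where i: "i \<in> I" "v = (\<lambda>x. amult r (f i x) (g i x))" by auto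
    define A where "A = aff_span (?q ` (I \<times> {..<2::nat}))"
    have q: "?q (i, k) \<in> A" if "k < 2" for k unfolding A_def
      by (rule aff_span_incl, use assms in simp, rule imageI) (use i that in auto)
    have "(\<lambda>x. ?q (i, 0) x - ?q (i, 1) x) \<in> A"
      unfolding A_def by (rule aff_span_diff; fold A_def; rule q; simp)
    then show "v \<in> aff_span (?q ` (I \<times> {..<2::nat}))"
      unfolding A_def[symmetric] i amult_def by simp
  qed
  then show ?thesis by (simp only: add_Suc_right add_Suc)
qed

text \<open>Products are formed from the end of the list. While the tail is being multiplied, the
  next head is carried along by identity layers, which accounts for the width added per
  factor.\<close>

lemma net_aprod:
  assumes "net W L U" "finite I" "\<And>i. i \<in> I \<Longrightarrow> length (fs i) = k \<and> set (fs i) \<subseteq> U"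
  shows "net (W + k * (W + 8 * card I)) (L + k * Suc r) ((\<lambda>i x. aprod r (map (\<lambda>f. f x) (fs i))) ` I)"
  using assms(3)
proof (induction k arbitrary: fs)
  case 0
  have "(\<lambda>i x. aprod r (map (\<lambda>f. f x) (fs i))) ` I \<subseteq> {\<lambda>x. 1}" using 0 by auto
  then show ?case using net_aff[OF assms(1), of "{\<lambda>x. 1}"] net_mono[of W L "{\<lambda>x. 1}" W]
    by (auto simp: aff_span_const)
next
  case (Suc k)
  let ?P = "\<lambda>i x. aprod r (map (\<lambda>f. f x) (tl (fs i)))" and ?H = "\<lambda>i. hd (fs i)"
  let ?w = "W + k * (W + 8 * card I)"
  have len: "length (tl (fs i)) = k" "set (tl (fs i)) \<subseteq> U" "hd (fs i) \<in> U" "fs i = hd (fs i) # tl (fs i)" if "i \<in> I" for i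
    using Suc(2)[OF that] by (cases "fs i"; auto)+
  have 1: "net ?w (L + k * Suc r) (?P ` I)" using len by (intro Suc.IH) auto
  have "net (max W (2 * card I)) (L + k * Suc r) (?H ` I)"
    by (rule net_pass) (use assms len in \<open>auto intro: net_mono[OF assms(1)] card_image_le\<close>)
  from net_Un[OF 1 this] have 2: "net (W + Suc k * (W + 8 * card I)) (L + k * Suc r) (?P ` I \<union> ?H ` I)"
    by (rule net_mono) auto
  have "net (W + Suc k * (W + 8 * card I)) (L + k * Suc r + Suc r) ((\<lambda>i x. amult r (?H i x) (?P i x)) ` I)"
    by (rule net_amult[OF 2]) (use assms in \<open>auto intro!: aff_span_incl\<close>)
  moreover have "(\<lambda>i x. amult r (?H i x) (?P i x)) ` I = (\<lambda>i x. aprod r (map (\<lambda>f. f x) (fs i))) ` I"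
    proof (rule image_cong[OF refl])
    fix i assume "i \<in> I"
    then obtain g gs where g: "fs i = g # gs" using len(4) by blast
    show "(\<lambda>x. amult r (?H i x) (?P i x)) = (\<lambda>x. aprod r (map (\<lambda>f. f x) (fs i)))"
      unfolding g by simp
  qed
  ultimately show ?case by (simp only: mult_Suc add_ac)
qed

section \<open>Lagrange interpolation of Hoelder functions\<close>

text \<open>The nodes lie in the half-open interval [0,1): without the right end, every node of a
  dyadic cell belongs to that cell and not to its neighbour.\<close>

definition inode :: "nat \<Rightarrow> nat \<Rightarrow> real" where "inode s l = real l / (real s + 1)"

definition lagr :: "nat \<Rightarrow> nat \<Rightarrow> real \<Rightarrow> real" where
  "lagr s l u = (\<Prod>k\<in>{..s} - {l}. (u - inode s k) / (inode s l - inode s k))"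

definition lagr_const :: "nat \<Rightarrow> real" where "lagr_const s = (2 * (real s + 1)) ^ s"

lemma inode_bounds: "l \<le> s \<Longrightarrow> 0 \<le> inode s l \<and> inode s l < 1"
  by (auto simp: inode_def)

lemma inode_diff: "k \<noteq> l \<Longrightarrow> 1 / (real s + 1) \<le> \<bar>inode s l - inode s k\<bar>"
proof -
  assume "k \<noteq> l"
  then have "1 \<le> \<bar>real l - real k\<bar>" by linarith
  then show ?thesis unfolding inode_def diff_divide_distrib[symmetric] abs_divide
    by (simp add: divide_right_mono)
qed

lemma inode_inj: "inode s l = inode s k \<longleftrightarrow> l = k"
  by (auto simp: inode_def)

lemma lagr_const_ge_1: "1 \<le> lagr_const s"
  unfolding lagr_const_def by (rule one_le_power) auto

text \<open>Each of the \<open>s\<close> factors is at most 2 over the node spacing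
  \<open>1 / (s + 1)\<close>. The range is [-1,1] and not only [0,1] because the hats of the
  two-scale scheme reach to both sides of their node.\<close>

lemma lagr_bound:
  assumes "l \<le> s" "\<bar>u\<bar> \<le> 1" shows "\<bar>lagr s l u\<bar> \<le> lagr_const s"
proof -
  have "\<bar>lagr s l u\<bar> = (\<Prod>k\<in>{..s} - {l}. \<bar>(u - inode s k) / (inode s l - inode s k)\<bar>)"
    unfolding lagr_def by (rule abs_prod)
  also have "\<dots> \<le> (\<Prod>k\<in>{..s} - {l}. 2 * (real s + 1))"
  proof (rule prod_mono, safe)
    fix k assume k: "k \<le> s" "k \<noteq> l"
    have "\<bar>u - inode s k\<bar> \<le> 2" using inode_bounds[OF k(1)] assms(2) by linarith
    then have "\<bar>u - inode s k\<bar> / \<bar>inode s l - inode s k\<bar> \<le> 2 / (1 / (real s + 1))"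
      using inode_diff[OF k(2), of s] by (intro frac_le) auto
    then show "\<bar>(u - inode s k) / (inode s l - inode s k)\<bar> \<le> 2 * (real s + 1)"
      by (simp add: abs_divide)
  qed simp
  also have "\<dots> = lagr_const s" using assms by (simp add: lagr_const_def)
  finally show ?thesis .
qed

lemma lagr_node: "l \<le> s \<Longrightarrow> k \<le> s \<Longrightarrow> lagr s l (inode s k) = (if l = k then 1 else 0)"
  by (auto simp: lagr_def inode_inj intro!: prod.neutral)

definition lagr_poly :: "nat \<Rightarrow> nat \<Rightarrow> real poly" where
  "lagr_poly s l = (\<Prod>k\<in>{..s} - {l}. smult (1 / (inode s l - inode s k)) [:- inode s k, 1:])"

lemma poly_lagr_poly: "poly (lagr_poly s l) u = lagr s l u"
  by (auto simp: lagr_poly_def lagr_def poly_prod diff_divide_distrib intro!: prod.cong)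

lemma degree_lagr_poly: assumes "l \<le> s" shows "degree (lagr_poly s l) \<le> s"
proof -
  have "degree (lagr_poly s l) \<le> (\<Sum>k\<in>{..s} - {l}. degree (smult (1 / (inode s l - inode s k)) [:- inode s k, 1:]))"
    unfolding lagr_poly_def by (rule order.trans[OF degree_prod_sum_le]) (simp_all add: comp_def)
  also have "\<dots> \<le> (\<Sum>k\<in>{..s} - {l}. 1)" by (rule sum_mono) auto
  also have "\<dots> = s" using assms by simp
  finally show ?thesis .
qed

lemma lagr_reproduce:
  assumes "degree p \<le> s"
  shows "(\<Sum>l\<le>s. lagr s l u * poly p (inode s l)) = poly p u"
proof -
  let ?q = "\<Sum>l\<le>s. smult (poly p (inode s l)) (lagr_poly s l)"
  have "?q = p"
  proof (rule poly_eqI_degree[of "inode s ` {..s}"])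
    show "poly ?q x = poly p x" if "x \<in> inode s ` {..s}" for x
    proof -
      obtain k where k: "k \<le> s" "x = inode s k" using \<open>x \<in> _\<close> by auto
      have "poly ?q x = (\<Sum>l\<le>s. poly p (inode s l) * (if l = k then 1 else 0))"
        unfolding k(2) by (auto simp: poly_sum poly_lagr_poly lagr_node k intro!: sum.cong)
      also have "\<dots> = poly p x" using k by (simp add: if_distrib[of "\<lambda>t. _ * t"] cong: if_cong)
      finally show ?thesis .
    qed
    have c: "card (inode s ` {..s}) = Suc s" by (subst card_image) (auto simp: inj_on_def inode_inj)
    have "degree ?q \<le> s"
      by (rule degree_sum_le) (auto intro!: degree_lagr_poly)
    then show "degree ?q < card (inode s ` {..s})" unfolding c by simp
    show "degree p < card (inode s ` {..s})" unfolding c using assms by simp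
  qed
  then have "poly p u = poly ?q u" by simp
  then show ?thesis by (simp add: poly_sum poly_lagr_poly mult.commute)
qed

text \<open>All that interpolation needs from a Hoelder function is its behaviour along lines
  parallel to an axis. The derivatives are a witness sequence \<open>D\<close>, so that iterated
  partials can be plugged in directly.\<close>

definition holder_line :: "real \<Rightarrow> (real \<Rightarrow> real) \<Rightarrow> bool" where
  "holder_line \<beta> g \<longleftrightarrow> (\<exists>D. D 0 = g \<and>
     (\<forall>l<holder_s \<beta>. \<forall>x. (D l has_real_derivative D (Suc l) x) (at x)) \<and>
     (\<forall>x y. \<bar>D (holder_s \<beta>) x - D (holder_s \<beta>) y\<bar> \<le> \<bar>x - y\<bar> powr holder_r \<beta>))"

lemma holder_sr:
  assumes "\<beta> > 0" shows "0 < holder_r \<beta>" "holder_r \<beta> \<le> 1" "real (holder_s \<beta>) + holder_r \<beta> = \<beta>"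
proof -
  have c: "\<lceil>\<beta>\<rceil> \<ge> 1" using assms by linarith
  then have "real (holder_s \<beta>) = of_int \<lceil>\<beta>\<rceil> - 1" unfolding holder_s_def by auto
  then show "0 < holder_r \<beta>" "holder_r \<beta> \<le> 1" "real (holder_s \<beta>) + holder_r \<beta> = \<beta>"
    unfolding holder_r_def by linarith+
qed

text \<open>Lagrange's remainder evaluates the top derivative at an intermediate point. Against its
  value at \<open>x0\<close> this leaves a difference of size \<open>\<bar>t\<bar> powr r\<close>,
  and the factor \<open>t ^ s\<close> completes the exponent to \<beta>.\<close>

lemma holder_taylor:
  assumes "\<beta> > 0" "holder_line \<beta> g"
  shows "\<exists>p. degree p \<le> holder_s \<beta> \<and> (\<forall>t. \<bar>g (x0 + t) - poly p t\<bar> \<le> \<bar>t\<bar> powr \<beta>)"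
proof -
  define s where "s = holder_s \<beta>"
  define r where "r = holder_r \<beta>"
  have r: "0 < r" "r \<le> 1" "real s + r = \<beta>" unfolding s_def r_def using holder_sr[OF assms(1)] by auto
  obtain D where D: "D 0 = g" "\<And>l x. l < s \<Longrightarrow> (D l has_real_derivative D (Suc l) x) (at x)"
    "\<And>x y. \<bar>D s x - D s y\<bar> \<le> \<bar>x - y\<bar> powr r"
    using assms(2) unfolding holder_line_def s_def r_def by metis
  define p where "p = (\<Sum>m\<le>s. monom (D m x0 / fact m) m)"
  have "degree p \<le> s" unfolding p_def by (rule degree_sum_le) (auto intro: order.trans[OF degree_monom_le])
  moreover have "\<bar>g (x0 + t) - poly p t\<bar> \<le> \<bar>t\<bar> powr \<beta>" for t
  proof -
    have p: "poly p t = (\<Sum>m<s. D m x0 / fact m * t ^ m) + D s x0 / fact s * t ^ s"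
      unfolding p_def lessThan_Suc_atMost[symmetric] by (simp add: poly_sum poly_monom)
    have "\<exists>\<xi>. \<bar>\<xi> - x0\<bar> \<le> \<bar>t\<bar> \<and> g (x0 + t) = (\<Sum>m<s. D m x0 / fact m * t ^ m) + D s \<xi> / fact s * t ^ s"
    \<comment> \<open>Taylor's theorem asks for positive order and a point different from the
      centre, so these two cases are settled by hand.\<close>
    proof (cases "s = 0 \<or> t = 0")
      case True
      then show ?thesis
      proof
        assume "s = 0" then show ?thesis using D(1) by (intro exI[of _ "x0 + t"]) auto
      next
        assume "t = 0" then show ?thesis using D(1)
          by (intro exI[of _ x0]) (cases s; auto simp: sum.lessThan_Suc_shift simp del: sum.lessThan_Suc)
      qed
    next
      case False
      have "\<exists>\<xi>. (if x0 + t < x0 then x0 + t < \<xi> \<and> \<xi> < x0 else x0 < \<xi> \<and> \<xi> < x0 + t) \<and>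
         g (x0 + t) = (\<Sum>m<s. D m x0 / fact m * (x0 + t - x0) ^ m) + D s \<xi> / fact s * (x0 + t - x0) ^ s"
        by (rule Taylor[where a = "x0 - \<bar>t\<bar>" and b = "x0 + \<bar>t\<bar>"]) (use False D in auto)
      then obtain \<xi> where "if x0 + t < x0 then x0 + t < \<xi> \<and> \<xi> < x0 else x0 < \<xi> \<and> \<xi> < x0 + t"
         "g (x0 + t) = (\<Sum>m<s. D m x0 / fact m * t ^ m) + D s \<xi> / fact s * t ^ s" by auto
      then show ?thesis by (intro exI[of _ \<xi>]) (auto split: if_splits)
    qed
    then obtain \<xi> where \<xi>: "\<bar>\<xi> - x0\<bar> \<le> \<bar>t\<bar>" "g (x0 + t) = (\<Sum>m<s. D m x0 / fact m * t ^ m) + D s \<xi> / fact s * t ^ s" by blast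
    have "g (x0 + t) - poly p t = (D s \<xi> - D s x0) * t ^ s / fact s" unfolding p \<xi>(2) by (simp add: field_simps)
    also have "\<bar>\<dots>\<bar> = \<bar>D s \<xi> - D s x0\<bar> * \<bar>t\<bar> ^ s / fact s" by (simp add: abs_mult power_abs)
    also have "\<dots> \<le> \<bar>D s \<xi> - D s x0\<bar> * \<bar>t\<bar> ^ s / 1" by (rule divide_left_mono) (auto simp: fact_ge_1)
    also have "\<dots> \<le> \<bar>t\<bar> powr r * \<bar>t\<bar> ^ s"
      using order.trans[OF D(3)[of \<xi> x0] powr_mono2[OF _ _ \<xi>(1), of r]] r by (auto intro!: mult_right_mono)
    also have "\<dots> = \<bar>t\<bar> powr \<beta>"
    proof (cases "t = 0")
      case False
      then have "\<bar>t\<bar> ^ s = \<bar>t\<bar> powr real s" by (simp add: powr_realpow)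
      then show ?thesis unfolding r(3)[symmetric] by (simp add: powr_add)
    qed (use r in auto)
    finally show ?thesis .
  qed
  ultimately show ?thesis unfolding s_def by blast
qed

text \<open>One plus a bound for the Lebesgue constant, as in Lebesgue's inequality for
  interpolation errors.\<close>

definition interp_const :: "real \<Rightarrow> real" where
  "interp_const \<beta> = 1 + (real (holder_s \<beta>) + 1) * lagr_const (holder_s \<beta>)"

lemma interp_const_ge_1: "1 \<le> interp_const \<beta>"
  using lagr_const_ge_1[of "holder_s \<beta>"] unfolding interp_const_def by (simp add: )

text \<open>The Taylor polynomial at \<open>x0\<close> is reproduced exactly, so only remainders
  have to be bounded. The step \<delta> may be negative: the fold of the two-scale scheme runs
  through some coarse cells backwards.\<close>

lemma lagr_interp_err:
  assumes "\<beta> > 0" "holder_line \<beta> g" "\<bar>u\<bar> \<le> 1"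
  defines "s \<equiv> holder_s \<beta>"
  shows "\<bar>g (x0 + \<delta> * u) - (\<Sum>l\<le>s. lagr s l u * g (x0 + \<delta> * inode s l))\<bar> \<le> interp_const \<beta> * \<bar>\<delta>\<bar> powr \<beta>"
proof -
  obtain p where p: "degree p \<le> s" "\<And>t. \<bar>g (x0 + t) - poly p t\<bar> \<le> \<bar>t\<bar> powr \<beta>"
    using holder_taylor[OF assms(1,2)] unfolding s_def by blast
  define q where "q = pcompose p [:0, \<delta>:]"
  have q: "poly q v = poly p (\<delta> * v)" for v by (simp add: q_def poly_pcompose mult.commute)
  have "degree q \<le> s" unfolding q_def
    using degree_pcompose_le[of p "[:0, \<delta>:]"] p(1) by (auto split: if_splits)
  then have rep: "(\<Sum>l\<le>s. lagr s l u * poly q (inode s l)) = poly q u" by (rule lagr_reproduce)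
  have b: "\<bar>g (x0 + \<delta> * v) - poly q v\<bar> \<le> \<bar>\<delta>\<bar> powr \<beta>" if "\<bar>v\<bar> \<le> 1" for v
  proof -
    have "\<bar>g (x0 + \<delta> * v) - poly q v\<bar> \<le> \<bar>\<delta> * v\<bar> powr \<beta>" unfolding q by (rule p(2))
    also have "\<dots> \<le> \<bar>\<delta>\<bar> powr \<beta>" using that assms(1) by (intro powr_mono2) (auto simp: abs_mult mult_left_le)
    finally show ?thesis .
  qed
  have "g (x0 + \<delta> * u) - (\<Sum>l\<le>s. lagr s l u * g (x0 + \<delta> * inode s l))
    = (g (x0 + \<delta> * u) - poly q u) - (\<Sum>l\<le>s. lagr s l u * (g (x0 + \<delta> * inode s l) - poly q (inode s l)))"
    unfolding rep[symmetric] by (simp add: right_diff_distrib sum_subtractf)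
  also have "\<bar>\<dots>\<bar> \<le> \<bar>\<delta>\<bar> powr \<beta> + (\<Sum>l\<le>s. lagr_const s * \<bar>\<delta>\<bar> powr \<beta>)"
  proof (rule order.trans[OF abs_triangle_ineq4 add_mono[OF b[OF assms(3)]]])
    show "\<bar>\<Sum>l\<le>s. lagr s l u * (g (x0 + \<delta> * inode s l) - poly q (inode s l))\<bar> \<le> (\<Sum>l\<le>s. lagr_const s * \<bar>\<delta>\<bar> powr \<beta>)"
    proof (rule order.trans[OF sum_abs sum_mono])
      fix l assume "l \<in> {..s}"
      then have l: "l \<le> s" by simp
      show "\<bar>lagr s l u * (g (x0 + \<delta> * inode s l) - poly q (inode s l))\<bar> \<le> lagr_const s * \<bar>\<delta>\<bar> powr \<beta>"
        unfolding abs_mult using inode_bounds[OF l] lagr_const_ge_1[of s]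
        by (intro mult_mono lagr_bound[OF l assms(3)] b) auto
    qed
  qed
  also have "\<dots> = interp_const \<beta> * \<bar>\<delta>\<bar> powr \<beta>" by (simp add: interp_const_def s_def algebra_simps)
  finally show ?thesis .
qed

section \<open>Hoelder functions along coordinate lines\<close>

definition vupd :: "real^'d \<Rightarrow> 'd \<Rightarrow> real \<Rightarrow> real^'d" where
  "vupd x i v = (\<chi> j. if j = i then v else x $ j)"

lemma vupd_eq: "vupd x i v = vupd x i 0 + v *\<^sub>R axis i 1"
  by (auto simp: vupd_def vec_eq_iff axis_def)

text \<open>The class asks for a derivative at 0 along every line; moving the base point of the line
  turns this into a derivative at every \<open>t\<close>.\<close>

lemma pdl_line_deriv:
  assumes "h \<in> holder_class \<beta>" "length js < holder_s \<beta>"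
  shows "((\<lambda>t. pdl js h (x + t *\<^sub>R axis i 1)) has_real_derivative pdl (i # js) h (x + t *\<^sub>R axis i 1)) (at t)"
proof -
  let ?y = "x + t *\<^sub>R axis i 1"
  have "(\<lambda>u. pdl js h (?y + u *\<^sub>R axis i 1)) differentiable (at 0)"
    using assms unfolding holder_class_def by blast
  then have "((\<lambda>u. pdl js h (?y + u *\<^sub>R axis i 1)) has_real_derivative pdl (i # js) h ?y) (at 0)"
    by (simp add: pd_def real_differentiable_def DERIV_deriv_iff_real_differentiable)
  moreover have "(\<lambda>u. pdl js h (?y + u *\<^sub>R axis i 1)) = (\<lambda>u. pdl js h (x + (u + t) *\<^sub>R axis i 1))"
    by (simp add: algebra_simps)
  ultimately show ?thesis
    using DERIV_shift[of "\<lambda>t. pdl js h (x + t *\<^sub>R axis i 1)" _ 0 t] by simp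
qed

lemma holder_class_line:
  assumes "h \<in> holder_class \<beta>"
  shows "holder_line \<beta> (\<lambda>v. h (vupd x i v))"
proof -
  let ?s = "holder_s \<beta>" and ?x = "vupd x i 0"
  define D where "D l v = pdl (replicate l i) h (?x + v *\<^sub>R axis i 1)" for l v
  have "D 0 = (\<lambda>v. h (vupd x i v))" by (auto simp: D_def fun_eq_iff simp flip: vupd_eq)
  moreover have "(D l has_real_derivative D (Suc l) v) (at v)" if "l < ?s" for l v
    unfolding D_def replicate_Suc by (rule pdl_line_deriv[OF assms]) (use that in simp)
  moreover have "\<bar>D ?s v - D ?s w\<bar> \<le> \<bar>v - w\<bar> powr holder_r \<beta>" for v w
  proof (cases "v = w")
    case False
    let ?y = "?x + v *\<^sub>R axis i 1" and ?z = "?x + w *\<^sub>R axis i 1"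
    have n: "?y - ?z = (v - w) *\<^sub>R axis i 1" by (simp add: algebra_simps)
    have nn: "norm (?y - ?z) = \<bar>v - w\<bar>" unfolding n by simp
    with False have "?y \<noteq> ?z" by auto
    then have "\<bar>D ?s v - D ?s w\<bar> / norm (?y - ?z) powr holder_r \<beta> \<le> 1"
      using assms unfolding D_def holder_class_def by (metis (mono_tags, lifting) length_replicate mem_Collect_eq)
    then show ?thesis unfolding nn using False by (simp add: divide_le_eq)
  qed simp
  ultimately show ?thesis unfolding holder_line_def by blast
qed

lemma holder_class_bound: "h \<in> holder_class \<beta> \<Longrightarrow> \<bar>h x\<bar> \<le> 1"
  unfolding holder_class_def by (metis (mono_tags, lifting) le0 list.size(3) mem_Collect_eq pdl.simps(1))

lemma holder_class_line_modulus:
  assumes "\<beta> > 0" "h \<in> holder_class \<beta>"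
  shows "\<bar>h (vupd x i v) - h (vupd x i w)\<bar> \<le> \<bar>v - w\<bar> + \<bar>v - w\<bar> powr \<beta>"
proof (cases "holder_s \<beta> = 0")
  case True
  then have "holder_r \<beta> = \<beta>" using holder_sr[OF assms(1)] by simp
  then have "\<bar>h (vupd x i v) - h (vupd x i w)\<bar> \<le> \<bar>v - w\<bar> powr \<beta>"
    using holder_class_line[OF assms(2), of x i] True unfolding holder_line_def by auto
  then show ?thesis by simp
next
  case False
  let ?D = "\<lambda>v. pdl [i] h (vupd x i 0 + v *\<^sub>R axis i 1)"
  have "norm (h (vupd x i 0 + v *\<^sub>R axis i 1) - h (vupd x i 0 + w *\<^sub>R axis i 1)) \<le> 1 * norm (v - w)"
  proof (rule field_differentiable_bound[of UNIV _ ?D])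
    show "((\<lambda>v. h (vupd x i 0 + v *\<^sub>R axis i 1)) has_field_derivative ?D z) (at z within UNIV)" for z
      using pdl_line_deriv[OF assms(2), of "[]" "vupd x i 0" i z] False by simp
    show "norm (?D z) \<le> 1" for z
      using assms(2) False unfolding holder_class_def by (auto dest!: spec[of _ "[i]"])
  qed auto
  then show ?thesis unfolding vupd_eq[symmetric] by (auto intro: order.trans)
qed

text \<open>Coordinates are exchanged one at a time. The class speaks about partial derivatives
  only, so joint continuity, and with it measurability, has to be derived.\<close>

lemma holder_class_modulus:
  fixes h :: "real^'d \<Rightarrow> real"
  assumes "\<beta> > 0" "h \<in> holder_class \<beta>"
  shows "\<bar>h x - h y\<bar> \<le> real CARD('d) * (dist x y + dist x y powr \<beta>)"
proof -
  have *: "\<bar>h x - h (\<chi> j. if j \<in> S then y $ j else x $ j)\<bar> \<le> (\<Sum>i\<in>S. dist x y + dist x y powr \<beta>)" for S :: "'d set"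
  proof (induction S rule: infinite_finite_induct)
    case (insert a S)
    let ?z = "\<chi> j. if j \<in> S then y $ j else x $ j"
    have "\<bar>x $ a - y $ a\<bar> \<le> dist x y" using dist_vec_nth_le[of x a y] by (simp add: dist_real_def)
    then have "\<bar>x $ a - y $ a\<bar> powr \<beta> \<le> dist x y powr \<beta>" using assms(1) by (intro powr_mono2) auto
    then have "\<bar>h (vupd ?z a (x $ a)) - h (vupd ?z a (y $ a))\<bar> \<le> dist x y + dist x y powr \<beta>"
      using holder_class_line_modulus[OF assms, of ?z a "x $ a" "y $ a"] \<open>\<bar>x $ a - y $ a\<bar> \<le> dist x y\<close> by linarith
    moreover have "vupd ?z a (x $ a) = ?z" "vupd ?z a (y $ a) = (\<chi> j. if j \<in> insert a S then y $ j else x $ j)"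
      using insert by (auto simp: vupd_def vec_eq_iff)
    ultimately have "\<bar>h ?z - h (\<chi> j. if j \<in> insert a S then y $ j else x $ j)\<bar> \<le> dist x y + dist x y powr \<beta>" by simp
    with insert(3) show ?case unfolding sum.insert[OF insert(1,2)] by linarith
  qed auto
  have "(\<chi> j. if j \<in> UNIV then y $ j else x $ j) = y" by (simp add: vec_eq_iff)
  with *[of UNIV] show ?thesis by simp
qed

lemma holder_class_continuous:
  assumes "\<beta> > 0" "h \<in> holder_class \<beta>" shows "continuous_on UNIV h"
proof -
  have "(h \<longlongrightarrow> h x) (at x)" for x
  proof (rule Lim_null_comparison[THEN LIM_zero_cancel])
    show "\<forall>\<^sub>F y in at x. norm (h y - h x) \<le> real CARD('a) * (dist y x + dist y x powr \<beta>)"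
      using holder_class_modulus[OF assms] by (auto intro!: always_eventually)
    have "((\<lambda>y. real CARD('a) * (dist y x + dist y x powr \<beta>)) \<longlongrightarrow> real CARD('a) * (dist x x + dist x x powr \<beta>)) (at x)"
      using assms(1) by (intro tendsto_intros tendsto_powr2 tendsto_ident_at) (auto intro!: tendsto_intros always_eventually)
    then show "((\<lambda>y. real CARD('a) * (dist y x + dist y x powr \<beta>)) \<longlongrightarrow> 0) (at x)" using assms(1) by simp
  qed
  then show ?thesis by (simp add: continuous_on_def)
qed

section \<open>Tensor products of one-dimensional interpolation\<close>

lemma tensor_abs_sum:
  fixes w :: "'k \<Rightarrow> real \<Rightarrow> real" and x :: "'d \<Rightarrow> real"
  assumes "finite K" "finite S" "\<And>i. i \<in> S \<Longrightarrow> (\<Sum>k\<in>K. \<bar>w k (x i)\<bar>) \<le> \<Lambda>"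
  shows "(\<Sum>\<kappa>\<in>PiE S (\<lambda>_. K). \<bar>\<Prod>i\<in>S. w (\<kappa> i) (x i)\<bar>) \<le> \<Lambda> ^ card S"
proof -
  have "(\<Sum>\<kappa>\<in>PiE S (\<lambda>_. K). \<bar>\<Prod>i\<in>S. w (\<kappa> i) (x i)\<bar>) = (\<Prod>i\<in>S. \<Sum>k\<in>K. \<bar>w k (x i)\<bar>)"
    unfolding abs_prod by (rule prod_sum_PiE[symmetric]) (use assms in auto)
  also have "\<dots> \<le> (\<Prod>i\<in>S. \<Lambda>)" using assms by (intro prod_mono) (auto intro: sum_nonneg)
  finally show ?thesis by simp
qed

text \<open>Hybrid argument: \<open>Q S\<close> interpolates in the coordinates of \<open>S\<close>
  and keeps exact values in the others. Enlarging \<open>S\<close> by one coordinate costs one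
  one-dimensional error, amplified by the absolute weight sum already present. Weights and nodes are
  abstract so that both the dyadic and the folded scheme fit.\<close>

lemma tensor_interp_err:
  fixes h :: "real^'d \<Rightarrow> real" and w :: "'k \<Rightarrow> real \<Rightarrow> real"
  assumes K: "finite K" and L: "1 \<le> \<Lambda>" "0 \<le> \<epsilon>"
    and bnd: "\<And>v. v \<in> I \<Longrightarrow> (\<Sum>k\<in>K. \<bar>w k v\<bar>) \<le> \<Lambda>"
    and err: "\<And>y i v. v \<in> I \<Longrightarrow> \<bar>h (vupd y i v) - (\<Sum>k\<in>K. w k v * h (vupd y i (nd k)))\<bar> \<le> \<epsilon>"
    and x: "\<And>i. x $ i \<in> I"
  shows "\<bar>h x - (\<Sum>\<kappa>\<in>PiE UNIV (\<lambda>_. K). (\<Prod>i\<in>UNIV. w (\<kappa> i) (x $ i)) * h (\<chi> i. nd (\<kappa> i)))\<bar>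
    \<le> real CARD('d) * \<Lambda> ^ CARD('d) * \<epsilon>"
proof -
  define Q where "Q S = (\<Sum>\<kappa>\<in>PiE S (\<lambda>_. K). (\<Prod>i\<in>S. w (\<kappa> i) (x $ i)) * h (\<chi> i. if i \<in> S then nd (\<kappa> i) else x $ i))" for S
  have *: "\<bar>h x - Q S\<bar> \<le> real (card S) * \<Lambda> ^ CARD('d) * \<epsilon>" for S
  proof (induction S rule: infinite_finite_induct)
    case empty
    have "(\<chi> i. x $ i) = x" by (simp add: vec_eq_iff)
    then show ?case by (simp add: Q_def PiE_empty_domain)
  next
    case (insert a S)
    let ?z = "\<lambda>\<kappa>. (\<chi> i. if i \<in> S then nd (\<kappa> i) else x $ i) :: real^'d"
    have z: "vupd (?z \<kappa>) a (x $ a) = ?z \<kappa>" for \<kappa> using insert by (auto simp: vupd_def vec_eq_iff)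
    have "Q (insert a S) = (\<Sum>(k, \<kappa>)\<in>K \<times> PiE S (\<lambda>_. K). (\<Prod>i\<in>insert a S. w ((\<kappa>(a := k)) i) (x $ i)) * h (\<chi> i. if i \<in> insert a S then nd ((\<kappa>(a := k)) i) else x $ i))"
      unfolding Q_def PiE_insert_eq
      by (subst sum.reindex[OF inj_combinator]) (use insert in \<open>auto simp: case_prod_unfold\<close>)
    also have "\<dots> = (\<Sum>(k, \<kappa>)\<in>K \<times> PiE S (\<lambda>_. K). w k (x $ a) * (\<Prod>i\<in>S. w (\<kappa> i) (x $ i)) * h (vupd (?z \<kappa>) a (nd k)))"
    proof (intro sum.cong refl, clarify)
      fix k \<kappa>
      have "(\<Prod>i\<in>S. w ((\<kappa>(a := k)) i) (x $ i)) = (\<Prod>i\<in>S. w (\<kappa> i) (x $ i))"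
        using insert by (intro prod.cong) auto
      moreover have "(\<chi> i. if i \<in> insert a S then nd ((\<kappa>(a := k)) i) else x $ i) = vupd (?z \<kappa>) a (nd k)"
        by (auto simp: vupd_def vec_eq_iff)
      ultimately show "(\<Prod>i\<in>insert a S. w ((\<kappa>(a := k)) i) (x $ i)) * h (\<chi> i. if i \<in> insert a S then nd ((\<kappa>(a := k)) i) else x $ i)
        = w k (x $ a) * (\<Prod>i\<in>S. w (\<kappa> i) (x $ i)) * h (vupd (?z \<kappa>) a (nd k))"
        using insert by simp
    qed
    also have "\<dots> = (\<Sum>\<kappa>\<in>PiE S (\<lambda>_. K). (\<Prod>i\<in>S. w (\<kappa> i) (x $ i)) * (\<Sum>k\<in>K. w k (x $ a) * h (vupd (?z \<kappa>) a (nd k))))"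
      by (subst sum.cartesian_product[symmetric], subst sum.swap) (simp add: sum_distrib_left mult_ac)
    finally have "Q S - Q (insert a S) = (\<Sum>\<kappa>\<in>PiE S (\<lambda>_. K). (\<Prod>i\<in>S. w (\<kappa> i) (x $ i)) *
       (h (vupd (?z \<kappa>) a (x $ a)) - (\<Sum>k\<in>K. w k (x $ a) * h (vupd (?z \<kappa>) a (nd k)))))"
      unfolding z by (simp add: Q_def right_diff_distrib sum_subtractf)
    also have "\<bar>\<dots>\<bar> \<le> (\<Sum>\<kappa>\<in>PiE S (\<lambda>_. K). \<bar>\<Prod>i\<in>S. w (\<kappa> i) (x $ i)\<bar> * \<epsilon>)"
      by (rule order.trans[OF sum_abs sum_mono]) (auto simp: abs_mult intro!: mult_left_mono err x)
    also have "\<dots> = (\<Sum>\<kappa>\<in>PiE S (\<lambda>_. K). \<bar>\<Prod>i\<in>S. w (\<kappa> i) (x $ i)\<bar>) * \<epsilon>" by (simp add: sum_distrib_right)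
    also have "\<dots> \<le> \<Lambda> ^ card S * \<epsilon>"
      using tensor_abs_sum[OF K, of S w "\<lambda>i. x $ i" \<Lambda>] bnd x insert L by (intro mult_right_mono) auto
    also have "\<dots> \<le> \<Lambda> ^ CARD('d) * \<epsilon>"
      using L by (intro mult_right_mono power_increasing card_mono) auto
    finally have "\<bar>h x - Q (insert a S)\<bar> \<le> real (card S) * \<Lambda> ^ CARD('d) * \<epsilon> + \<Lambda> ^ CARD('d) * \<epsilon>"
      using insert by linarith
    then show ?case using insert by (simp add: algebra_simps)
  qed auto
  have "Q UNIV = (\<Sum>\<kappa>\<in>PiE UNIV (\<lambda>_. K). (\<Prod>i\<in>UNIV. w (\<kappa> i) (x $ i)) * h (\<chi> i. nd (\<kappa> i)))"
    by (simp add: Q_def)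
  with *[of UNIV] show ?thesis by simp
qed

section \<open>Deviation of the empirical measure\<close>

definition dev :: "'a measure \<Rightarrow> nat \<Rightarrow> (nat \<Rightarrow> 'a) \<Rightarrow> ('a \<Rightarrow> real) \<Rightarrow> real" where
  "dev M n X f = (\<integral>x. f x \<partial>M) - (\<Sum>i<n. f (X i)) / real n"

lemma dev_measurable [measurable]:
  assumes [measurable]: "f \<in> borel_measurable M"
  shows "(\<lambda>X. dev M n X f) \<in> borel_measurable (PiM {0..<n} (\<lambda>_. M))"
  unfolding dev_def by measurable

lemma dev_square_expectation:
  assumes "prob_space M" and f [measurable]: "f \<in> borel_measurable M" and B: "\<And>x. \<bar>f x\<bar> \<le> B" and n: "n > 0"
  shows "(\<integral>\<^sup>+X. ennreal ((dev M n X f)\<^sup>2) \<partial>PiM {0..<n} (\<lambda>_. M)) \<le> ennreal ((\<integral>x. (f x)\<^sup>2 \<partial>M) / n)"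
proof -
  interpret M: prob_space M by fact
  interpret P: product_prob_space "\<lambda>_. M" "{0..<n}" ..
  interpret F: finite_product_prob_space "\<lambda>_::nat. M" "{0..<n}" by standard auto
  let ?P = "PiM {0..<n} (\<lambda>_. M)"
  define m where "m = (\<integral>x. f x \<partial>M)"
  define Y where "Y x = f x - m" for x
  have [measurable]: "Y \<in> borel_measurable M" unfolding Y_def by measurable
  have If: "integrable M f" by (rule M.integrable_const_bound[of _ B]) (auto simp: B)
  have If2: "integrable M (\<lambda>x. (f x)\<^sup>2)"
  proof (rule M.integrable_const_bound[of _ "B\<^sup>2"])
    show "AE x in M. norm ((f x)\<^sup>2) \<le> B\<^sup>2" by (auto intro!: AE_I2 abs_le_square_iff[THEN iffD1] order.trans[OF B])
  qed simp
  have IY: "integrable M Y" unfolding Y_def by (intro Bochner_Integration.integrable_diff If M.integrable_const)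
  have Y2: "(Y x)\<^sup>2 = (f x)\<^sup>2 - 2 * m * f x + m\<^sup>2" for x by (simp add: Y_def power2_eq_square algebra_simps)
  have IY2: "integrable M (\<lambda>x. Y x * Y x)"
    unfolding power2_eq_square[symmetric] Y2 by (intro Bochner_Integration.integrable_add Bochner_Integration.integrable_diff If2 integrable_mult_right If M.integrable_const)
  have EY: "(\<integral>x. Y x \<partial>M) = 0" unfolding Y_def using If by (simp add: m_def M.prob_space)
  have EY2: "(\<integral>x. Y x * Y x \<partial>M) \<le> (\<integral>x. (f x)\<^sup>2 \<partial>M)"
  proof -
    have "(\<integral>x. Y x * Y x \<partial>M) = (\<integral>x. (f x)\<^sup>2 \<partial>M) - 2 * m * m + m\<^sup>2"
      unfolding power2_eq_square[symmetric, of "Y _"] Y2 using If If2 by (simp add: m_def M.prob_space)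
    then show ?thesis by (simp add: power2_eq_square)
  qed
  \<comment> \<open>Written as a product over all coordinates, \<open>Y (X i) * Y (X j)\<close>
    falls under the product formula for integrals, on and off the diagonal alike.\<close>
  define g where "g i j k = (\<lambda>x. (if k = i then Y x else 1) * (if k = j then Y x else 1))" for i j k :: nat
  have Ig: "integrable M (g i j k)" for i j k
    unfolding g_def using IY IY2 by (cases "k = i"; cases "k = j") auto
  have prod: "(\<Prod>k\<in>{0..<n}. g i j k (X k)) = Y (X i) * Y (X j)" if "i < n" "j < n" for i j X
    unfolding g_def prod.distrib using that by (simp add: prod.delta)
  have Iij: "integrable ?P (\<lambda>X. Y (X i) * Y (X j))" if "i < n" "j < n" for i j
    using P.product_integrable_prod[of "{0..<n}" "g i j"] Ig prod[OF that] by simp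
  have Eij: "(\<integral>X. Y (X i) * Y (X j) \<partial>?P) = (if i = j then (\<integral>x. Y x * Y x \<partial>M) else 0)" if "i < n" "j < n" for i j
  proof -
    have "(\<integral>X. Y (X i) * Y (X j) \<partial>?P) = (\<Prod>k\<in>{0..<n}. \<integral>x. g i j k x \<partial>M)"
      using P.product_integral_prod[of "{0..<n}" "g i j"] Ig prod[OF that] by simp
    also have "\<dots> = (if i = j then (\<integral>x. Y x * Y x \<partial>M) else 0)"
    proof (cases "i = j")
      case True
      have "(\<Prod>k\<in>{0..<n}. \<integral>x. g i j k x \<partial>M) = (\<Prod>k\<in>{0..<n}. if k = i then (\<integral>x. Y x * Y x \<partial>M) else 1)"
        unfolding g_def True by (rule prod.cong) (auto simp: M.prob_space)
      then show ?thesis using that True by (simp add: prod.delta)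
    next
      case False
      have "(\<integral>x. g i j i x \<partial>M) = 0" unfolding g_def using False EY by simp
      then show ?thesis using that False by (auto intro!: prod_zero)
    qed
    finally show ?thesis .
  qed
  have dev: "(dev M n X f)\<^sup>2 = (\<Sum>i<n. \<Sum>j<n. Y (X i) * Y (X j)) / (real n)\<^sup>2" for X
  proof -
    have "dev M n X f = - (\<Sum>i<n. Y (X i)) / real n"
      unfolding dev_def Y_def using n by (simp add: sum_subtractf m_def field_simps)
    then have "(dev M n X f)\<^sup>2 = ((\<Sum>i<n. Y (X i)) * (\<Sum>j<n. Y (X j))) / (real n)\<^sup>2"
      by (simp add: power2_eq_square)
    then show ?thesis by (simp add: sum_product)
  qed
  have I: "integrable ?P (\<lambda>X. (dev M n X f)\<^sup>2)"
    unfolding dev by (intro integrable_divide Bochner_Integration.integrable_sum Iij) auto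
  have "(\<integral>X. (dev M n X f)\<^sup>2 \<partial>?P) = (\<Sum>i<n. \<Sum>j<n. \<integral>X. Y (X i) * Y (X j) \<partial>?P) / (real n)\<^sup>2"
  proof -
    have "(\<integral>X. (\<Sum>i<n. \<Sum>j<n. Y (X i) * Y (X j)) \<partial>?P) = (\<Sum>i<n. \<integral>X. (\<Sum>j<n. Y (X i) * Y (X j)) \<partial>?P)"
      by (rule Bochner_Integration.integral_sum) (auto intro!: Bochner_Integration.integrable_sum Iij)
    also have "\<dots> = (\<Sum>i<n. \<Sum>j<n. \<integral>X. Y (X i) * Y (X j) \<partial>?P)"
      by (intro sum.cong refl Bochner_Integration.integral_sum Iij) auto
    finally show ?thesis unfolding dev by (simp only: integral_divide_zero)
  qed
  also have "\<dots> = (\<Sum>i<n. \<integral>x. Y x * Y x \<partial>M) / (real n)\<^sup>2"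
    by (intro arg_cong[where f = "\<lambda>t. t / _"] sum.cong refl) (simp add: Eij)
  also have "\<dots> \<le> (\<integral>x. (f x)\<^sup>2 \<partial>M) / n"
    using n EY2 by (simp add: power2_eq_square divide_right_mono)
  finally have "(\<integral>X. (dev M n X f)\<^sup>2 \<partial>?P) \<le> (\<integral>x. (f x)\<^sup>2 \<partial>M) / n" .
  then show ?thesis by (subst nn_integral_eq_integral[OF I]) (auto intro: ennreal_leI)
qed

text \<open>The squares add up to at most the square of \<open>B\<close> at every point, so the
  total variance does not grow with the number of functions.\<close>

lemma sum_dev_square_expectation:
  assumes "prob_space M" "finite I" "\<And>k. k \<in> I \<Longrightarrow> b k \<in> borel_measurable M"
    and B: "\<And>x. (\<Sum>k\<in>I. \<bar>b k x\<bar>) \<le> B" and n: "n > 0"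
  shows "(\<integral>\<^sup>+X. ennreal (\<Sum>k\<in>I. (dev M n X (b k))\<^sup>2) \<partial>PiM {0..<n} (\<lambda>_. M)) \<le> ennreal (B\<^sup>2 / n)"
proof -
  interpret M: prob_space M by fact
  let ?P = "PiM {0..<n} (\<lambda>_. M)"
  have bB: "\<bar>b k x\<bar> \<le> B" if "k \<in> I" for k x
    using order.trans[OF member_le_sum[OF that, of "\<lambda>k. \<bar>b k x\<bar>"] B] assms(2) by auto
  have B0: "0 \<le> B" using order.trans[OF sum_nonneg B] by fastforce
  have I2: "integrable M (\<lambda>x. (b k x)\<^sup>2)" if "k \<in> I" for k
  proof (rule M.integrable_const_bound[of _ "B\<^sup>2"])
    show "AE x in M. norm ((b k x)\<^sup>2) \<le> B\<^sup>2" using B0 bB[OF that] by (auto intro!: AE_I2 abs_le_square_iff[THEN iffD1])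
  qed (use assms(3)[OF that] in measurable)
  have "(\<integral>\<^sup>+X. ennreal (\<Sum>k\<in>I. (dev M n X (b k))\<^sup>2) \<partial>?P) = (\<integral>\<^sup>+X. (\<Sum>k\<in>I. ennreal ((dev M n X (b k))\<^sup>2)) \<partial>?P)"
    by (intro nn_integral_cong) (simp add: sum_ennreal)
  also have "\<dots> = (\<Sum>k\<in>I. \<integral>\<^sup>+X. ennreal ((dev M n X (b k))\<^sup>2) \<partial>?P)"
    using assms(3) by (intro nn_integral_sum) measurable
  also have "\<dots> \<le> (\<Sum>k\<in>I. ennreal ((\<integral>x. (b k x)\<^sup>2 \<partial>M) / n))"
  proof (rule sum_mono)
    fix k assume "k \<in> I"
    show "(\<integral>\<^sup>+X. ennreal ((dev M n X (b k))\<^sup>2) \<partial>?P) \<le> ennreal ((\<integral>x. (b k x)\<^sup>2 \<partial>M) / n)"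
      by (rule dev_square_expectation[OF assms(1) assms(3)[OF \<open>k \<in> I\<close>] bB[OF \<open>k \<in> I\<close>] n])
  qed
  also have "\<dots> = ennreal ((\<integral>x. (\<Sum>k\<in>I. (b k x)\<^sup>2) \<partial>M) / n)"
    using I2 by (subst sum_ennreal) (auto simp: Bochner_Integration.integral_sum sum_divide_distrib)
  also have "\<dots> \<le> ennreal (B\<^sup>2 / n)"
  proof (intro ennreal_leI divide_right_mono)
    have "(\<Sum>k\<in>I. (b k x)\<^sup>2) \<le> B\<^sup>2" for x
    proof -
      have "(\<Sum>k\<in>I. (b k x)\<^sup>2) \<le> (\<Sum>k\<in>I. \<bar>b k x\<bar> * B)"
      proof (rule sum_mono)
        fix k assume "k \<in> I"
        have "(b k x)\<^sup>2 = \<bar>b k x\<bar> * \<bar>b k x\<bar>" by (simp add: power2_eq_square)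
        then show "(b k x)\<^sup>2 \<le> \<bar>b k x\<bar> * B" using mult_left_mono[OF bB[OF \<open>k \<in> I\<close>], of "\<bar>b k x\<bar>" x] by simp
      qed
      also have "\<dots> \<le> B * B" using B[of x] B0 by (simp flip: sum_distrib_right add: mult_right_mono)
      finally show ?thesis by (simp add: power2_eq_square)
    qed
    then have "(\<integral>x. (\<Sum>k\<in>I. (b k x)\<^sup>2) \<partial>M) \<le> (\<integral>x. B\<^sup>2 \<partial>M)"
      using I2 by (intro integral_mono) auto
    then show "(\<integral>x. (\<Sum>k\<in>I. (b k x)\<^sup>2) \<partial>M) \<le> B\<^sup>2" by (simp add: M.prob_space)
  qed simp
  finally show ?thesis .
qed

lemma abs_le_am_gm: assumes "(0::real) < c" shows "\<bar>t\<bar> \<le> c / 2 + t\<^sup>2 / (2 * c)"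
proof -
  have "0 \<le> (\<bar>t\<bar> - c)\<^sup>2" by simp
  then have "2 * c * \<bar>t\<bar> \<le> c\<^sup>2 + t\<^sup>2" by (simp add: power2_eq_square algebra_simps)
  then show ?thesis using assms by (simp add: field_simps power2_eq_square)
qed

text \<open>Passing from second to first moments costs \<open>sqrt (card I)\<close>, as with
  Cauchy-Schwarz; the elementary inequality \<open>abs_le_am_gm\<close> does this inside nonnegative
  integrals.\<close>

lemma sum_abs_dev_expectation:
  assumes "prob_space M" "finite I" "I \<noteq> {}" "\<And>k. k \<in> I \<Longrightarrow> b k \<in> borel_measurable M"
    and B: "\<And>x. (\<Sum>k\<in>I. \<bar>b k x\<bar>) \<le> B" and n: "n > 0"
  shows "(\<integral>\<^sup>+X. ennreal (\<Sum>k\<in>I. \<bar>dev M n X (b k)\<bar>) \<partial>PiM {0..<n} (\<lambda>_. M)) \<le> ennreal (sqrt (card I / n) * (1 + B\<^sup>2) / 2)"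
proof -
  interpret M: prob_space M by fact
  interpret P: product_prob_space "\<lambda>_. M" "{0..<n}" ..
  let ?P = "PiM {0..<n} (\<lambda>_. M)"
  \<comment> \<open>Balancing choice: \<open>card I * (c / 2)\<close> and
    \<open>1 / (2 * c) / n\<close> both become \<open>sqrt (card I / n) / 2\<close>.\<close>
  define c where "c = 1 / sqrt (card I * n)"
  have N: "real (card I) > 0" using assms by (simp add: card_gt_0_iff)
  then have c: "c > 0" unfolding c_def using n by simp
  have c1: "card I * (c / 2) = sqrt (card I / n) / 2" "1 / (2 * c) / n = sqrt (card I / n) / 2"
    unfolding c_def using N n by (auto simp: real_sqrt_mult real_sqrt_divide field_simps)
  have "(\<integral>\<^sup>+X. ennreal (\<Sum>k\<in>I. \<bar>dev M n X (b k)\<bar>) \<partial>?P)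
     \<le> (\<integral>\<^sup>+X. ennreal (card I * (c / 2)) + ennreal (1 / (2 * c)) * ennreal (\<Sum>k\<in>I. (dev M n X (b k))\<^sup>2) \<partial>?P)"
  proof (intro nn_integral_mono)
    fix X
    have "(\<Sum>k\<in>I. \<bar>dev M n X (b k)\<bar>) \<le> (\<Sum>k\<in>I. c / 2 + (dev M n X (b k))\<^sup>2 / (2 * c))"
      by (intro sum_mono abs_le_am_gm c)
    also have "\<dots> = card I * (c / 2) + 1 / (2 * c) * (\<Sum>k\<in>I. (dev M n X (b k))\<^sup>2)"
      by (simp add: sum.distrib sum_divide_distrib)
    finally show "ennreal (\<Sum>k\<in>I. \<bar>dev M n X (b k)\<bar>) \<le> ennreal (card I * (c / 2)) + ennreal (1 / (2 * c)) * ennreal (\<Sum>k\<in>I. (dev M n X (b k))\<^sup>2)"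
      using c N by (simp flip: ennreal_plus ennreal_mult' add: sum_nonneg ennreal_leI)
  qed
  also have "\<dots> = ennreal (card I * (c / 2)) + ennreal (1 / (2 * c)) * (\<integral>\<^sup>+X. ennreal (\<Sum>k\<in>I. (dev M n X (b k))\<^sup>2) \<partial>?P)"
    using assms(4) by (subst nn_integral_add) (auto simp: nn_integral_cmult P.emeasure_space_1)
  also have "\<dots> \<le> ennreal (card I * (c / 2)) + ennreal (1 / (2 * c)) * ennreal (B\<^sup>2 / n)"
    by (intro add_left_mono mult_left_mono sum_dev_square_expectation assms) auto
  also have "\<dots> = ennreal (card I * (c / 2) + 1 / (2 * c) / n * B\<^sup>2)"
    using c N by (simp flip: ennreal_plus ennreal_mult')
  also have "card I * (c / 2) + 1 / (2 * c) / n * B\<^sup>2 = sqrt (card I / n) * (1 + B\<^sup>2) / 2"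
    unfolding c1 by (simp add: algebra_simps)
  finally show ?thesis .
qed

section \<open>Dyadic interpolation on the unit cube\<close>

lemma mem_unit_cube: "(x::real^'d) \<in> cbox 0 One \<longleftrightarrow> (\<forall>i. x $ i \<in> {0..1})"
proof -
  have "(One::real^'d) \<bullet> axis i 1 = 1" for i :: 'd
    by (simp add: inner_sum_left_Basis axis_in_Basis_iff)
  then show ?thesis by (auto simp: mem_box Basis_vec_def inner_axis)
qed

text \<open>The cap puts the right end \<open>v = 1\<close> into the last cell, so that the cells
  partition the closed interval [0,1].\<close>

definition dcell :: "nat \<Rightarrow> real \<Rightarrow> nat" where
  "dcell j v = min (nat \<lfloor>2 ^ j * v\<rfloor>) (2 ^ j - 1)"

lemma dcell_less: "dcell j v < 2 ^ j"
  by (simp add: dcell_def min.strict_coboundedI2)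

lemma dcell_bounds:
  assumes "v \<in> {0..1}" shows "real (dcell j v) \<le> 2 ^ j * v" "2 ^ j * v \<le> real (dcell j v) + 1"
proof -
  have nn: "0 \<le> 2 ^ j * v" using assms by simp
  have le: "2 ^ j * v \<le> 2 ^ j" using assms by (simp add: mult_left_le)
  have "real (dcell j v) \<le> real (nat \<lfloor>2 ^ j * v\<rfloor>)" unfolding dcell_def by simp
  then show "real (dcell j v) \<le> 2 ^ j * v" using nn by linarith
  show "2 ^ j * v \<le> real (dcell j v) + 1"
  proof (cases "nat \<lfloor>2 ^ j * v\<rfloor> \<le> 2 ^ j - 1")
    case True
    then have "dcell j v = nat \<lfloor>2 ^ j * v\<rfloor>" by (simp add: dcell_def)
    then show ?thesis using nn by linarith
  next
    case False
    then have "dcell j v = 2 ^ j - 1" by (simp add: dcell_def)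
    then have "real (dcell j v) + 1 = 2 ^ j" by (simp add: of_nat_diff)
    then show ?thesis using le by simp
  qed
qed

lemma dcell_eq: "k < 2 ^ j \<Longrightarrow> real k \<le> 2 ^ j * v \<Longrightarrow> 2 ^ j * v < real k + 1 \<Longrightarrow> dcell j v = k"
proof -
  assume "k < 2 ^ j" "real k \<le> 2 ^ j * v" "2 ^ j * v < real k + 1"
  then have "\<lfloor>2 ^ j * v\<rfloor> = int k" by linarith
  then show ?thesis using \<open>k < 2 ^ j\<close> by (simp add: dcell_def)
qed

lemma dcell_one: "dcell j 1 = 2 ^ j - 1"
proof -
  have "\<lfloor>2 ^ j * (1::real)\<rfloor> = 2 ^ j" by (metis floor_of_int mult.right_neutral of_int_numeral of_int_power)
  then show ?thesis by (simp add: dcell_def nat_power_eq)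
qed

lemma dcell_Suc: assumes "v \<in> {0..1}" shows "dcell (Suc j) v div 2 = dcell j v"
proof (cases "v = 1")
  case True
  have "dcell (Suc j) v = 2 * 2 ^ j - 1" "dcell j v = 2 ^ j - 1" using dcell_one by (simp_all add: True)
  moreover have "(1::nat) \<le> 2 ^ j" by simp
  ultimately show ?thesis by arith
next
  case False
  define k where "k = dcell (Suc j) v"
  have lt: "2 ^ Suc j * v < real k + 1"
  proof (rule ccontr)
    assume *: "\<not> ?thesis"
    have "v < 1" using False assms by auto
    then have "2 ^ Suc j * v < 2 ^ Suc j" by simp
    then have "real k + 1 < 2 ^ Suc j" using * by linarith
    moreover have "\<lfloor>2 ^ Suc j * v\<rfloor> \<ge> int k + 1" using * by linarith
    then have "k + 1 \<le> nat \<lfloor>2 ^ Suc j * v\<rfloor>" by linarith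
    ultimately show False unfolding k_def dcell_def by (auto simp: min_def split: if_splits)
  qed
  have ge: "real k \<le> 2 ^ Suc j * v" unfolding k_def by (rule dcell_bounds[OF assms])
  have "dcell j v = k div 2"
  proof (rule dcell_eq)
    show "k div 2 < 2 ^ j" using dcell_less[of "Suc j" v] unfolding k_def by simp
    have "real (2 * (k div 2)) \<le> real k" "real k \<le> real (2 * (k div 2) + 1)" by (simp_all only: of_nat_le_iff)
    then have k2: "2 * real (k div 2) \<le> real k" "real k \<le> 2 * real (k div 2) + 1" by simp_all
    show "real (k div 2) \<le> 2 ^ j * v" using ge k2 unfolding power_Suc by linarith
    show "2 ^ j * v < real (k div 2) + 1" using lt k2 unfolding power_Suc by linarith
  qed
  then show ?thesis unfolding k_def by simp
qed

text \<open>Piecewise polynomial and in general discontinuous at cell boundaries, which is harmless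
  under an integral. It is cut to 0 outside [0,1] so that the weight bounds hold at every point, as
  the variance estimate asks.\<close>

definition dwt :: "nat \<Rightarrow> nat \<Rightarrow> nat \<times> nat \<Rightarrow> real \<Rightarrow> real" where
  "dwt s j kl v = (if v \<in> {0..1} \<and> dcell j v = fst kl then lagr s (snd kl) (2 ^ j * v - real (fst kl)) else 0)"

definition dnode :: "nat \<Rightarrow> nat \<Rightarrow> nat \<times> nat \<Rightarrow> real" where
  "dnode s j kl = (real (fst kl) + inode s (snd kl)) / 2 ^ j"

definition dindex :: "nat \<Rightarrow> nat \<Rightarrow> (nat \<times> nat) set" where
  "dindex s j = {..<2 ^ j} \<times> {..s}"

lemma finite_dindex: "finite (dindex s j)" by (simp add: dindex_def)

text \<open>Only the cell of \<open>v\<close> carries nonzero weights; a general \<open>F\<close>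
  with \<open>F 0 kl = 0\<close> covers weighted sums and sums of absolute values at once.\<close>

lemma sum_dindex:
  assumes "v \<in> {0..1}" and F0: "\<And>kl. F 0 kl = (0::real)"
  shows "(\<Sum>kl\<in>dindex s j. F (dwt s j kl v) kl) = (\<Sum>l\<le>s. F (lagr s l (2 ^ j * v - real (dcell j v))) (dcell j v, l))"
proof -
  have "(\<Sum>kl\<in>dindex s j. F (dwt s j kl v) kl) = (\<Sum>k<2^j. \<Sum>l\<le>s. F (dwt s j (k, l) v) (k, l))"
    unfolding dindex_def by (simp add: sum.cartesian_product)
  also have "\<dots> = (\<Sum>k<2^j. if k = dcell j v then \<Sum>l\<le>s. F (lagr s l (2 ^ j * v - real k)) (k, l) else 0)"
    using assms by (intro sum.cong) (auto simp: dwt_def F0)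
  also have "\<dots> = (\<Sum>l\<le>s. F (lagr s l (2 ^ j * v - real (dcell j v))) (dcell j v, l))"
    using dcell_less[of j v] by (simp add: sum.delta)
  finally show ?thesis .
qed

lemma dcell_local: "v \<in> {0..1} \<Longrightarrow> \<bar>2 ^ j * v - real (dcell j v)\<bar> \<le> 1"
  using dcell_bounds[of v j] by auto

lemma dwt_abs_sum: "(\<Sum>kl\<in>dindex s j. \<bar>dwt s j kl v\<bar>) \<le> (real s + 1) * lagr_const s"
proof (cases "v \<in> {0..1}")
  case True
  have "(\<Sum>kl\<in>dindex s j. \<bar>dwt s j kl v\<bar>) = (\<Sum>l\<le>s. \<bar>lagr s l (2 ^ j * v - real (dcell j v))\<bar>)"
    using sum_dindex[OF True, of "\<lambda>t _. \<bar>t\<bar>"] by simp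
  also have "\<dots> \<le> (\<Sum>l\<le>s. lagr_const s)" by (intro sum_mono lagr_bound dcell_local True) auto
  finally show ?thesis by (simp add: algebra_simps)
next
  case False
  have "(\<Sum>kl\<in>dindex s j. \<bar>dwt s j kl v\<bar>) = 0" using False by (intro sum.neutral) (auto simp: dwt_def)
  then show ?thesis using lagr_const_ge_1[of s] by simp
qed

lemma dwt_measurable [measurable]: "dwt s j kl \<in> borel_measurable borel"
  unfolding dwt_def lagr_def dcell_def by measurable

lemma dwt_interp_err:
  assumes "\<beta> > 0" "holder_line \<beta> g" "v \<in> {0..1}"
  shows "\<bar>g v - (\<Sum>kl\<in>dindex (holder_s \<beta>) j. dwt (holder_s \<beta>) j kl v * g (dnode (holder_s \<beta>) j kl))\<bar>
    \<le> interp_const \<beta> * (1 / 2 ^ j) powr \<beta>"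
proof -
  let ?k = "real (dcell j v)" and ?s = "holder_s \<beta>"
  have "(\<Sum>kl\<in>dindex ?s j. dwt ?s j kl v * g (dnode ?s j kl))
    = (\<Sum>l\<le>?s. lagr ?s l (2 ^ j * v - ?k) * g (?k / 2 ^ j + 1 / 2 ^ j * inode ?s l))"
    using sum_dindex[OF assms(3), of "\<lambda>t kl. t * g (dnode ?s j kl)"] by (simp add: dnode_def add_divide_distrib)
  moreover have abs2: "\<bar>1 / 2 ^ j\<bar> = (1 / 2 ^ j :: real)" by simp
  moreover have "?k / 2 ^ j + 1 / 2 ^ j * (2 ^ j * v - ?k) = v" by (simp add: field_simps)
  ultimately show ?thesis
    using lagr_interp_err[OF assms(1,2) dcell_local[OF assms(3), of j], of "?k / 2 ^ j" "1 / 2 ^ j"] abs2 by (simp only:)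
qed

lemma dnode_in: assumes "kl \<in> dindex s j" shows "dnode s j kl \<in> {0..1}" "dcell j (dnode s j kl) = fst kl"
proof -
  obtain k l where kl: "kl = (k, l)" "k < 2 ^ j" "l \<le> s" using assms by (auto simp: dindex_def)
  have i: "0 \<le> inode s l" "inode s l < 1" using inode_bounds[OF kl(3)] by auto
  have "k + 1 \<le> 2 ^ j" using kl by simp
  then have "real (k + 1) \<le> real (2 ^ j)" by (simp only: of_nat_le_iff)
  then have "real k + 1 \<le> 2 ^ j" by simp
  then show "dnode s j kl \<in> {0..1}" using i by (simp add: dnode_def kl divide_le_eq)
  show "dcell j (dnode s j kl) = fst kl" using i kl by (intro dcell_eq) (auto simp: dnode_def)
qed

text \<open>On a cell of level \<open>j + 1\<close> the coarser interpolant is a single polynomial, hence reproduced.\<close>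

lemma dwt_refine:
  assumes "v \<in> {0..1}" "kl \<in> dindex s j"
  shows "(\<Sum>kl'\<in>dindex s (Suc j). dwt s (Suc j) kl' v * dwt s j kl (dnode s (Suc j) kl')) = dwt s j kl v"
proof -
  let ?c = "dcell (Suc j) v"
  obtain k l where kl: "kl = (k, l)" "k < 2 ^ j" "l \<le> s" using assms by (auto simp: dindex_def)
  let ?u = "2 ^ Suc j * v - real ?c"
  have c: "(?c, l') \<in> dindex s (Suc j)" if "l' \<le> s" for l' using dcell_less[of "Suc j" v] that by (simp add: dindex_def)
  have cc: "dcell j (dnode s (Suc j) (?c, l')) = dcell j v" if "l' \<le> s" for l'
    using dcell_Suc[OF dnode_in(1)[OF c[OF that]], of j] dnode_in(2)[OF c[OF that]] dcell_Suc[OF assms(1), of j] by simp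
  have "(\<Sum>kl'\<in>dindex s (Suc j). dwt s (Suc j) kl' v * dwt s j kl (dnode s (Suc j) kl'))
    = (\<Sum>l'\<le>s. lagr s l' ?u * dwt s j kl (dnode s (Suc j) (?c, l')))"
    using sum_dindex[OF assms(1), of "\<lambda>t kl'. t * dwt s j kl (dnode s (Suc j) kl')" s "Suc j"] by simp
  also have "\<dots> = dwt s j kl v"
  proof (cases "dcell j v = k")
    case False
    then show ?thesis using cc kl by (auto simp: dwt_def)
  next
    case True
    define p where "p = pcompose (lagr_poly s l) [:real ?c / 2 - real k, 1 / 2:]"
    have p: "poly p t = lagr s l (real ?c / 2 - real k + t / 2)" for t
      by (simp add: p_def poly_pcompose poly_lagr_poly)
    have "degree p \<le> s" unfolding p_def
      using degree_pcompose_le[of "lagr_poly s l" "[:real ?c / 2 - real k, 1 / 2:]"] degree_lagr_poly[OF kl(3)] by simp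
    from lagr_reproduce[OF this, of ?u] have "(\<Sum>l'\<le>s. lagr s l' ?u * poly p (inode s l')) = poly p ?u" .
    moreover have "real ?c / 2 - real k + ?u / 2 = 2 ^ j * v - real k" by (simp add: diff_divide_distrib)
    then have "poly p ?u = dwt s j kl v" unfolding p dwt_def using assms True kl(1) by (simp only: fst_conv snd_conv simp_thms if_True)
    moreover have "poly p (inode s l') = dwt s j kl (dnode s (Suc j) (?c, l'))" if "l' \<le> s" for l'
    proof -
      have "2 ^ j * dnode s (Suc j) (?c, l') = (real ?c + inode s l') / 2" by (simp add: dnode_def)
      then have "dwt s j kl (dnode s (Suc j) (?c, l')) = lagr s l ((real ?c + inode s l') / 2 - real k)"
        using cc[OF that] True kl(1) dnode_in(1)[OF c[OF that]] unfolding dwt_def by (simp only: fst_conv snd_conv simp_thms if_True)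
      then show ?thesis unfolding p by (simp add: add_divide_distrib algebra_simps)
    qed
    ultimately show ?thesis by simp
  qed
  finally show ?thesis .
qed

definition mindex :: "nat \<Rightarrow> nat \<Rightarrow> ('d::finite \<Rightarrow> nat \<times> nat) set" where
  "mindex s j = PiE UNIV (\<lambda>_. dindex s j)"

definition mwt :: "nat \<Rightarrow> nat \<Rightarrow> ('d::finite \<Rightarrow> nat \<times> nat) \<Rightarrow> real^'d \<Rightarrow> real" where
  "mwt s j \<kappa> x = (\<Prod>i\<in>UNIV. dwt s j (\<kappa> i) (x $ i))"

definition mnode :: "nat \<Rightarrow> nat \<Rightarrow> ('d::finite \<Rightarrow> nat \<times> nat) \<Rightarrow> real^'d" where
  "mnode s j \<kappa> = (\<chi> i. dnode s j (\<kappa> i))"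

definition minterp :: "nat \<Rightarrow> nat \<Rightarrow> (real^'d::finite \<Rightarrow> real) \<Rightarrow> real^'d \<Rightarrow> real" where
  "minterp s j h x = (\<Sum>\<kappa>\<in>mindex s j. mwt s j \<kappa> x * h (mnode s j \<kappa>))"

lemma finite_mindex: "finite (mindex s j)"
  unfolding mindex_def by (intro finite_PiE) (auto simp: finite_dindex)

lemma card_mindex: "card (mindex s j :: ('d::finite \<Rightarrow> nat \<times> nat) set) = (2 ^ j * Suc s) ^ CARD('d)"
  unfolding mindex_def by (simp add: card_PiE dindex_def card_cartesian_product)

lemma mwt_abs_sum:
  "(\<Sum>\<kappa>\<in>mindex s j. \<bar>mwt s j \<kappa> (x::real^'d)\<bar>) \<le> ((real s + 1) * lagr_const s) ^ CARD('d)"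
  unfolding mindex_def mwt_def by (intro tensor_abs_sum finite_dindex dwt_abs_sum) auto

lemma mwt_measurable: "mwt s j \<kappa> \<in> borel_measurable borel"
  unfolding mwt_def by (intro borel_measurable_prod measurable_compose[OF _ dwt_measurable]) simp

definition minterp_const :: "real \<Rightarrow> nat \<Rightarrow> real" where
  "minterp_const \<beta> d = real d * interp_const \<beta> ^ d * interp_const \<beta>"

lemma minterp_err:
  fixes h :: "real^'d \<Rightarrow> real"
  assumes "\<beta> > 0" "h \<in> holder_class \<beta>" "x \<in> cbox 0 One"
  shows "\<bar>h x - minterp (holder_s \<beta>) j h x\<bar> \<le> minterp_const \<beta> CARD('d) * (1 / 2 ^ j) powr \<beta>"
proof -
  have "\<bar>h x - minterp (holder_s \<beta>) j h x\<bar> \<le> real CARD('d) * interp_const \<beta> ^ CARD('d) * (interp_const \<beta> * (1 / 2 ^ j) powr \<beta>)"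
    unfolding minterp_def mindex_def mwt_def mnode_def
  proof (rule tensor_interp_err[where I = "{0..1}"])
    show "(\<Sum>k\<in>dindex (holder_s \<beta>) j. \<bar>dwt (holder_s \<beta>) j k v\<bar>) \<le> interp_const \<beta>" for v
      using dwt_abs_sum[where s = "holder_s \<beta>" and j = j and v = v] unfolding interp_const_def by linarith
    show "\<bar>h (vupd y i v) - (\<Sum>k\<in>dindex (holder_s \<beta>) j. dwt (holder_s \<beta>) j k v * h (vupd y i (dnode (holder_s \<beta>) j k)))\<bar>
      \<le> interp_const \<beta> * (1 / 2 ^ j) powr \<beta>" if "v \<in> {0..1}" for y i v
      using dwt_interp_err[OF assms(1) holder_class_line[OF assms(2), of y i] that, of j] by simp
    show "x $ i \<in> {0..1}" for i using assms(3) by (simp add: mem_unit_cube)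
  qed (use interp_const_ge_1[of \<beta>] in \<open>auto simp: finite_dindex\<close>)
  then show ?thesis by (simp add: minterp_const_def mult_ac)
qed

lemma mnode_in: "\<kappa> \<in> mindex s j \<Longrightarrow> mnode s j \<kappa> \<in> cbox 0 One"
  unfolding mem_unit_cube mnode_def mindex_def using dnode_in(1) by (auto simp: PiE_iff)

text \<open>This is \<open>dwt_refine\<close> in every coordinate. It makes the corrections of
  successive levels telescope.\<close>

lemma minterp_refine:
  fixes x :: "real^'d"
  assumes "x \<in> cbox 0 One"
  shows "minterp s (Suc j) (minterp s j h) x = minterp s j h x"
proof -
  have *: "(\<Sum>\<kappa>\<in>mindex s (Suc j). mwt s (Suc j) \<kappa> x * mwt s j \<kappa>' (mnode s (Suc j) \<kappa>)) = mwt s j \<kappa>' x"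
    if "\<kappa>' \<in> mindex s j" for \<kappa>'
  proof -
    have "(\<Sum>\<kappa>\<in>mindex s (Suc j). mwt s (Suc j) \<kappa> x * mwt s j \<kappa>' (mnode s (Suc j) \<kappa>))
      = (\<Sum>\<kappa>\<in>mindex s (Suc j). \<Prod>i\<in>UNIV. dwt s (Suc j) (\<kappa> i) (x $ i) * dwt s j (\<kappa>' i) (dnode s (Suc j) (\<kappa> i)))"
      unfolding mwt_def mnode_def prod.distrib by simp
    also have "\<dots> = (\<Prod>i\<in>UNIV. \<Sum>kl\<in>dindex s (Suc j). dwt s (Suc j) kl (x $ i) * dwt s j (\<kappa>' i) (dnode s (Suc j) kl))"
      unfolding mindex_def by (rule prod_sum_PiE[symmetric]) (auto simp: finite_dindex)
    also have "\<dots> = mwt s j \<kappa>' x"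
      unfolding mwt_def using that assms unfolding mindex_def mem_unit_cube
      by (intro prod.cong refl dwt_refine) auto
    finally show ?thesis .
  qed
  have "minterp s (Suc j) (minterp s j h) x
    = (\<Sum>\<kappa>'\<in>mindex s j. (\<Sum>\<kappa>\<in>mindex s (Suc j). mwt s (Suc j) \<kappa> x * mwt s j \<kappa>' (mnode s (Suc j) \<kappa>)) * h (mnode s j \<kappa>'))"
    unfolding minterp_def sum_distrib_left sum_distrib_right by (subst sum.swap) (simp add: mult_ac)
  also have "\<dots> = minterp s j h x" unfolding minterp_def by (intro sum.cong refl) (simp add: *)
  finally show ?thesis .
qed

text \<open>Hierarchical surplus: \<open>h\<close> is the sum over levels of its interpolation corrections, whose coefficients decay like \<open>2 powr (- \<beta> * j)\<close>.\<close>

fun mcoef :: "nat \<Rightarrow> (real^'d::finite \<Rightarrow> real) \<Rightarrow> nat \<Rightarrow> ('d \<Rightarrow> nat \<times> nat) \<Rightarrow> real" where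
  "mcoef s h 0 \<kappa> = h (mnode s 0 \<kappa>)"
| "mcoef s h (Suc j) \<kappa> = h (mnode s (Suc j) \<kappa>) - minterp s j h (mnode s (Suc j) \<kappa>)"

lemma minterp_telescope:
  assumes "x \<in> cbox 0 One"
  shows "minterp s J h x = (\<Sum>j\<le>J. \<Sum>\<kappa>\<in>mindex s j. mcoef s h j \<kappa> * mwt s j \<kappa> x)"
proof (induction J)
  case 0 then show ?case by (simp add: minterp_def mult.commute)
next
  case (Suc J)
  have "(\<Sum>\<kappa>\<in>mindex s (Suc J). mcoef s h (Suc J) \<kappa> * mwt s (Suc J) \<kappa> x)
    = minterp s (Suc J) h x - minterp s (Suc J) (minterp s J h) x"
    by (simp add: minterp_def[of s "Suc J"] sum_subtractf[symmetric] algebra_simps)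
  then show ?case using Suc minterp_refine[OF assms, of s J h] by simp
qed

section \<open>Balancing bias and variance over the levels\<close>

lemma rate_ge:
  assumes "n \<ge> 2"
  shows "real n powr (- \<beta> / real d) \<le> rate \<beta> d n"
    and "2 * \<beta> = real d \<Longrightarrow> real n powr (-1/2) * ln (real n) \<le> rate \<beta> d n"
    and "2 * \<beta> \<noteq> real d \<Longrightarrow> real n powr (-1/2) \<le> rate \<beta> d n"
    and "0 < rate \<beta> d n"
proof -
  show 1: "real n powr (- \<beta> / real d) \<le> rate \<beta> d n" unfolding rate_def by (rule max.cobounded1)
  show "2 * \<beta> = real d \<Longrightarrow> real n powr (-1/2) * ln (real n) \<le> rate \<beta> d n"
    "2 * \<beta> \<noteq> real d \<Longrightarrow> real n powr (-1/2) \<le> rate \<beta> d n"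
    unfolding rate_def by simp_all
  have "0 < real n powr (- \<beta> / real d)" using assms by simp
  with 1 show "0 < rate \<beta> d n" by linarith
qed

lemma inverse_power_powr: "(1 / 2 ^ j) powr \<beta> = 2 powr (- \<beta> * real j)"
proof -
  have "1 / 2 ^ j = (2::real) powr (- real j)" unfolding powr_minus powr_realpow[of 2 j, simplified] by (simp add: divide_inverse)
  then have "(1 / 2 ^ j) powr \<beta> = 2 powr (- real j * \<beta>)" unfolding powr_powr[symmetric] by simp
  then show ?thesis by (simp add: mult.commute)
qed

lemma inverse_sqrt_powr: "1 / sqrt (real n) = real n powr (-1/2)"
proof -
  have e: "(-1/2::real) = -(1/2)" by simp
  show ?thesis unfolding e powr_minus powr_half_sqrt[OF of_nat_0_le_iff] by (rule inverse_eq_divide[symmetric])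
qed

lemma sqrt_power_powr: "sqrt ((2 ^ j) ^ d) = 2 powr (real d / 2 * real j)"
proof -
  have "((2::real) ^ j) ^ d = 2 powr (real (j * d))" by (simp only: powr_realpow power_mult zero_less_numeral)
  then have "sqrt ((2 ^ j) ^ d) = (2 powr (real (j * d))) powr (1/2)" by (simp add: powr_half_sqrt)
  then show ?thesis by (simp add: powr_powr mult.commute)
qed

text \<open>The finest level \<open>J\<close> satisfies \<open>2 ^ (J * d) \<le> n\<close>, up to
  rounding with equality; there the bias \<open>2 powr (- \<beta> * J)\<close> has come down to
  \<open>n powr (- \<beta> / d)\<close>, up to a constant.\<close>

definition dlevel :: "nat \<Rightarrow> nat \<Rightarrow> nat" where "dlevel d n = nat \<lfloor>log 2 (real n) / real d\<rfloor>"

lemma dlevel_bounds: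
  assumes "n \<ge> 2" "d > 0"
  shows "real (dlevel d n) \<le> log 2 (real n) / real d" "log 2 (real n) / real d \<le> real (dlevel d n) + 1"
proof -
  have "0 \<le> log 2 (real n) / real d" using assms by simp
  then show "real (dlevel d n) \<le> log 2 (real n) / real d" "log 2 (real n) / real d \<le> real (dlevel d n) + 1"
    unfolding dlevel_def by linarith+
qed

lemma powr_log_scale: "n \<ge> 2 \<Longrightarrow> 2 powr (a * (log 2 (real n) / b)) = real n powr (a / b)"
proof -
  assume "n \<ge> 2"
  have "2 powr (a * (log 2 (real n) / b)) = 2 powr (log 2 (real n) * (a / b))" by (simp add: mult.commute)
  also have "\<dots> = real n powr (a / b)" unfolding powr_powr[symmetric] using \<open>n \<ge> 2\<close> by simp
  finally show ?thesis .
qed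

lemma dlevel_bias:
  assumes "\<beta> > 0" "d > 0" "n \<ge> 2"
  shows "(1 / 2 ^ dlevel d n) powr \<beta> \<le> 2 powr \<beta> * rate \<beta> d n"
proof -
  let ?J = "dlevel d n"
  have "(1 / 2 ^ ?J) powr \<beta> = 2 powr (- \<beta> * real ?J)" by (rule inverse_power_powr)
  also have "\<dots> \<le> 2 powr (\<beta> + - \<beta> * (log 2 (real n) / real d))"
  proof (intro powr_mono)
    have "\<beta> * (log 2 (real n) / real d) \<le> \<beta> * (real ?J + 1)"
      using dlevel_bounds(2)[OF assms(3,2)] assms(1) by (intro mult_left_mono) auto
    then show "- \<beta> * real ?J \<le> \<beta> + - \<beta> * (log 2 (real n) / real d)" by (simp add: algebra_simps)
  qed simp
  also have "\<dots> = 2 powr \<beta> * real n powr (- \<beta> / real d)"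
    unfolding powr_add powr_log_scale[OF assms(3)] ..
  also have "\<dots> \<le> 2 powr \<beta> * rate \<beta> d n" by (intro mult_left_mono rate_ge assms) auto
  finally show ?thesis .
qed

text \<open>Level \<open>j\<close> contributes \<open>q ^ j / sqrt n\<close>. For
  \<open>q < 1\<close> the coarsest level dominates and gives the parametric rate; for
  \<open>q > 1\<close> the finest one gives \<open>n powr (- \<beta> / d)\<close>; for
  \<open>q = 1\<close>, that is \<open>2 * \<beta> = d\<close>, all levels weigh the same and their
  number is the logarithm in \<open>rate\<close>.\<close>

lemma dlevel_sum:
  assumes "\<beta> > 0" "d > 0"
  shows "\<exists>C>0. \<forall>n\<ge>2. (\<Sum>j\<le>dlevel d n. (1 / 2 ^ j) powr \<beta> * sqrt ((2 ^ j) ^ d / real n)) \<le> C * rate \<beta> d n"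
proof -
  define q where "q = (2::real) powr (real d / 2 - \<beta>)"
  have q0: "q > 0" unfolding q_def by simp
  have t: "(1 / 2 ^ j) powr \<beta> * sqrt ((2 ^ j) ^ d / real n) = q ^ j * real n powr (-1/2)" if "n \<ge> 2" for j n
  proof -
    have "(1 / 2 ^ j) powr \<beta> = 2 powr (- \<beta> * real j)" by (rule inverse_power_powr)
    moreover have "sqrt ((2 ^ j) ^ d / real n) = 2 powr (real d / 2 * real j) * real n powr (-1/2)"
    proof -
      have "sqrt ((2 ^ j) ^ d) = 2 powr (real d / 2 * real j)" by (rule sqrt_power_powr)
      then have "sqrt ((2 ^ j) ^ d / real n) = 2 powr (real d / 2 * real j) * (1 / sqrt (real n))"
        by (simp add: real_sqrt_divide)
      then show ?thesis unfolding inverse_sqrt_powr .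
    qed
    moreover have "q ^ j = 2 powr ((real d / 2 - \<beta>) * real j)" by (simp add: q_def powr_realpow[symmetric] powr_powr)
    ultimately show ?thesis by (simp add: powr_add[symmetric] algebra_simps)
  qed
  have S: "(\<Sum>j\<le>dlevel d n. (1 / 2 ^ j) powr \<beta> * sqrt ((2 ^ j) ^ d / real n)) = (\<Sum>j\<le>dlevel d n. q ^ j) * real n powr (-1/2)"
    if "n \<ge> 2" for n by (simp add: t[OF that] sum_distrib_right)
  consider "q < 1" | "q = 1" | "q > 1" by linarith
  then show ?thesis
  proof cases
    case 1
    then have "2 powr (real d / 2 - \<beta>) < 2 powr 0" by (simp add: q_def)
    then have ne: "2 * \<beta> \<noteq> real d" by (subst (asm) powr_less_cancel_iff) auto
    have g: "(\<Sum>j\<le>J. q ^ j) \<le> 1 / (1 - q)" for J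
      using 1 q0 by (simp add: sum_gp0 divide_right_mono)
    show ?thesis
    proof (intro exI[of _ "1 / (1 - q)"] conjI allI impI)
      fix n :: nat assume n: "n \<ge> 2"
      show "(\<Sum>j\<le>dlevel d n. (1 / 2 ^ j) powr \<beta> * sqrt ((2 ^ j) ^ d / real n)) \<le> 1 / (1 - q) * rate \<beta> d n"
        unfolding S[OF n] by (intro mult_mono g rate_ge(3) n ne) (use 1 in auto)
    qed (use 1 in simp)
  next
    case 2
    then have "2 powr (real d / 2 - \<beta>) = 2 powr 0" by (simp add: q_def)
    then have e: "2 * \<beta> = real d" by (subst (asm) powr_inj) auto
    show ?thesis
    proof (intro exI[of _ "2 / ln 2"] conjI allI impI)
      fix n :: nat assume n: "n \<ge> 2"
      have l: "1 \<le> ln n / ln 2" using n by simp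
      have "log 2 (real n) / real d \<le> log 2 (real n) / 1" using n assms(2) by (intro divide_left_mono) auto
      then have "real (dlevel d n) \<le> ln n / ln 2" using dlevel_bounds(1)[OF n assms(2)] by (simp add: log_def)
      note a = this
      have "real (dlevel d n) + 1 \<le> 2 / ln 2 * ln n"
      proof -
        have "2 / ln 2 * ln n = ln n / ln 2 + ln n / ln 2" by simp
        then show ?thesis using a l by linarith
      qed
      then have "(\<Sum>j\<le>dlevel d n. q ^ j) \<le> 2 / ln 2 * ln n" by (simp add: 2 add.commute)
      then have "(\<Sum>j\<le>dlevel d n. q ^ j) * real n powr (-1/2) \<le> 2 / ln 2 * ln n * real n powr (-1/2)" by (rule mult_right_mono) simp
      also have "\<dots> = 2 / ln 2 * (real n powr (-1/2) * ln n)" by simp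
      also have "\<dots> \<le> 2 / ln 2 * rate \<beta> d n" by (intro mult_left_mono rate_ge(2) n e) auto
      finally show "(\<Sum>j\<le>dlevel d n. (1 / 2 ^ j) powr \<beta> * sqrt ((2 ^ j) ^ d / real n)) \<le> 2 / ln 2 * rate \<beta> d n"
        unfolding S[OF n] .
    qed simp
  next
    case 3
    then have "2 powr 0 < 2 powr (real d / 2 - \<beta>)" by (simp add: q_def)
    then have a: "0 < real d / 2 - \<beta>" by (subst (asm) powr_less_cancel_iff) auto
    have g: "(\<Sum>j\<le>J. q ^ j) \<le> q / (q - 1) * q ^ J" for J
    proof -
      have "(\<Sum>j\<le>J. q ^ j) = (q ^ Suc J - 1) / (q - 1)"
        using 3 by (simp add: sum_gp0 field_simps)
      also have "\<dots> \<le> q ^ Suc J / (q - 1)" using 3 by (intro divide_right_mono) auto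
      finally show ?thesis by simp
    qed
    show ?thesis
    proof (intro exI[of _ "q / (q - 1)"] conjI allI impI)
      fix n :: nat assume n: "n \<ge> 2"
      have "q ^ dlevel d n = 2 powr ((real d / 2 - \<beta>) * real (dlevel d n))"
        by (simp add: q_def powr_realpow[symmetric] powr_powr)
      also have "\<dots> \<le> 2 powr ((real d / 2 - \<beta>) * (log 2 (real n) / real d))"
        using dlevel_bounds(1)[OF n assms(2)] a by (intro powr_mono mult_left_mono) auto
      also have "\<dots> = real n powr ((real d / 2 - \<beta>) / real d)" by (rule powr_log_scale[OF n])
      finally have "q ^ dlevel d n * real n powr (-1/2) \<le> real n powr ((real d / 2 - \<beta>) / real d) * real n powr (-1/2)"
        by (rule mult_right_mono) simp
      also have "\<dots> = real n powr (- \<beta> / real d)" unfolding powr_add[symmetric]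
        using assms(2) by (intro arg_cong[where f = "\<lambda>t. _ powr t"]) (simp add: field_simps)
      also have "\<dots> \<le> rate \<beta> d n" by (rule rate_ge(1)[OF n])
      finally have r: "q ^ dlevel d n * real n powr (-1/2) \<le> rate \<beta> d n" .
      have "(\<Sum>j\<le>dlevel d n. q ^ j) * real n powr (-1/2) \<le> q / (q - 1) * q ^ dlevel d n * real n powr (-1/2)"
        by (intro mult_right_mono g) auto
      also have "\<dots> = q / (q - 1) * (q ^ dlevel d n * real n powr (-1/2))" by simp
      also have "\<dots> \<le> q / (q - 1) * rate \<beta> d n" using 3 by (intro mult_left_mono r) auto
      finally show "(\<Sum>j\<le>dlevel d n. (1 / 2 ^ j) powr \<beta> * sqrt ((2 ^ j) ^ d / real n)) \<le> q / (q - 1) * rate \<beta> d n"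
        unfolding S[OF n] .
    qed (use 3 in simp)
  qed
qed

context
  fixes \<beta> :: real and \<mu> :: "(real^'d::finite) measure"
  assumes beta_pos: "\<beta> > 0"
    and mu_prob: "prob_space \<mu>" and mu_sets: "sets \<mu> = sets borel"
    and mu_supp: "emeasure \<mu> (cbox 0 One) = 1"
begin

lemma AE_unit_cube: "AE x in \<mu>. x \<in> cbox 0 One"
proof -
  interpret prob_space \<mu> by (rule mu_prob)
  have "prob (cbox 0 One) = 1" using mu_supp by (simp add: measure_def)
  from AE_prob_1[OF this] show ?thesis .
qed

text \<open>A coefficient of level \<open>j > 0\<close> is an interpolation error of level
  \<open>j - 1\<close>; the factor \<open>2 powr \<beta>\<close> translates between the two scales.
  Level 0 has only the sup bound 1.\<close>

lemma mcoef_bound: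
  fixes h :: "real^'d \<Rightarrow> real"
  assumes "h \<in> holder_class \<beta>" "\<kappa> \<in> mindex (holder_s \<beta>) j"
  shows "\<bar>mcoef (holder_s \<beta>) h j \<kappa>\<bar> \<le> max 1 (minterp_const \<beta> CARD('d) * 2 powr \<beta>) * (1 / 2 ^ j) powr \<beta>"
    (is "_ \<le> ?c * _")
proof (cases j)
  case 0
  have "\<bar>mcoef (holder_s \<beta>) h j \<kappa>\<bar> \<le> 1" using holder_class_bound[OF assms(1)] 0 by simp
  then show ?thesis using 0 by simp
next
  case (Suc i)
  have "\<bar>mcoef (holder_s \<beta>) h j \<kappa>\<bar> \<le> minterp_const \<beta> CARD('d) * (1 / 2 ^ i) powr \<beta>"
    using minterp_err[OF beta_pos assms(1) mnode_in[OF assms(2)], of i] by (simp add: Suc)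
  also have "(1 / 2 ^ i) powr \<beta> = 2 powr \<beta> * (1 / 2 ^ j) powr \<beta>"
    unfolding Suc by (simp add: powr_divide powr_mult)
  also have "minterp_const \<beta> CARD('d) * (2 powr \<beta> * (1 / 2 ^ j) powr \<beta>) \<le> ?c * (1 / 2 ^ j) powr \<beta>"
    unfolding mult.assoc[symmetric] by (intro mult_right_mono) auto
  finally show ?thesis .
qed

text \<open>A measurable majorant of the supremum over the Hoelder ball; it replaces an entropy or chaining argument.\<close>

definition emp_bound :: "nat \<Rightarrow> nat \<Rightarrow> (nat \<Rightarrow> real^'d) \<Rightarrow> real" where
  "emp_bound J n X = (\<Sum>j\<le>J. max 1 (minterp_const \<beta> CARD('d) * 2 powr \<beta>) * (1 / 2 ^ j) powr \<beta> *
      (\<Sum>\<kappa>\<in>mindex (holder_s \<beta>) j. \<bar>dev \<mu> n X (mwt (holder_s \<beta>) j \<kappa>)\<bar>))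
    + 2 * (minterp_const \<beta> CARD('d) * (1 / 2 ^ J) powr \<beta>)"

lemma mwt_measurable_mu: "mwt s j \<kappa> \<in> borel_measurable \<mu>"
  using mwt_measurable measurable_cong_sets[OF mu_sets refl] by blast

lemma mwt_bound: "\<kappa> \<in> mindex s j \<Longrightarrow> \<bar>mwt s j \<kappa> (x::real^'d)\<bar> \<le> ((real s + 1) * lagr_const s) ^ CARD('d)"
  using order.trans[OF member_le_sum[of \<kappa> "mindex s j" "\<lambda>\<kappa>. \<bar>mwt s j \<kappa> x\<bar>"] mwt_abs_sum] by (simp add: finite_mindex)

text \<open>The function enters only through coefficients of known decay, while the deviations of
  the weights are common to the whole class. The interpolation remainder is paid twice, under \<mu>
  and under the sample.\<close>

lemma dev_le_emp_bound:
  assumes h: "h \<in> holder_class \<beta>" and X: "\<And>i. i < n \<Longrightarrow> X i \<in> cbox 0 One" and n: "n > 0"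
  shows "dev \<mu> n X h \<le> emp_bound J n X"
proof -
  interpret prob_space \<mu> by (rule mu_prob)
  let ?s = "holder_s \<beta>" and ?e = "minterp_const \<beta> CARD('d) * (1 / 2 ^ J) powr \<beta>"
  let ?T = "\<lambda>x. \<Sum>j\<le>J. \<Sum>\<kappa>\<in>mindex ?s j. mcoef ?s h j \<kappa> * mwt ?s j \<kappa> x"
  have err: "\<bar>h x - ?T x\<bar> \<le> ?e" if "x \<in> cbox 0 One" for x
    using minterp_err[OF beta_pos h that, of J] unfolding minterp_telescope[OF that, of ?s J h] .
  have Iw: "integrable \<mu> (mwt ?s j \<kappa>)" if "\<kappa> \<in> mindex ?s j" for j \<kappa>
    by (rule integrable_const_bound[of _ "((real ?s + 1) * lagr_const ?s) ^ CARD('d)"])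
       (use mwt_bound[OF that] mwt_measurable_mu in auto)
  have IT: "integrable \<mu> ?T" by (intro Bochner_Integration.integrable_sum integrable_mult_right Iw)
  have hm: "h \<in> borel_measurable \<mu>"
    using borel_measurable_continuous_onI[OF holder_class_continuous[OF beta_pos h]] measurable_cong_sets[OF mu_sets refl] by blast
  have Ih: "integrable \<mu> h" by (rule integrable_const_bound[of _ 1]) (use holder_class_bound[OF h] hm in auto)
  have "(\<integral>x. h x \<partial>\<mu>) \<le> (\<integral>x. ?T x + ?e \<partial>\<mu>)"
    using AE_unit_cube err by (intro integral_mono_AE Ih Bochner_Integration.integrable_add IT) (fastforce elim: eventually_mono)+
  then have 1: "(\<integral>x. h x \<partial>\<mu>) \<le> (\<integral>x. ?T x \<partial>\<mu>) + ?e" using IT by (simp add: prob_space)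
  have "(\<Sum>i<n. ?T (X i) - ?e) \<le> (\<Sum>i<n. h (X i))" using err[OF X] by (intro sum_mono) fastforce
  then have "((\<Sum>i<n. ?T (X i)) - n * ?e) / n \<le> (\<Sum>i<n. h (X i)) / n"
    by (intro divide_right_mono) (simp_all add: sum_subtractf)
  then have 2: "(\<Sum>i<n. ?T (X i)) / n - ?e \<le> (\<Sum>i<n. h (X i)) / n" using n by (simp add: diff_divide_distrib)
  have "(\<integral>x. ?T x \<partial>\<mu>) - (\<Sum>i<n. ?T (X i)) / n = (\<Sum>j\<le>J. \<Sum>\<kappa>\<in>mindex ?s j. mcoef ?s h j \<kappa> * dev \<mu> n X (mwt ?s j \<kappa>))"
  proof -
    have "(\<integral>x. ?T x \<partial>\<mu>) = (\<Sum>j\<le>J. \<integral>x. (\<Sum>\<kappa>\<in>mindex ?s j. mcoef ?s h j \<kappa> * mwt ?s j \<kappa> x) \<partial>\<mu>)"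
      by (intro Bochner_Integration.integral_sum Bochner_Integration.integrable_sum integrable_mult_right Iw)
    also have "\<dots> = (\<Sum>j\<le>J. \<Sum>\<kappa>\<in>mindex ?s j. mcoef ?s h j \<kappa> * (\<integral>x. mwt ?s j \<kappa> x \<partial>\<mu>))"
    proof (rule sum.cong[OF refl])
      fix j
      have "(\<integral>x. (\<Sum>\<kappa>\<in>mindex ?s j. mcoef ?s h j \<kappa> * mwt ?s j \<kappa> x) \<partial>\<mu>) = (\<Sum>\<kappa>\<in>mindex ?s j. \<integral>x. mcoef ?s h j \<kappa> * mwt ?s j \<kappa> x \<partial>\<mu>)"
        by (intro Bochner_Integration.integral_sum integrable_mult_right Iw)
      then show "(\<integral>x. (\<Sum>\<kappa>\<in>mindex ?s j. mcoef ?s h j \<kappa> * mwt ?s j \<kappa> x) \<partial>\<mu>) = (\<Sum>\<kappa>\<in>mindex ?s j. mcoef ?s h j \<kappa> * (\<integral>x. mwt ?s j \<kappa> x \<partial>\<mu>))"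
        by simp
    qed
    finally have a: "(\<integral>x. ?T x \<partial>\<mu>) = (\<Sum>j\<le>J. \<Sum>\<kappa>\<in>mindex ?s j. mcoef ?s h j \<kappa> * (\<integral>x. mwt ?s j \<kappa> x \<partial>\<mu>))" .
    have "(\<Sum>i<n. ?T (X i)) = (\<Sum>j\<le>J. \<Sum>i<n. \<Sum>\<kappa>\<in>mindex ?s j. mcoef ?s h j \<kappa> * mwt ?s j \<kappa> (X i))" by (rule sum.swap)
    also have "\<dots> = (\<Sum>j\<le>J. \<Sum>\<kappa>\<in>mindex ?s j. \<Sum>i<n. mcoef ?s h j \<kappa> * mwt ?s j \<kappa> (X i))" by (intro sum.cong refl sum.swap)
    finally have b: "(\<Sum>i<n. ?T (X i)) / n = (\<Sum>j\<le>J. \<Sum>\<kappa>\<in>mindex ?s j. mcoef ?s h j \<kappa> * ((\<Sum>i<n. mwt ?s j \<kappa> (X i)) / n))"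
      by (simp add: sum_divide_distrib sum_distrib_left)
    show ?thesis unfolding a b dev_def by (simp add: right_diff_distrib sum_subtractf)
  qed
  also have "\<dots> \<le> (\<Sum>j\<le>J. \<Sum>\<kappa>\<in>mindex ?s j. max 1 (minterp_const \<beta> CARD('d) * 2 powr \<beta>) * (1 / 2 ^ j) powr \<beta> * \<bar>dev \<mu> n X (mwt ?s j \<kappa>)\<bar>)"
  proof (rule sum_mono, rule sum_mono)
    fix j and \<kappa> :: "'d \<Rightarrow> nat \<times> nat" assume "\<kappa> \<in> mindex ?s j"
    note m = mult_right_mono[OF mcoef_bound[OF h this] abs_ge_zero[of "dev \<mu> n X (mwt ?s j \<kappa>)"]]
    show "mcoef ?s h j \<kappa> * dev \<mu> n X (mwt ?s j \<kappa>) \<le>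
      max 1 (minterp_const \<beta> CARD('d) * 2 powr \<beta>) * (1 / 2 ^ j) powr \<beta> * \<bar>dev \<mu> n X (mwt ?s j \<kappa>)\<bar>"
      by (rule order.trans[OF abs_ge_self], subst abs_mult, rule m)
  qed
  finally have 3: "(\<integral>x. ?T x \<partial>\<mu>) - (\<Sum>i<n. ?T (X i)) / n \<le> \<dots>" .
  show ?thesis unfolding dev_def[of \<mu> n X h] emp_bound_def sum_distrib_left using 1 2 3 by linarith
qed

lemma emp_bound_measurable: "emp_bound J n \<in> borel_measurable (PiM {0..<n} (\<lambda>_. \<mu>))"
  unfolding emp_bound_def using mwt_measurable_mu by measurable

lemma emp_bound_nonneg: "0 \<le> emp_bound J n X"
  unfolding emp_bound_def minterp_const_def using interp_const_ge_1[of \<beta>]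
  by (intro add_nonneg_nonneg sum_nonneg mult_nonneg_nonneg) auto

text \<open>Level \<open>j\<close> has \<open>(2 ^ j * Suc s) ^ d\<close> weights, hence an expected
  total deviation of order \<open>sqrt ((2 ^ j) ^ d / n)\<close>; weighted with the decay of the
  coefficients this is the sum treated in \<open>dlevel_sum\<close>.\<close>

lemma emp_bound_expectation:
  "\<exists>C>0. \<forall>n\<ge>2. (\<integral>\<^sup>+X. ennreal (emp_bound (dlevel CARD('d) n) n X) \<partial>PiM {0..<n} (\<lambda>_. \<mu>)) \<le> ennreal (C * rate \<beta> CARD('d) n)"
proof -
  interpret prob_space \<mu> by (rule mu_prob)
  let ?d = "CARD('d)" and ?s = "holder_s \<beta>"
  define B where "B = ((real ?s + 1) * lagr_const ?s) ^ ?d"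
  define e where "e = minterp_const \<beta> ?d"
  define c where "c = max 1 (e * 2 powr \<beta>)"
  define a where "a = c * (sqrt (real (Suc ?s) ^ ?d) * (1 + B\<^sup>2) / 2)"
  have e0: "e \<ge> 0" unfolding e_def minterp_const_def using interp_const_ge_1[of \<beta>] by simp
  have c1: "c \<ge> 1" by (simp add: c_def)
  have a0: "a > 0" unfolding a_def using c1 by (intro mult_pos_pos divide_pos_pos) (auto simp: add_pos_nonneg)
  obtain C where C: "C > 0" "\<And>n. n \<ge> 2 \<Longrightarrow> (\<Sum>j\<le>dlevel ?d n. (1 / 2 ^ j) powr \<beta> * sqrt ((2 ^ j) ^ ?d / real n)) \<le> C * rate \<beta> ?d n"
    using dlevel_sum[OF beta_pos, of ?d] by auto
  have "(\<integral>\<^sup>+X. ennreal (emp_bound (dlevel ?d n) n X) \<partial>PiM {0..<n} (\<lambda>_. \<mu>)) \<le> ennreal ((a * C + 2 * e * 2 powr \<beta>) * rate \<beta> ?d n)"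
    if n: "n \<ge> 2" for n
  proof -
    interpret P: product_prob_space "\<lambda>_. \<mu>" "{0..<n}" ..
    let ?J = "dlevel ?d n" and ?P = "PiM {0..<n} (\<lambda>_. \<mu>)"
    let ?S = "\<lambda>j X. \<Sum>\<kappa>\<in>mindex ?s j. \<bar>dev \<mu> n X (mwt ?s j \<kappa>)\<bar>"
    have Sm: "?S j \<in> borel_measurable ?P" for j
      using mwt_measurable_mu by measurable
    have ES: "(\<integral>\<^sup>+X. ennreal (?S j X) \<partial>?P) \<le> ennreal (sqrt ((2 ^ j) ^ ?d / real n) * (sqrt (real (Suc ?s) ^ ?d) * (1 + B\<^sup>2) / 2))" for j
    proof -
      have "(\<integral>\<^sup>+X. ennreal (?S j X) \<partial>?P) \<le> ennreal (sqrt (card (mindex ?s j :: ('d \<Rightarrow> nat \<times> nat) set) / n) * (1 + B\<^sup>2) / 2)"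
        unfolding B_def
      proof (rule sum_abs_dev_expectation[OF mu_prob finite_mindex])
        have "card (mindex ?s j :: ('d \<Rightarrow> nat \<times> nat) set) > 0" unfolding card_mindex by simp
        then show "(mindex ?s j :: ('d \<Rightarrow> nat \<times> nat) set) \<noteq> {}" by (metis card.empty less_irrefl)
      qed (use n mwt_abs_sum mwt_measurable_mu in auto)
      also have "sqrt (card (mindex ?s j :: ('d \<Rightarrow> nat \<times> nat) set) / n) * (1 + B\<^sup>2) / 2
        = sqrt ((2 ^ j) ^ ?d / real n) * (sqrt (real (Suc ?s) ^ ?d) * (1 + B\<^sup>2) / 2)"
      proof -
        have "real (card (mindex ?s j :: ('d \<Rightarrow> nat \<times> nat) set)) = (2 ^ j) ^ ?d * real (Suc ?s) ^ ?d"
          unfolding card_mindex by (simp only: of_nat_power of_nat_mult power_mult_distrib of_nat_numeral)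
        then have "sqrt (card (mindex ?s j :: ('d \<Rightarrow> nat \<times> nat) set) / n) = sqrt ((2 ^ j) ^ ?d / real n) * sqrt (real (Suc ?s) ^ ?d)"
          by (simp only: real_sqrt_mult[symmetric] times_divide_eq_left)
        then show ?thesis by (simp only: mult.assoc times_divide_eq_right)
      qed
      finally show ?thesis .
    qed
    have "(\<integral>\<^sup>+X. ennreal (emp_bound ?J n X) \<partial>?P)
      = (\<integral>\<^sup>+X. (\<Sum>j\<le>?J. ennreal (c * (1 / 2 ^ j) powr \<beta>) * ennreal (?S j X)) + ennreal (2 * (e * (1 / 2 ^ ?J) powr \<beta>)) \<partial>?P)"
      unfolding emp_bound_def e_def[symmetric] c_def[symmetric] using c1 e0
      by (intro nn_integral_cong) (simp flip: ennreal_mult' ennreal_plus add: sum_nonneg sum_ennreal)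
    also have "\<dots> = (\<Sum>j\<le>?J. ennreal (c * (1 / 2 ^ j) powr \<beta>) * (\<integral>\<^sup>+X. ennreal (?S j X) \<partial>?P)) + ennreal (2 * (e * (1 / 2 ^ ?J) powr \<beta>))"
      using Sm by (simp add: nn_integral_add nn_integral_sum nn_integral_cmult P.emeasure_space_1)
    also have "\<dots> \<le> (\<Sum>j\<le>?J. ennreal (c * (1 / 2 ^ j) powr \<beta>) * ennreal (sqrt ((2 ^ j) ^ ?d / real n) * (sqrt (real (Suc ?s) ^ ?d) * (1 + B\<^sup>2) / 2))) + ennreal (2 * (e * (1 / 2 ^ ?J) powr \<beta>))"
      by (intro add_right_mono sum_mono mult_left_mono ES) auto
    also have "\<dots> = (\<Sum>j\<le>?J. ennreal (a * ((1 / 2 ^ j) powr \<beta> * sqrt ((2 ^ j) ^ ?d / real n)))) + ennreal (2 * (e * (1 / 2 ^ ?J) powr \<beta>))"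
      using c1 by (simp flip: ennreal_mult' add: a_def mult_ac)
    also have "\<dots> = ennreal (a * (\<Sum>j\<le>?J. (1 / 2 ^ j) powr \<beta> * sqrt ((2 ^ j) ^ ?d / real n)) + 2 * (e * (1 / 2 ^ ?J) powr \<beta>))"
      using a0 e0 by (simp add: sum_ennreal sum_distrib_left ennreal_plus sum_nonneg)
    also have "\<dots> \<le> ennreal (a * (C * rate \<beta> ?d n) + 2 * (e * (2 powr \<beta> * rate \<beta> ?d n)))"
      using a0 e0 by (intro ennreal_leI add_mono mult_left_mono C(2) dlevel_bias beta_pos n) auto
    finally show ?thesis by (simp add: algebra_simps)
  qed
  moreover have "a * C + 2 * e * 2 powr \<beta> > 0" using a0 C e0 by (intro add_pos_nonneg) auto
  ultimately show ?thesis by blast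
qed

end

section \<open>Approximation by discriminators\<close>

definition clmp :: "real \<Rightarrow> real" where "clmp t = max (-1) (min 1 t)"
definition hat :: "real \<Rightarrow> real" where "hat t = 1 - \<bar>clmp t\<bar>"

lemma clmp_relu: "clmp t = relu (t + 1) - relu (t - 1) - 1"
  by (auto simp: clmp_def relu_def)
lemma hat_relu: "hat t = relu (t + 1) - 2 * relu t + relu (t - 1)"
  by (auto simp: hat_def clmp_def relu_def)
lemma clmp_range: "\<bar>clmp t\<bar> \<le> 1" by (auto simp: clmp_def)
lemma clmp_lip: "\<bar>clmp t - clmp u\<bar> \<le> \<bar>t - u\<bar>" by (auto simp: clmp_def)
lemma hat_range: "0 \<le> hat t" "hat t \<le> 1" using clmp_range[of t] by (auto simp: hat_def)
lemma hat_lip: "\<bar>hat t - hat u\<bar> \<le> \<bar>t - u\<bar>" using clmp_lip[of t u] by (auto simp: hat_def)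
lemma hat_nonzero: "hat t \<noteq> 0 \<Longrightarrow> \<bar>t\<bar> < 1" by (auto simp: hat_def clmp_def split: if_splits)
lemma clmp_id: "\<bar>t\<bar> \<le> 1 \<Longrightarrow> clmp t = t" by (auto simp: clmp_def)

lemma hat_partition:
  assumes "0 \<le> t" "t \<le> real N" shows "(\<Sum>k\<le>N. hat (t - real k)) = 1"
proof -
  define G where "G u = max 0 (min 1 u)" for u :: real
  have h: "hat u = G (u + 1) - G u" for u by (auto simp: G_def hat_def clmp_def)
  have "(\<Sum>k\<le>n. hat (t - real k)) = G (t + 1) - G (t - real n)" for n
  proof (induction n)
    case (Suc n)
    have "t - real (Suc n) + 1 = t - real n" by simp
    then show ?case using Suc h[of "t - real (Suc n)"] by simp
  qed (simp add: h)
  then show ?thesis using assms by (simp add: G_def)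
qed

lemma hat_sum_near: "card {k \<in> {..N}. hat (t - real k) \<noteq> 0} \<le> 2"
proof -
  have "{k \<in> {..N}. hat (t - real k) \<noteq> 0} \<subseteq> {nat \<lfloor>t\<rfloor>, nat \<lfloor>t\<rfloor> + 1}"
    by (auto dest!: hat_nonzero; linarith)
  then have "card {k \<in> {..N}. hat (t - real k) \<noteq> 0} \<le> card {nat \<lfloor>t\<rfloor>, nat \<lfloor>t\<rfloor> + 1}" by (intro card_mono) auto
  then show ?thesis by (auto intro: order.trans[OF _ card_insert_le_m1])
qed

text \<open>A triangle wave turning at the odd integers, written as a sum of clamps so that it costs one ReLU layer.\<close>
definition wave :: "nat \<Rightarrow> real \<Rightarrow> real" where
  "wave C t = -1 + (\<Sum>c<C. (-1) ^ c * (clmp (t - 2 * real c) + 1))"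

lemma wave_end: "2 * real C - 1 \<le> t \<Longrightarrow> wave C t = - ((-1) ^ C)"
proof (induction C)
  case (Suc C)
  then have "clmp (t - 2 * real C) = 1" by (auto simp: clmp_def)
  then show ?case using Suc by (simp add: wave_def)
qed (simp add: wave_def)

lemma wave_val:
  assumes "\<bar>t - 2 * real c\<bar> \<le> 1" "c < C" shows "wave C t = (-1) ^ c * (t - 2 * real c)"
  using assms(2)
proof (induction C)
  case (Suc C)
  have w: "wave (Suc C) t = wave C t + (-1) ^ C * (clmp (t - 2 * real C) + 1)" by (simp add: wave_def)
  show ?case
  proof (cases "C = c")
    case True
    have "wave C t = - ((-1) ^ C)" using assms(1) True by (intro wave_end) auto
    then have "wave c t = - ((-1) ^ c)" using True by simp
    then show ?thesis unfolding True w[unfolded True] clmp_id[OF assms(1)] by (simp add: distrib_left)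
  next
    case False
    then have "c < C" "real c + 1 \<le> real C" using Suc by auto
    then have "clmp (t - 2 * real C) = -1" using assms(1) by (auto simp: clmp_def)
    then show ?thesis unfolding w using Suc \<open>c < C\<close> by simp
  qed
qed simp

lemma clmp_telescope: "(\<Sum>c<C. clmp (t - 2 * real c) + 1) = max 0 (min (2 * real C) (t + 1))"
proof (induction C)
  case (Suc C) then show ?case by (auto simp: clmp_def)
qed simp

text \<open>The clamps move on disjoint intervals, so even with all signs dropped their increments
  between \<open>u\<close> and \<open>t\<close> add up to at most \<open>t - u\<close>.\<close>

lemma wave_lip: "\<bar>wave C t - wave C u\<bar> \<le> \<bar>t - u\<bar>"
proof -
  have *: "\<bar>wave C t - wave C u\<bar> \<le> t - u" if "u \<le> t" for t u
  proof -
    have "wave C t - wave C u = (\<Sum>c<C. (-1) ^ c * (clmp (t - 2 * real c) - clmp (u - 2 * real c)))"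
      by (simp add: wave_def sum_subtractf[symmetric] algebra_simps)
    also have "\<bar>\<dots>\<bar> \<le> (\<Sum>c<C. \<bar>(-1) ^ c * (clmp (t - 2 * real c) - clmp (u - 2 * real c))\<bar>)" by (rule sum_abs)
    also have "\<dots> = (\<Sum>c<C. (clmp (t - 2 * real c) + 1) - (clmp (u - 2 * real c) + 1))"
      using that by (intro sum.cong refl) (auto simp: abs_mult clmp_def)
    also have "\<dots> = max 0 (min (2 * real C) (t + 1)) - max 0 (min (2 * real C) (u + 1))"
      unfolding sum_subtractf clmp_telescope ..
    also have "\<dots> \<le> t - u" using that by auto
    finally show ?thesis .
  qed
  show ?thesis using *[of u t] *[of t u] by (cases "u \<le> t") (auto simp: abs_minus_commute)
qed

text \<open>The wave is linear on intervals of length 2 around even integers, which is the support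
  of a coarse hat in scaled coordinates. Neighbouring supports overlap, so two folds are needed,
  shifted by \<open>p = 0\<close> and \<open>p = 1\<close>; the hat \<open>a\<close> uses the fold
  of its own parity.\<close>

definition fold1 :: "nat \<Rightarrow> nat \<Rightarrow> real \<Rightarrow> real" where
  "fold1 M p v = wave (Suc M) (real M * v - real p)"

lemma fold1_lip: "\<bar>fold1 M p v - fold1 M p w\<bar> \<le> real M * \<bar>v - w\<bar>"
proof -
  have "\<bar>fold1 M p v - fold1 M p w\<bar> \<le> \<bar>(real M * v - real p) - (real M * w - real p)\<bar>"
    unfolding fold1_def by (rule wave_lip)
  also have "\<dots> = real M * \<bar>v - w\<bar>" by (simp add: abs_mult flip: right_diff_distrib)
  finally show ?thesis .
qed

lemma fold1_val:
  assumes "\<bar>real M * v - real a\<bar> \<le> 1" "a \<le> M"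
  shows "fold1 M (a mod 2) v = (-1) ^ (a div 2) * (real M * v - real a)"
proof -
  have a: "real a = real (a mod 2) + 2 * real (a div 2)"
    by (metis mod_mult_div_eq of_nat_add of_nat_mult of_nat_numeral)
  have "a div 2 < Suc M" using assms(2) by simp
  then have "fold1 M (a mod 2) v = (-1) ^ (a div 2) * ((real M * v - real (a mod 2)) - 2 * real (a div 2))"
    unfolding fold1_def using assms(1) a by (intro wave_val) (auto simp: algebra_simps)
  then show ?thesis unfolding a by (simp add: algebra_simps)
qed

text \<open>\<open>loc M p k\<close> is the fine coordinate around the \<open>k\<close>-th node of the folded variable.\<close>
definition loc :: "nat \<Rightarrow> nat \<Rightarrow> nat \<Rightarrow> real \<Rightarrow> real" where
  "loc M p k v = real M * fold1 M p v + real M - real k"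

text \<open>The clamp keeps the polynomial bounded where the fine hat vanishes and changes nothing
  where the hat is positive.\<close>

definition fwt :: "nat \<Rightarrow> nat \<Rightarrow> nat \<times> (nat \<times> nat) \<Rightarrow> real \<Rightarrow> real" where
  "fwt s M \<equiv> \<lambda>(a, k, l) v. hat (real M * v - real a) * (hat (loc M (a mod 2) k v) * lagr s l (clmp (loc M (a mod 2) k v)))"

text \<open>Preimage under the fold within the cell of \<open>a\<close>; the sign records whether
  the fold runs forwards or backwards there. Nodes may lie outside [0,1], which is harmless because
  the class is controlled on the whole space.\<close>

definition fnode :: "nat \<Rightarrow> nat \<Rightarrow> nat \<times> (nat \<times> nat) \<Rightarrow> real" where
  "fnode s M \<equiv> \<lambda>(a, k, l). (real a + (-1) ^ (a div 2) * ((real k - real M) + inode s l) / real M) / real M"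

definition findex :: "nat \<Rightarrow> nat \<Rightarrow> (nat \<times> (nat \<times> nat)) set" where
  "findex s M = {..M} \<times> ({..2 * M} \<times> {..s})"

lemma sum_findex: "(\<Sum>q\<in>findex s M. F q) = (\<Sum>a\<le>M. \<Sum>k\<le>2*M. \<Sum>l\<le>s. F (a, k, l))"
  unfolding findex_def by (simp add: sum.cartesian_product)

lemma fold_hat_partition:
  assumes "hat (real M * v - real a) \<noteq> 0" "a \<le> M"
  shows "(\<Sum>k\<le>2*M. hat (loc M (a mod 2) k v)) = 1"
proof -
  have b: "\<bar>real M * v - real a\<bar> \<le> 1" using hat_nonzero[OF assms(1)] by simp
  have "\<bar>fold1 M (a mod 2) v\<bar> \<le> 1" unfolding fold1_val[OF b assms(2)] using b by (simp add: abs_mult)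
  then have "\<bar>real M * fold1 M (a mod 2) v\<bar> \<le> real M" by (simp add: abs_mult mult_left_le)
  then have "0 \<le> real M * fold1 M (a mod 2) v + real M" "real M * fold1 M (a mod 2) v + real M \<le> real (2 * M)" by auto
  from hat_partition[OF this] show ?thesis unfolding loc_def by simp
qed

lemma fine_total:
  assumes "v \<in> {0..1}"
  shows "(\<Sum>a\<le>M. \<Sum>k\<le>2*M. hat (real M * v - real a) * hat (loc M (a mod 2) k v)) = 1"
proof -
  have "(\<Sum>a\<le>M. \<Sum>k\<le>2*M. hat (real M * v - real a) * hat (loc M (a mod 2) k v)) = (\<Sum>a\<le>M. hat (real M * v - real a))"
    unfolding sum_distrib_left[symmetric]
    by (rule sum.cong[OF refl]) (metis atMost_iff fold_hat_partition mult.right_neutral mult_zero_left)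
  also have "\<dots> = 1" using assms by (intro hat_partition) (auto simp: mult_left_le)
  finally show ?thesis .
qed

lemma fwt_abs_sum:
  assumes "v \<in> {0..1}"
  shows "(\<Sum>q\<in>findex s M. \<bar>fwt s M q v\<bar>) \<le> (real s + 1) * lagr_const s"
proof -
  have "(\<Sum>q\<in>findex s M. \<bar>fwt s M q v\<bar>) = (\<Sum>a\<le>M. \<Sum>k\<le>2*M. \<Sum>l\<le>s. hat (real M * v - real a) * hat (loc M (a mod 2) k v) * \<bar>lagr s l (clmp (loc M (a mod 2) k v))\<bar>)"
    unfolding sum_findex by (simp add: fwt_def abs_mult hat_range mult_ac)
  also have "\<dots> \<le> (\<Sum>a\<le>M. \<Sum>k\<le>2*M. \<Sum>l\<le>s. hat (real M * v - real a) * hat (loc M (a mod 2) k v) * lagr_const s)"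
    by (intro sum_mono mult_left_mono mult_nonneg_nonneg hat_range lagr_bound clmp_range) auto
  also have "\<dots> = (\<Sum>a\<le>M. \<Sum>k\<le>2*M. hat (real M * v - real a) * hat (loc M (a mod 2) k v)) * ((real s + 1) * lagr_const s)"
    by (simp add: sum_distrib_left sum_distrib_right mult_ac add.commute)
  finally show ?thesis using fine_total[OF assms] by simp
qed

text \<open>Two nested partitions of unity reduce the claim to local interpolation with step
  \<open>1 / M\<^sup>2\<close>: order \<open>M\<close> coarse and order \<open>M\<close> fine pieces
  resolve the product of both scales.\<close>

lemma fwt_interp_err:
  assumes "\<beta> > 0" "holder_line \<beta> g" "v \<in> {0..1}" "M > 0"
  shows "\<bar>g v - (\<Sum>q\<in>findex (holder_s \<beta>) M. fwt (holder_s \<beta>) M q v * g (fnode (holder_s \<beta>) M q))\<bar>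
    \<le> interp_const \<beta> * (1 / (real M)\<^sup>2) powr \<beta>"
proof -
  let ?s = "holder_s \<beta>" and ?E = "interp_const \<beta> * (1 / (real M)\<^sup>2) powr \<beta>"
  let ?H = "\<lambda>a k. hat (real M * v - real a) * hat (loc M (a mod 2) k v)"
  let ?I = "\<lambda>a k. (\<Sum>l\<le>?s. lagr ?s l (clmp (loc M (a mod 2) k v)) * g (fnode ?s M (a, k, l)))"
  have "(\<Sum>q\<in>findex ?s M. fwt ?s M q v * g (fnode ?s M q)) = (\<Sum>a\<le>M. \<Sum>k\<le>2*M. ?H a k * ?I a k)"
    unfolding sum_findex by (simp add: fwt_def sum_distrib_left mult_ac)
  moreover have "g v = (\<Sum>a\<le>M. \<Sum>k\<le>2*M. ?H a k * g v)"
    unfolding sum_distrib_right[symmetric] fine_total[OF assms(3)] by simp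
  ultimately have eq: "g v - (\<Sum>q\<in>findex ?s M. fwt ?s M q v * g (fnode ?s M q)) = (\<Sum>a\<le>M. \<Sum>k\<le>2*M. ?H a k * (g v - ?I a k))"
    by (simp add: right_diff_distrib sum_subtractf)
  have "\<bar>\<Sum>a\<le>M. \<Sum>k\<le>2*M. ?H a k * (g v - ?I a k)\<bar> \<le> (\<Sum>a\<le>M. \<bar>\<Sum>k\<le>2*M. ?H a k * (g v - ?I a k)\<bar>)" by (rule sum_abs)
  also have "\<dots> \<le> (\<Sum>a\<le>M. \<Sum>k\<le>2*M. \<bar>?H a k * (g v - ?I a k)\<bar>)" by (rule sum_mono) (rule sum_abs)
  also have "\<dots> \<le> (\<Sum>a\<le>M. \<Sum>k\<le>2*M. ?H a k * ?E)"
  proof (intro sum_mono)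
    fix a k assume ak: "a \<in> {..M}" "k \<in> {..2*M}"
    have *: "\<bar>g v - ?I a k\<bar> \<le> ?E" if ne: "?H a k \<noteq> 0"
    proof -
      have a: "\<bar>real M * v - real a\<bar> \<le> 1" and k: "\<bar>loc M (a mod 2) k v\<bar> \<le> 1"
        using ne hat_nonzero[of "real M * v - real a"] hat_nonzero[of "loc M (a mod 2) k v"] by auto
      \<comment> \<open>\<sigma> is the direction of the fold on this cell. Since
        \<open>\<sigma> * \<sigma> = 1\<close> the fold inverts explicitly, and \<open>v\<close> and
        the nodes become points \<open>x0 + \<delta> * u\<close> for one signed step
        \<delta>.\<close>
      define \<sigma> where "\<sigma> = ((-1) ^ (a div 2) :: real)"
      have s2: "\<sigma> * \<sigma> = 1" "\<bar>\<sigma>\<bar> = 1" unfolding \<sigma>_def by (simp_all flip: power_mult_distrib)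
      define u where "u = loc M (a mod 2) k v"
      have u: "u = real M * (\<sigma> * (real M * v - real a)) + real M - real k"
        unfolding u_def loc_def fold1_val[OF a, of, simplified] \<sigma>_def using fold1_val[OF a] ak by simp
      have "\<sigma> * u = real M * ((\<sigma> * \<sigma>) * (real M * v - real a)) + \<sigma> * (real M - real k)" unfolding u by (simp add: algebra_simps)
      then have su: "\<sigma> * u = real M * (real M * v - real a) + \<sigma> * (real M - real k)" unfolding s2 by simp
      let ?x0 = "(real a + \<sigma> * (real k - real M) / real M) / real M"
      have v: "?x0 + \<sigma> / (real M)\<^sup>2 * u = v"
      proof -
        have "?x0 + \<sigma> / (real M)\<^sup>2 * u = (real M * real a + \<sigma> * (real k - real M) + \<sigma> * u) / (real M)\<^sup>2"
          using assms(4) by (simp add: power2_eq_square add_divide_distrib)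
        also have "real M * real a + \<sigma> * (real k - real M) + \<sigma> * u = (real M)\<^sup>2 * v" unfolding su by (simp add: power2_eq_square algebra_simps)
        finally show ?thesis using assms(4) by simp
      qed
      have nd: "fnode ?s M (a, k, l) = ?x0 + \<sigma> / (real M)\<^sup>2 * inode ?s l" for l
        unfolding fnode_def \<sigma>_def using assms(4) by (simp add: power2_eq_square add_divide_distrib distrib_left)
      have cl: "clmp (loc M (a mod 2) k v) = u" unfolding u_def by (rule clmp_id[OF k])
      have "\<bar>g (?x0 + \<sigma> / (real M)\<^sup>2 * u) - (\<Sum>l\<le>?s. lagr ?s l u * g (?x0 + \<sigma> / (real M)\<^sup>2 * inode ?s l))\<bar>
        \<le> interp_const \<beta> * \<bar>\<sigma> / (real M)\<^sup>2\<bar> powr \<beta>"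
        using k unfolding u_def by (intro lagr_interp_err assms)
      then show ?thesis unfolding v cl nd by (simp add: abs_divide s2)
    qed
    show "\<bar>?H a k * (g v - ?I a k)\<bar> \<le> ?H a k * ?E"
    proof (cases "?H a k = 0")
      case True then show ?thesis by (simp only: mult_zero_left abs_zero order_refl)
    next
      case False
      have H0: "0 \<le> ?H a k" by (intro mult_nonneg_nonneg hat_range)
      show ?thesis unfolding abs_mult[of "?H a k"] abs_of_nonneg[OF H0] by (rule mult_left_mono[OF *[OF False] H0])
    qed
  qed
  also have "\<dots> = ?E" unfolding sum_distrib_right[symmetric] fine_total[OF assms(3)] by simp
  finally show ?thesis unfolding eq .
qed

lemma near_sum_bound:
  fixes F :: "'i \<Rightarrow> real"
  assumes "finite I" "card {i \<in> I. F i \<noteq> 0} \<le> n" "\<And>i. i \<in> I \<Longrightarrow> \<bar>F i\<bar> \<le> b" "0 \<le> b"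
  shows "\<bar>\<Sum>i\<in>I. F i\<bar> \<le> real n * b"
proof -
  have "(\<Sum>i\<in>I. F i) = (\<Sum>i\<in>{i \<in> I. F i \<noteq> 0}. F i)" using assms(1) by (intro sum.mono_neutral_right) auto
  also have "\<bar>\<dots>\<bar> \<le> (\<Sum>i\<in>{i \<in> I. F i \<noteq> 0}. b)" by (rule order.trans[OF sum_abs sum_mono]) (use assms in auto)
  also have "\<dots> = real (card {i \<in> I. F i \<noteq> 0}) * b" by simp
  also have "\<dots> \<le> real n * b" using assms by (intro mult_right_mono) auto
  finally show ?thesis .
qed

text \<open>Terms alive at either of the two points count, hence the factor 2; the size of
  \<open>I\<close> does not enter.\<close>

lemma near_sum_lip:
  fixes F G :: "'i \<Rightarrow> real"
  assumes "finite I" "card {i \<in> I. F i \<noteq> 0} \<le> n" "card {i \<in> I. G i \<noteq> 0} \<le> n"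
    and "\<And>i. i \<in> I \<Longrightarrow> \<bar>F i - G i\<bar> \<le> b" "0 \<le> b"
  shows "\<bar>(\<Sum>i\<in>I. F i) - (\<Sum>i\<in>I. G i)\<bar> \<le> 2 * real n * b"
proof -
  have "{i \<in> I. F i - G i \<noteq> 0} \<subseteq> {i \<in> I. F i \<noteq> 0} \<union> {i \<in> I. G i \<noteq> 0}" by auto
  then have "card {i \<in> I. F i - G i \<noteq> 0} \<le> card ({i \<in> I. F i \<noteq> 0} \<union> {i \<in> I. G i \<noteq> 0})"
    using assms(1) by (intro card_mono) auto
  also have "\<dots> \<le> 2 * n" using card_Un_le[of "{i \<in> I. F i \<noteq> 0}" "{i \<in> I. G i \<noteq> 0}"] assms(2,3) by linarith
  finally have "\<bar>\<Sum>i\<in>I. F i - G i\<bar> \<le> real (2 * n) * b" by (intro near_sum_bound assms)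
  then show ?thesis by (simp add: sum_subtractf)
qed

text \<open>A fixed order of the coordinates, since \<open>aprod\<close> works on lists and its
  value may depend on the order of the factors.\<close>

definition coords :: "'d::finite list" where "coords = (SOME l. set l = UNIV \<and> distinct l)"

lemma coords: "set (coords :: 'd::finite list) = UNIV" "distinct (coords :: 'd list)"
  using someI_ex[OF finite_distinct_list[OF finite_class.finite_UNIV]] unfolding coords_def by metis+

lemma length_coords: "length (coords :: 'd::finite list) = CARD('d)"
  using distinct_card[OF coords(2)] coords(1) by metis

lemma prod_list_coords: "prod_list (map f (coords :: 'd list)) = (\<Prod>i\<in>UNIV. f i)" for f :: "'d::finite \<Rightarrow> real"
  using prod.distinct_set_conv_list[OF coords(2), of f] unfolding coords(1) by simp

section \<open>Factors of the two-scale weights and their products\<close>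

definition fac_c :: "nat \<Rightarrow> nat \<Rightarrow> 'd \<Rightarrow> real^'d::finite \<Rightarrow> real" where
  "fac_c M a i x = hat (real M * x $ i - real a)"

definition fac_h :: "nat \<Rightarrow> nat \<Rightarrow> nat \<Rightarrow> 'd \<Rightarrow> real^'d::finite \<Rightarrow> real" where
  "fac_h M p k i x = hat (loc M p k (x $ i))"

text \<open>Halved to stay within [-1,1], as \<open>amult\<close> requires; the factors of 2 are
  restored by \<open>lcoef\<close>.\<close>

definition fac_z :: "nat \<Rightarrow> nat \<Rightarrow> nat \<Rightarrow> nat \<Rightarrow> nat \<Rightarrow> 'd \<Rightarrow> real^'d::finite \<Rightarrow> real" where
  "fac_z s M p k j i x = (clmp (loc M p k (x $ i)) - inode s j) / 2"

definition afacs :: "nat \<Rightarrow> ('d \<Rightarrow> nat) \<Rightarrow> (real^'d::finite \<Rightarrow> real) list" where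
  "afacs M a = map (\<lambda>i. fac_c M (a i) i) coords"

text \<open>One hat and \<open>s\<close> linear factors per coordinate in a single list, so that one
  use of \<open>net_aprod\<close> forms a whole fine weight.\<close>

definition bfacs :: "nat \<Rightarrow> nat \<Rightarrow> ('d \<Rightarrow> nat) \<Rightarrow> ('d \<Rightarrow> nat \<times> nat) \<Rightarrow> (real^'d::finite \<Rightarrow> real) list" where
  "bfacs s M \<pi> kl = concat (map (\<lambda>i. fac_h M (\<pi> i) (fst (kl i)) i #
     map (\<lambda>j. fac_z s M (\<pi> i) (fst (kl i)) j i) (filter (\<lambda>j. j \<noteq> snd (kl i)) [0..<Suc s])) coords)"

definition aP :: "nat \<Rightarrow> nat \<Rightarrow> ('d \<Rightarrow> nat) \<Rightarrow> real^'d::finite \<Rightarrow> real" where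
  "aP r M a x = aprod r (map (\<lambda>f. f x) (afacs M a))"

definition bP :: "nat \<Rightarrow> nat \<Rightarrow> nat \<Rightarrow> ('d \<Rightarrow> nat) \<Rightarrow> ('d \<Rightarrow> nat \<times> nat) \<Rightarrow> real^'d::finite \<Rightarrow> real" where
  "bP s r M \<pi> kl x = aprod r (map (\<lambda>f. f x) (bfacs s M \<pi> kl))"

lemma length_afacs: "length (afacs M (a :: 'd::finite \<Rightarrow> nat)) = CARD('d)"
  by (simp add: afacs_def length_coords)

lemma length_filter_neq: "l \<le> s \<Longrightarrow> length (filter (\<lambda>j. j \<noteq> l) [0..<Suc s]) = s"
proof -
  assume "l \<le> s"
  have "length (filter (\<lambda>j. j \<noteq> l) [0..<Suc s]) = card (set (filter (\<lambda>j. j \<noteq> l) [0..<Suc s]))"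
    by (rule distinct_card[symmetric]) simp
  also have "set (filter (\<lambda>j. j \<noteq> l) [0..<Suc s]) = {..s} - {l}" by auto
  finally show ?thesis using \<open>l \<le> s\<close> by simp
qed

lemma length_bfacs:
  assumes "\<And>i. snd (kl i) \<le> s" shows "length (bfacs s M \<pi> (kl :: 'd::finite \<Rightarrow> nat \<times> nat)) = CARD('d) * Suc s"
proof -
  have "length (bfacs s M \<pi> kl) = sum_list (map (\<lambda>i::'d. Suc s) coords)"
    unfolding bfacs_def length_concat map_map by (intro arg_cong[where f = sum_list] map_cong refl)
      (simp add: length_filter_neq[OF assms] del: upt_Suc)
  then show ?thesis by (simp add: sum_list_triv length_coords)
qed

text \<open>The fold has slope \<open>M\<close> and the fine coordinate stretches it by another
  \<open>M\<close>; the resulting square is the slope scale of everything built from these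
  factors.\<close>

lemma fac_bounds:
  fixes x y :: "real^'d::finite"
  shows "\<bar>fac_c M a i x\<bar> \<le> 1" "\<bar>fac_h M p k i x\<bar> \<le> 1" "j \<le> s \<Longrightarrow> \<bar>fac_z s M p k j i x\<bar> \<le> 1"
    and "M > 0 \<Longrightarrow> \<bar>fac_c M a i x - fac_c M a i y\<bar> \<le> (real M)\<^sup>2 * dist x y"
    and "\<bar>fac_h M p k i x - fac_h M p k i y\<bar> \<le> (real M)\<^sup>2 * dist x y"
    and "\<bar>fac_z s M p k j i x - fac_z s M p k j i y\<bar> \<le> (real M)\<^sup>2 * dist x y"
proof -
  show "\<bar>fac_c M a i x\<bar> \<le> 1" "\<bar>fac_h M p k i x\<bar> \<le> 1" by (simp_all add: fac_c_def fac_h_def hat_range)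
  show "\<bar>fac_z s M p k j i x\<bar> \<le> 1" if "j \<le> s"
    using inode_bounds[OF that] clmp_range[of "loc M p k (x $ i)"] by (auto simp: fac_z_def)
  have d: "\<bar>x $ i - y $ i\<bar> \<le> dist x y" using dist_vec_nth_le[of x i y] by (simp add: dist_real_def)
  have l: "\<bar>loc M p k (x $ i) - loc M p k (y $ i)\<bar> \<le> (real M)\<^sup>2 * dist x y"
  proof -
    have "\<bar>loc M p k (x $ i) - loc M p k (y $ i)\<bar> = real M * \<bar>fold1 M p (x $ i) - fold1 M p (y $ i)\<bar>"
      unfolding loc_def by (simp add: abs_mult flip: right_diff_distrib)
    also have "\<dots> \<le> real M * (real M * dist x y)"
      by (intro mult_left_mono order.trans[OF fold1_lip] d) auto
    finally show ?thesis by (simp add: power2_eq_square mult.assoc)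
  qed
  show "\<bar>fac_h M p k i x - fac_h M p k i y\<bar> \<le> (real M)\<^sup>2 * dist x y"
    unfolding fac_h_def by (rule order.trans[OF hat_lip l])
  show "\<bar>fac_z s M p k j i x - fac_z s M p k j i y\<bar> \<le> (real M)\<^sup>2 * dist x y"
  proof -
    have "\<bar>clmp (loc M p k (x $ i)) - clmp (loc M p k (y $ i))\<bar> \<le> (real M)\<^sup>2 * dist x y" by (rule order.trans[OF clmp_lip l])
    then have "\<bar>clmp (loc M p k (x $ i)) - clmp (loc M p k (y $ i))\<bar> / 2 \<le> (real M)\<^sup>2 * dist x y"
      by (rule order.trans[rotated]) simp
    moreover have "fac_z s M p k j i x - fac_z s M p k j i y = (clmp (loc M p k (x $ i)) - clmp (loc M p k (y $ i))) / 2"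
      by (simp add: fac_z_def diff_divide_distrib)
    ultimately show ?thesis by simp
  qed
  show "\<bar>fac_c M a i x - fac_c M a i y\<bar> \<le> (real M)\<^sup>2 * dist x y" if "M > 0"
  proof -
    have "\<bar>fac_c M a i x - fac_c M a i y\<bar> \<le> \<bar>(real M * x $ i - real a) - (real M * y $ i - real a)\<bar>"
      unfolding fac_c_def by (rule hat_lip)
    also have "\<dots> = real M * \<bar>x $ i - y $ i\<bar>" by (simp add: abs_mult flip: right_diff_distrib)
    also have "\<dots> \<le> (real M)\<^sup>2 * dist x y" using that d by (intro mult_mono) (auto simp: power2_eq_square)
    finally show ?thesis .
  qed
qed

lemma set_bfacs: "f \<in> set (bfacs s M \<pi> kl) \<Longrightarrow> (\<exists>i. f = fac_h M (\<pi> i) (fst (kl i)) i) \<or> (\<exists>i j. j \<le> s \<and> f = fac_z s M (\<pi> i) (fst (kl i)) j i)"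
  unfolding bfacs_def by (auto simp del: upt_Suc simp: less_Suc_eq_le)

text \<open>The last claim is exact and not approximate, because \<open>aprod\<close> vanishes with
  any of its factors: multiplication errors never leak outside the supports of the hats.\<close>

lemma aP_props:
  fixes x y :: "real^'d::finite"
  assumes "M > 0"
  shows "\<bar>aP r M a x\<bar> \<le> 1" "\<bar>aP r M a x - (\<Prod>i\<in>UNIV. hat (real M * x $ i - real (a i)))\<bar> \<le> CARD('d) * (1/4) ^ r"
    "\<bar>aP r M a x - aP r M a y\<bar> \<le> 4 ^ CARD('d) * ((real M)\<^sup>2 * dist x y)"
    "aP r M a x \<noteq> 0 \<Longrightarrow> hat (real M * x $ i - real (a i)) \<noteq> 0"
proof -
  have b: "\<forall>v\<in>set (map (\<lambda>f. f x) (afacs M a)). \<bar>v\<bar> \<le> 1" by (auto simp: afacs_def fac_bounds)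
  show "\<bar>aP r M a x\<bar> \<le> 1" unfolding aP_def by (rule aprod_range[OF b])
  have "prod_list (map (\<lambda>f. f x) (afacs M a)) = (\<Prod>i\<in>UNIV. hat (real M * x $ i - real (a i)))"
    unfolding afacs_def map_map comp_def fac_c_def by (rule prod_list_coords)
  then show "\<bar>aP r M a x - (\<Prod>i\<in>UNIV. hat (real M * x $ i - real (a i)))\<bar> \<le> CARD('d) * (1/4) ^ r"
    using aprod_err[OF b, of r] unfolding aP_def by (simp add: length_afacs)
  have "\<bar>aP r M a x - aP r M a y\<bar> \<le> (4 ^ length (afacs M a) - 1) * ((real M)\<^sup>2 * dist x y)"
    unfolding aP_def by (rule aprod_lip) (use assms in \<open>auto simp: afacs_def fac_bounds\<close>)
  also have "\<dots> \<le> 4 ^ CARD('d) * ((real M)\<^sup>2 * dist x y)" unfolding length_afacs by (intro mult_right_mono) auto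
  finally show "\<bar>aP r M a x - aP r M a y\<bar> \<le> 4 ^ CARD('d) * ((real M)\<^sup>2 * dist x y)" .
  show "hat (real M * x $ i - real (a i)) \<noteq> 0" if "aP r M a x \<noteq> 0"
  proof
    assume "hat (real M * x $ i - real (a i)) = 0"
    then have "0 \<in> set (map (\<lambda>f. f x) (afacs M a))" unfolding afacs_def using coords(1) by (force simp: fac_c_def)
    then show False using that aprod_0 unfolding aP_def by blast
  qed
qed

definition lcoef :: "nat \<Rightarrow> nat \<Rightarrow> real" where
  "lcoef s l = (\<Prod>j\<in>{..s} - {l}. 2 / (inode s l - inode s j))"

lemma lcoef_bound: assumes "l \<le> s" shows "\<bar>lcoef s l\<bar> \<le> lagr_const s"
proof -
  have "\<bar>lcoef s l\<bar> = (\<Prod>j\<in>{..s} - {l}. \<bar>2 / (inode s l - inode s j)\<bar>)" unfolding lcoef_def by (rule abs_prod)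
  also have "\<dots> \<le> (\<Prod>k\<in>{..s} - {l}. 2 * (real s + 1))"
  proof (rule prod_mono, safe)
    fix k assume k: "k \<le> s" "k \<noteq> l"
    have "2 / \<bar>inode s l - inode s k\<bar> \<le> 2 / (1 / (real s + 1))"
      using inode_diff[OF k(2), of s] by (intro frac_le) auto
    then show "\<bar>2 / (inode s l - inode s k)\<bar> \<le> 2 * (real s + 1)" by (simp add: abs_divide)
  qed simp
  also have "\<dots> = lagr_const s" using assms by (simp add: lagr_const_def)
  finally show ?thesis .
qed

lemma lagr_lcoef: "lagr s l u = lcoef s l * (\<Prod>j\<in>{..s} - {l}. (u - inode s j) / 2)"
proof -
  have g: "v / b = 2 / b * (v / 2)" for v b :: real by simp
  show ?thesis unfolding lagr_def lcoef_def prod.distrib[symmetric] by (rule prod.cong[OF refl g])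
qed

lemma prod_list_concat: "prod_list (concat xss) = prod_list (map prod_list xss)" for xss :: "real list list"
  by (induction xss) auto

lemma bP_props:
  fixes x y :: "real^'d::finite"
  assumes "\<And>i. snd (kl i) \<le> s"
  shows "\<bar>bP s r M \<pi> kl x\<bar> \<le> 1"
    "\<bar>(\<Prod>i\<in>UNIV. lcoef s (snd (kl i))) * bP s r M \<pi> kl x -
      (\<Prod>i\<in>UNIV. hat (loc M (\<pi> i) (fst (kl i)) (x $ i)) * lagr s (snd (kl i)) (clmp (loc M (\<pi> i) (fst (kl i)) (x $ i))))\<bar>
      \<le> lagr_const s ^ CARD('d) * (CARD('d) * Suc s * (1/4) ^ r)"
    "\<bar>bP s r M \<pi> kl x - bP s r M \<pi> kl y\<bar> \<le> 4 ^ (CARD('d) * Suc s) * ((real M)\<^sup>2 * dist x y)"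
    "bP s r M \<pi> kl x \<noteq> 0 \<Longrightarrow> hat (loc M (\<pi> i) (fst (kl i)) (x $ i)) \<noteq> 0"
proof -
  have b: "\<forall>v\<in>set (map (\<lambda>f. f z) (bfacs s M \<pi> kl)). \<bar>v\<bar> \<le> 1" for z :: "real^'d"
    by (auto dest!: set_bfacs simp: fac_bounds)
  show "\<bar>bP s r M \<pi> kl x\<bar> \<le> 1" unfolding bP_def by (rule aprod_range[OF b])
  let ?L = "\<Prod>i\<in>UNIV. lcoef s (snd (kl i))"
  have L: "\<bar>?L\<bar> \<le> lagr_const s ^ CARD('d)"
  proof -
    have "\<bar>?L\<bar> \<le> (\<Prod>i::'d\<in>UNIV. lagr_const s)" unfolding abs_prod by (intro prod_mono) (auto intro: lcoef_bound assms)
    then show ?thesis by simp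
  qed
  have one: "prod_list (map (\<lambda>f. f x) (fac_h M p k i # map (\<lambda>j. fac_z s M p k j i) (filter (\<lambda>j. j \<noteq> l) [0..<Suc s])))
    = hat (loc M p k (x $ i)) * (\<Prod>j\<in>{..s} - {l}. (clmp (loc M p k (x $ i)) - inode s j) / 2)" for p k i l
  proof -
    have st: "set (filter (\<lambda>j. j \<noteq> l) [0..<Suc s]) = {..s} - {l}" by auto
    have "prod_list (map (\<lambda>j. (clmp (loc M p k (x $ i)) - inode s j) / 2) (filter (\<lambda>j. j \<noteq> l) [0..<Suc s]))
      = (\<Prod>j\<in>set (filter (\<lambda>j. j \<noteq> l) [0..<Suc s]). (clmp (loc M p k (x $ i)) - inode s j) / 2)"
      by (rule prod.distinct_set_conv_list[symmetric]) simp
    then show ?thesis unfolding st by (simp add: comp_def fac_h_def fac_z_def del: upt_Suc)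
  qed
  have pl: "prod_list (map (\<lambda>f. f x) (bfacs s M \<pi> kl))
    = (\<Prod>i\<in>UNIV. hat (loc M (\<pi> i) (fst (kl i)) (x $ i)) * (\<Prod>j\<in>{..s} - {snd (kl i)}. (clmp (loc M (\<pi> i) (fst (kl i)) (x $ i)) - inode s j) / 2))"
    unfolding bfacs_def map_concat prod_list_concat map_map
    by (subst prod_list_coords[symmetric], intro arg_cong[where f = prod_list] map_cong refl) (simp only: comp_def one)
  have ex: "(\<Prod>i\<in>UNIV. hat (loc M (\<pi> i) (fst (kl i)) (x $ i)) * lagr s (snd (kl i)) (clmp (loc M (\<pi> i) (fst (kl i)) (x $ i))))
    = ?L * prod_list (map (\<lambda>f. f x) (bfacs s M \<pi> kl))"
    unfolding pl prod.distrib[symmetric] by (intro prod.cong refl) (simp add: lagr_lcoef mult_ac)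
  have "\<bar>bP s r M \<pi> kl x - prod_list (map (\<lambda>f. f x) (bfacs s M \<pi> kl))\<bar> \<le> CARD('d) * Suc s * (1/4) ^ r"
    using aprod_err[OF b, of r x] unfolding bP_def length_map length_bfacs[OF assms] by simp
  then show "\<bar>?L * bP s r M \<pi> kl x -
      (\<Prod>i\<in>UNIV. hat (loc M (\<pi> i) (fst (kl i)) (x $ i)) * lagr s (snd (kl i)) (clmp (loc M (\<pi> i) (fst (kl i)) (x $ i))))\<bar>
      \<le> lagr_const s ^ CARD('d) * (CARD('d) * Suc s * (1/4) ^ r)"
    unfolding ex right_diff_distrib[symmetric] abs_mult using lagr_const_ge_1[of s] by (intro mult_mono L) auto
  have "\<bar>bP s r M \<pi> kl x - bP s r M \<pi> kl y\<bar> \<le> (4 ^ length (bfacs s M \<pi> kl) - 1) * ((real M)\<^sup>2 * dist x y)"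
    unfolding bP_def by (rule aprod_lip) (auto dest!: set_bfacs simp: fac_bounds)
  also have "\<dots> \<le> 4 ^ (CARD('d) * Suc s) * ((real M)\<^sup>2 * dist x y)" unfolding length_bfacs[OF assms] by (intro mult_right_mono) auto
  finally show "\<bar>bP s r M \<pi> kl x - bP s r M \<pi> kl y\<bar> \<le> 4 ^ (CARD('d) * Suc s) * ((real M)\<^sup>2 * dist x y)" .
  show "hat (loc M (\<pi> i) (fst (kl i)) (x $ i)) \<noteq> 0" if "bP s r M \<pi> kl x \<noteq> 0"
  proof
    assume z: "hat (loc M (\<pi> i) (fst (kl i)) (x $ i)) = 0"
    have "fac_h M (\<pi> i) (fst (kl i)) i \<in> set (bfacs s M \<pi> kl)" unfolding bfacs_def using coords(1) by auto
    then have "0 \<in> set (map (\<lambda>f. f x) (bfacs s M \<pi> kl))" using z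
      unfolding set_map by (intro image_eqI[of _ _ "fac_h M (\<pi> i) (fst (kl i)) i"]) (simp_all add: fac_h_def)
    then show False using that aprod_0 unfolding bP_def by blast
  qed
qed

section \<open>Locality of the two-scale interpolant\<close>

definition IA :: "nat \<Rightarrow> ('d::finite \<Rightarrow> nat) set" where "IA M = PiE UNIV (\<lambda>_. {..M})"
definition IB :: "nat \<Rightarrow> nat \<Rightarrow> ('d::finite \<Rightarrow> nat \<times> nat) set" where "IB s M = PiE UNIV (\<lambda>_. {..2 * M} \<times> {..s})"

lemma finite_IA: "finite (IA M)" and finite_IB: "finite (IB s M)"
  unfolding IA_def IB_def by (intro finite_PiE; simp)+

lemma card_IA: "card (IA M :: ('d::finite \<Rightarrow> nat) set) = Suc M ^ CARD('d)"
  and card_IB: "card (IB s M :: ('d::finite \<Rightarrow> nat \<times> nat) set) = (Suc (2 * M) * Suc s) ^ CARD('d)"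
  unfolding IA_def IB_def by (simp_all add: card_PiE card_cartesian_product)

text \<open>Indices whose hats are alive at \<open>x\<close>. Their number is bounded independently
  of \<open>M\<close>, which keeps errors and Lipschitz constants free of the number of
  cells.\<close>

definition NA :: "nat \<Rightarrow> real^'d::finite \<Rightarrow> ('d \<Rightarrow> nat) set" where
  "NA M x = PiE UNIV (\<lambda>i. {k \<in> {..M}. hat (real M * x $ i - real k) \<noteq> 0})"

definition NB :: "nat \<Rightarrow> nat \<Rightarrow> ('d \<Rightarrow> nat) \<Rightarrow> real^'d::finite \<Rightarrow> ('d \<Rightarrow> nat \<times> nat) set" where
  "NB s M \<pi> x = PiE UNIV (\<lambda>i. {k \<in> {..2 * M}. hat (loc M (\<pi> i) k (x $ i)) \<noteq> 0} \<times> {..s})"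

lemma finite_NA: "finite (NA M x)" and finite_NB: "finite (NB s M \<pi> x)"
  unfolding NA_def NB_def by (intro finite_PiE; simp)+

lemma card_NA: "card (NA M (x :: real^'d::finite)) \<le> 2 ^ CARD('d)"
proof -
  have "card (NA M x) \<le> (\<Prod>i::'d\<in>UNIV. 2)" unfolding NA_def card_PiE[OF finite_class.finite_UNIV]
    by (intro prod_mono conjI hat_sum_near) auto
  then show ?thesis by simp
qed

lemma card_NB: "card (NB s M \<pi> (x :: real^'d::finite)) \<le> (2 * Suc s) ^ CARD('d)"
proof -
  have "card (NB s M \<pi> x) \<le> (\<Prod>i::'d\<in>UNIV. 2 * Suc s)"
    unfolding NB_def card_PiE[OF finite_class.finite_UNIV] card_cartesian_product loc_def
    by (intro prod_mono conjI mult_mono hat_sum_near) auto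
  then show ?thesis by simp
qed

text \<open>Number of live fine terms times a bound on each; it rescales \<open>uS\<close> into
  [-1,1] before the outer multiplication.\<close>

definition Lam :: "nat \<Rightarrow> nat \<Rightarrow> real" where "Lam s d = real ((2 * Suc s) ^ d) * lagr_const s ^ d"

lemma Lam_ge_1: "1 \<le> Lam s d"
proof -
  have "1 \<le> real ((2 * Suc s) ^ d)" by (simp add: one_le_power del: power_mult_distrib)
  moreover have "1 \<le> lagr_const s ^ d" using lagr_const_ge_1 by (rule one_le_power)
  ultimately show ?thesis unfolding Lam_def using mult_mono[of 1 "real ((2 * Suc s) ^ d)" 1 "lagr_const s ^ d"] by simp
qed

definition FS_lip_const :: "nat \<Rightarrow> nat \<Rightarrow> real" where
  "FS_lip_const s d = 2 * 2 ^ d * (Lam s d * (2 * (4 ^ d + 2 * 4 ^ (d * Suc s))))"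

context
  fixes s M r :: nat and h :: "real^'d::finite \<Rightarrow> real"
  assumes M: "M > 0" and h: "\<And>x. \<bar>h x\<bar> \<le> 1"
begin

definition gnode :: "('d \<Rightarrow> nat) \<Rightarrow> ('d \<Rightarrow> nat \<times> nat) \<Rightarrow> real^'d" where
  "gnode a kl = (\<chi> i. fnode s M (a i, kl i))"

definition uS :: "('d \<Rightarrow> nat) \<Rightarrow> real^'d \<Rightarrow> real" where
  "uS a x = (\<Sum>kl\<in>IB s M. h (gnode a kl) * ((\<Prod>i\<in>UNIV. lcoef s (snd (kl i))) * bP s r M (\<lambda>i. a i mod 2) kl x))"

text \<open>The function interpolated at \<open>n\<close> nodes has only \<open>O(sqrt n)\<close> coarse factors \<open>aP\<close> and \<open>O(sqrt n)\<close> fine factors \<open>bP\<close>: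
  the fine ones live in a folded coordinate shared by all coarse cells, and the \<open>n\<close> nodal values are the entries of the
  weight matrix between the two families. This is what makes width times depth of order \<open>sqrt n\<close> (up to logarithms) suffice.\<close>

definition FS :: "real^'d \<Rightarrow> real" where
  "FS x = (\<Sum>a\<in>IA M. Lam s CARD('d) * amult r (aP r M a x) (uS a x / Lam s CARD('d)))"

lemma IB_snd: "kl \<in> IB s M \<Longrightarrow> snd (kl i) \<le> s"
  unfolding IB_def by (auto dest!: PiE_mem[of _ _ _ i])

lemma lprod_bound: "kl \<in> IB s M \<Longrightarrow> \<bar>\<Prod>i\<in>UNIV. lcoef s (snd (kl (i::'d)))\<bar> \<le> lagr_const s ^ CARD('d)"
proof -
  assume "kl \<in> IB s M"
  then have "\<bar>\<Prod>i\<in>UNIV. lcoef s (snd (kl i))\<bar> \<le> (\<Prod>i::'d\<in>UNIV. lagr_const s)"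
    unfolding abs_prod by (intro prod_mono) (auto intro: lcoef_bound IB_snd)
  then show ?thesis by simp
qed

lemma aP_near: "{a \<in> IA M. aP r M a x \<noteq> 0} \<subseteq> NA M x"
  using aP_props(4)[OF M] unfolding NA_def IA_def by (auto simp: PiE_iff)

lemma bP_near: "{kl \<in> IB s M. bP s r M \<pi> kl x \<noteq> 0} \<subseteq> NB s M \<pi> x"
proof safe
  fix kl assume kl: "kl \<in> IB s M" "bP s r M \<pi> kl x \<noteq> 0"
  have "kl i \<in> {k \<in> {..2 * M}. hat (loc M (\<pi> i) k (x $ i)) \<noteq> 0} \<times> {..s}" for i
    using bP_props(4)[OF IB_snd[OF kl(1)] kl(2), of i] kl(1) unfolding IB_def
    by (cases "kl i") (auto dest!: PiE_mem[of _ _ _ i])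
  then show "kl \<in> NB s M \<pi> x" unfolding NB_def by auto
qed

lemma uS_term_card: "card {kl \<in> IB s M. h (gnode a kl) * ((\<Prod>i\<in>UNIV. lcoef s (snd (kl i))) * bP s r M \<pi> kl x) \<noteq> 0} \<le> (2 * Suc s) ^ CARD('d)"
  by (rule order.trans[OF card_mono[OF finite_NB] card_NB]) (use bP_near in auto)

lemma uS_bound: "\<bar>uS a x\<bar> \<le> Lam s CARD('d)"
  unfolding uS_def Lam_def
proof (rule near_sum_bound[OF finite_IB uS_term_card])
  fix kl :: "'d \<Rightarrow> nat \<times> nat" assume kl: "kl \<in> IB s M"
  have "\<bar>h (gnode a kl)\<bar> * (\<bar>\<Prod>i\<in>UNIV. lcoef s (snd (kl i))\<bar> * \<bar>bP s r M (\<lambda>i. a i mod 2) kl x\<bar>) \<le> 1 * (lagr_const s ^ CARD('d) * 1)"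
    using lagr_const_ge_1[of s] by (intro mult_mono h lprod_bound kl bP_props(1) IB_snd) auto
  then show "\<bar>h (gnode a kl) * ((\<Prod>i\<in>UNIV. lcoef s (snd (kl i))) * bP s r M (\<lambda>i. a i mod 2) kl x)\<bar> \<le> lagr_const s ^ CARD('d)"
    by (simp add: abs_mult)
qed (use lagr_const_ge_1[of s] in simp)

lemma uS_lip: "\<bar>uS a x - uS a y\<bar> \<le> 2 * Lam s CARD('d) * (4 ^ (CARD('d) * Suc s) * ((real M)\<^sup>2 * dist x y))"
proof -
  let ?D = "4 ^ (CARD('d) * Suc s) * ((real M)\<^sup>2 * dist x y)"
  have "\<bar>uS a x - uS a y\<bar> \<le> 2 * real ((2 * Suc s) ^ CARD('d)) * (lagr_const s ^ CARD('d) * ?D)"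
    unfolding uS_def
  proof (rule near_sum_lip[OF finite_IB uS_term_card uS_term_card])
    fix kl :: "'d \<Rightarrow> nat \<times> nat" assume kl: "kl \<in> IB s M"
    let ?L = "\<Prod>i\<in>UNIV. lcoef s (snd (kl i))" and ?b = "bP s r M (\<lambda>i. a i mod 2) kl"
    have "\<bar>h (gnode a kl)\<bar> * (\<bar>?L\<bar> * \<bar>?b x - ?b y\<bar>) \<le> 1 * (lagr_const s ^ CARD('d) * ?D)"
      using lagr_const_ge_1[of s] by (intro mult_mono h lprod_bound kl bP_props(3) IB_snd) auto
    then show "\<bar>h (gnode a kl) * (?L * ?b x) - h (gnode a kl) * (?L * ?b y)\<bar> \<le> lagr_const s ^ CARD('d) * ?D"
      by (simp add: abs_mult flip: right_diff_distrib)
  qed (use lagr_const_ge_1[of s] in simp)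
  then show ?thesis unfolding Lam_def by (simp only: mult.assoc)
qed

lemma uS_scaled: "\<bar>uS a x / Lam s CARD('d)\<bar> \<le> 1"
  using uS_bound[of a x] Lam_ge_1[of s "CARD('d)"] by (simp add: abs_divide divide_le_eq)

lemma FS_term_card: "card {a \<in> IA M. Lam s CARD('d) * amult r (aP r M a x) (uS a x / Lam s CARD('d)) \<noteq> 0} \<le> 2 ^ CARD('d)"
  by (rule order.trans[OF card_mono[OF finite_NA] card_NA[of M x]]) (use aP_near[of x] in auto)

text \<open>At each point boundedly many coarse terms are alive, each with slope of order
  \<open>M\<^sup>2\<close>, the resolution of the fine scale; the number of stored values does not
  enter.\<close>

lemma FS_lip: "\<bar>FS x - FS y\<bar> \<le> FS_lip_const s CARD('d) * ((real M)\<^sup>2 * dist x y)"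
proof -
  let ?L = "Lam s CARD('d)" and ?D = "(real M)\<^sup>2 * dist x y"
  let ?K = "2 * (4 ^ CARD('d) + 2 * 4 ^ (CARD('d) * Suc s)) :: real"
  have L: "?L > 0" using Lam_ge_1[of s "CARD('d)"] by linarith
  have "\<bar>FS x - FS y\<bar> \<le> 2 * real (2 ^ CARD('d)) * (?L * (?K * ?D))"
    unfolding FS_def
  proof (rule near_sum_lip[OF finite_IA FS_term_card FS_term_card])
    fix a :: "'d \<Rightarrow> nat"
    have "\<bar>uS a x / ?L - uS a y / ?L\<bar> = \<bar>uS a x - uS a y\<bar> / ?L"
      using L by (simp add: abs_divide flip: diff_divide_distrib)
    also have "\<dots> \<le> 2 * (4 ^ (CARD('d) * Suc s) * ?D)" using uS_lip[of a x y] L by (simp add: divide_le_eq mult_ac)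
    finally have u: "\<bar>uS a x / ?L - uS a y / ?L\<bar> \<le> 2 * (4 ^ (CARD('d) * Suc s) * ?D)" .
    have "\<bar>amult r (aP r M a x) (uS a x / ?L) - amult r (aP r M a y) (uS a y / ?L)\<bar>
      \<le> 2 * (\<bar>aP r M a x - aP r M a y\<bar> + \<bar>uS a x / ?L - uS a y / ?L\<bar>)"
      by (intro amult_lip aP_props M uS_scaled)
    also have "\<dots> \<le> 2 * (4 ^ CARD('d) * ?D + 2 * (4 ^ (CARD('d) * Suc s) * ?D))"
      by (intro mult_left_mono add_mono aP_props M u) auto
    also have "\<dots> = ?K * ?D" by (simp add: algebra_simps)
    finally show "\<bar>?L * amult r (aP r M a x) (uS a x / ?L) - ?L * amult r (aP r M a y) (uS a y / ?L)\<bar> \<le> ?L * (?K * ?D)"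
      using L by (simp add: abs_mult flip: right_diff_distrib)
  qed (use L in simp)
  then show ?thesis unfolding FS_lip_const_def by (simp only: mult.assoc of_nat_power of_nat_numeral)
qed

text \<open>\<open>exA\<close>, \<open>exB\<close> and \<open>exU\<close> are built with exact
  products. Comparing with them separates multiplication errors from interpolation errors.\<close>

definition exB :: "('d \<Rightarrow> nat) \<Rightarrow> ('d \<Rightarrow> nat \<times> nat) \<Rightarrow> real^'d \<Rightarrow> real" where
  "exB \<pi> kl x = (\<Prod>i\<in>UNIV. hat (loc M (\<pi> i) (fst (kl i)) (x $ i)) * lagr s (snd (kl i)) (clmp (loc M (\<pi> i) (fst (kl i)) (x $ i))))"

definition exA :: "('d \<Rightarrow> nat) \<Rightarrow> real^'d \<Rightarrow> real" where
  "exA a x = (\<Prod>i\<in>UNIV. hat (real M * x $ i - real (a i)))"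

definition exU :: "('d \<Rightarrow> nat) \<Rightarrow> real^'d \<Rightarrow> real" where
  "exU a x = (\<Sum>kl\<in>IB s M. h (gnode a kl) * exB (\<lambda>i. a i mod 2) kl x)"

lemma exA_range: "\<bar>exA a x\<bar> \<le> 1"
  unfolding exA_def abs_prod by (intro prod_le_1) (auto simp: hat_range)

lemma exB_near: "{kl \<in> IB s M. exB \<pi> kl x \<noteq> 0} \<subseteq> NB s M \<pi> x"
proof safe
  fix kl assume kl: "kl \<in> IB s M" "exB \<pi> kl x \<noteq> 0"
  have "kl i \<in> {k \<in> {..2 * M}. hat (loc M (\<pi> i) k (x $ i)) \<noteq> 0} \<times> {..s}" for i
    using kl unfolding IB_def exB_def
    by (cases "kl i") (auto dest!: PiE_mem[of _ _ _ i] spec[of _ i])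
  then show "kl \<in> NB s M \<pi> x" unfolding NB_def by auto
qed

lemma exA_near: "{a \<in> IA M. exA a x \<noteq> 0} \<subseteq> NA M x"
  unfolding NA_def IA_def exA_def by (auto simp: PiE_iff)

lemma uS_exU: "\<bar>uS a x - exU a x\<bar> \<le> Lam s CARD('d) * (CARD('d) * Suc s * (1/4) ^ r)"
proof -
  let ?\<pi> = "\<lambda>i. a i mod 2"
  have "uS a x - exU a x = (\<Sum>kl\<in>IB s M. h (gnode a kl) * ((\<Prod>i\<in>UNIV. lcoef s (snd (kl i))) * bP s r M ?\<pi> kl x - exB ?\<pi> kl x))"
    unfolding uS_def exU_def by (simp add: sum_subtractf right_diff_distrib)
  moreover have "\<bar>\<Sum>kl\<in>IB s M. h (gnode a kl) * ((\<Prod>i\<in>UNIV. lcoef s (snd (kl i))) * bP s r M ?\<pi> kl x - exB ?\<pi> kl x)\<bar>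
    \<le> real ((2 * Suc s) ^ CARD('d)) * (lagr_const s ^ CARD('d) * (CARD('d) * Suc s * (1/4) ^ r))"
  proof (rule near_sum_bound[OF finite_IB])
    show "card {kl \<in> IB s M. h (gnode a kl) * ((\<Prod>i\<in>UNIV. lcoef s (snd (kl i))) * bP s r M ?\<pi> kl x - exB ?\<pi> kl x) \<noteq> 0} \<le> (2 * Suc s) ^ CARD('d)"
    proof (rule order.trans[OF card_mono[OF finite_NB] card_NB[of s M ?\<pi> x]])
      have "{kl \<in> IB s M. h (gnode a kl) * ((\<Prod>i\<in>UNIV. lcoef s (snd (kl i))) * bP s r M ?\<pi> kl x - exB ?\<pi> kl x) \<noteq> 0}
        \<subseteq> {kl \<in> IB s M. bP s r M ?\<pi> kl x \<noteq> 0} \<union> {kl \<in> IB s M. exB ?\<pi> kl x \<noteq> 0}" by auto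
      then show "{kl \<in> IB s M. h (gnode a kl) * ((\<Prod>i\<in>UNIV. lcoef s (snd (kl i))) * bP s r M ?\<pi> kl x - exB ?\<pi> kl x) \<noteq> 0} \<subseteq> NB s M ?\<pi> x"
        using bP_near[of ?\<pi> x] exB_near[of ?\<pi> x] by blast
    qed
    fix kl :: "'d \<Rightarrow> nat \<times> nat" assume kl: "kl \<in> IB s M"
    have "\<bar>h (gnode a kl)\<bar> * \<bar>(\<Prod>i\<in>UNIV. lcoef s (snd (kl i))) * bP s r M ?\<pi> kl x - exB ?\<pi> kl x\<bar>
      \<le> 1 * (lagr_const s ^ CARD('d) * (CARD('d) * Suc s * (1/4) ^ r))"
      unfolding exB_def by (intro mult_mono h bP_props(2) IB_snd kl) auto
    then show "\<bar>h (gnode a kl) * ((\<Prod>i\<in>UNIV. lcoef s (snd (kl i))) * bP s r M ?\<pi> kl x - exB ?\<pi> kl x)\<bar>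
      \<le> lagr_const s ^ CARD('d) * (CARD('d) * Suc s * (1/4) ^ r)" by (simp only: abs_mult mult_1)
  qed (use lagr_const_ge_1[of s] in simp)
  ultimately show ?thesis unfolding Lam_def by (simp only: mult.assoc)
qed

text \<open>Three errors add up: the outer multiplication, the coarse product and the fine sum. All
  are local, so the constant in front of \<open>(1/4) ^ r\<close> is free of
  \<open>M\<close>.\<close>

lemma FS_exact: "\<bar>FS x - (\<Sum>a\<in>IA M. exA a x * exU a x)\<bar> \<le> 2 ^ CARD('d) * (Lam s CARD('d) * ((1 + CARD('d) + CARD('d) * Suc s) * (1/4) ^ r))"
proof -
  let ?L = "Lam s CARD('d)" and ?q = "(1/4 :: real) ^ r"
  have L: "?L > 0" using Lam_ge_1[of s "CARD('d)"] by linarith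
  have "FS x - (\<Sum>a\<in>IA M. exA a x * exU a x) = (\<Sum>a\<in>IA M. ?L * amult r (aP r M a x) (uS a x / ?L) - exA a x * exU a x)"
    unfolding FS_def by (simp add: sum_subtractf)
  moreover have "\<bar>\<Sum>a\<in>IA M. ?L * amult r (aP r M a x) (uS a x / ?L) - exA a x * exU a x\<bar>
    \<le> real (2 ^ CARD('d)) * (?L * ((1 + CARD('d) + CARD('d) * Suc s) * ?q))"
  proof (rule near_sum_bound[OF finite_IA])
    show "card {a \<in> IA M. ?L * amult r (aP r M a x) (uS a x / ?L) - exA a x * exU a x \<noteq> 0} \<le> 2 ^ CARD('d)"
    proof (rule order.trans[OF card_mono[OF finite_NA] card_NA[of M x]])
      have "{a \<in> IA M. ?L * amult r (aP r M a x) (uS a x / ?L) - exA a x * exU a x \<noteq> 0}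
        \<subseteq> {a \<in> IA M. aP r M a x \<noteq> 0} \<union> {a \<in> IA M. exA a x \<noteq> 0}" by auto
      then show "{a \<in> IA M. ?L * amult r (aP r M a x) (uS a x / ?L) - exA a x * exU a x \<noteq> 0} \<subseteq> NA M x"
        using aP_near[of x] exA_near[of x] by blast
    qed
    fix a :: "'d \<Rightarrow> nat"
    have "\<bar>amult r (aP r M a x) (uS a x / ?L) - aP r M a x * (uS a x / ?L)\<bar> \<le> ?q"
      by (intro amult_err aP_props(1) M uS_scaled)
    then have "?L * \<bar>amult r (aP r M a x) (uS a x / ?L) - aP r M a x * (uS a x / ?L)\<bar> \<le> ?L * ?q" using L by (intro mult_left_mono) auto
    moreover have "?L * amult r (aP r M a x) (uS a x / ?L) - aP r M a x * uS a x = ?L * (amult r (aP r M a x) (uS a x / ?L) - aP r M a x * (uS a x / ?L))"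
      using L by (simp add: right_diff_distrib)
    ultimately have 1: "\<bar>?L * amult r (aP r M a x) (uS a x / ?L) - aP r M a x * uS a x\<bar> \<le> ?L * ?q"
      using L by (simp add: abs_mult)
    have "\<bar>aP r M a x - exA a x\<bar> * \<bar>uS a x\<bar> \<le> (CARD('d) * ?q) * ?L"
      unfolding exA_def by (intro mult_mono aP_props M uS_bound) auto
    then have 2: "\<bar>(aP r M a x - exA a x) * uS a x\<bar> \<le> (CARD('d) * ?q) * ?L" by (simp only: abs_mult)
    have "\<bar>exA a x\<bar> * \<bar>uS a x - exU a x\<bar> \<le> 1 * (?L * (CARD('d) * Suc s * ?q))"
      by (intro mult_mono exA_range uS_exU) auto
    then have 3: "\<bar>exA a x * (uS a x - exU a x)\<bar> \<le> ?L * (CARD('d) * Suc s * ?q)" by (simp only: abs_mult mult_1)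
    have "?L * amult r (aP r M a x) (uS a x / ?L) - exA a x * exU a x
      = (?L * amult r (aP r M a x) (uS a x / ?L) - aP r M a x * uS a x) + (aP r M a x - exA a x) * uS a x + exA a x * (uS a x - exU a x)"
      by (simp add: algebra_simps)
    also have "\<bar>\<dots>\<bar> \<le> ?L * ?q + (CARD('d) * ?q) * ?L + ?L * (CARD('d) * Suc s * ?q)"
      using 1 2 3 by linarith
    also have "\<dots> = ?L * ((1 + CARD('d) + CARD('d) * Suc s) * ?q)" by (simp add: algebra_simps)
    finally show "\<bar>?L * amult r (aP r M a x) (uS a x / ?L) - exA a x * exU a x\<bar> \<le> \<dots>" .
  qed (use L in simp)
  ultimately show ?thesis by simp
qed

text \<open>Pairs of index functions are regrouped as functions into pairs; the parities of
  \<open>a\<close> passed to \<open>exB\<close> make the factors match \<open>fwt\<close>.\<close>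

lemma exact_tensor:
  "(\<Sum>a\<in>IA M. exA a x * exU a x) = (\<Sum>\<kappa>\<in>PiE UNIV (\<lambda>_. findex s M). (\<Prod>i\<in>UNIV. fwt s M (\<kappa> i) (x $ i)) * h (\<chi> i. fnode s M (\<kappa> i)))"
proof -
  have "(\<Sum>a\<in>IA M. exA a x * exU a x) = (\<Sum>(a, kl)\<in>IA M \<times> IB s M. exA a x * (h (gnode a kl) * exB (\<lambda>i. a i mod 2) kl x))"
    unfolding exU_def sum_distrib_left by (rule sum.cartesian_product)
  also have "\<dots> = (\<Sum>\<kappa>\<in>PiE UNIV (\<lambda>_. findex s M). (\<Prod>i\<in>UNIV. fwt s M (\<kappa> i) (x $ i)) * h (\<chi> i. fnode s M (\<kappa> i)))"
  proof (rule sum.reindex_bij_witness[where i = "\<lambda>\<kappa>. (\<lambda>i. fst (\<kappa> i), \<lambda>i. snd (\<kappa> i))" and j = "\<lambda>(a, kl) i. (a i, kl i)"])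
    fix p :: "('d \<Rightarrow> nat) \<times> ('d \<Rightarrow> nat \<times> nat)" assume p: "p \<in> IA M \<times> IB s M"
    obtain a kl where akl: "p = (a, kl)" by (cases p)
    show "(\<lambda>(a, kl) i. (a i, kl i)) p \<in> PiE UNIV (\<lambda>_. findex s M)"
      using p unfolding akl IA_def IB_def findex_def by (auto simp: PiE_iff)
    have "(\<Prod>i\<in>UNIV. fwt s M (a i, kl i) (x $ i)) = exA a x * exB (\<lambda>i. a i mod 2) kl x"
      unfolding exA_def exB_def prod.distrib[symmetric] by (intro prod.cong refl) (auto simp: fwt_def split: prod.splits)
    then show "(\<Prod>i\<in>UNIV. fwt s M ((\<lambda>(a, kl) i. (a i, kl i)) p i) (x $ i)) * h (\<chi> i. fnode s M ((\<lambda>(a, kl) i. (a i, kl i)) p i))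
      = (case p of (a, kl) \<Rightarrow> exA a x * (h (gnode a kl) * exB (\<lambda>i. a i mod 2) kl x))"
      unfolding akl by (simp add: gnode_def)
  qed (auto simp: IA_def IB_def findex_def PiE_iff mem_Times_iff)
  finally show ?thesis .
qed

end

definition disc_err_const :: "real \<Rightarrow> nat \<Rightarrow> real" where
  "disc_err_const \<beta> d = max (minterp_const \<beta> d) (2 ^ d * (Lam (holder_s \<beta>) d * (1 + d + d * Suc (holder_s \<beta>))))"

text \<open>The final clamp provides the sup bound asked of discriminators and cannot hurt, since
  \<open>h\<close> itself stays within [-1,1].\<close>

lemma disc_approx:
  fixes h :: "real^'d::finite \<Rightarrow> real"
  assumes "\<beta> > 0" "h \<in> holder_class \<beta>" "M > 0" "x \<in> cbox 0 One"
  shows "\<bar>h x - clmp (FS (holder_s \<beta>) M r h x)\<bar> \<le> disc_err_const \<beta> CARD('d) * ((1 / (real M)\<^sup>2) powr \<beta> + (1/4) ^ r)"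
proof -
  let ?s = "holder_s \<beta>"
  have hb: "\<bar>h y\<bar> \<le> 1" for y by (rule holder_class_bound[OF assms(2)])
  let ?Q = "\<Sum>\<kappa>\<in>PiE UNIV (\<lambda>_. findex ?s M). (\<Prod>i\<in>UNIV. fwt ?s M (\<kappa> i) (x $ i)) * h (\<chi> i. fnode ?s M (\<kappa> i))"
  have 1: "\<bar>h x - ?Q\<bar> \<le> real CARD('d) * interp_const \<beta> ^ CARD('d) * (interp_const \<beta> * (1 / (real M)\<^sup>2) powr \<beta>)"
  proof (rule tensor_interp_err[where I = "{0..1}"])
    show "finite (findex ?s M)" by (simp add: findex_def)
    show "(\<Sum>k\<in>findex ?s M. \<bar>fwt ?s M k v\<bar>) \<le> interp_const \<beta>" if "v \<in> {0..1}" for v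
      using fwt_abs_sum[OF that, of ?s M] unfolding interp_const_def by linarith
    show "\<bar>h (vupd y i v) - (\<Sum>k\<in>findex ?s M. fwt ?s M k v * h (vupd y i (fnode ?s M k)))\<bar>
      \<le> interp_const \<beta> * (1 / (real M)\<^sup>2) powr \<beta>" if "v \<in> {0..1}" for y i v
      using fwt_interp_err[OF assms(1) holder_class_line[OF assms(2), of y i] that assms(3)] by simp
    show "x $ i \<in> {0..1}" for i using assms(4) by (simp add: mem_unit_cube)
  qed (use interp_const_ge_1[of \<beta>] in auto)
  have 2: "\<bar>FS ?s M r h x - ?Q\<bar> \<le> 2 ^ CARD('d) * (Lam ?s CARD('d) * ((1 + CARD('d) + CARD('d) * Suc ?s) * (1/4) ^ r))"
    using FS_exact[OF assms(3) hb, where s = ?s and r = r and x = x] unfolding exact_tensor[OF assms(3) hb, where s = ?s and x = x] .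
  have "\<bar>h x - clmp (FS ?s M r h x)\<bar> = \<bar>clmp (h x) - clmp (FS ?s M r h x)\<bar>" using clmp_id[OF hb] by simp
  also have "\<dots> \<le> \<bar>h x - FS ?s M r h x\<bar>" by (rule clmp_lip)
  also have "\<dots> \<le> minterp_const \<beta> CARD('d) * (1 / (real M)\<^sup>2) powr \<beta> + (2 ^ CARD('d) * (Lam ?s CARD('d) * (1 + CARD('d) + CARD('d) * Suc ?s))) * (1/4) ^ r"
    using 1 2 unfolding minterp_const_def by (simp only: mult.assoc)
  also have "\<dots> \<le> disc_err_const \<beta> CARD('d) * (1 / (real M)\<^sup>2) powr \<beta> + disc_err_const \<beta> CARD('d) * (1/4) ^ r"
    unfolding disc_err_const_def by (intro add_mono mult_right_mono) auto
  finally show ?thesis by (simp add: distrib_left)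
qed

section \<open>Discriminators as networks\<close>

abbreviation (input) U1c :: "nat \<Rightarrow> (real^'d::finite \<Rightarrow> real) set" where
  "U1c M \<equiv> (\<lambda>(i, a). fac_c M a i) ` (UNIV \<times> {..M})"

abbreviation (input) U1f :: "nat \<Rightarrow> (real^'d::finite \<Rightarrow> real) set" where
  "U1f M \<equiv> (\<lambda>(i, p) x. fold1 M p (x $ i)) ` (UNIV \<times> {..<2})"

abbreviation (input) U2b :: "nat \<Rightarrow> nat \<Rightarrow> (real^'d::finite \<Rightarrow> real) set" where
  "U2b s M \<equiv> (\<lambda>(i, p, k). fac_h M p k i) ` (UNIV \<times> {..<2} \<times> {..2 * M}) \<union>
     (\<lambda>(i, p, k, j). fac_z s M p k j i) ` (UNIV \<times> {..<2} \<times> {..2 * M} \<times> {..s})"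

text \<open>All kinks of the coarse hats and of the folds sit at integers in the variable
  \<open>M * x $ i\<close>, so one family of shifted ReLUs serves both.\<close>

lemma net_coarse: "net (CARD('d) * (2 * M + 7)) (Suc 0) (U1c M \<union> U1f M :: (real^'d::finite \<Rightarrow> real) set)"
proof -
  let ?J = "(UNIV :: 'd set) \<times> {..<2 * M + 7}"
  let ?g = "\<lambda>(i::'d, t::nat) (x::real^'d). relu (real M * x $ i - (real t - 1))"
  have N: "net (CARD('d) * (2 * M + 7)) (Suc 0) (?g ` ?J)"
  proof (rule net_first)
    show "card (?g ` ?J) \<le> CARD('d) * (2 * M + 7)"
      by (rule order.trans[OF card_image_le]) (simp_all add: card_cartesian_product)
    fix v assume "v \<in> ?g ` ?J"
    then obtain i t where v: "v = (\<lambda>x. relu (real M * x $ i - (real t - 1)))" by auto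
    have "real M * x $ i - (real t - 1) = inner (real M *\<^sub>R axis i 1) x + - (real t - 1)" for x
      using cart_eq_inner_axis[of x i] by (simp add: inner_commute)
    then show "\<exists>a c. v = (\<lambda>x. relu (inner a x + c))" unfolding v
      by (intro exI[of _ "real M *\<^sub>R axis i 1"] exI[of _ "- (real t - 1)"]) (simp only:)
  qed simp
  define A where "A = aff_span (?g ` ?J)"
  have g: "(\<lambda>x. relu (real M * x $ i - (real t - 1))) \<in> A" if "t < 2 * M + 7" for i :: 'd and t
    unfolding A_def by (rule aff_span_incl, simp, rule image_eqI[of _ _ "(i, t)"]) (use that in auto)
  note cl = aff_span_add[of _ "?g ` ?J", folded A_def] aff_span_diff[of _ "?g ` ?J", folded A_def]
     aff_span_scale[of _ "?g ` ?J", folded A_def] aff_span_const[of _ "?g ` ?J", folded A_def] aff_span_sum[of _ _ "?g ` ?J", folded A_def]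
  have h: "fac_c M a i \<in> A" if "a \<le> M" for a and i :: 'd
  proof -
    have "fac_c M a i x = relu (real M * x $ i - (real a - 1)) - 2 * relu (real M * x $ i - (real (a + 1) - 1)) + relu (real M * x $ i - (real (a + 2) - 1))" for x :: "real^'d"
      unfolding fac_c_def hat_relu by (simp add: algebra_simps)
    then have "fac_c M a i = (\<lambda>x. relu (real M * x $ i - (real a - 1)) - 2 * relu (real M * x $ i - (real (a + 1) - 1)) + relu (real M * x $ i - (real (a + 2) - 1)))" by (rule ext)
    also have "\<dots> \<in> A" by (intro cl g) (use that in auto)
    finally show ?thesis .
  qed
  have f: "(\<lambda>x::real^'d. fold1 M p (x $ i)) \<in> A" if "p < 2" for p i
  proof -
    have "fold1 M p (x $ i) = -1 + (\<Sum>c<Suc M. (-1) ^ c * (relu (real M * x $ i - (real (p + 2 * c) - 1)) - relu (real M * x $ i - (real (p + 2 * c + 2) - 1))))" for x :: "real^'d"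
      unfolding fold1_def wave_def clmp_relu by (intro arg_cong2[where f = "(+)"] sum.cong refl) (simp add: algebra_simps)
    then have "(\<lambda>x::real^'d. fold1 M p (x $ i)) = (\<lambda>x. -1 + (\<Sum>c<Suc M. (-1) ^ c * (relu (real M * x $ i - (real (p + 2 * c) - 1)) - relu (real M * x $ i - (real (p + 2 * c + 2) - 1)))))" by (rule ext)
    also have "\<dots> \<in> A" by (intro cl g) (use that in auto)
    finally show ?thesis .
  qed
  show ?thesis by (rule net_aff[OF N]) (fold A_def, use h f in auto)
qed

text \<open>Fine hats and clamps have their kinks at integers of the scaled fold. The coarse hats
  are passed on beside them, because they are multiplied only later.\<close>

lemma net_fine: "net (30 * CARD('d) * M) (Suc (Suc 0)) (U1c M \<union> U2b s M :: (real^'d::finite \<Rightarrow> real) set)"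
  if M: "M > 0"
proof -
  let ?d = "CARD('d)"
  let ?J = "(UNIV :: 'd set) \<times> {..<2::nat} \<times> {..<2 * M + 3}"
  let ?g = "\<lambda>(i::'d, p::nat, t::nat) (x::real^'d). real M * fold1 M p (x $ i) + real M - (real t - 1)"
  let ?B = "(\<lambda>i x. relu (?g i x)) ` ?J"
  have N1: "net (?d * (2 * M + 7)) (Suc 0) (U1c M \<union> U1f M :: (real^'d \<Rightarrow> real) set)" by (rule net_coarse)
  define A where "A = aff_span ?B"
  have g: "(\<lambda>x. relu (real M * fold1 M p (x $ i) + real M - (real t - 1))) \<in> A" if "p < 2" "t < 2 * M + 3" for i :: 'd and p t
    unfolding A_def by (rule aff_span_incl, simp, rule image_eqI[of _ _ "(i, p, t)"]) (use that in auto)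
  note cl = aff_span_add[of _ ?B, folded A_def] aff_span_diff[of _ ?B, folded A_def]
     aff_span_scale[of _ ?B, folded A_def] aff_span_const[of _ ?B, folded A_def]
  have N2: "net (max (?d * (2 * M + 7)) (2 * ?d * (2 * M + 3))) (Suc (Suc 0)) (U2b s M :: (real^'d \<Rightarrow> real) set)"
  proof (rule net_aff_relu[OF N1, of ?J _ ?g])
    show "finite ?J" by simp
    show "card ?J \<le> 2 * ?d * (2 * M + 3)" by (simp add: card_cartesian_product)
    show "?g q \<in> aff_span (U1c M \<union> U1f M)" if qJ: "q \<in> ?J" for q
    proof -
      obtain i p t where q: "q = (i, p, t)" "p < 2" using qJ by auto
      have "(\<lambda>x::real^'d. fold1 M p (x $ i)) \<in> aff_span (U1c M \<union> U1f M)"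
        by (rule aff_span_incl, simp, rule UnI2, rule image_eqI[of _ _ "(i, p)"]) (use q in auto)
      then show ?thesis unfolding q prod.case by (intro aff_span_add aff_span_diff aff_span_scale aff_span_const)
    qed
    fix v :: "real^'d \<Rightarrow> real" assume v: "v \<in> U2b s M"
    have h: "fac_h M p k i \<in> A" if "p < 2" "k \<le> 2 * M" for p k and i :: 'd
    proof -
      have "fac_h M p k i x = relu (real M * fold1 M p (x $ i) + real M - (real k - 1)) - 2 * relu (real M * fold1 M p (x $ i) + real M - (real (k + 1) - 1)) + relu (real M * fold1 M p (x $ i) + real M - (real (k + 2) - 1))" for x :: "real^'d"
        unfolding fac_h_def hat_relu loc_def by (simp add: algebra_simps)
      then have "fac_h M p k i = (\<lambda>x. relu (real M * fold1 M p (x $ i) + real M - (real k - 1)) - 2 * relu (real M * fold1 M p (x $ i) + real M - (real (k + 1) - 1)) + relu (real M * fold1 M p (x $ i) + real M - (real (k + 2) - 1)))" by (rule ext)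
      also have "\<dots> \<in> A" by (intro cl g) (use that in auto)
      finally show ?thesis .
    qed
    have z: "fac_z s M p k j i \<in> A" if "p < 2" "k \<le> 2 * M" for p k j and i :: 'd
    proof -
      have "fac_z s M p k j i x = (1/2) * (relu (real M * fold1 M p (x $ i) + real M - (real k - 1)) - relu (real M * fold1 M p (x $ i) + real M - (real (k + 2) - 1)) - 1 - inode s j)" for x :: "real^'d"
      proof -
        have e: "loc M p k (x $ i) + 1 = real M * fold1 M p (x $ i) + real M - (real k - 1)"
          "loc M p k (x $ i) - 1 = real M * fold1 M p (x $ i) + real M - (real (k + 2) - 1)" by (simp_all add: loc_def)
        show ?thesis unfolding fac_z_def clmp_relu e by simp
      qed
      then have "fac_z s M p k j i = (\<lambda>x. (1/2) * (relu (real M * fold1 M p (x $ i) + real M - (real k - 1)) - relu (real M * fold1 M p (x $ i) + real M - (real (k + 2) - 1)) - 1 - inode s j))" by (rule ext)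
      also have "\<dots> \<in> A" by (intro cl g) (use that in auto)
      finally show ?thesis .
    qed
    show "v \<in> aff_span ?B" unfolding A_def[symmetric] using v h z by auto
  qed
  have c: "card (U1c M :: (real^'d \<Rightarrow> real) set) \<le> ?d * Suc M"
    by (rule order.trans[OF card_image_le]) (simp_all add: card_cartesian_product)
  have N3: "net (max (?d * (2 * M + 7)) (2 * (?d * Suc M))) (Suc (Suc 0)) (U1c M :: (real^'d \<Rightarrow> real) set)"
    by (rule net_pass1[OF net_mono[OF N1]]) (use c in auto)
  have "?d * (2 * M + 7) \<le> ?d * (9 * M)" "?d * (2 * (2 * M + 3)) \<le> ?d * (10 * M)" "?d * (2 * Suc M) \<le> ?d * (9 * M)"
    using M by (intro mult_left_mono; simp)+
  then have "max (?d * (2 * M + 7)) (2 * (?d * Suc M)) \<le> ?d * (9 * M)"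
    and "max (?d * (2 * M + 7)) (2 * ?d * (2 * M + 3)) \<le> ?d * (9 * M) + ?d * (10 * M)"
    by (simp_all only: max.bounded_iff mult.left_commute[of 2] mult.assoc) auto
  note w = add_mono[OF this]
  show ?thesis
    by (rule net_mono[OF net_Un[OF N3 N2] order.trans[OF w]]) auto
qed

definition disc_kA :: "nat \<Rightarrow> nat" where "disc_kA d = 30 * d + d * (30 * d + 8 * 2 ^ d)"
definition disc_kB :: "nat \<Rightarrow> nat \<Rightarrow> nat" where "disc_kB s d = 30 * d + d * Suc s * (30 * d + 8 * (6 * Suc s) ^ d)"
definition disc_width :: "nat \<Rightarrow> nat \<Rightarrow> nat" where "disc_width s d = disc_kA d + disc_kB s d + 16 * 2 ^ d + 2"
definition disc_depth :: "nat \<Rightarrow> nat \<Rightarrow> nat \<Rightarrow> nat" where "disc_depth s d r = 3 + (d * Suc s + 1) * Suc r"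

text \<open>Every stage keeps to order \<open>M ^ d\<close> neurons, although order
  \<open>M ^ (2 * d)\<close> nodal values enter.\<close>

lemma disc_network:
  fixes h :: "real^'d::finite \<Rightarrow> real"
  assumes M: "M > 0" and h: "\<And>x. \<bar>h x\<bar> \<le> 1"
  shows "(\<lambda>x. clmp (FS s M r h x)) \<in> nn_class (disc_width s CARD('d) * M ^ CARD('d)) (disc_depth s CARD('d) r)"
proof -
  let ?d = "CARD('d)" let ?P = "M ^ ?d" let ?W = "disc_width s ?d * ?P"
  have P1: "1 \<le> ?P" "M \<le> ?P" using M by (simp_all add: Suc_leI self_le_power)
  have cA: "card (IA M :: ('d \<Rightarrow> nat) set) \<le> 2 ^ ?d * ?P"
    unfolding card_IA power_mult_distrib[symmetric] using M by (intro power_mono) auto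
  \<comment> \<open>A fine product depends on the coarse cell only through the parities of its
    index, so there are \<open>2 ^ d\<close> families of fine products and not one per cell.\<close>
  define IP where "IP = PiE (UNIV :: 'd set) (\<lambda>_. {..<2::nat}) \<times> (IB s M :: ('d \<Rightarrow> nat \<times> nat) set)"
  have fP: "finite IP" unfolding IP_def by (intro finite_cartesian_product finite_PiE finite_IB) auto
  have cP: "card IP \<le> (6 * Suc s) ^ ?d * ?P"
  proof -
    have "card IP = 2 ^ ?d * (Suc (2 * M) * Suc s) ^ ?d"
      unfolding IP_def card_cartesian_product card_IB by (simp add: card_PiE)
    also have "\<dots> = (2 * (Suc (2 * M) * Suc s)) ^ ?d" by (simp only: power_mult_distrib)
    also have "\<dots> \<le> (6 * Suc s * M) ^ ?d"
    proof (intro power_mono)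
      have "Suc (2 * M) \<le> 3 * M" using M by simp
      then have "Suc (2 * M) * Suc s \<le> 3 * M * Suc s" by (rule mult_right_mono) simp
      then show "2 * (Suc (2 * M) * Suc s) \<le> 6 * Suc s * M" by (simp add: algebra_simps)
    qed simp
    also have "\<dots> = (6 * Suc s) ^ ?d * ?P" by (rule power_mult_distrib)
    finally show ?thesis .
  qed
  let ?U = "U1c M \<union> U2b s M :: (real^'d \<Rightarrow> real) set"
  have "30 * ?d * M \<le> 30 * ?d * ?P" using P1 by (intro mult_left_mono) auto
  then have N: "net (30 * ?d * ?P) (Suc (Suc 0)) ?U" by (rule net_mono[OF net_fine[OF M, where s = s]]) auto
  have NA1: "net (30 * ?d * ?P + ?d * (30 * ?d * ?P + 8 * card (IA M :: ('d \<Rightarrow> nat) set))) (Suc (Suc 0) + ?d * Suc r) (aP r M ` (IA M :: ('d \<Rightarrow> nat) set))"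
  proof -
    have "net (30 * ?d * ?P + ?d * (30 * ?d * ?P + 8 * card (IA M :: ('d \<Rightarrow> nat) set))) (Suc (Suc 0) + ?d * Suc r)
      ((\<lambda>a x. aprod r (map (\<lambda>f. f x) (afacs M a))) ` (IA M :: ('d \<Rightarrow> nat) set))"
    proof (rule net_aprod[OF N finite_IA])
      fix a :: "'d \<Rightarrow> nat" assume "a \<in> IA M"
      then show "length (afacs M a) = ?d \<and> set (afacs M a) \<subseteq> ?U"
        unfolding length_afacs by (auto simp: afacs_def IA_def PiE_iff image_iff)
    qed
    moreover have "aP r M = (\<lambda>a x. aprod r (map (\<lambda>f. f x) (afacs M (a :: 'd \<Rightarrow> nat))))" by (intro ext) (simp add: aP_def)
    ultimately show ?thesis by simp
  qed
  have wA: "30 * ?d * ?P + ?d * (30 * ?d * ?P + 8 * card (IA M :: ('d \<Rightarrow> nat) set)) \<le> disc_kA ?d * ?P"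
  proof -
    have "?d * (30 * ?d * ?P + 8 * card (IA M :: ('d \<Rightarrow> nat) set)) \<le> ?d * (30 * ?d * ?P + 8 * (2 ^ ?d * ?P))"
      using cA by (intro mult_left_mono add_mono) auto
    then show ?thesis unfolding disc_kA_def by (simp add: algebra_simps)
  qed
  \<comment> \<open>Coarse products have \<open>d\<close> factors and fine ones
    \<open>d * Suc s\<close>; the coarse ones wait out the remaining \<open>d * s\<close>
    multiplications in identity layers.\<close>
  have NA2: "net (disc_kA ?d * ?P + 2 * (2 ^ ?d * ?P)) (Suc (Suc 0) + ?d * Suc r + ?d * s * Suc r) (aP r M ` (IA M :: ('d \<Rightarrow> nat) set))"
  proof (rule net_mono[OF net_pass[OF NA1]])
    show "finite (aP r M ` (IA M :: ('d \<Rightarrow> nat) set))" by (simp add: finite_IA)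
    show "2 * card (aP r M ` (IA M :: ('d \<Rightarrow> nat) set)) \<le> 2 * (2 ^ ?d * ?P)"
      using card_image_le[OF finite_IA, of "aP r M" M] cA by (meson le_trans mult_le_mono2)
  qed (use wA in auto)
  have depth: "Suc (Suc 0) + ?d * Suc r + ?d * s * Suc r = Suc (Suc 0) + ?d * Suc s * Suc r" by (simp add: algebra_simps)
  have NB1: "net (30 * ?d * ?P + ?d * Suc s * (30 * ?d * ?P + 8 * card IP)) (Suc (Suc 0) + ?d * Suc s * Suc r) ((\<lambda>(\<pi>, kl). bP s r M \<pi> kl) ` IP)"
  proof -
    have "net (30 * ?d * ?P + ?d * Suc s * (30 * ?d * ?P + 8 * card IP)) (Suc (Suc 0) + ?d * Suc s * Suc r)
      ((\<lambda>q x. aprod r (map (\<lambda>f. f x) (bfacs s M (fst q) (snd q)))) ` IP)"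
    proof (rule net_aprod[OF N fP])
      fix q assume "q \<in> IP"
      then obtain \<pi> kl where q: "q = (\<pi>, kl)" "\<pi> \<in> PiE UNIV (\<lambda>_. {..<2})" "kl \<in> IB s M" by (auto simp: IP_def)
      have pk: "\<pi> i < 2" "fst (kl i) \<le> 2 * M" "snd (kl i) \<le> s" for i
        using q(2,3) unfolding IB_def by (auto simp: PiE_iff mem_Times_iff)
      have "set (bfacs s M \<pi> kl) \<subseteq> ?U"
      proof
        fix f assume "f \<in> set (bfacs s M \<pi> kl)"
        from set_bfacs[OF this] show "f \<in> ?U"
        proof (elim disjE exE conjE)
          fix i assume "f = fac_h M (\<pi> i) (fst (kl i)) i"
          then have "f \<in> (\<lambda>(i, p, k). fac_h M p k i) ` (UNIV \<times> {..<2} \<times> {..2 * M})"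
            using pk[of i] by (intro image_eqI[of _ _ "(i, \<pi> i, fst (kl i))"]) auto
          then show ?thesis by blast
        next
          fix i j assume "j \<le> s" "f = fac_z s M (\<pi> i) (fst (kl i)) j i"
          then have "f \<in> (\<lambda>(i, p, k, j). fac_z s M p k j i) ` (UNIV \<times> {..<2} \<times> {..2 * M} \<times> {..s})"
            using pk[of i] by (intro image_eqI[of _ _ "(i, \<pi> i, fst (kl i), j)"]) auto
          then show ?thesis by blast
        qed
      qed
      then show "length (bfacs s M (fst q) (snd q)) = ?d * Suc s \<and> set (bfacs s M (fst q) (snd q)) \<subseteq> ?U"
        unfolding q fst_conv snd_conv using length_bfacs[OF pk(3)] by simp
    qed
    moreover have "(\<lambda>(\<pi>, kl). bP s r M \<pi> kl) = (\<lambda>q x. aprod r (map (\<lambda>f. f x) (bfacs s M (fst q) (snd (q :: ('d \<Rightarrow> nat) \<times> ('d \<Rightarrow> nat \<times> nat))))))"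
      by (intro ext) (auto simp: bP_def)
    ultimately show ?thesis by simp
  qed
  have wB: "30 * ?d * ?P + ?d * Suc s * (30 * ?d * ?P + 8 * card IP) \<le> disc_kB s ?d * ?P"
  proof -
    have "?d * Suc s * (30 * ?d * ?P + 8 * card IP) \<le> ?d * Suc s * (30 * ?d * ?P + 8 * ((6 * Suc s) ^ ?d * ?P))"
      using cP by (intro mult_left_mono add_mono) auto
    then show ?thesis unfolding disc_kB_def by (simp only: distrib_right mult.assoc)
  qed
  let ?V = "aP r M ` (IA M :: ('d \<Rightarrow> nat) set) \<union> (\<lambda>(\<pi>, kl). bP s r M \<pi> kl) ` IP"
  have fV: "finite ?V" using finite_IA fP by auto
  have W1: "disc_kA ?d * ?P + 2 * (2 ^ ?d * ?P) + disc_kB s ?d * ?P \<le> ?W"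
    unfolding disc_width_def by (simp add: algebra_simps)
  have NV: "net ?W (Suc (Suc 0) + ?d * Suc s * Suc r) ?V"
    by (rule net_mono[OF net_Un[OF NA2[unfolded depth] net_mono[OF NB1 wB order.refl]] W1 order.refl])
  have bV: "bP s r M \<pi> kl \<in> aff_span ?V" if "\<pi> \<in> PiE UNIV (\<lambda>_. {..<2})" "kl \<in> IB s M" for \<pi> kl
    by (rule aff_span_incl[OF fV], rule UnI2, rule image_eqI[of _ _ "(\<pi>, kl)"]) (use that in \<open>auto simp: IP_def\<close>)
  have N3: "net ?W (Suc (Suc 0) + ?d * Suc s * Suc r + Suc r) ((\<lambda>a x. amult r (aP r M a x) (uS s M r h a x / Lam s ?d)) ` IA M)"
  proof (rule net_amult[OF NV finite_IA])
    show "aP r M a \<in> aff_span ?V" if "a \<in> IA M" for a by (rule aff_span_incl[OF fV]) (use that in blast)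
    \<comment> \<open>The nodal values of \<open>h\<close> appear here as coefficients of an affine
      combination, at no cost in layers.\<close>
    show "(\<lambda>x. uS s M r h a x / Lam s ?d) \<in> aff_span ?V" for a
    proof -
      have "(\<lambda>x. uS s M r h a x / Lam s ?d) = (\<lambda>x. (1 / Lam s ?d) * (\<Sum>kl\<in>IB s M. (h (gnode s M a kl) * (\<Prod>i\<in>UNIV. lcoef s (snd (kl i)))) * bP s r M (\<lambda>i. a i mod 2) kl x))"
        unfolding uS_def[OF M h] by (simp add: mult.assoc)
      also have "\<dots> \<in> aff_span ?V"
        by (intro aff_span_scale aff_span_sum bV) auto
      finally show ?thesis .
    qed
    have "8 * card (IA M :: ('d \<Rightarrow> nat) set) \<le> 8 * (2 ^ ?d * ?P)" using cA by (rule mult_left_mono) simp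
    also have "\<dots> \<le> 16 * 2 ^ ?d * ?P" by simp
    also have "\<dots> \<le> ?W" unfolding disc_width_def by (intro mult_right_mono) auto
    finally show "8 * card (IA M :: ('d \<Rightarrow> nat) set) \<le> ?W" .
  qed
  let ?G = "(\<lambda>a x. amult r (aP r M a x) (uS s M r h a x / Lam s ?d)) ` IA M"
  have F: "FS s M r h \<in> aff_span ?G"
  proof -
    have "FS s M r h = (\<lambda>x. \<Sum>a\<in>IA M. Lam s ?d * amult r (aP r M a x) (uS s M r h a x / Lam s ?d))"
      by (rule ext) (simp add: FS_def[OF M h])
    also have "\<dots> \<in> aff_span ?G"
      by (intro aff_span_sum aff_span_scale aff_span_incl imageI) (simp_all add: finite_IA)
    finally show ?thesis .
  qed
  let ?g = "\<lambda>t::real. \<lambda>x. FS s M r h x + t"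
  have "net (max ?W 2) (Suc (Suc (Suc 0) + ?d * Suc s * Suc r + Suc r)) {\<lambda>x. clmp (FS s M r h x)}"
  proof (rule net_aff_relu[OF N3, of "{1, -1}" 2 ?g])
    show "?g t \<in> aff_span ?G" for t by (intro aff_span_add F aff_span_const)
    have rl: "(\<lambda>x. relu (FS s M r h x + t)) \<in> aff_span ((\<lambda>i x. relu (?g i x)) ` {1, -1})" if "t \<in> {1, -1}" for t
      by (rule aff_span_incl, simp, rule image_eqI[of _ _ t]) (use that in auto)
    have "(\<lambda>x. relu (FS s M r h x + 1) - relu (FS s M r h x + -1) - 1) \<in> aff_span ((\<lambda>i x. relu (?g i x)) ` {1, -1})"
      by (rule aff_span_diff[OF aff_span_diff[OF rl rl] aff_span_const]) simp_all
    then show "v \<in> aff_span ((\<lambda>i x. relu (?g i x)) ` {1, -1})" if "v \<in> {\<lambda>x. clmp (FS s M r h x)}" for v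
      using that by (simp add: clmp_relu)
  qed auto
  moreover have "max ?W 2 = ?W" using mult_mono[of 2 "disc_width s ?d" 1 ?P] P1 by (simp add: disc_width_def)
  moreover have "Suc (Suc (Suc 0) + ?d * Suc s * Suc r + Suc r) = disc_depth s ?d r" by (simp add: disc_depth_def)
  ultimately have "net ?W (disc_depth s ?d r) {\<lambda>x. clmp (FS s M r h x)}" by (simp only:)
  then obtain S where S: "relu_layer ?W (disc_depth s ?d r) S" "(\<lambda>x. clmp (FS s M r h x)) \<in> aff_span S"
    unfolding net_def by auto
  then obtain A b where Ab: "(\<lambda>x. clmp (FS s M r h x)) = (\<lambda>x. (\<Sum>g\<in>S. A g * g x) + b)" unfolding aff_span_def by auto
  have "(\<lambda>x. (\<Sum>g\<in>S. g x *\<^sub>R A g) + b) \<in> nn_class ?W (disc_depth s ?d r)"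
    by (rule relu_layer_nn_class[OF S(1) order.refl])
  then show ?thesis unfolding Ab by (simp add: mult.commute)
qed

lemma discriminator_exists:
  fixes h :: "real^'d::finite \<Rightarrow> real"
  assumes "\<beta> > 0" "h \<in> holder_class \<beta>" "M > 0"
  shows "\<exists>f \<in> nn_class (disc_width (holder_s \<beta>) CARD('d) * M ^ CARD('d)) (disc_depth (holder_s \<beta>) CARD('d) r)
    \<inter> lip_class (FS_lip_const (holder_s \<beta>) CARD('d) * (real M)\<^sup>2) 1.
    \<forall>x\<in>cbox 0 One. \<bar>h x - f x\<bar> \<le> disc_err_const \<beta> CARD('d) * ((1 / (real M)\<^sup>2) powr \<beta> + (1/4) ^ r)"
proof (intro bexI ballI IntI)
  have hb: "\<bar>h y\<bar> \<le> 1" for y by (rule holder_class_bound[OF assms(2)])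
  show "(\<lambda>x. clmp (FS (holder_s \<beta>) M r h x)) \<in> nn_class (disc_width (holder_s \<beta>) CARD('d) * M ^ CARD('d)) (disc_depth (holder_s \<beta>) CARD('d) r)"
    by (rule disc_network[OF assms(3) hb])
  show "(\<lambda>x. clmp (FS (holder_s \<beta>) M r h x)) \<in> lip_class (FS_lip_const (holder_s \<beta>) CARD('d) * (real M)\<^sup>2) 1"
    using order.trans[OF clmp_lip FS_lip[OF assms(3) hb]] clmp_range unfolding lip_class_def by (auto simp: mult.assoc)
qed (rule disc_approx[OF assms])

section \<open>Generators\<close>

text \<open>Different indices may define the same neuron; their output vectors are then added
  up.\<close>

lemma nn_class_family:
  fixes F :: "'i \<Rightarrow> 'a::real_inner \<Rightarrow> real" and v :: "'i \<Rightarrow> 'b::real_vector"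
  assumes "relu_layer W L (F ` I)" "finite I"
  shows "(\<lambda>x. \<Sum>i\<in>I. F i x *\<^sub>R v i) \<in> nn_class W L"
proof -
  have "(\<Sum>i\<in>I. F i x *\<^sub>R v i) = (\<Sum>g\<in>F ` I. g x *\<^sub>R (\<Sum>i\<in>{i \<in> I. F i = g}. v i)) + 0" for x
    unfolding sum.image_gen[OF assms(2), of "\<lambda>i. F i x *\<^sub>R v i" F] scaleR_sum_right by simp
  then show ?thesis using relu_layer_nn_class[OF assms(1) order.refl, of "\<lambda>g. \<Sum>i\<in>{i \<in> I. F i = g}. v i" 0] by simp
qed

section \<open>Piecewise linear interpolation in blocks\<close>

definition ramp :: "real \<Rightarrow> real \<Rightarrow> real \<Rightarrow> real" where
  "ramp s t z = (relu (z - s) - relu (z - t)) / (t - s)"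

lemma ramp_simps: "s < t \<Longrightarrow> z \<le> s \<Longrightarrow> ramp s t z = 0" "s < t \<Longrightarrow> t \<le> z \<Longrightarrow> ramp s t z = 1"
  "s \<le> z \<Longrightarrow> z \<le> t \<Longrightarrow> ramp s t z = (z - s) / (t - s)"
  by (auto simp: ramp_def relu_def)

lemma ramp_range: "s < t \<Longrightarrow> 0 \<le> ramp s t z \<and> ramp s t z \<le> 1"
  by (auto simp: ramp_def relu_def divide_simps)

lemma interp_sum:
  fixes \<sigma> y :: "nat \<Rightarrow> real"
  assumes "\<And>k. k < T \<Longrightarrow> \<sigma> k < \<sigma> (Suc k)" "j < T" "\<sigma> j \<le> z" "z \<le> \<sigma> (Suc j)"
  shows "(\<Sum>k<T. (y (Suc k) - y k) * ramp (\<sigma> k) (\<sigma> (Suc k)) z) = y j - y 0 + (y (Suc j) - y j) * ramp (\<sigma> j) (\<sigma> (Suc j)) z"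
proof -
  have mono: "\<sigma> k \<le> \<sigma> l" if "k \<le> l" "l \<le> T" for k l
    using that
  proof (induction rule: dec_induct)
    case (step n)
    have "\<sigma> k \<le> \<sigma> n" using step by simp
    also have "\<sigma> n < \<sigma> (Suc n)" using step by (intro assms(1)) simp
    finally show ?case by simp
  qed simp
  have e: "{..<T} = {..<j} \<union> {j} \<union> {Suc j..<T}" using assms(2) by auto
  have "(\<Sum>k<T. (y (Suc k) - y k) * ramp (\<sigma> k) (\<sigma> (Suc k)) z)
    = (\<Sum>k<j. (y (Suc k) - y k) * ramp (\<sigma> k) (\<sigma> (Suc k)) z) + (y (Suc j) - y j) * ramp (\<sigma> j) (\<sigma> (Suc j)) z
      + (\<Sum>k=Suc j..<T. (y (Suc k) - y k) * ramp (\<sigma> k) (\<sigma> (Suc k)) z)"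
  proof -
    let ?f = "\<lambda>k. (y (Suc k) - y k) * ramp (\<sigma> k) (\<sigma> (Suc k)) z"
    have "sum ?f {..<T} = sum ?f ({..<j} \<union> {j}) + sum ?f {Suc j..<T}" unfolding e by (rule sum.union_disjoint) auto
    moreover have "sum ?f ({..<j} \<union> {j}) = sum ?f {..<j} + ?f j" by (subst sum.union_disjoint) auto
    ultimately show ?thesis by simp
  qed
  also have "(\<Sum>k<j. (y (Suc k) - y k) * ramp (\<sigma> k) (\<sigma> (Suc k)) z) = (\<Sum>k<j. y (Suc k) - y k)"
  proof (rule sum.cong[OF refl])
    fix k assume "k \<in> {..<j}"
    then have "\<sigma> (Suc k) \<le> z" "\<sigma> k < \<sigma> (Suc k)" using mono[of "Suc k" j] assms by auto
    then show "(y (Suc k) - y k) * ramp (\<sigma> k) (\<sigma> (Suc k)) z = y (Suc k) - y k" by (simp add: ramp_simps)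
  qed
  also have "(\<Sum>k<j. y (Suc k) - y k) = y j - y 0" by (rule sum_lessThan_telescope)
  also have "(\<Sum>k=Suc j..<T. (y (Suc k) - y k) * ramp (\<sigma> k) (\<sigma> (Suc k)) z) = 0"
  proof (rule sum.neutral, rule ballI)
    fix k assume "k \<in> {Suc j..<T}"
    then have "z \<le> \<sigma> k" "\<sigma> k < \<sigma> (Suc k)" using mono[of "Suc j" k] assms by auto
    then show "(y (Suc k) - y k) * ramp (\<sigma> k) (\<sigma> (Suc k)) z = 0" by (simp add: ramp_simps)
  qed
  finally show ?thesis by simp
qed

lemma interp_sum_range:
  fixes \<sigma> y :: "nat \<Rightarrow> real"
  assumes "\<And>k. k < T \<Longrightarrow> \<sigma> k < \<sigma> (Suc k)" "\<sigma> 0 \<le> z" "z \<le> \<sigma> T" "y 0 = 0" "\<And>k. 0 \<le> y k \<and> y k \<le> 1"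
  shows "(\<Sum>k<T. (y (Suc k) - y k) * ramp (\<sigma> k) (\<sigma> (Suc k)) z) \<in> {0..1}"
proof (cases "T = 0")
  case False
  have "\<exists>j<T. \<sigma> j \<le> z \<and> z \<le> \<sigma> (Suc j)"
    using assms(3) False
  proof (induction T)
    case (Suc T)
    show ?case
    proof (cases "z \<le> \<sigma> T \<and> T \<noteq> 0")
      case True then show ?thesis using Suc by (meson less_SucI)
    next
      case False then show ?thesis using Suc assms(2) by (intro exI[of _ T]) auto
    qed
  qed simp
  then obtain j where j: "j < T" "\<sigma> j \<le> z" "z \<le> \<sigma> (Suc j)" by blast
  let ?\<theta> = "ramp (\<sigma> j) (\<sigma> (Suc j)) z"
  have th: "0 \<le> ?\<theta>" "?\<theta> \<le> 1" using ramp_range[OF assms(1)[OF j(1)], of z] by auto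
  have "y j - y 0 + (y (Suc j) - y j) * ?\<theta> = (1 - ?\<theta>) * y j + ?\<theta> * y (Suc j)" using assms(4) by (simp add: algebra_simps)
  moreover have "0 \<le> (1 - ?\<theta>) * y j + ?\<theta> * y (Suc j)" using th assms(5) by (intro add_nonneg_nonneg mult_nonneg_nonneg) auto
  moreover have "(1 - ?\<theta>) * y j + ?\<theta> * y (Suc j) \<le> 1" by (rule convex_bound_le) (use th assms(5) in auto)
  ultimately show ?thesis using interp_sum[OF assms(1) j, of y] by simp
qed simp

definition tri :: "real \<Rightarrow> real \<Rightarrow> real \<Rightarrow> real \<Rightarrow> real" where
  "tri l c r z = ramp l c z - ramp c r z"

lemma tri_outside: "l < c \<Longrightarrow> c < r \<Longrightarrow> z \<le> l \<or> r \<le> z \<Longrightarrow> tri l c r z = 0"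
  by (auto simp: tri_def ramp_simps)

text \<open>The working interval of block \<open>a\<close> runs from \<open>s a\<close> to
  \<open>e a\<close>. The margins, from \<open>l a\<close> to \<open>s a\<close> and from
  \<open>e a\<close> to \<open>m a\<close>, let preactivations return to 0 so that blocks do not
  interact.\<close>

locale gen_blocks =
  fixes A T :: nat and l s e m :: "nat \<Rightarrow> real"
  assumes lt: "\<And>a. l a < s a" "\<And>a. s a < e a" "\<And>a. e a < m a" "\<And>a. m a \<le> l (Suc a)"
begin

lemma l_mono: "a \<le> b \<Longrightarrow> l a \<le> l b"
proof (induction rule: dec_induct)
  case (step b)
  then show ?case using lt[of b] by linarith
qed simp

lemma m_le_l: "a < b \<Longrightarrow> m a \<le> l b"
  using l_mono[of "Suc a" b] lt(4)[of a] by simp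

text \<open>One second-layer neuron contributes a kink of slope \<open>c a\<close> at \<open>u a\<close> in every block \<open>a\<close> and is zero between the blocks.
  So \<open>T\<close> of them, fed by \<open>O(A)\<close> first-layer neurons, interpolate \<open>T * A\<close> values.\<close>

definition pre :: "(nat \<Rightarrow> real) \<Rightarrow> (nat \<Rightarrow> real) \<Rightarrow> real \<Rightarrow> real" where
  "pre c u z = (\<Sum>a<A. c a * (s a - u a) * tri (l a) (s a) (e a) z + c a * (e a - u a) * tri (s a) (e a) (m a) z)"

definition neuron :: "(nat \<Rightarrow> real) \<Rightarrow> (nat \<Rightarrow> real) \<Rightarrow> real \<Rightarrow> real" where
  "neuron c u z = relu (pre c u z)"

lemma pre_block:
  assumes "a < A" "l a \<le> z" "z \<le> m a"
  shows "pre c u z = c a * (s a - u a) * tri (l a) (s a) (e a) z + c a * (e a - u a) * tri (s a) (e a) (m a) z"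
proof -
  have "pre c u z = (\<Sum>b<A. if b = a then c a * (s a - u a) * tri (l a) (s a) (e a) z + c a * (e a - u a) * tri (s a) (e a) (m a) z else 0)"
    unfolding pre_def
  proof (rule sum.cong[OF refl])
    fix b
    show "c b * (s b - u b) * tri (l b) (s b) (e b) z + c b * (e b - u b) * tri (s b) (e b) (m b) z
      = (if b = a then c a * (s a - u a) * tri (l a) (s a) (e a) z + c a * (e a - u a) * tri (s a) (e a) (m a) z else 0)"
    proof (cases b a rule: linorder_cases)
      case less
      then have "m b \<le> z" using m_le_l assms by force
      then show ?thesis using less lt[of b] by (simp add: tri_outside)
    next
      case greater
      then have "z \<le> l b" using m_le_l[of a b] assms by force
      then show ?thesis using greater lt[of b] by (simp add: tri_outside)
    qed simp
  qed
  then show ?thesis using assms(1) by simp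
qed

lemma pre_outside:
  assumes "\<And>a. a < A \<Longrightarrow> z \<le> l a \<or> m a \<le> z" shows "pre c u z = 0"
  unfolding pre_def
proof (rule sum.neutral, rule ballI)
  fix a assume "a \<in> {..<A}"
  then have "z \<le> l a \<or> m a \<le> z" using assms by simp
  then show "c a * (s a - u a) * tri (l a) (s a) (e a) z + c a * (e a - u a) * tri (s a) (e a) (m a) z = 0"
    using lt[of a] by (auto simp: tri_outside)
qed

lemma neuron_outside: "(\<And>a. a < A \<Longrightarrow> z \<le> l a \<or> m a \<le> z) \<Longrightarrow> neuron c u z = 0"
  by (simp add: neuron_def pre_outside relu_def)

text \<open>On the left margin the preactivation runs linearly from 0 to a value that is
  nonpositive, because the kink \<open>u a\<close> does not lie left of \<open>s a\<close>.\<close>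

lemma neuron_left:
  assumes "a < A" "l a \<le> z" "z \<le> s a" "0 \<le> c a" "s a \<le> u a"
  shows "neuron c u z = 0"
proof -
  have "pre c u z = c a * (s a - u a) * ramp (l a) (s a) z"
    using assms lt[of a] by (subst pre_block[of a]) (auto simp: tri_def ramp_simps)
  also have "\<dots> \<le> 0" using assms ramp_range[OF lt(1)[of a], of z] by (intro mult_nonpos_nonneg mult_nonneg_nonpos) auto
  finally show ?thesis by (simp add: neuron_def relu_def)
qed

lemma neuron_mid:
  assumes "a < A" "s a \<le> z" "z \<le> e a" "0 \<le> c a"
  shows "neuron c u z = c a * relu (z - u a)"
proof -
  have "pre c u z = c a * ((s a - u a) * (1 - (z - s a) / (e a - s a)) + (e a - u a) * ((z - s a) / (e a - s a)))"
  proof -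
    have t: "tri (l a) (s a) (e a) z = 1 - (z - s a) / (e a - s a)" "tri (s a) (e a) (m a) z = (z - s a) / (e a - s a)"
      using assms lt[of a] by (simp_all add: tri_def ramp_simps)
    show ?thesis using assms lt[of a] by (subst pre_block[of a]) (auto simp only: t distrib_left mult.assoc)
  qed
  also have "(s a - u a) * (1 - (z - s a) / (e a - s a)) + (e a - u a) * ((z - s a) / (e a - s a)) = z - u a"
  proof -
    have "(s a - u a) * (1 - t) + (e a - u a) * t = (s a - u a) + (e a - s a) * t" for t by (simp add: algebra_simps)
    also have "(s a - u a) + (e a - s a) * ((z - s a) / (e a - s a)) = z - u a" using lt(2)[of a] by simp
    finally show ?thesis .
  qed
  finally show ?thesis using assms(4) by (auto simp: neuron_def relu_def max_def mult_nonneg_nonneg zero_le_mult_iff mult_le_0_iff)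
qed

text \<open>On the right margin all neurons decay by one common factor, and so does any combination
  of them; this keeps the generator inside the cube there.\<close>

lemma neuron_right:
  assumes "a < A" "e a \<le> z" "z \<le> m a" "0 \<le> c a" "u a \<le> e a"
  shows "neuron c u z = neuron c u (e a) * (1 - ramp (e a) (m a) z)"
proof -
  have "pre c u z = c a * (e a - u a) * (1 - ramp (e a) (m a) z)"
    using assms lt[of a] by (subst pre_block[of a]) (auto simp: tri_def ramp_simps)
  moreover have "0 \<le> c a * (e a - u a) * (1 - ramp (e a) (m a) z)"
    using assms ramp_range[OF lt(3)[of a], of z] by (intro mult_nonneg_nonneg) auto
  moreover have "neuron c u (e a) = c a * (e a - u a)"
    using neuron_mid[of a "e a" c u] assms lt[of a] by (simp add: relu_def)
  ultimately show ?thesis by (simp add: neuron_def relu_def)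
qed

lemma neuron_layer:
  assumes "finite J" "\<And>j. j \<in> J \<Longrightarrow> F j = neuron (c j) (u j)" "card J \<le> W" "4 * A \<le> W"
  shows "relu_layer W (Suc (Suc 0)) (F ` J)"
proof -
  let ?N = "(\<lambda>t z. relu (z - t)) ` (l ` {..<A} \<union> s ` {..<A} \<union> e ` {..<A} \<union> m ` {..<A})"
  have 1: "relu_layer W (Suc 0) ?N"
  proof (rule relu_layer.first)
    have "card (l ` {..<A} \<union> s ` {..<A} \<union> e ` {..<A} \<union> m ` {..<A}) \<le> A + A + A + A"
      by (intro order.trans[OF card_Un_le] add_mono) (metis card_image_le card_lessThan finite_lessThan)+
    then show "card ?N \<le> W" using assms(4) by (intro order.trans[OF card_image_le]) auto
    fix f assume "f \<in> ?N"
    then obtain t where "f = (\<lambda>z. relu (z - t))" by auto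
    then show "\<exists>a c. f = (\<lambda>x. relu (inner a x + c))" by (intro exI[of _ 1] exI[of _ "- t"]) simp
  qed simp
  have f: "finite ?N" by simp
  have r: "ramp x y \<in> aff_span ?N" if "(\<lambda>z. relu (z - x)) \<in> ?N" "(\<lambda>z. relu (z - y)) \<in> ?N" for x y
  proof -
    have "ramp x y = (\<lambda>z. (1 / (y - x)) * (relu (z - x) - relu (z - y)))" by (auto simp: ramp_def)
    also have "\<dots> \<in> aff_span ?N" by (intro aff_span_scale aff_span_diff aff_span_incl that f)
    finally show ?thesis .
  qed
  have p: "pre c u \<in> aff_span ?N" for c u
  proof -
    have "pre c u = (\<lambda>z. \<Sum>a<A. c a * (s a - u a) * (ramp (l a) (s a) z - ramp (s a) (e a) z) + c a * (e a - u a) * (ramp (s a) (e a) z - ramp (e a) (m a) z))"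
      by (rule ext) (simp add: pre_def tri_def)
    also have "\<dots> \<in> aff_span ?N"
      by (intro aff_span_sum aff_span_add aff_span_scale aff_span_diff r imageI) auto
    finally show ?thesis .
  qed
  show ?thesis
  proof (rule relu_layer.next_layer[OF 1])
    show "card (F ` J) \<le> W" using card_image_le[OF assms(1), of F] assms(3) by linarith
    fix f assume "f \<in> F ` J"
    then obtain j where "j \<in> J" "f = neuron (c j) (u j)" using assms(2) by auto
    then show "\<exists>g\<in>aff_span ?N. f = (\<lambda>x. relu (g x))" using p by (intro bexI[of _ "pre (c j) (u j)"]) (auto simp: neuron_def)
  qed (use assms(1) in simp)
qed

end

text \<open>Within a block the output is the linear interpolant of \<open>Y\<close>, started at 0;
  it is scaled back to 0 before the next block. On an interval with equal end values it is therefore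
  constant.\<close>

lemma generator_blocks:
  fixes \<rho> :: "nat \<Rightarrow> real" and Y :: "nat \<Rightarrow> real^'d::finite"
  assumes \<rho>: "\<And>k. \<rho> k < \<rho> (Suc k)" and Y: "\<And>k. Y k \<in> cbox 0 One" and T: "T > 0"
  shows "\<exists>g\<in>nn_class (4 * CARD('d) * T + 4 * A) 2. (\<forall>z. g z \<in> cbox 0 One) \<and>
    (\<forall>a k z. a < A \<longrightarrow> Suc k < T \<longrightarrow> Y (T * a + k) = Y (T * a + Suc k) \<longrightarrow>
       \<rho> (T * a + k) \<le> z \<longrightarrow> z \<le> \<rho> (T * a + Suc k) \<longrightarrow> g z = Y (T * a + k))"
proof -
  \<comment> \<open>Block \<open>a\<close> ends at its last given point. The gap up to the first
    point of the next block is cut into thirds: the output fades to 0 on the first, stays 0 on the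
    second and rises to the next value on the third.\<close>
  define e where "e a = \<rho> (T * a + (T - 1))" for a
  define gap where "gap a = \<rho> (T * Suc a) - e a" for a
  define m where "m a = e a + gap a / 3" for a
  define s where "s a = (case a of 0 \<Rightarrow> \<rho> 0 - 1 | Suc b \<Rightarrow> e b + 2 * gap b / 3)" for a
  define l where "l a = (case a of 0 \<Rightarrow> \<rho> 0 - 2 | Suc b \<Rightarrow> m b)" for a
  have \<rho>m: "strict_mono \<rho>" by (rule strict_mono_Suc_iff[THEN iffD2]) (use \<rho> in blast)
  have gap: "gap a > 0" for a unfolding gap_def e_def using T strict_monoD[OF \<rho>m, of "T * a + (T - 1)" "T * Suc a"] by simp
  have s\<rho>: "s a < \<rho> (T * a)" for a
  proof (cases a)
    case (Suc b)
    have "\<rho> (T * a) = e b + gap b" by (simp add: gap_def Suc)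
    then show ?thesis using gap[of b] by (simp add: s_def Suc)
  qed (simp add: s_def)
  have se: "\<rho> (T * a) \<le> e a" for a unfolding e_def using strict_mono_mono[OF \<rho>m] by (auto intro: monoD)
  interpret gen_blocks A T l s e m
  proof
    show "l a < s a" for a using gap[of "a - 1"] by (cases a) (auto simp: l_def s_def m_def)
    show "s a < e a" for a using s\<rho>[of a] se[of a] by linarith
    show "e a < m a" for a using gap[of a] by (simp add: m_def)
    show "m a \<le> l (Suc a)" for a by (simp add: l_def)
  qed
  \<comment> \<open>Node 0 is the start \<open>s a\<close> with value 0, so the given points are
    shifted by one; node \<open>T\<close> is then exactly \<open>e a\<close>.\<close>
  define \<sigma> where "\<sigma> a k = (case k of 0 \<Rightarrow> s a | Suc j \<Rightarrow> \<rho> (T * a + j))" for a k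
  define y where "y i a k = (case k of 0 \<Rightarrow> 0 | Suc j \<Rightarrow> Y (T * a + j) $ i)" for i a k
  have \<sigma>: "\<sigma> a k < \<sigma> a (Suc k)" for a k using s\<rho>[of a] \<rho> by (cases k) (auto simp: \<sigma>_def)
  have \<sigma>T: "\<sigma> a T = e a" "\<sigma> a 0 = s a" for a using T by (cases T; simp add: \<sigma>_def e_def)+
  have y: "0 \<le> y i a k \<and> y i a k \<le> 1" for i a k using Y[of "T * a + (k - 1)"] unfolding mem_unit_cube by (cases k) (auto simp: y_def)
  have y0: "y i a 0 = 0" for i a by (simp add: y_def)
  define \<kappa> where "\<kappa> i k a = (y i a (Suc k) - y i a k) / (\<sigma> a (Suc k) - \<sigma> a k)" for i k a
  have \<sigma>mono: "\<sigma> a j \<le> \<sigma> a k" if "j \<le> k" for a j k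
    using strict_mono_mono[OF strict_mono_Suc_iff[THEN iffD2], of "\<sigma> a"] \<sigma> that by (auto intro: monoD)
  \<comment> \<open>A ramp is a difference of two ReLUs (index \<open>q\<close>), and its slope is
    split into positive and negative part (index \<open>p\<close>) because the lemmas on
    \<open>neuron\<close> ask for nonnegative slopes: four neurons per coordinate and node.\<close>
  define J where "J = (UNIV :: 'd set) \<times> {..<T} \<times> (UNIV :: bool set) \<times> (UNIV :: bool set)"
  define F where "F = (\<lambda>(i, k, p, q). neuron (\<lambda>a. if p then max 0 (\<kappa> i k a) else max 0 (- \<kappa> i k a)) (\<lambda>a. if q then \<sigma> a k else \<sigma> a (Suc k)))"
  define sgn where "sgn = (\<lambda>(i :: 'd, k :: nat, p :: bool, q :: bool). (if p = q then 1 else -1) *\<^sub>R axis i (1::real))"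
  define g where "g z = (\<Sum>j\<in>J. F j z *\<^sub>R sgn j)" for z
  have fJ: "finite J" unfolding J_def by simp
  have cJ: "card J = 4 * CARD('d) * T" unfolding J_def by (simp add: card_cartesian_product)
  have "relu_layer (4 * CARD('d) * T + 4 * A) (Suc (Suc 0)) (F ` J)"
    by (rule neuron_layer[OF fJ, where
        c = "\<lambda>(i, k, p, q) a. if p then max 0 (\<kappa> i k a) else max 0 (- \<kappa> i k a)" and
        u = "\<lambda>(i, k, p, q) a. if q then \<sigma> a k else \<sigma> a (Suc k)"])
       (auto simp: F_def cJ)
  then have g_nn: "g \<in> nn_class (4 * CARD('d) * T + 4 * A) 2"
    unfolding g_def[abs_def] numeral_2_eq_2 by (rule nn_class_family[OF _ fJ])
  have gi: "g z $ i = (\<Sum>k<T. \<Sum>p\<in>UNIV. \<Sum>q\<in>UNIV. (if p = q then 1 else -1) * F (i, k, p, q) z)" for z i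
  proof -
    have "g z $ i = (\<Sum>j\<in>J. if fst j = i then (case j of (i, k, p, q) \<Rightarrow> (if p = q then 1 else -1) * F (i, k, p, q) z) else 0)"
      unfolding g_def sum_component by (rule sum.cong) (auto simp: sgn_def axis_def)
    also have "\<dots> = (\<Sum>i'\<in>UNIV. \<Sum>x\<in>{..<T} \<times> UNIV \<times> UNIV. if i' = i then (case x of (k, p, q) \<Rightarrow> (if p = q then 1 else -1) * F (i, k, p, q) z) else 0)"
      unfolding J_def by (subst sum.cartesian_product') (intro sum.cong refl, auto)
    also have "\<dots> = (\<Sum>i'\<in>UNIV. if i' = i then (\<Sum>x\<in>{..<T} \<times> UNIV \<times> UNIV. case x of (k, p, q) \<Rightarrow> (if p = q then 1 else -1) * F (i, k, p, q) z) else 0)"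
      by (intro sum.cong refl) auto
    also have "\<dots> = (\<Sum>x\<in>{..<T} \<times> UNIV \<times> UNIV. case x of (k, p, q) \<Rightarrow> (if p = q then 1 else -1) * F (i, k, p, q) z)" by simp
    also have "\<dots> = (\<Sum>k<T. \<Sum>p\<in>UNIV. \<Sum>q\<in>UNIV. (if p = q then 1 else -1) * F (i, k, p, q) z)"
      by (simp add: sum.cartesian_product)
    finally show ?thesis .
  qed
  have u: "s a \<le> \<sigma> a k" for a k using \<sigma>mono[of 0 k a] \<sigma>T by simp
  have u': "\<sigma> a k \<le> e a" if "k \<le> T" for a k using \<sigma>mono[OF that, of a] \<sigma>T by simp
  have mid: "g z $ i = (\<Sum>k<T. (y i a (Suc k) - y i a k) * ramp (\<sigma> a k) (\<sigma> a (Suc k)) z)"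
    if "a < A" "s a \<le> z" "z \<le> e a" for a z i
    unfolding gi
  proof (rule sum.cong[OF refl])
    fix k
    have F: "F (i, k, p, q) z = (if p then max 0 (\<kappa> i k a) else max 0 (- \<kappa> i k a)) * relu (z - (if q then \<sigma> a k else \<sigma> a (Suc k)))" for p q
      unfolding F_def prod.case by (rule neuron_mid[OF that]) auto
    have "(\<Sum>p\<in>UNIV. \<Sum>q\<in>UNIV. (if p = q then 1 else -1) * F (i, k, p, q) z)
      = (max 0 (\<kappa> i k a) - max 0 (- \<kappa> i k a)) * (relu (z - \<sigma> a k) - relu (z - \<sigma> a (Suc k)))"
      unfolding UNIV_bool F by (simp add: algebra_simps)
    also have "max 0 (\<kappa> i k a) - max 0 (- \<kappa> i k a) = \<kappa> i k a" by auto
    finally show "(\<Sum>p\<in>UNIV. \<Sum>q\<in>UNIV. (if p = q then 1 else -1) * F (i, k, p, q) z) = (y i a (Suc k) - y i a k) * ramp (\<sigma> a k) (\<sigma> a (Suc k)) z"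
      by (simp add: \<kappa>_def ramp_def)
  qed
  have mid_range: "g z $ i \<in> {0..1}" if "a < A" "s a \<le> z" "z \<le> e a" for a z i
    unfolding mid[OF that] by (rule interp_sum_range) (use that \<sigma> \<sigma>T y y0 in auto)
  have right: "g z $ i = g (e a) $ i * (1 - ramp (e a) (m a) z)" if az: "a < A" "e a \<le> z" "z \<le> m a" for a z i
  proof -
    have F: "F (i, k, p, q) z = F (i, k, p, q) (e a) * (1 - ramp (e a) (m a) z)" if k: "k < T" for k p q
      unfolding F_def prod.case by (rule neuron_right[OF az]) (use u'[of k a] u'[of "Suc k" a] k in auto)
    show ?thesis unfolding gi sum_distrib_right by (intro sum.cong refl) (simp add: F)
  qed
  have left: "g z $ i = 0" if "a < A" "l a \<le> z" "z \<le> s a" for a z i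
  proof -
    have F: "F (i, k, p, q) z = 0" for k p q
      unfolding F_def prod.case by (rule neuron_left[OF that]) (use u[of a k] u[of a "Suc k"] in auto)
    show ?thesis unfolding gi by (intro sum.neutral ballI) (simp add: F)
  qed
  have out: "g z $ i = 0" if "\<And>a. a < A \<Longrightarrow> z \<le> l a \<or> m a \<le> z" for z i
  proof -
    have F: "F (i, k, p, q) z = 0" for k p q
      unfolding F_def prod.case by (rule neuron_outside[OF that])
    show ?thesis unfolding gi by (intro sum.neutral ballI) (simp add: F)
  qed
  have "g z \<in> cbox 0 One" for z
    unfolding mem_unit_cube
  proof
    fix i
    show "g z $ i \<in> {0..1}"
    proof (cases "\<exists>a<A. l a < z \<and> z < m a")
      case True
      then obtain a where a: "a < A" "l a < z" "z < m a" by blast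
      consider "z \<le> s a" | "s a \<le> z" "z \<le> e a" | "e a \<le> z" by linarith
      then show ?thesis
      proof cases
        case 1 then show ?thesis using left[of a z i] a by simp
      next
        case 2 then show ?thesis using mid_range a by blast
      next
        case 3
        have "g (e a) $ i \<in> {0..1}" using mid_range[of a "e a" i] a lt(2)[of a] by simp
        then show ?thesis using right[of a z i] a 3 ramp_range[OF lt(3)[of a], of z]
          by (auto intro!: mult_nonneg_nonneg mult_le_one)
      qed
    next
      case False
      then show ?thesis using out[of z i] by force
    qed
  qed
  moreover have "g z = Y (T * a + k)" if "a < A" "Suc k < T" "Y (T * a + k) = Y (T * a + Suc k)"
    "\<rho> (T * a + k) \<le> z" "z \<le> \<rho> (T * a + Suc k)" for a k z
  proof -
    have z: "\<sigma> a (Suc k) \<le> z" "z \<le> \<sigma> a (Suc (Suc k))" using that by (simp_all add: \<sigma>_def)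
    have "s a \<le> z" "z \<le> e a" using u[of a "Suc k"] u'[of "Suc (Suc k)" a] z that by auto
    then have "g z $ i = Y (T * a + k) $ i" for i
      unfolding mid[OF \<open>a < A\<close> \<open>s a \<le> z\<close> \<open>z \<le> e a\<close>] interp_sum[where j = "Suc k" and T = T and \<sigma> = "\<sigma> a" and z = z and y = "y i a", OF \<sigma> that(2) z]
      using that(3) by (simp add: y_def)
    then show ?thesis by (simp add: vec_eq_iff)
  qed
  ultimately show ?thesis using g_nn by blast
qed

section \<open>Quantiles of the latent distribution\<close>

context
  fixes \<nu> :: "real measure"
  assumes nu_prob: "prob_space \<nu>" and nu_sets: "sets \<nu> = sets borel" and nu_ac: "absolutely_continuous lborel \<nu>"
begin

lemma nu_space: "space \<nu> = UNIV" using sets_eq_imp_space_eq[OF nu_sets] by simp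

lemma nu_real_distribution: "real_distribution \<nu>"
  using nu_prob nu_sets by (simp add: real_distribution_def real_distribution_axioms_def nu_space)

text \<open>Absolute continuity enters through the absence of atoms: with a continuous distribution
  function every level strictly between 0 and 1 is attained.\<close>

lemma nu_cdf_continuous: "isCont (cdf \<nu>) x"
proof -
  interpret real_distribution \<nu> by (rule nu_real_distribution)
  have "{x} \<in> null_sets lborel" by (auto intro!: null_setsI)
  then have "{x} \<in> null_sets \<nu>" using nu_ac unfolding absolutely_continuous_def by blast
  then show ?thesis unfolding isCont_cdf by (simp add: null_setsD1 measure_def)
qed

lemma nu_quantile:
  assumes "0 < u" "u < 1" shows "\<exists>x. cdf \<nu> x = u"
proof -
  interpret real_distribution \<nu> by (rule nu_real_distribution)
  have "eventually (\<lambda>x. cdf \<nu> x < u) at_bot" using order_tendstoD(2)[OF cdf_lim_at_bot assms(1)] .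
  then obtain a where a: "\<And>x. x \<le> a \<Longrightarrow> cdf \<nu> x < u" unfolding eventually_at_bot_linorder by blast
  have "eventually (\<lambda>x. u < cdf \<nu> x) at_top" using order_tendstoD(1)[OF cdf_lim_at_top_prob assms(2)] .
  then obtain b where b: "\<And>x. b \<le> x \<Longrightarrow> u < cdf \<nu> x" unfolding eventually_at_top_linorder by blast
  have "\<exists>x\<ge>min a b. x \<le> max a b \<and> cdf \<nu> x = u"
    using nu_cdf_continuous a[of "min a b"] b[of "max a b"] by (intro IVT) auto
  then show ?thesis by blast
qed

definition quant :: "real \<Rightarrow> real" where "quant u = (SOME x. cdf \<nu> x = u)"

lemma cdf_quant: "0 < u \<Longrightarrow> u < 1 \<Longrightarrow> cdf \<nu> (quant u) = u"
  unfolding quant_def by (rule someI_ex[OF nu_quantile])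

lemma nu_cdf_mono: "x \<le> y \<Longrightarrow> cdf \<nu> x \<le> cdf \<nu> y"
proof -
  interpret real_distribution \<nu> by (rule nu_real_distribution)
  show "x \<le> y \<Longrightarrow> cdf \<nu> x \<le> cdf \<nu> y" by (rule cdf_nondecreasing)
qed

lemma nu_cdf_less: "cdf \<nu> x < cdf \<nu> y \<Longrightarrow> x < y"
  using nu_cdf_mono[of y x] by linarith

lemma generator_exists:
  fixes X :: "nat \<Rightarrow> real^'d::finite"
  assumes n: "n > 0" and X: "\<And>i. i < n \<Longrightarrow> X i \<in> cbox 0 One" and \<eta>: "\<eta> > 0" and A: "n \<le> A * A"
  shows "\<exists>g\<in>nn_class ((8 * CARD('d) + 4) * A) 2. (\<forall>z. g z \<in> cbox 0 One) \<and>
    (\<forall>f. f \<circ> g \<in> borel_measurable borel \<longrightarrow> (\<forall>x. \<bar>f x\<bar> \<le> 1) \<longrightarrow> \<bar>(\<Sum>i<n. f (X i)) / n - (\<integral>z. f (g z) \<partial>\<nu>)\<bar> \<le> \<eta>)"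
proof -
  interpret real_distribution \<nu> by (rule nu_real_distribution)
  define \<theta> where "\<theta> = min (1/4) (\<eta> / 4)"
  have \<theta>: "0 < \<theta>" "\<theta> \<le> 1/4" "4 * \<theta> \<le> \<eta>" using \<eta> by (auto simp: \<theta>_def)
  \<comment> \<open>Levels \<open>2 * i\<close> and \<open>2 * i + 1\<close> bound the
    \<open>i\<close>-th interval of mass \<open>1 / n\<close>, shrunk by \<open>\<theta> / n\<close>
    at both ends. The mass given up is where the generator moves from one sample point to the
    next.\<close>
  define v where "v k = (real (k div 2) + (if even k then \<theta> else 1 - \<theta>)) / n" for k
  have v01: "0 < v k" "v k < 1" if "k < 2 * n" for k
  proof -
    have "k div 2 + 1 \<le> n" using that by linarith
    then have "real (k div 2) + 1 \<le> real n" by linarith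
    then show "0 < v k" "v k < 1" using \<theta> n by (auto simp: v_def divide_less_eq)
  qed
  have vinc: "v k < v (Suc k)" for k
    unfolding v_def using \<theta> n by (intro divide_strict_right_mono) (auto elim!: evenE oddE)
  \<comment> \<open>Beyond the last quantile the sequence continues in unit steps, since
    \<open>generator_blocks\<close> expects an infinite increasing sequence.\<close>
  define \<rho> where "\<rho> k = (if k < 2 * n then quant (v k) else quant (v (2 * n - 1)) + real (k - (2 * n - 1)))" for k
  have \<rho>: "\<rho> k < \<rho> (Suc k)" for k
  proof -
    consider "Suc k < 2 * n" | "Suc k = 2 * n" | "Suc k > 2 * n" by linarith
    then show ?thesis
    proof cases
      case 1
      then have "cdf \<nu> (quant (v k)) < cdf \<nu> (quant (v (Suc k)))" using vinc[of k] by (simp add: cdf_quant v01)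
      then show ?thesis using 1 nu_cdf_less by (simp add: \<rho>_def)
    next
      case 2 then have "k = 2 * n - 1" by simp
      then show ?thesis using n by (simp add: \<rho>_def)
    next
      case 3 then show ?thesis by (simp add: \<rho>_def of_nat_diff)
    qed
  qed
  have \<rho>m: "strict_mono \<rho>" by (rule strict_mono_Suc_iff[THEN iffD2]) (use \<rho> in blast)
  define Y where "Y k = (if k div 2 < n then X (k div 2) else X 0)" for k
  have Y: "Y k \<in> cbox 0 One" for k using X n by (auto simp: Y_def)
  have A0: "A > 0" using A n by (cases A) auto
  obtain g where g: "g \<in> nn_class (4 * CARD('d) * (2 * A) + 4 * A) 2" "\<And>z. g z \<in> cbox 0 One"
    and gY: "\<And>a k z. a < A \<Longrightarrow> Suc k < 2 * A \<Longrightarrow> Y (2 * A * a + k) = Y (2 * A * a + Suc k) \<Longrightarrow>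
       \<rho> (2 * A * a + k) \<le> z \<Longrightarrow> z \<le> \<rho> (2 * A * a + Suc k) \<Longrightarrow> g z = Y (2 * A * a + k)"
    using generator_blocks[of \<rho> Y "2 * A" A, OF \<rho> Y] A0 by fastforce
  have gX: "g z = X i" if "i < n" "\<rho> (2 * i) \<le> z" "z \<le> \<rho> (Suc (2 * i))" for i z
  proof -
    \<comment> \<open>Blocks have the even length \<open>2 * A\<close>, so the two ends of an
      interval never fall into different blocks.\<close>
    have i: "2 * A * (i div A) + 2 * (i mod A) = 2 * i"
      by (metis distrib_left mult.assoc mult_div_mod_eq)
    have "i div A < A" using that(1) A by (intro less_mult_imp_div_less) simp
    moreover have "Suc (2 * (i mod A)) < 2 * A" using A0 mod_less_divisor[of A i] by linarith
    ultimately have "g z = Y (2 * A * (i div A) + 2 * (i mod A))"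
      using that i by (intro gY) (auto simp: Y_def)
    then show ?thesis using that(1) unfolding i by (simp add: Y_def)
  qed
  define I where "I i = {\<rho> (2 * i)<..\<rho> (Suc (2 * i))}" for i
  have PI: "prob (I i) = (1 - 2 * \<theta>) / n" if "i < n" for i
  proof -
    have "prob (I i) = cdf \<nu> (\<rho> (Suc (2 * i))) - cdf \<nu> (\<rho> (2 * i))"
      unfolding I_def using \<rho>[of "2 * i"] by (simp add: cdf_diff_eq)
    also have "\<dots> = v (Suc (2 * i)) - v (2 * i)" using that by (simp add: \<rho>_def cdf_quant v01)
    also have "\<dots> = (1 - 2 * \<theta>) / n" by (simp add: v_def diff_divide_distrib[symmetric])
    finally show ?thesis .
  qed
  have disj: "z \<notin> I j" if "z \<in> I i" "i \<noteq> j" for i j z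
  proof
    assume z: "z \<in> I j"
    consider "Suc (2 * i) \<le> 2 * j" | "Suc (2 * j) \<le> 2 * i" using \<open>i \<noteq> j\<close> by linarith
    then show False
    proof cases
      case 1
      then have "\<rho> (Suc (2 * i)) \<le> \<rho> (2 * j)" using monoD[OF strict_mono_mono[OF \<rho>m]] by blast
      then show False using z that(1) by (auto simp: I_def)
    next
      case 2
      then have "\<rho> (Suc (2 * j)) \<le> \<rho> (2 * i)" using monoD[OF strict_mono_mono[OF \<rho>m]] by blast
      then show False using z that(1) by (auto simp: I_def)
    qed
  qed
  have main: "\<bar>(\<Sum>i<n. f (X i)) / n - (\<integral>z. f (g z) \<partial>\<nu>)\<bar> \<le> \<eta>"
    if fg: "f \<circ> g \<in> borel_measurable borel" and fb: "\<And>x. \<bar>f x\<bar> \<le> 1" for f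
  proof -
    have Im: "I i \<in> sets \<nu>" for i unfolding nu_sets I_def by simp
    have Ifg: "integrable \<nu> (\<lambda>z. f (g z))"
    proof (rule integrable_const_bound[of _ 1])
      show "(\<lambda>z. f (g z)) \<in> borel_measurable \<nu>" using fg measurable_cong_sets[OF nu_sets refl] unfolding comp_def by blast
    qed (use fb in auto)
    have Iind: "integrable \<nu> (indicator (I i) :: real \<Rightarrow> real)" for i using Im[of i] by (simp add: integrable_indicator_iff emeasure_eq_measure)
    have Is: "integrable \<nu> (\<lambda>z. \<Sum>i<n. c i * indicator (I i) z)" for c :: "nat \<Rightarrow> real"
      by (intro Bochner_Integration.integrable_sum integrable_mult_right Iind)
    have Es: "(\<integral>z. (\<Sum>i<n. c i * indicator (I i) z) \<partial>\<nu>) = (\<Sum>i<n. c i) * ((1 - 2 * \<theta>) / n)" for c :: "nat \<Rightarrow> real"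
    proof -
      have "(\<integral>z. (\<Sum>i<n. c i * indicator (I i) z) \<partial>\<nu>) = (\<Sum>i<n. \<integral>z. c i * indicator (I i) z \<partial>\<nu>)"
        by (intro Bochner_Integration.integral_sum integrable_mult_right Iind)
      also have "\<dots> = (\<Sum>i<n. c i * ((1 - 2 * \<theta>) / n))"
        using Im by (intro sum.cong refl) (simp add: PI)
      finally show ?thesis unfolding sum_distrib_right[symmetric] .
    qed
    \<comment> \<open>The generator hits the sample point exactly on each interval; elsewhere the
      sup bound on \<open>f\<close> is enough.\<close>
    have pt: "\<bar>f (g z) - (\<Sum>i<n. f (X i) * indicator (I i) z)\<bar> \<le> 1 - (\<Sum>i<n. 1 * indicator (I i) z)" for z
    proof (cases "\<exists>i<n. z \<in> I i")
      case True
      then obtain i where i: "i < n" "z \<in> I i" by blast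
      have s: "(\<Sum>j<n. c j * indicator (I j) z) = c i" for c :: "nat \<Rightarrow> real"
      proof -
        have "(\<Sum>j<n. c j * indicator (I j) z) = (\<Sum>j<n. if j = i then c i else 0)"
          using disj[OF i(2)] i by (intro sum.cong refl) (auto simp: indicator_def)
        then show ?thesis using i by simp
      qed
      have "g z = X i" using i by (intro gX) (auto simp: I_def)
      then show ?thesis unfolding s by simp
    next
      case False
      then have s: "(\<Sum>j<n. c j * indicator (I j) z) = 0" for c :: "nat \<Rightarrow> real"
        by (intro sum.neutral) (auto simp: indicator_def)
      show ?thesis unfolding s using fb by simp
    qed
    have "\<bar>\<integral>z. f (g z) - (\<Sum>i<n. f (X i) * indicator (I i) z) \<partial>\<nu>\<bar> \<le> (\<integral>z. 1 - (\<Sum>i<n. 1 * indicator (I i) z) \<partial>\<nu>)"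
      unfolding real_norm_def[symmetric]
      by (rule Bochner_Integration.integral_norm_bound_integral[OF Bochner_Integration.integrable_diff[OF Ifg Is]
            Bochner_Integration.integrable_diff[OF integrable_const Is[of "\<lambda>_. 1"]]]) (simp only: real_norm_def pt)
    also have "(\<integral>z. 1 - (\<Sum>i<n. 1 * indicator (I i) z) \<partial>\<nu>) = 2 * \<theta>"
      using n by (subst Bochner_Integration.integral_diff[OF integrable_const Is[of "\<lambda>_. 1"]]) (simp only: Es, simp add: prob_space[unfolded nu_space])
    also have "(\<integral>z. f (g z) - (\<Sum>i<n. f (X i) * indicator (I i) z) \<partial>\<nu>) = (\<integral>z. f (g z) \<partial>\<nu>) - (\<Sum>i<n. f (X i)) * ((1 - 2 * \<theta>) / n)"
      by (subst Bochner_Integration.integral_diff[OF Ifg Is]) (simp only: Es)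
    finally have 1: "\<bar>(\<integral>z. f (g z) \<partial>\<nu>) - (\<Sum>i<n. f (X i)) * ((1 - 2 * \<theta>) / n)\<bar> \<le> 2 * \<theta>" .
    \<comment> \<open>Each interval has mass \<open>(1 - 2 * \<theta>) / n\<close> instead of
      \<open>1 / n\<close>. This costs another \<open>2 * \<theta>\<close>, which explains the
      choice of \<theta> as at most a quarter of \<eta>.\<close>
    have "\<bar>\<Sum>i<n. f (X i)\<bar> \<le> (\<Sum>i<n. 1)" by (rule order.trans[OF sum_abs sum_mono]) (rule fb)
    then have "\<bar>\<Sum>i<n. f (X i)\<bar> / n * (2 * \<theta>) \<le> 1 * (2 * \<theta>)" using n \<theta> by (intro mult_right_mono) auto
    then have "\<bar>(\<Sum>i<n. f (X i)) / n * (2 * \<theta>)\<bar> \<le> 2 * \<theta>" using \<theta> by (simp add: abs_mult)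
    moreover have "(\<Sum>i<n. f (X i)) * ((1 - 2 * \<theta>) / n) = (\<Sum>i<n. f (X i)) / n - (\<Sum>i<n. f (X i)) / n * (2 * \<theta>)"
      by (simp add: right_diff_distrib diff_divide_distrib)
    moreover have "\<bar>S - E\<bar> \<le> \<eta>" if "\<bar>P\<bar> \<le> 2 * \<theta>" "Q = S - P" "\<bar>E - Q\<bar> \<le> 2 * \<theta>" for S E P Q :: real
      using that \<theta>(3) by linarith
    ultimately show ?thesis using 1 by blast
  qed
  have "4 * CARD('d) * (2 * A) + 4 * A = (8 * CARD('d) + 4) * A" by (simp add: algebra_simps)
  with g main show ?thesis by (intro bexI[of _ g]) auto
qed

end

section \<open>Variation of discriminators along generators\<close>

text \<open>Affinity is asked for on the closed interval although only the open one has to avoid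
  \<open>Z\<close>; this builds in continuity at isolated breakpoints.\<close>

definition pw_affine :: "real set \<Rightarrow> (real \<Rightarrow> real) \<Rightarrow> bool" where
  "pw_affine Z f \<longleftrightarrow> (\<forall>u v. u < v \<longrightarrow> {u<..<v} \<inter> Z = {} \<longrightarrow> (\<exists>a b. \<forall>x\<in>{u..v}. f x = a * x + b))"

lemma pw_affine_mono: "pw_affine Z f \<Longrightarrow> Z \<subseteq> Z' \<Longrightarrow> pw_affine Z' f"
  unfolding pw_affine_def by blast

lemma pw_affine_linear: "pw_affine Z (\<lambda>x. a * x + b)"
  unfolding pw_affine_def by blast

lemma pw_affine_add:
  assumes "pw_affine Z f" "pw_affine Z g" shows "pw_affine Z (\<lambda>x. f x + g x)"
  unfolding pw_affine_def
proof (intro allI impI)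
  fix u v :: real assume "u < v" "{u<..<v} \<inter> Z = {}"
  then obtain a b a' b' where "\<forall>x\<in>{u..v}. f x = a * x + b" "\<forall>x\<in>{u..v}. g x = a' * x + b'"
    using assms unfolding pw_affine_def by metis
  then show "\<exists>a b. \<forall>x\<in>{u..v}. f x + g x = a * x + b"
    by (intro exI[of _ "a + a'"] exI[of _ "b + b'"]) (simp add: algebra_simps)
qed

lemma pw_affine_scale:
  assumes "pw_affine Z f" shows "pw_affine Z (\<lambda>x. c * f x)"
  unfolding pw_affine_def
proof (intro allI impI)
  fix u v :: real assume "u < v" "{u<..<v} \<inter> Z = {}"
  then obtain a b where "\<forall>x\<in>{u..v}. f x = a * x + b"
    using assms unfolding pw_affine_def by metis
  then show "\<exists>a b. \<forall>x\<in>{u..v}. c * f x = a * x + b"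
    by (intro exI[of _ "c * a"] exI[of _ "c * b"]) (simp add: algebra_simps)
qed

lemma pw_affine_const: "pw_affine Z (\<lambda>x. c)"
  using pw_affine_linear[of Z 0 c] by simp

lemma pw_affine_sum: "(\<And>i. i \<in> I \<Longrightarrow> pw_affine Z (f i)) \<Longrightarrow> pw_affine Z (\<lambda>x. \<Sum>i\<in>I. f i x)"
  by (induction I rule: infinite_finite_induct) (auto intro: pw_affine_add pw_affine_const)

text \<open>Each gap of \<open>Z\<close> contains at most one sign change; gaps are labelled by the number of points of \<open>Z\<close> to the left.\<close>
lemma pw_affine_relu:
  assumes "finite Z" "pw_affine Z f"
  shows "\<exists>Z'. finite Z' \<and> card Z' \<le> card Z + 1 \<and> pw_affine (Z \<union> Z') (\<lambda>x. relu (f x))"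
proof -
  \<comment> \<open>A zero counts only if \<open>f\<close> is nonzero somewhere in the same gap: a
    gap on which \<open>f\<close> vanishes identically produces no kink and would contribute
    infinitely many points.\<close>
  define Z' where "Z' = {x. x \<notin> Z \<and> f x = 0 \<and> (\<exists>y. {min x y..max x y} \<inter> Z = {} \<and> f y \<noteq> 0)}"
  define ind where "ind x = card {z \<in> Z. z < x}" for x
  have inj: "inj_on ind Z'"
  proof (rule linorder_inj_onI)
    show "x \<le> y \<or> y \<le> x" for x y :: real by auto
    fix x x' assume x: "x < x'" "x \<in> Z'" "x' \<in> Z'"
    show "ind x \<noteq> ind x'"
    proof
      assume eq: "ind x = ind x'"
      have "{z \<in> Z. z < x} \<subseteq> {z \<in> Z. z < x'}" using x by auto
      then have "{z \<in> Z. z < x} = {z \<in> Z. z < x'}" using eq assms(1) unfolding ind_def by (intro card_subset_eq) auto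
      note same = this
      have gap: "{x..x'} \<inter> Z = {}"
      proof (rule equals0I)
        fix z assume z: "z \<in> {x..x'} \<inter> Z"
        have "z \<noteq> x" "z \<noteq> x'" using z x unfolding Z'_def by auto
        then have "z \<in> {z \<in> Z. z < x'}" "z \<notin> {z \<in> Z. z < x}" using z by auto
        then show False using same by blast
      qed
      \<comment> \<open>Two such zeros in one gap would make the affine function vanish on the whole
        gap, including the witness \<open>y\<close>.\<close>
      obtain y where y: "{min x y..max x y} \<inter> Z = {}" "f y \<noteq> 0" using x(2) unfolding Z'_def by blast
      let ?u = "min x y" and ?v = "max x' y"
      have "{?u..?v} \<subseteq> {min x y..max x y} \<union> {x..x'}" by auto
      moreover have "{?u<..<?v} \<subseteq> {?u..?v}" by (rule greaterThanLessThan_subseteq_atLeastAtMost_iff[THEN iffD2]) simp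
      ultimately have "{?u<..<?v} \<inter> Z = {}" using gap y(1) by blast
      moreover have "?u < ?v" using x(1) by auto
      ultimately obtain a b where ab: "\<forall>t\<in>{?u..?v}. f t = a * t + b" using assms(2) unfolding pw_affine_def by blast
      have "a * x + b = 0" "a * x' + b = 0" using ab x unfolding Z'_def by force+
      then have "a * x' = a * x" by linarith
      then have "a = 0" "b = 0" using x(1) \<open>a * x + b = 0\<close> by auto
      then show False using ab y(2) by auto
    qed
  qed
  have "ind ` Z' \<subseteq> {..card Z}" using assms(1) by (auto simp: ind_def intro!: card_mono)
  then have fin: "finite Z'" and "card Z' \<le> card {..card Z}"
    using inj finite_subset[of "ind ` Z'"] finite_imageD card_inj_on_le[OF inj] by blast+
  then have c: "card Z' \<le> card Z + 1" by simp
  have "pw_affine (Z \<union> Z') (\<lambda>x. relu (f x))"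
    unfolding pw_affine_def
  proof (intro allI impI)
    fix u v :: real assume uv: "u < v" and gap: "{u<..<v} \<inter> (Z \<union> Z') = {}"
    then obtain a b where ab: "\<And>x. x \<in> {u..v} \<Longrightarrow> f x = a * x + b" using assms(2) unfolding pw_affine_def by blast
    show "\<exists>a b. \<forall>x\<in>{u..v}. relu (f x) = a * x + b"
    proof (cases "(\<forall>x\<in>{u..v}. f x \<ge> 0) \<or> (\<forall>x\<in>{u..v}. f x \<le> 0)")
      case True
      then show ?thesis
      proof
        assume "\<forall>x\<in>{u..v}. f x \<ge> 0"
        then show ?thesis using ab by (intro exI[of _ a] exI[of _ b]) (auto simp: relu_def)
      next
        assume "\<forall>x\<in>{u..v}. f x \<le> 0"
        then show ?thesis by (intro exI[of _ 0]) (auto simp: relu_def)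
      qed
    next
      case False
      then obtain x1 x2 where x12: "x1 \<in> {u..v}" "f x1 < 0" "x2 \<in> {u..v}" "f x2 > 0" by fastforce
      have a0: "a \<noteq> 0" using ab x12 by force
      define t where "t = - b / a"
      have t0: "a * t + b = 0" using a0 by (simp add: t_def)
      have d1: "a * (x1 - t) < 0" and d2: "a * (x2 - t) > 0" using ab x12 t0 by (simp_all add: algebra_simps)
      have tuv: "u < t" "t < v"
        using d1 d2 x12(1,3) by (auto simp: zero_less_mult_iff mult_less_0_iff)
      then have "t \<notin> Z" "t \<notin> Z'" using gap by auto
      define w where "w = (t + u) / 2"
      have w: "u < w" "w < t" using tuv by (auto simp: w_def)
      have "f w \<noteq> 0"
      proof
        assume "f w = 0"
        then have "a * w + b = 0" using ab[of w] w tuv by auto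
        then have "a * t = a * w" using t0 by linarith
        then show False using a0 w by simp
      qed
      moreover have "{min t w..max t w} \<subseteq> {u<..<v}" using w tuv by auto
      then have "{min t w..max t w} \<inter> Z = {}" using gap by blast
      moreover have "f t = 0" using ab[of t] t0 tuv by simp
      ultimately have "t \<in> Z'" unfolding Z'_def using \<open>t \<notin> Z\<close> by blast
      then show ?thesis using \<open>t \<notin> Z'\<close> by blast
    qed
  qed
  with fin c show ?thesis by blast
qed

lemma pw_affine_relu_family:
  fixes K :: nat
  assumes "finite Z" "\<And>k. k < K \<Longrightarrow> pw_affine Z (f k)"
  shows "\<exists>Z'. finite Z' \<and> Z \<subseteq> Z' \<and> card Z' \<le> card Z + K * (card Z + 1) \<and> (\<forall>k<K. pw_affine Z' (\<lambda>x. relu (f k x)))"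
proof -
  have "\<forall>k<K. \<exists>Z'. finite Z' \<and> card Z' \<le> card Z + 1 \<and> pw_affine (Z \<union> Z') (\<lambda>x. relu (f k x))"
    using pw_affine_relu[OF assms(1)] assms(2) by blast
  then obtain z where z: "\<And>k. k < K \<Longrightarrow> finite (z k) \<and> card (z k) \<le> card Z + 1 \<and> pw_affine (Z \<union> z k) (\<lambda>x. relu (f k x))"
    by metis
  let ?Z = "Z \<union> (\<Union>k<K. z k)"
  have "card ?Z \<le> card Z + (\<Sum>k<K. card (z k))"
    using card_UN_le[of "{..<K}" z] by (intro order.trans[OF card_Un_le] add_mono) auto
  also have "\<dots> \<le> card Z + (\<Sum>k<K. card Z + 1)" using z by (intro add_mono sum_mono) auto
  finally have "card ?Z \<le> card Z + K * (card Z + 1)" by simp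
  moreover have "pw_affine ?Z (\<lambda>x. relu (f k x))" if "k < K" for k
    by (rule pw_affine_mono[of "Z \<union> z k"]) (use z that in auto)
  ultimately show ?thesis using assms(1) z by (intro exI[of _ ?Z]) auto
qed

text \<open>The first layer has at most \<open>W\<close> kinks, and each second-layer neuron adds at
  most one per gap; hence the quadratic term. A width of order sqrt n therefore means order n
  pieces.\<close>

lemma nn_class_two_pieces:
  fixes g :: "real \<Rightarrow> real^'d::finite"
  assumes "g \<in> nn_class W 2"
  shows "\<exists>Z. finite Z \<and> card Z \<le> W + W * (W + 1) \<and> (\<forall>i. pw_affine Z (\<lambda>x. g x $ i))"
  using assms unfolding nn_class_def mem_Collect_eq
proof (elim disjE exE conjE)
  fix f and e :: "real^'d" assume f: "linear f" "g = (\<lambda>x. f x + e)"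
  have "g x $ i = (f 1 $ i) * x + e $ i" for x i
    using linear_scale[OF f(1), of x 1] f(2) by (simp add: mult.commute)
  then show ?thesis by (intro exI[of _ "{}"]) (auto simp: pw_affine_linear)
next
  fix N :: "nat list" and Ts and a :: "nat \<Rightarrow> real" and c and w :: "nat \<Rightarrow> real^'d" and e
  assume N: "N \<noteq> []" "length N \<le> 2" "length Ts + 1 = length N" "\<forall>n\<in>set N. n \<le> W"
    and g: "g = (\<lambda>x. (\<Sum>i<last N. nn_hid N Ts (relu_vec (\<lambda>j. inner (a j) x + c j)) i *\<^sub>R w i) + e)"
  have lin: "pw_affine {} (\<lambda>x. inner (a j) x + c j)" for j
    using pw_affine_linear[of "{}" "a j" "c j"] by simp
  show ?thesis
  proof (cases "length N = 1")
    case True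
    then obtain n1 where n1: "N = [n1]" by (auto simp: length_Suc_conv)
    then have "Ts = []" using N by simp
    obtain Z where Z: "finite Z" "card Z \<le> n1" "\<And>k. k < n1 \<Longrightarrow> pw_affine Z (\<lambda>x. relu (inner (a k) x + c k))"
      using pw_affine_relu_family[of "{}" n1 "\<lambda>j x. inner (a j) x + c j"] lin by auto
    have "g x $ i = (\<Sum>k<n1. w k $ i * relu (inner (a k) x + c k)) + e $ i" for x i
      unfolding g n1 \<open>Ts = []\<close> by (simp add: relu_vec_def sum_component mult.commute)
    then have "pw_affine Z (\<lambda>x. g x $ i)" for i
      using Z(3) by (auto intro!: pw_affine_add pw_affine_sum pw_affine_scale pw_affine_const)
    moreover have "card Z \<le> W + W * (W + 1)" using Z(2) N(4) n1 by (simp add: trans_le_add1)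
    ultimately show ?thesis using Z(1) by blast
  next
    case False
    then have "length N = 2" using N by (cases N) (auto simp: le_Suc_eq)
    then obtain n1 n2 where n: "N = [n1, n2]" by (auto simp: length_Suc_conv numeral_2_eq_2)
    then obtain A b where Ts: "Ts = [(A, b)]" using N(3) by (auto simp: length_Suc_conv)
    have nW: "n1 \<le> W" "n2 \<le> W" using N(4) n by auto
    obtain Z where Z: "finite Z" "card Z \<le> n1" "\<And>k. k < n1 \<Longrightarrow> pw_affine Z (\<lambda>x. relu (inner (a k) x + c k))"
      using pw_affine_relu_family[of "{}" n1 "\<lambda>j x. inner (a j) x + c j"] lin by auto
    have "pw_affine Z (\<lambda>x. (\<Sum>i<n1. A j i * relu (inner (a i) x + c i)) + b j)" for j
      using Z(3) by (intro pw_affine_add pw_affine_sum pw_affine_scale pw_affine_const) auto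
    then obtain Z' where Z': "finite Z'" "card Z' \<le> card Z + n2 * (card Z + 1)"
      "\<And>k. k < n2 \<Longrightarrow> pw_affine Z' (\<lambda>x. relu ((\<Sum>i<n1. A k i * relu (inner (a i) x + c i)) + b k))"
      using pw_affine_relu_family[OF Z(1), of n2 "\<lambda>j x. (\<Sum>i<n1. A j i * relu (inner (a i) x + c i)) + b j"] by blast
    have "g x $ i = (\<Sum>k<n2. w k $ i * relu ((\<Sum>i<n1. A k i * relu (inner (a i) x + c i)) + b k)) + e $ i" for x i
      unfolding g n Ts by (simp add: relu_vec_def sum_component mult.commute)
    then have "pw_affine Z' (\<lambda>x. g x $ i)" for i
      using Z'(3) by (auto intro!: pw_affine_add pw_affine_sum pw_affine_scale pw_affine_const)
    moreover have "card Z' \<le> W + W * (W + 1)"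
      using Z'(2) Z(2) nW by (meson add_le_mono mult_le_mono order.trans le_refl)
    ultimately show ?thesis using Z'(1) by blast
  qed
qed

text \<open>Total variation, phrased for ordered disjoint intervals instead of partitions, so that
  points can be picked cell by cell.\<close>

definition var_le :: "(real \<Rightarrow> real) \<Rightarrow> real \<Rightarrow> bool" where
  "var_le f V \<longleftrightarrow> (\<forall>T x y. (\<forall>k<T. x k \<le> y k) \<longrightarrow> (\<forall>k. Suc k < T \<longrightarrow> y k \<le> x (Suc k)) \<longrightarrow>
     (\<Sum>k<T. \<bar>f (y k) - f (x k)\<bar>) \<le> V)"

definition var_le_on :: "real \<Rightarrow> real \<Rightarrow> (real \<Rightarrow> real) \<Rightarrow> real \<Rightarrow> bool" where
  "var_le_on a b f V \<longleftrightarrow> (\<forall>T x y. (\<forall>k<T. a \<le> x k \<and> x k \<le> y k \<and> y k \<le> b) \<longrightarrow> (\<forall>k. Suc k < T \<longrightarrow> y k \<le> x (Suc k)) \<longrightarrow>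
     (\<Sum>k<T. \<bar>f (y k) - f (x k)\<bar>) \<le> V)"

lemma var_le_on_split:
  assumes "var_le_on a c f V1" "var_le_on c b f V2" "a \<le> c" "c \<le> b"
  shows "var_le_on a b f (V1 + V2)"
  unfolding var_le_on_def
proof (intro allI impI)
  fix T and x y :: "nat \<Rightarrow> real"
  assume xy: "\<forall>k<T. a \<le> x k \<and> x k \<le> y k \<and> y k \<le> b" "\<forall>k. Suc k < T \<longrightarrow> y k \<le> x (Suc k)"
  have "(\<Sum>k<T. \<bar>f (y k) - f (x k)\<bar>) \<le> (\<Sum>k<T. \<bar>f (min (y k) c) - f (min (x k) c)\<bar> + \<bar>f (max (y k) c) - f (max (x k) c)\<bar>)"
  proof (rule sum_mono)
    fix k assume "k \<in> {..<T}"
    then have "x k \<le> y k" using xy by simp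
    then consider "y k \<le> c" "x k \<le> c" | "c \<le> x k" "c \<le> y k" | "x k \<le> c" "c \<le> y k" by linarith
    then show "\<bar>f (y k) - f (x k)\<bar> \<le> \<bar>f (min (y k) c) - f (min (x k) c)\<bar> + \<bar>f (max (y k) c) - f (max (x k) c)\<bar>"
      by cases (simp_all add: min_absorb1 min_absorb2 max_absorb1 max_absorb2)
  qed
  also have "\<dots> = (\<Sum>k<T. \<bar>f (min (y k) c) - f (min (x k) c)\<bar>) + (\<Sum>k<T. \<bar>f (max (y k) c) - f (max (x k) c)\<bar>)"
    by (rule sum.distrib)
  also have "(\<Sum>k<T. \<bar>f (min (y k) c) - f (min (x k) c)\<bar>) \<le> V1"
    using assms(1)[unfolded var_le_on_def, rule_format, of T "\<lambda>k. min (x k) c" "\<lambda>k. min (y k) c"] xy assms(3,4) by force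
  also have "(\<Sum>k<T. \<bar>f (max (y k) c) - f (max (x k) c)\<bar>) \<le> V2"
    using assms(2)[unfolded var_le_on_def, rule_format, of T "\<lambda>k. max (x k) c" "\<lambda>k. max (y k) c"] xy assms(3,4) by force
  finally show "(\<Sum>k<T. \<bar>f (y k) - f (x k)\<bar>) \<le> V1 + V2" by simp
qed

lemma sum_gaps:
  assumes "\<forall>k<T. a \<le> x k \<and> x k \<le> y k \<and> y k \<le> b" "\<forall>k. Suc k < T \<longrightarrow> y k \<le> x (Suc k)" "a \<le> (b::real)"
  shows "(\<Sum>k<T. y k - x k) \<le> b - a"
proof -
  have *: "(\<Sum>k<Suc T. y k - x k) \<le> y T - a" if "\<forall>k<Suc T. a \<le> x k \<and> x k \<le> y k \<and> y k \<le> b" "\<forall>k. Suc k < Suc T \<longrightarrow> y k \<le> x (Suc k)" for T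
    using that
  proof (induction T)
    case (Suc T)
    have "(\<Sum>k<Suc T. y k - x k) \<le> y T - a" using Suc by auto
    moreover have "y T \<le> x (Suc T)" using Suc.prems by auto
    ultimately show ?case by simp
  qed simp
  show ?thesis
  proof (cases T)
    case (Suc T')
    have "(\<Sum>k<Suc T'. y k - x k) \<le> y T' - a" by (rule *) (use assms Suc in auto)
    moreover have "y T' \<le> b" using assms(1) Suc by auto
    ultimately show ?thesis unfolding Suc by linarith
  qed (use assms in simp)
qed

text \<open>Induction on the interior breakpoints: the interval is split at one of them. Between
  breakpoints the function is monotone, so its variation is at most 1, the length of its
  range.\<close>

lemma pw_affine_var_on:
  assumes "finite Z" "pw_affine Z f" "\<And>x. 0 \<le> f x \<and> f x \<le> 1" "a \<le> b"
  shows "var_le_on a b f (real (card (Z \<inter> {a<..<b})) + 1)"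
  using assms(4)
proof (induction "card (Z \<inter> {a<..<b})" arbitrary: a b rule: less_induct)
  case less
  show ?case
  proof (cases "Z \<inter> {a<..<b} = {}")
    case True
    show ?thesis unfolding var_le_on_def
    proof (intro allI impI)
      fix T and x y :: "nat \<Rightarrow> real"
      assume xy: "\<forall>k<T. a \<le> x k \<and> x k \<le> y k \<and> y k \<le> b" "\<forall>k. Suc k < T \<longrightarrow> y k \<le> x (Suc k)"
      show "(\<Sum>k<T. \<bar>f (y k) - f (x k)\<bar>) \<le> real (card (Z \<inter> {a<..<b})) + 1"
      proof (cases "a = b")
        case True
        then have "\<And>k. k < T \<Longrightarrow> y k = x k" using xy by force
        then have "(\<Sum>k<T. \<bar>f (y k) - f (x k)\<bar>) = 0" by (intro sum.neutral) auto
        then show ?thesis by simp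
      next
        case False
        then have "a < b" using less.prems by simp
        then obtain p q where pq: "\<And>t. t \<in> {a..b} \<Longrightarrow> f t = p * t + q"
          using assms(2) True unfolding pw_affine_def by (metis inf_commute)
        have "(\<Sum>k<T. \<bar>f (y k) - f (x k)\<bar>) = (\<Sum>k<T. \<bar>p\<bar> * (y k - x k))"
        proof (rule sum.cong[OF refl])
          fix k assume "k \<in> {..<T}"
          then have k: "a \<le> x k" "x k \<le> y k" "y k \<le> b" using xy by auto
          have "f (y k) - f (x k) = p * (y k - x k)" using pq[of "y k"] pq[of "x k"] k by (simp add: algebra_simps)
          then show "\<bar>f (y k) - f (x k)\<bar> = \<bar>p\<bar> * (y k - x k)" using k by (simp add: abs_mult)
        qed
        also have "\<dots> = \<bar>p\<bar> * (\<Sum>k<T. y k - x k)" by (simp add: sum_distrib_left)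
        also have "\<dots> \<le> \<bar>p\<bar> * (b - a)" using sum_gaps[OF xy] less.prems by (intro mult_left_mono) auto
        also have "\<dots> = \<bar>f b - f a\<bar>" using pq[of b] pq[of a] \<open>a < b\<close> by (simp add: abs_mult flip: right_diff_distrib)
        also have "\<dots> \<le> 1" using assms(3)[of a] assms(3)[of b] by auto
        finally show ?thesis by simp
      qed
    qed
  next
    case False
    then obtain c where c: "c \<in> Z" "a < c" "c < b" by auto
    have e: "Z \<inter> {a<..<b} = insert c ((Z \<inter> {a<..<c}) \<union> (Z \<inter> {c<..<b}))" using c by auto
    have fin: "finite (Z \<inter> {a<..<c})" "finite (Z \<inter> {c<..<b})" using assms(1) by auto
    have "card ((Z \<inter> {a<..<c}) \<union> (Z \<inter> {c<..<b})) = card (Z \<inter> {a<..<c}) + card (Z \<inter> {c<..<b})"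
      using fin by (intro card_Un_disjoint) auto
    then have card: "card (Z \<inter> {a<..<b}) = Suc (card (Z \<inter> {a<..<c}) + card (Z \<inter> {c<..<b}))"
      unfolding e using fin by (subst card_insert_disjoint) auto
    have "var_le_on a b f ((real (card (Z \<inter> {a<..<c})) + 1) + (real (card (Z \<inter> {c<..<b})) + 1))"
      by (rule var_le_on_split[of a c f _ b]) (use less.hyps card c in auto)
    then show ?thesis unfolding card by (simp add: algebra_simps)
  qed
qed

lemma pw_affine_var:
  assumes "finite Z" "pw_affine Z f" "\<And>x. 0 \<le> f x \<and> f x \<le> 1"
  shows "var_le f (real (card Z) + 1)"
  unfolding var_le_def
proof (intro allI impI)
  fix T and x y :: "nat \<Rightarrow> real"
  assume xy: "\<forall>k<T. x k \<le> y k" "\<forall>k. Suc k < T \<longrightarrow> y k \<le> x (Suc k)"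
  let ?a = "Min (insert 0 (x ` {..<T}))" and ?b = "Max (insert 0 (y ` {..<T}))"
  have ab: "?a \<le> 0" "0 \<le> ?b" by (simp_all add: Min_le_iff Max_ge_iff)
  have "\<forall>k<T. ?a \<le> x k \<and> x k \<le> y k \<and> y k \<le> ?b" using xy(1) by (auto intro!: Min_le Max_ge)
  then have "(\<Sum>k<T. \<bar>f (y k) - f (x k)\<bar>) \<le> real (card (Z \<inter> {?a<..<?b})) + 1"
    using pw_affine_var_on[OF assms, of ?a ?b] ab xy(2) unfolding var_le_on_def by (meson order.trans)
  also have "\<dots> \<le> real (card Z) + 1" using assms(1) by (simp add: card_mono)
  finally show "(\<Sum>k<T. \<bar>f (y k) - f (x k)\<bar>) \<le> real (card Z) + 1" .
qed

text \<open>Variation is measured on the coordinates of \<open>g\<close> and passed on through the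
  Lipschitz constant, so the bound is uniform over all generators and discriminators of the given
  sizes.\<close>

lemma lip_comp_var:
  fixes g :: "real \<Rightarrow> real^'d::finite"
  assumes g: "g \<in> nn_class W 2" "\<And>z i. 0 \<le> g z $ i \<and> g z $ i \<le> 1"
    and f: "\<And>x y. \<bar>f x - f y\<bar> \<le> K * dist x y" and K: "0 \<le> K"
  shows "var_le (\<lambda>z. f (g z)) (K * (CARD('d) * (real (W + W * (W + 1)) + 1)))"
  unfolding var_le_def
proof (intro allI impI)
  fix T and x y :: "nat \<Rightarrow> real"
  assume xy: "\<forall>k<T. x k \<le> y k" "\<forall>k. Suc k < T \<longrightarrow> y k \<le> x (Suc k)"
  obtain Z where Z: "finite Z" "card Z \<le> W + W * (W + 1)" "\<And>i. pw_affine Z (\<lambda>x. g x $ i)"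
    using nn_class_two_pieces[OF g(1)] by blast
  have "(\<Sum>k<T. \<bar>f (g (y k)) - f (g (x k))\<bar>) \<le> (\<Sum>k<T. K * (\<Sum>i\<in>UNIV. \<bar>g (y k) $ i - g (x k) $ i\<bar>))"
  proof (rule sum_mono)
    fix k
    have "dist (g (y k)) (g (x k)) \<le> (\<Sum>i\<in>UNIV. \<bar>g (y k) $ i - g (x k) $ i\<bar>)"
      using norm_le_l1_cart[of "g (y k) - g (x k)"] by (simp add: dist_norm)
    then show "\<bar>f (g (y k)) - f (g (x k))\<bar> \<le> K * (\<Sum>i\<in>UNIV. \<bar>g (y k) $ i - g (x k) $ i\<bar>)"
      using f[of "g (y k)" "g (x k)"] mult_left_mono[OF _ K] by (meson order.trans)
  qed
  also have "\<dots> = K * (\<Sum>i\<in>UNIV. \<Sum>k<T. \<bar>g (y k) $ i - g (x k) $ i\<bar>)"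
    unfolding sum_distrib_left[symmetric] by (subst sum.swap) simp
  also have "\<dots> \<le> K * (\<Sum>i::'d\<in>UNIV. real (W + W * (W + 1)) + 1)"
  proof (intro mult_left_mono K sum_mono)
    fix i :: 'd
    have "(\<Sum>k<T. \<bar>g (y k) $ i - g (x k) $ i\<bar>) \<le> real (card Z) + 1"
      using pw_affine_var[OF Z(1) Z(3)[of i]] g(2) xy unfolding var_le_def by blast
    then show "(\<Sum>k<T. \<bar>g (y k) $ i - g (x k) $ i\<bar>) \<le> real (W + W * (W + 1)) + 1" using Z(2) by linarith
  qed
  finally show "(\<Sum>k<T. \<bar>f (g (y k)) - f (g (x k))\<bar>) \<le> K * (CARD('d) * (real (W + W * (W + 1)) + 1))" by simp
qed

section \<open>Uniform deviation for functions of bounded variation\<close>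

context
  fixes \<nu> :: "real measure"
  assumes nu_prob: "prob_space \<nu>" and nu_sets: "sets \<nu> = sets borel" and nu_ac: "absolutely_continuous lborel \<nu>"
begin

lemma nu_cdf_range: "cdf \<nu> z \<in> {0..1}"
proof -
  interpret real_distribution \<nu> by (rule nu_real_distribution[OF nu_prob nu_sets nu_ac])
  show ?thesis by (simp add: cdf_nonneg cdf_bounded_prob)
qed

lemma nu_cdf_measurable: "cdf \<nu> \<in> borel_measurable borel"
  by (rule borel_measurable_mono) (auto intro!: monoI nu_cdf_mono[OF nu_prob nu_sets nu_ac])

definition ucell :: "nat \<Rightarrow> real \<Rightarrow> nat" where "ucell j z = dcell j (cdf \<nu> z)"

lemma ucell_measurable: "{z. ucell j z = k} \<in> sets borel"
proof -
  have [measurable]: "cdf \<nu> \<in> borel_measurable borel" by (rule nu_cdf_measurable)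
  have "ucell j \<in> borel \<rightarrow>\<^sub>M count_space UNIV" unfolding ucell_def dcell_def by measurable
  then have "ucell j -` {k} \<inter> space borel \<in> sets borel" by (rule measurable_sets) simp
  then show ?thesis by (simp add: vimage_def)
qed

lemma ucell_less: "ucell j z < 2 ^ j" unfolding ucell_def by (rule dcell_less)

lemma ucell_Suc: "ucell (Suc j) z div 2 = ucell j z"
  unfolding ucell_def by (rule dcell_Suc[OF nu_cdf_range])

text \<open>The levels bounding a cell may be 0 or 1, where a quantile need not exist; so the cell
  is enclosed between quantiles at levels moved outwards by \<open>\<epsilon> / 2\<close>.\<close>

lemma ucell_prob:
  assumes "k < 2 ^ j" shows "measure \<nu> {z. ucell j z = k} \<le> 1 / 2 ^ j"
proof (rule field_le_epsilon)
  fix \<epsilon> :: real assume \<epsilon>: "\<epsilon> > 0"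
  interpret real_distribution \<nu> by (rule nu_real_distribution[OF nu_prob nu_sets nu_ac])
  let ?D = "{z. ucell j z = k}" and ?a = "real k / 2 ^ j" and ?b = "(real k + 1) / 2 ^ j"
  have D: "?a \<le> cdf \<nu> z \<and> cdf \<nu> z \<le> ?b" if "z \<in> ?D" for z
    using dcell_bounds[OF nu_cdf_range, of j z] that unfolding ucell_def by (auto simp: field_simps)
  have Dm: "?D \<in> sets \<nu>" using ucell_measurable nu_sets by simp
  define u where "u = (if ?b + \<epsilon> / 2 < 1 then {..quant \<nu> (?b + \<epsilon> / 2)} else UNIV)"
  have b0: "?b > 0" "?a \<ge> 0" by (auto intro!: divide_pos_pos)
  have bp: "0 < ?b + \<epsilon> / 2" using b0 \<epsilon> by linarith
  have um: "u \<in> sets \<nu>" unfolding u_def nu_sets by simp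
  have Du: "?D \<subseteq> u"
  proof (cases "?b + \<epsilon> / 2 < 1")
    case True
    have c: "cdf \<nu> (quant \<nu> (?b + \<epsilon> / 2)) = ?b + \<epsilon> / 2" by (rule cdf_quant[OF nu_prob nu_sets nu_ac bp True])
    show ?thesis
    proof
      fix z assume "z \<in> ?D"
      then have "cdf \<nu> z < cdf \<nu> (quant \<nu> (?b + \<epsilon> / 2))" unfolding c using D[of z] \<epsilon> by auto
      then show "z \<in> u" unfolding u_def using True nu_cdf_less[OF nu_prob nu_sets nu_ac] by fastforce
    qed
  qed (simp add: u_def)
  have pu: "measure \<nu> u \<le> ?b + \<epsilon> / 2"
  proof (cases "?b + \<epsilon> / 2 < 1")
    case True
    have "cdf \<nu> (quant \<nu> (?b + \<epsilon> / 2)) = ?b + \<epsilon> / 2" by (rule cdf_quant[OF nu_prob nu_sets nu_ac bp True])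
    then show ?thesis using True by (simp add: u_def cdf_def)
  next
    case False
    then have "measure \<nu> u \<le> 1" by simp
    then show ?thesis using False by linarith
  qed
  have "measure \<nu> ?D \<le> ?b - ?a + \<epsilon>"
  proof (cases "?a - \<epsilon> / 2 > 0")
    case True
    let ?x = "quant \<nu> (?a - \<epsilon> / 2)"
    have "?a \<le> 1" using assms by (simp add: divide_le_eq)
    then have "?a - \<epsilon> / 2 < 1" using \<epsilon> by linarith
    then have c: "cdf \<nu> ?x = ?a - \<epsilon> / 2" by (rule cdf_quant[OF nu_prob nu_sets nu_ac True])
    have sub: "?D \<subseteq> u - {..?x}"
    proof
      fix z assume z: "z \<in> ?D"
      then have "cdf \<nu> ?x < cdf \<nu> z" unfolding c using D[of z] \<epsilon> by auto
      then have "?x < z" by (rule nu_cdf_less[OF nu_prob nu_sets nu_ac])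
      then show "z \<in> u - {..?x}" using z Du by auto
    qed
    have "{..?x} \<subseteq> u"
    proof (cases "?b + \<epsilon> / 2 < 1")
      case True
      have "cdf \<nu> (quant \<nu> (?b + \<epsilon> / 2)) = ?b + \<epsilon> / 2" by (rule cdf_quant[OF nu_prob nu_sets nu_ac bp True])
      moreover have "?a \<le> ?b" by (simp add: divide_right_mono)
      ultimately have "cdf \<nu> ?x < cdf \<nu> (quant \<nu> (?b + \<epsilon> / 2))" unfolding c using \<epsilon> by linarith
      then have "?x < quant \<nu> (?b + \<epsilon> / 2)" by (rule nu_cdf_less[OF nu_prob nu_sets nu_ac])
      then show ?thesis unfolding u_def using True by auto
    qed (simp add: u_def)
    then have "measure \<nu> (u - {..?x}) = measure \<nu> u - measure \<nu> {..?x}" using um nu_sets by (intro finite_measure_Diff) auto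
    moreover have "measure \<nu> ?D \<le> measure \<nu> (u - {..?x})" using sub um nu_sets by (intro finite_measure_mono) auto
    moreover have "measure \<nu> {..?x} = ?a - \<epsilon> / 2" using c by (simp add: cdf_def)
    ultimately show ?thesis using pu by linarith
  next
    case False
    have "measure \<nu> ?D \<le> measure \<nu> u" using Du um by (intro finite_measure_mono)
    then show ?thesis using pu False by linarith
  qed
  also have "?b - ?a = 1 / 2 ^ j" by (simp add: diff_divide_distrib[symmetric])
  finally show "measure \<nu> ?D \<le> 1 / 2 ^ j + \<epsilon>" .
qed

text \<open>The middle level of a cell lies strictly between 0 and 1, so that a representative
  exists for every cell.\<close>

definition urep :: "nat \<Rightarrow> nat \<Rightarrow> real" where "urep j k = quant \<nu> ((real k + 1/2) / 2 ^ j)"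

lemma ucell_urep: assumes "k < 2 ^ j" shows "ucell j (urep j k) = k"
proof -
  have "k + 1 \<le> 2 ^ j" using assms by simp
  then have "real (k + 1) \<le> real (2 ^ j)" by (simp only: of_nat_le_iff)
  then have "real k + 1 \<le> 2 ^ j" by simp
  then have "cdf \<nu> (urep j k) = (real k + 1/2) / 2 ^ j"
    unfolding urep_def by (intro cdf_quant[OF nu_prob nu_sets nu_ac]) (auto simp: divide_less_eq)
  then show ?thesis unfolding ucell_def using assms by (intro dcell_eq) auto
qed

lemma ucell_order: "ucell j x < ucell j y \<Longrightarrow> x < y"
proof -
  assume *: "ucell j x < ucell j y"
  have "\<not> cdf \<nu> y \<le> cdf \<nu> x"
  proof
    assume "cdf \<nu> y \<le> cdf \<nu> x"
    then have "ucell j y \<le> ucell j x" unfolding ucell_def dcell_def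
      by (intro min.mono nat_mono floor_mono mult_left_mono) auto
    then show False using * by simp
  qed
  then show "x < y" using nu_cdf_less[OF nu_prob nu_sets nu_ac] by simp
qed

text \<open>Points of successive cells are ordered on the line, so one pair per cell spans disjoint
  intervals. The order within a pair is free, hence minimum and maximum.\<close>

lemma cell_variation:
  assumes "var_le F V" "\<And>k. k < N \<Longrightarrow> ucell j (x k) = k \<and> ucell j (y k) = k"
  shows "(\<Sum>k<N. \<bar>F (y k) - F (x k)\<bar>) \<le> V"
proof -
  have "(\<Sum>k<N. \<bar>F (y k) - F (x k)\<bar>) = (\<Sum>k<N. \<bar>F (max (x k) (y k)) - F (min (x k) (y k))\<bar>)"
    by (intro sum.cong refl) (auto simp: max_def min_def)
  also have "\<dots> \<le> V"
  proof (rule assms(1)[unfolded var_le_def, rule_format])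
    fix k assume k: "Suc k < N"
    have "u < w" if "u \<in> {x k, y k}" "w \<in> {x (Suc k), y (Suc k)}" for u w
      by (rule ucell_order[of j]) (use assms(2)[of k] assms(2)[of "Suc k"] k that in auto)
    then show "max (x k) (y k) \<le> min (x (Suc k)) (y (Suc k))" by (auto intro: less_imp_le)
  qed auto
  finally show ?thesis .
qed

definition uinc :: "(real \<Rightarrow> real) \<Rightarrow> nat \<Rightarrow> nat \<Rightarrow> real" where
  "uinc F j k = F (urep (Suc j) k) - F (urep j (k div 2))"

lemma urep_coarse: "k < 2 ^ Suc j \<Longrightarrow> ucell j (urep (Suc j) k) = k div 2"
  using ucell_Suc[of j "urep (Suc j) k"] ucell_urep[of k "Suc j"] by simp

text \<open>Even and odd children are treated separately: each family has one point per coarse cell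
  and costs \<open>V\<close>.\<close>

lemma uinc_sum:
  assumes "var_le F V" shows "(\<Sum>k<2 ^ Suc j. \<bar>uinc F j k\<bar>) \<le> 2 * V"
proof -
  have split: "(\<Sum>k<2 * N. g k) = (\<Sum>k<N. g (2 * k)) + (\<Sum>k<N. g (2 * k + 1))" for g :: "nat \<Rightarrow> real" and N
    by (induction N) auto
  have 1: "(\<Sum>k<2 ^ j. \<bar>F (urep (Suc j) (2 * k)) - F (urep j k)\<bar>) \<le> V"
    by (rule cell_variation[OF assms, of _ j]) (auto simp: urep_coarse ucell_urep)
  have 2: "(\<Sum>k<2 ^ j. \<bar>F (urep (Suc j) (2 * k + 1)) - F (urep j k)\<bar>) \<le> V"
    by (rule cell_variation[OF assms, of _ j]) (auto simp: urep_coarse ucell_urep)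
  show ?thesis using 1 2 unfolding power_Suc split uinc_def by simp
qed

definition ucell_ind :: "nat \<Rightarrow> nat \<Rightarrow> real \<Rightarrow> real" where
  "ucell_ind j k z = indicator {z. ucell j z = k} z"

lemma ucell_ind_measurable: "ucell_ind j k \<in> borel_measurable \<nu>"
  unfolding ucell_ind_def[abs_def] using ucell_measurable[of j k] nu_sets by (intro borel_measurable_indicator) simp

lemma ucell_ind_sum: "(\<Sum>k<2 ^ j. c k * ucell_ind j k z) = c (ucell j z)"
proof -
  have "(\<Sum>k<2 ^ j. c k * ucell_ind j k z) = (\<Sum>k<2 ^ j. if k = ucell j z then c k else 0)"
    by (intro sum.cong) (auto simp: ucell_ind_def indicator_def)
  then show ?thesis using ucell_less[of j z] by simp
qed

definition usq :: "nat \<Rightarrow> nat \<Rightarrow> (nat \<Rightarrow> real) \<Rightarrow> real" where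
  "usq m j Z = (\<Sum>k<2 ^ j. (dev \<nu> m Z (ucell_ind j k))\<^sup>2)"

lemma usq_measurable: "usq m j \<in> borel_measurable (PiM {0..<m} (\<lambda>_. \<nu>))"
  unfolding usq_def using ucell_ind_measurable by measurable

lemma usq_nonneg: "0 \<le> usq m j Z" unfolding usq_def by (rule sum_nonneg) simp

text \<open>The indicators of one level add up to 1, which gives the same bound \<open>1 / m\<close>
  on every level, however fine.\<close>

lemma usq_expectation:
  assumes "m > 0" shows "(\<integral>\<^sup>+Z. ennreal (usq m j Z) \<partial>PiM {0..<m} (\<lambda>_. \<nu>)) \<le> ennreal (1 / m)"
proof -
  have s: "(\<Sum>k<2 ^ j. \<bar>ucell_ind j k x\<bar>) \<le> 1" for x
  proof -
    have "(\<Sum>k<2 ^ j. \<bar>ucell_ind j k x\<bar>) = (\<Sum>k<2 ^ j. 1 * ucell_ind j k x)" by (simp add: ucell_ind_def)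
    then show ?thesis unfolding ucell_ind_sum[of "\<lambda>_. 1"] by simp
  qed
  show ?thesis using sum_dev_square_expectation[OF nu_prob, of "{..<2 ^ j}" "ucell_ind j" 1 m] s assms ucell_ind_measurable
    unfolding usq_def by simp
qed

lemma dev_cells:
  "dev \<nu> m Z (\<lambda>z. \<Sum>k<2 ^ j. c k * ucell_ind j k z) = (\<Sum>k<2 ^ j. c k * dev \<nu> m Z (ucell_ind j k))"
proof -
  interpret prob_space \<nu> by (rule nu_prob)
  have I: "integrable \<nu> (ucell_ind j k)" for k
    by (rule integrable_const_bound[of _ 1]) (auto simp: ucell_ind_measurable ucell_ind_def)
  have a: "(\<integral>z. (\<Sum>k<2 ^ j. c k * ucell_ind j k z) \<partial>\<nu>) = (\<Sum>k<2 ^ j. c k * (\<integral>z. ucell_ind j k z \<partial>\<nu>))"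
  proof -
    have "(\<integral>z. (\<Sum>k<2 ^ j. c k * ucell_ind j k z) \<partial>\<nu>) = (\<Sum>k<2 ^ j. \<integral>z. c k * ucell_ind j k z \<partial>\<nu>)"
      by (intro Bochner_Integration.integral_sum integrable_mult_right I)
    then show ?thesis by simp
  qed
  have "(\<Sum>i<m. \<Sum>k<2 ^ j. c k * ucell_ind j k (Z i)) = (\<Sum>k<2 ^ j. c k * (\<Sum>i<m. ucell_ind j k (Z i)))"
    by (subst sum.swap) (simp add: sum_distrib_left)
  then have b: "(\<Sum>i<m. \<Sum>k<2 ^ j. c k * ucell_ind j k (Z i)) / m = (\<Sum>k<2 ^ j. c k * ((\<Sum>i<m. ucell_ind j k (Z i)) / m))"
    by (simp only: times_divide_eq_right sum_divide_distrib[symmetric])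
  show ?thesis unfolding dev_def a b by (simp add: right_diff_distrib sum_subtractf)
qed

text \<open>This separates the function from the sample: the coefficients enter only through their
  absolute sum, the sample only through \<open>usq\<close>. The sup bound 2 trades the square of a
  coefficient for its absolute value.\<close>

lemma cells_am_gm:
  assumes "\<tau> > 0" "\<And>k. k < 2 ^ j \<Longrightarrow> \<bar>c k\<bar> \<le> 2" "(\<Sum>k<2 ^ j. \<bar>c k\<bar>) \<le> U"
  shows "(\<Sum>k<2 ^ j. \<bar>c k\<bar> * \<bar>dev \<nu> m Z (ucell_ind j k)\<bar>) \<le> \<tau> * U + usq m j Z / (2 * \<tau>)"
proof -
  have "(\<Sum>k<2 ^ j. \<bar>c k\<bar> * \<bar>dev \<nu> m Z (ucell_ind j k)\<bar>) \<le> (\<Sum>k<2 ^ j. \<tau> * \<bar>c k\<bar> + (dev \<nu> m Z (ucell_ind j k))\<^sup>2 / (2 * \<tau>))"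
  proof (rule sum_mono)
    fix k :: nat assume "k \<in> {..<2 ^ j}"
    let ?d = "dev \<nu> m Z (ucell_ind j k)"
    have c: "\<bar>c k\<bar> \<le> 2" using assms(2) \<open>k \<in> _\<close> by simp
    have "0 \<le> (\<bar>?d\<bar> - \<tau> * \<bar>c k\<bar>)\<^sup>2" by simp
    then have "2 * \<tau> * (\<bar>c k\<bar> * \<bar>?d\<bar>) \<le> \<tau>\<^sup>2 * (\<bar>c k\<bar> * \<bar>c k\<bar>) + ?d\<^sup>2" by (simp add: power2_eq_square algebra_simps)
    also have "\<dots> \<le> \<tau>\<^sup>2 * (2 * \<bar>c k\<bar>) + ?d\<^sup>2" using c by (intro add_right_mono mult_left_mono mult_right_mono) auto
    finally have "2 * \<tau> * (\<bar>c k\<bar> * \<bar>?d\<bar>) / (2 * \<tau>) \<le> (\<tau>\<^sup>2 * (2 * \<bar>c k\<bar>) + ?d\<^sup>2) / (2 * \<tau>)"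
      using assms(1) by (intro divide_right_mono) auto
    then show "\<bar>c k\<bar> * \<bar>?d\<bar> \<le> \<tau> * \<bar>c k\<bar> + ?d\<^sup>2 / (2 * \<tau>)"
      using assms(1) by (simp add: add_divide_distrib power2_eq_square)
  qed
  also have "\<dots> = \<tau> * (\<Sum>k<2 ^ j. \<bar>c k\<bar>) + usq m j Z / (2 * \<tau>)"
    unfolding usq_def by (simp add: sum.distrib sum_distrib_left sum_divide_distrib)
  also have "\<dots> \<le> \<tau> * U + usq m j Z / (2 * \<tau>)" using assms by (intro add_right_mono mult_left_mono) auto
  finally show ?thesis .
qed

text \<open>It depends on the function only through \<open>V\<close> and hence controls all
  compositions of discriminators and generators at once, including those selected from the
  sample.\<close>

definition uniform_bound :: "nat \<Rightarrow> real \<Rightarrow> real \<Rightarrow> nat \<Rightarrow> (nat \<Rightarrow> real) \<Rightarrow> real" where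
  "uniform_bound J V \<tau> m Z = 2 * V / 2 ^ J + (2 * real J + 1) * (\<tau> * V) + (\<Sum>j\<le>J. usq m j Z) / \<tau>"

text \<open>Haar-type telescoping along the dyadic quantile cells of \<open>\<nu>\<close>.\<close>
lemma dev_le_uniform_bound:
  assumes F: "F \<in> borel_measurable borel" "\<And>z. \<bar>F z\<bar> \<le> 1" "var_le F V" and \<tau>: "\<tau> > 0" and m: "m > 0"
  shows "\<bar>dev \<nu> m Z F\<bar> \<le> uniform_bound J V \<tau> m Z"
proof -
  interpret prob_space \<nu> by (rule nu_prob)
  define st where "st j z = (\<Sum>k<2 ^ j. F (urep j k) * ucell_ind j k z)" for j z
  have st: "st j z = F (urep j (ucell j z))" for j z unfolding st_def by (rule ucell_ind_sum)
  have stb: "\<bar>st j z\<bar> \<le> 1" for j z unfolding st by (rule F(2))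
  have stm: "st j \<in> borel_measurable \<nu>" for j unfolding st_def[abs_def] using ucell_ind_measurable by measurable
  have Fm: "F \<in> borel_measurable \<nu>" using F(1) measurable_cong_sets[OF nu_sets refl] by blast
  have Ist: "integrable \<nu> (st j)" for j by (rule integrable_const_bound[of _ 1]) (auto simp: stb stm)
  have IF: "integrable \<nu> F" by (rule integrable_const_bound[of _ 1]) (auto simp: F Fm)
  have dd: "dev \<nu> m Z (\<lambda>z. f z - g z) = dev \<nu> m Z f - dev \<nu> m Z g" if "integrable \<nu> f" "integrable \<nu> g" for f g
    using that by (simp add: dev_def sum_subtractf diff_divide_distrib)
  have step: "\<bar>dev \<nu> m Z (st (Suc j)) - dev \<nu> m Z (st j)\<bar> \<le> \<tau> * (2 * V) + usq m (Suc j) Z / (2 * \<tau>)" for j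
  proof -
    have e: "(\<lambda>z. st (Suc j) z - st j z) = (\<lambda>z. \<Sum>k<2 ^ Suc j. uinc F j k * ucell_ind (Suc j) k z)"
    proof
      fix z
      have "(\<Sum>k<2 ^ Suc j. uinc F j k * ucell_ind (Suc j) k z) = uinc F j (ucell (Suc j) z)" by (rule ucell_ind_sum)
      then show "st (Suc j) z - st j z = (\<Sum>k<2 ^ Suc j. uinc F j k * ucell_ind (Suc j) k z)"
        unfolding st uinc_def ucell_Suc by simp
    qed
    have "dev \<nu> m Z (st (Suc j)) - dev \<nu> m Z (st j) = (\<Sum>k<2 ^ Suc j. uinc F j k * dev \<nu> m Z (ucell_ind (Suc j) k))"
      unfolding dd[OF Ist Ist, symmetric] e dev_cells ..
    also have "\<bar>\<dots>\<bar> \<le> (\<Sum>k<2 ^ Suc j. \<bar>uinc F j k\<bar> * \<bar>dev \<nu> m Z (ucell_ind (Suc j) k)\<bar>)"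
      unfolding abs_mult[symmetric] by (rule sum_abs)
    also have "\<dots> \<le> \<tau> * (2 * V) + usq m (Suc j) Z / (2 * \<tau>)"
    proof (rule cells_am_gm[OF \<tau> _ uinc_sum[OF F(3)]])
      fix k show "\<bar>uinc F j k\<bar> \<le> 2" using F(2)[of "urep (Suc j) k"] F(2)[of "urep j (k div 2)"] unfolding uinc_def by linarith
    qed
    finally show ?thesis .
  qed
  have tele: "\<bar>dev \<nu> m Z (st J) - dev \<nu> m Z (st 0)\<bar> \<le> (\<Sum>j<J. \<tau> * (2 * V) + usq m (Suc j) Z / (2 * \<tau>))"
  proof (induction J)
    case (Suc J) then show ?case using step[of J] by simp
  qed simp
  have "st 0 = (\<lambda>z. F (urep 0 0))"
  proof
    fix z show "st 0 z = F (urep 0 0)" using ucell_less[of 0 z] by (simp add: st)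
  qed
  then have st0: "dev \<nu> m Z (st 0) = 0" using m by (simp add: dev_def prob_space)
  \<comment> \<open>Oscillation of \<open>F\<close> on a cell of the finest level, relative to the
    representative. These numbers sum to at most \<open>V\<close>, and each cell has mass at most
    \<open>1 / 2 ^ J\<close>.\<close>
  define os where "os k = (SUP z\<in>{z. ucell J z = k}. \<bar>F z - F (urep J k)\<bar>)" for k
  have dF: "\<bar>F x - F y\<bar> \<le> 2" for x y using F(2)[of x] F(2)[of y] by linarith
  have bdd: "bdd_above ((\<lambda>z. \<bar>F z - F (urep J k)\<bar>) ` {z. ucell J z = k})" for k by (rule bdd_aboveI2[of _ _ 2]) (rule dF)
  have osle: "\<bar>F z - st J z\<bar> \<le> os (ucell J z)" for z
    unfolding os_def st by (rule cSUP_upper[OF _ bdd]) simp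
  have ne: "{z. ucell J z = k} \<noteq> {}" if "k < 2 ^ J" for k using ucell_urep[OF that] by blast
  have os2: "\<bar>os k\<bar> \<le> 2" "0 \<le> os k" if "k < 2 ^ J" for k
  proof -
    have "os k \<le> 2" unfolding os_def by (rule cSUP_least[OF ne[OF that] dF])
    moreover show "0 \<le> os k" using osle[of "urep J k"] ucell_urep[OF that] by (metis abs_ge_zero order.trans)
    ultimately show "\<bar>os k\<bar> \<le> 2" by simp
  qed
  have ossum: "(\<Sum>k<2 ^ J. os k) \<le> V"
  proof (rule field_le_epsilon)
    fix \<epsilon> :: real assume \<epsilon>: "\<epsilon> > 0"
    \<comment> \<open>The suprema need not be attained; near-maximizers, one per cell, still form a
      family to which \<open>cell_variation\<close> applies.\<close>
    have "\<exists>z. ucell J z = k \<and> os k - \<epsilon> / 2 ^ J < \<bar>F z - F (urep J k)\<bar>" if "k < 2 ^ J" for k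
    proof -
      have "os k - \<epsilon> / 2 ^ J < os k" using \<epsilon> by simp
      then show ?thesis unfolding os_def less_cSUP_iff[OF ne[OF that] bdd] by blast
    qed
    then obtain z where z: "\<And>k. k < 2 ^ J \<Longrightarrow> ucell J (z k) = k \<and> os k - \<epsilon> / 2 ^ J < \<bar>F (z k) - F (urep J k)\<bar>" by metis
    have "(\<Sum>k<2 ^ J. os k) \<le> (\<Sum>k<2 ^ J. \<bar>F (z k) - F (urep J k)\<bar> + \<epsilon> / 2 ^ J)"
      using z by (intro sum_mono) force
    also have "\<dots> = (\<Sum>k<2 ^ J. \<bar>F (z k) - F (urep J k)\<bar>) + \<epsilon>" by (simp add: sum.distrib)
    also have "(\<Sum>k<2 ^ J. \<bar>F (z k) - F (urep J k)\<bar>) \<le> V"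
      using z ucell_urep by (intro cell_variation[OF F(3), of _ J]) auto
    finally show "(\<Sum>k<2 ^ J. os k) \<le> V + \<epsilon>" by simp
  qed
  \<comment> \<open>What is left below level \<open>J\<close> is dominated by a step function. Its
    empirical mean differs from its integral by a deviation over cells, so
    \<open>cells_am_gm\<close> applies once more.\<close>
  define O' where "O' z = (\<Sum>k<2 ^ J. os k * ucell_ind J k z)" for z
  have O': "O' z = os (ucell J z)" for z unfolding O'_def by (rule ucell_ind_sum)
  have IO: "integrable \<nu> O'"
  proof (rule integrable_const_bound[of _ 2])
    show "O' \<in> borel_measurable \<nu>" unfolding O'_def[abs_def] using ucell_ind_measurable by measurable
  qed (use os2(1)[OF ucell_less] in \<open>auto simp: O'\<close>)
  have Iind: "(\<integral>z. ucell_ind J k z \<partial>\<nu>) \<le> 1 / 2 ^ J" if "k < 2 ^ J" for k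
    using ucell_prob[OF that] ucell_measurable[of J k] nu_sets unfolding ucell_ind_def by simp
  have EO: "(\<integral>z. O' z \<partial>\<nu>) \<le> V / 2 ^ J"
  proof -
    have I: "integrable \<nu> (ucell_ind J k)" for k
      by (rule integrable_const_bound[of _ 1]) (auto simp: ucell_ind_measurable ucell_ind_def)
    have "(\<integral>z. O' z \<partial>\<nu>) = (\<Sum>k<2 ^ J. \<integral>z. os k * ucell_ind J k z \<partial>\<nu>)"
      unfolding O'_def by (intro Bochner_Integration.integral_sum integrable_mult_right I)
    also have "\<dots> = (\<Sum>k<2 ^ J. os k * (\<integral>z. ucell_ind J k z \<partial>\<nu>))" by simp
    also have "\<dots> \<le> (\<Sum>k<2 ^ J. os k * (1 / 2 ^ J))" using os2(2) Iind by (intro sum_mono mult_left_mono) auto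
    also have "\<dots> = (\<Sum>k<2 ^ J. os k) * (1 / 2 ^ J)" by (rule sum_distrib_right[symmetric])
    also have "\<dots> \<le> V * (1 / 2 ^ J)" by (intro mult_right_mono ossum) auto
    finally show ?thesis by simp
  qed
  have "\<bar>dev \<nu> m Z O'\<bar> \<le> (\<Sum>k<2 ^ J. \<bar>os k\<bar> * \<bar>dev \<nu> m Z (ucell_ind J k)\<bar>)"
    unfolding O'_def[abs_def] dev_cells abs_mult[symmetric] by (rule sum_abs)
  also have "\<dots> \<le> \<tau> * V + usq m J Z / (2 * \<tau>)"
    by (rule cells_am_gm[OF \<tau> os2(1)]) (use ossum os2(2) in auto)
  finally have dO: "\<bar>dev \<nu> m Z O'\<bar> \<le> \<tau> * V + usq m J Z / (2 * \<tau>)" .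
  have last: "\<bar>dev \<nu> m Z F - dev \<nu> m Z (st J)\<bar> \<le> 2 * (V / 2 ^ J) + (\<tau> * V + usq m J Z / (2 * \<tau>))"
  proof -
    have i1: "\<bar>(\<integral>z. F z - st J z \<partial>\<nu>)\<bar> \<le> (\<integral>z. O' z \<partial>\<nu>)"
      unfolding real_norm_def[symmetric]
      by (rule Bochner_Integration.integral_norm_bound_integral[OF Bochner_Integration.integrable_diff[OF IF Ist] IO])
        (simp only: real_norm_def O' osle)
    have "\<bar>\<Sum>i<m. F (Z i) - st J (Z i)\<bar> \<le> (\<Sum>i<m. O' (Z i))"
      by (rule order.trans[OF sum_abs sum_mono]) (simp only: O' osle)
    then have i2: "\<bar>(\<Sum>i<m. F (Z i) - st J (Z i)) / m\<bar> \<le> (\<Sum>i<m. O' (Z i)) / m" by (simp add: divide_right_mono)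
    have i3: "(\<Sum>i<m. O' (Z i)) / m = (\<integral>z. O' z \<partial>\<nu>) - dev \<nu> m Z O'" by (simp add: dev_def)
    have "dev \<nu> m Z F - dev \<nu> m Z (st J) = (\<integral>z. F z - st J z \<partial>\<nu>) - (\<Sum>i<m. F (Z i) - st J (Z i)) / m"
      using dd[OF IF Ist[of J]] by (simp only: dev_def)
    then have "\<bar>dev \<nu> m Z F - dev \<nu> m Z (st J)\<bar> \<le> \<bar>(\<integral>z. F z - st J z \<partial>\<nu>)\<bar> + \<bar>(\<Sum>i<m. F (Z i) - st J (Z i)) / m\<bar>"
      by (simp only: abs_triangle_ineq4)
    also have "\<dots> \<le> (\<integral>z. O' z \<partial>\<nu>) + ((\<integral>z. O' z \<partial>\<nu>) - dev \<nu> m Z O')" using i1 i2 unfolding i3 by linarith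
    also have "\<dots> \<le> 2 * (V / 2 ^ J) + (\<tau> * V + usq m J Z / (2 * \<tau>))" using EO dO by linarith
    finally show ?thesis .
  qed
  have "(\<Sum>j<J. usq m (Suc j) Z / (2 * \<tau>)) \<le> (\<Sum>j\<le>J. usq m j Z) / (2 * \<tau>)"
  proof -
    have "(\<Sum>j<J. usq m (Suc j) Z) \<le> (\<Sum>j\<le>J. usq m j Z)"
      unfolding lessThan_Suc_atMost[symmetric] sum.lessThan_Suc_shift using usq_nonneg by simp
    then show ?thesis using \<tau> by (simp add: sum_divide_distrib[symmetric] divide_right_mono)
  qed
  moreover have "usq m J Z / (2 * \<tau>) \<le> (\<Sum>j\<le>J. usq m j Z) / (2 * \<tau>)"
    using \<tau> usq_nonneg by (intro divide_right_mono member_le_sum) auto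
  ultimately have "\<bar>dev \<nu> m Z F\<bar> \<le> (\<Sum>j<J. \<tau> * (2 * V)) + (\<Sum>j\<le>J. usq m j Z) / (2 * \<tau>) + 2 * (V / 2 ^ J) + \<tau> * V + (\<Sum>j\<le>J. usq m j Z) / (2 * \<tau>)"
    using tele last unfolding st0 sum.distrib by linarith
  also have "\<dots> = uniform_bound J V \<tau> m Z" unfolding uniform_bound_def using \<tau> by (simp add: field_simps)
  finally show ?thesis .
qed

lemma uniform_bound_measurable: "uniform_bound J V \<tau> m \<in> borel_measurable (PiM {0..<m} (\<lambda>_. \<nu>))"
  unfolding uniform_bound_def using usq_measurable by measurable

lemma uniform_bound_nonneg: "0 \<le> V \<Longrightarrow> 0 < \<tau> \<Longrightarrow> 0 \<le> uniform_bound J V \<tau> m Z"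
  unfolding uniform_bound_def using usq_nonneg
  by (intro add_nonneg_nonneg divide_nonneg_nonneg mult_nonneg_nonneg sum_nonneg) auto

text \<open>The value \<open>1 / sqrt (V * m)\<close> balances \<open>\<tau> * V\<close> against
  \<open>1 / (m * \<tau>)\<close>; both equal \<open>sqrt (V / m)\<close>.\<close>

lemma uniform_bound_expectation:
  assumes "V > 0" "m > 0"
  shows "(\<integral>\<^sup>+Z. ennreal (uniform_bound J V (1 / sqrt (V * m)) m Z) \<partial>PiM {0..<m} (\<lambda>_. \<nu>))
    \<le> ennreal (2 * V / 2 ^ J + (3 * real J + 2) * sqrt (V / m))"
proof -
  interpret prob_space \<nu> by (rule nu_prob)
  interpret P: product_prob_space "\<lambda>_. \<nu>" "{0..<m}" ..
  let ?P = "PiM {0..<m} (\<lambda>_. \<nu>)" and ?l = "1 / sqrt (V * m)"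
  let ?c = "2 * V / 2 ^ J + (2 * real J + 1) * (?l * V)"
  have l: "?l > 0" using assms by simp
  have c: "?c \<ge> 0" using assms l by (intro add_nonneg_nonneg mult_nonneg_nonneg) auto
  have lV: "?l * V = sqrt (V / m)" "1 / m / ?l = sqrt (V / m)"
  proof -
    have "sqrt V * sqrt V = V" "sqrt (real m) * sqrt (real m) = m" using assms by simp_all
    then show "?l * V = sqrt (V / m)" "1 / m / ?l = sqrt (V / m)"
      using assms by (auto simp: real_sqrt_mult real_sqrt_divide field_simps)
  qed
  have "(\<integral>\<^sup>+Z. ennreal (uniform_bound J V ?l m Z) \<partial>?P) = (\<integral>\<^sup>+Z. ennreal ?c + ennreal (1 / ?l) * (\<Sum>j\<le>J. ennreal (usq m j Z)) \<partial>?P)"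
  proof (rule nn_integral_cong)
    fix Z
    have "uniform_bound J V ?l m Z = ?c + 1 / ?l * (\<Sum>j\<le>J. usq m j Z)" by (simp add: uniform_bound_def)
    then show "ennreal (uniform_bound J V ?l m Z) = ennreal ?c + ennreal (1 / ?l) * (\<Sum>j\<le>J. ennreal (usq m j Z))"
      using c l usq_nonneg by (simp add: ennreal_plus ennreal_mult' sum_ennreal sum_nonneg del: ennreal_plus[symmetric])
  qed
  also have "\<dots> = ennreal ?c + ennreal (1 / ?l) * (\<Sum>j\<le>J. \<integral>\<^sup>+Z. ennreal (usq m j Z) \<partial>?P)"
    using usq_measurable by (simp add: nn_integral_add nn_integral_cmult nn_integral_sum P.emeasure_space_1)
  also have "\<dots> \<le> ennreal ?c + ennreal (1 / ?l) * (\<Sum>j\<le>J. ennreal (1 / m))"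
    by (intro add_left_mono mult_left_mono sum_mono usq_expectation assms) auto
  also have "\<dots> = ennreal (?c + 1 / ?l * (\<Sum>j\<le>J. 1 / m))"
    using c l by (simp only: sum_ennreal ennreal_plus ennreal_mult' sum_nonneg divide_nonneg_nonneg zero_le_one of_nat_0_le_iff less_imp_le mult_nonneg_nonneg real_sqrt_ge_zero)
  also have "?c + 1 / ?l * (\<Sum>j\<le>J. 1 / m) = 2 * V / 2 ^ J + (3 * real J + 2) * sqrt (V / m)"
  proof -
    have "1 / ?l * (\<Sum>j\<le>J. 1 / m) = (real J + 1) * (1 / m / ?l)" by simp
    then show ?thesis unfolding lV by (simp add: algebra_simps)
  qed
  finally show ?thesis .
qed

end

section \<open>Choice of the sizes\<close>

definition gen_block :: "nat \<Rightarrow> nat" where "gen_block n = nat \<lceil>sqrt (real n)\<rceil>"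
definition gen_width :: "nat \<Rightarrow> nat \<Rightarrow> nat" where "gen_width d n = (8 * d + 4) * gen_block n"
text \<open>With this \<open>M\<close> the width factor \<open>M ^ d\<close> is of order sqrt n,
  while the resolution \<open>1 / M\<^sup>2\<close> gives the error
  \<open>n powr (- \<beta> / d)\<close>.\<close>

definition disc_cells :: "nat \<Rightarrow> nat \<Rightarrow> nat" where "disc_cells d n = nat \<lceil>real n powr (1 / (2 * real d))\<rceil>"
definition disc_iter :: "real \<Rightarrow> nat \<Rightarrow> nat \<Rightarrow> nat" where "disc_iter \<beta> d n = nat \<lceil>\<beta> / real d * log 2 (real n)\<rceil>"
definition disc_W :: "real \<Rightarrow> nat \<Rightarrow> nat \<Rightarrow> nat" where
  "disc_W \<beta> d n = disc_width (holder_s \<beta>) d * disc_cells d n ^ d"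
text \<open>The summand \<open>4 * log 2 n\<close> is idle depth: it makes \<open>2 powr (Lt\<^sup>2)\<close> at least \<open>n\<close> in the bound on \<open>K\<close>.\<close>
definition disc_L :: "real \<Rightarrow> nat \<Rightarrow> nat \<Rightarrow> nat" where
  "disc_L \<beta> d n = disc_depth (holder_s \<beta>) d (disc_iter \<beta> d n) + nat \<lceil>4 * log 2 (real n)\<rceil>"
text \<open>The slope is of order \<open>M\<^sup>2\<close>, that is \<open>n powr (1 / d)\<close>,
  which is relaxed to n for all dimensions.\<close>

definition disc_K :: "real \<Rightarrow> nat \<Rightarrow> nat \<Rightarrow> real" where
  "disc_K \<beta> d n = 4 * FS_lip_const (holder_s \<beta>) d * real n"

lemma gen_block_bounds:
  assumes "n \<ge> 1" shows "n \<le> gen_block n * gen_block n" "real (gen_block n) \<le> 2 * sqrt (real n)"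
proof -
  have s1: "1 \<le> sqrt (real n)" using assms by simp
  have "sqrt (real n) \<le> real (gen_block n)" unfolding gen_block_def by linarith
  then have "sqrt (real n) * sqrt (real n) \<le> real (gen_block n) * real (gen_block n)" by (intro mult_mono) auto
  then have "real n \<le> real (gen_block n * gen_block n)" by simp
  then show "n \<le> gen_block n * gen_block n" by (simp only: of_nat_le_iff)
  show "real (gen_block n) \<le> 2 * sqrt (real n)" using s1 unfolding gen_block_def by linarith
qed

lemma gen_width_sq: assumes "n \<ge> 1" shows "(real (gen_width d n))\<^sup>2 \<le> (2 * (8 * real d + 4))\<^sup>2 * real n"
proof -
  have "real (gen_width d n) \<le> (2 * (8 * real d + 4)) * sqrt (real n)"
    using mult_left_mono[OF gen_block_bounds(2)[OF assms], of "8 * real d + 4"] by (simp add: gen_width_def mult_ac)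
  then have "(real (gen_width d n))\<^sup>2 \<le> ((2 * (8 * real d + 4)) * sqrt (real n))\<^sup>2" by (intro power_mono) auto
  also have "\<dots> = (2 * (8 * real d + 4))\<^sup>2 * real n" by (simp only: power_mult_distrib real_sqrt_pow2[OF of_nat_0_le_iff])
  finally show ?thesis .
qed

lemma disc_cells_bounds:
  assumes "n \<ge> 1" "d > 0"
  shows "disc_cells d n > 0" "real n powr (1 / (2 * real d)) \<le> real (disc_cells d n)"
    "real (disc_cells d n) ^ d \<le> 2 ^ d * sqrt (real n)" "(real (disc_cells d n))\<^sup>2 \<le> 4 * real n"
    "real n powr (1 / real d) \<le> (real (disc_cells d n))\<^sup>2"
proof -
  let ?x = "real n powr (1 / (2 * real d))"
  have x1: "1 \<le> ?x" using assms by (intro ge_one_powr_ge_zero) auto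
  show "disc_cells d n > 0" "?x \<le> real (disc_cells d n)" using x1 unfolding disc_cells_def by linarith+
  then have M: "?x \<le> real (disc_cells d n)" by simp
  have u: "real (disc_cells d n) \<le> 2 * ?x" using x1 unfolding disc_cells_def by linarith
  have "real (disc_cells d n) ^ d \<le> (2 * ?x) ^ d" using u by (intro power_mono) auto
  also have "\<dots> = 2 ^ d * ?x ^ d" by (rule power_mult_distrib)
  also have "?x ^ d = sqrt (real n)"
    using assms by (simp add: powr_realpow[symmetric] powr_powr powr_half_sqrt)
  finally show "real (disc_cells d n) ^ d \<le> 2 ^ d * sqrt (real n)" .
  have x2: "?x\<^sup>2 = real n powr (1 / real d)"
    using assms by (simp add: powr_power)
  have "(real (disc_cells d n))\<^sup>2 \<le> (2 * ?x)\<^sup>2" using u by (intro power_mono) auto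
  also have "\<dots> = 4 * real n powr (1 / real d)" by (simp only: power_mult_distrib x2) simp
  also have "\<dots> \<le> 4 * real n powr 1" using assms by (intro mult_left_mono powr_mono) auto
  finally show "(real (disc_cells d n))\<^sup>2 \<le> 4 * real n" by simp
  show "real n powr (1 / real d) \<le> (real (disc_cells d n))\<^sup>2"
    unfolding x2[symmetric] using M by (intro power_mono) auto
qed

lemma disc_error_rate:
  assumes "\<beta> > 0" "d > 0" "n \<ge> 2"
  shows "(1 / (real (disc_cells d n))\<^sup>2) powr \<beta> \<le> real n powr (- \<beta> / real d)"
    "(1/4 :: real) ^ disc_iter \<beta> d n \<le> real n powr (- \<beta> / real d)"
proof -
  have n1: "n \<ge> 1" using assms by simp
  have "(1 / (real (disc_cells d n))\<^sup>2) powr \<beta> \<le> (1 / real n powr (1 / real d)) powr \<beta>"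
    using disc_cells_bounds[OF n1 assms(2)] assms by (intro powr_mono2 divide_left_mono) auto
  also have "\<dots> = real n powr (- \<beta> / real d)"
    by (simp add: powr_divide powr_powr powr_minus_divide)
  finally show "(1 / (real (disc_cells d n))\<^sup>2) powr \<beta> \<le> real n powr (- \<beta> / real d)" .
  let ?r = "disc_iter \<beta> d n"
  have r: "\<beta> / real d * log 2 (real n) \<le> real ?r" unfolding disc_iter_def by linarith
  have "(1/4 :: real) ^ ?r \<le> (1/2) ^ ?r" by (intro power_mono) auto
  also have "\<dots> = 2 powr (- real ?r)" by (simp only: powr_minus powr_realpow[OF zero_less_numeral] power_one_over inverse_eq_divide)
  also have "\<dots> \<le> 2 powr (- (\<beta> / real d) * log 2 (real n))" using r by (intro powr_mono) auto
  also have "\<dots> = (2 powr log 2 (real n)) powr (- (\<beta> / real d))" by (simp add: powr_powr mult.commute)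
  also have "\<dots> = real n powr (- \<beta> / real d)" using assms by simp
  finally show "(1/4 :: real) ^ ?r \<le> real n powr (- \<beta> / real d)" .
qed

lemma ln_ge: "n \<ge> 2 \<Longrightarrow> ln 2 \<le> ln (real n)" "n \<ge> 2 \<Longrightarrow> 1 / 2 < ln (real n)"
proof -
  show 1: "n \<ge> 2 \<Longrightarrow> ln 2 \<le> ln (real n)" by simp
  show "n \<ge> 2 \<Longrightarrow> 1 / 2 < ln (real n)" using 1 ln2_ge_two_thirds by linarith
qed

lemma ceil_log_le:
  assumes "n \<ge> 2" "a \<ge> 0" shows "real (nat \<lceil>a * log 2 (real n)\<rceil>) \<le> (2 * a + 2) * ln (real n)"
proof -
  have l: "log 2 (real n) \<le> 2 * ln (real n)"
  proof -
    have "log 2 (real n) = ln (real n) / ln 2" by (simp add: log_def)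
    also have "\<dots> \<le> ln (real n) / (1/2)" using ln2_ge_two_thirds assms by (intro divide_left_mono) auto
    finally show ?thesis by simp
  qed
  have "0 \<le> a * log 2 (real n)" using assms by simp
  then have "real (nat \<lceil>a * log 2 (real n)\<rceil>) \<le> a * log 2 (real n) + 1" by linarith
  also have "\<dots> \<le> a * (2 * ln (real n)) + 2 * ln (real n)"
    using l assms ln_ge(2)[OF assms(1)] by (intro add_mono mult_left_mono) auto
  finally show ?thesis by (simp add: algebra_simps)
qed

lemma disc_size:
  assumes "\<beta> > 0" "d > 0"
  shows "\<exists>C>0. \<forall>n\<ge>2. real (disc_W \<beta> d n) * real (disc_L \<beta> d n) \<le> C * sqrt (real n) * ln (real n) ^ 2"
proof -
  let ?s = "holder_s \<beta>"
  define w where "w = real (disc_width ?s d) * 2 ^ d"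
  define k where "k = real (d * Suc ?s + 1)"
  define c where "c = 2 * (3 + k) + k * (2 * (\<beta> / real d) + 2) + 10"
  have k0: "k \<ge> 1" unfolding k_def by simp
  have w0: "w > 0" unfolding w_def disc_width_def by (intro mult_pos_pos) (simp_all add: add_pos_nonneg)
  have c0: "c > 0" unfolding c_def using k0 assms by (intro add_nonneg_pos add_nonneg_nonneg mult_nonneg_nonneg) auto
  have "real (disc_W \<beta> d n) * real (disc_L \<beta> d n) \<le> (2 * w * c) * sqrt (real n) * ln (real n) ^ 2" if n: "n \<ge> 2" for n
  proof -
    \<comment> \<open>From \<open>n = 2\<close> on this absorbs additive constants into the
      logarithm; it also supplies the second logarithm of the claim.\<close>
    have l: "1 \<le> 2 * ln (real n)" using ln_ge(2)[OF n] by linarith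
    have "real (disc_W \<beta> d n) = real (disc_width ?s d) * real (disc_cells d n) ^ d" by (simp add: disc_W_def)
    also have "\<dots> \<le> real (disc_width ?s d) * (2 ^ d * sqrt (real n))" using disc_cells_bounds(3)[of n d] n assms by (intro mult_left_mono) auto
    finally have W: "real (disc_W \<beta> d n) \<le> w * sqrt (real n)" by (simp add: w_def)
    have "real (disc_L \<beta> d n) = 3 + k + k * real (disc_iter \<beta> d n) + real (nat \<lceil>4 * log 2 (real n)\<rceil>)"
      unfolding disc_L_def disc_depth_def k_def by (simp add: algebra_simps)
    also have "\<dots> \<le> (3 + k) * (2 * ln (real n)) + k * ((2 * (\<beta> / real d) + 2) * ln (real n)) + (2 * 4 + 2) * ln (real n)"
      using k0 l n assms mult_left_mono[OF l, of "3 + k"] unfolding disc_iter_def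
      by (intro add_mono mult_left_mono ceil_log_le) auto
    also have "\<dots> = c * ln (real n)" by (simp add: c_def algebra_simps)
    finally have L: "real (disc_L \<beta> d n) \<le> c * ln (real n)" .
    have "real (disc_W \<beta> d n) * real (disc_L \<beta> d n) \<le> (w * sqrt (real n)) * (c * ln (real n))"
      using W L w0 by (intro mult_mono) auto
    also have "\<dots> = w * c * sqrt (real n) * ln (real n) * 1" by simp
    also have "\<dots> \<le> w * c * sqrt (real n) * ln (real n) * (2 * ln (real n))"
      using l w0 c0 n by (intro mult_left_mono) auto
    finally show ?thesis by (simp add: power2_eq_square)
  qed
  moreover have "2 * w * c > 0" using w0 c0 by simp
  ultimately show ?thesis by blast
qed

lemma log2_le: assumes "x \<ge> (1::real)" shows "log 2 x \<le> x"
proof -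
  have "ln x = ln (x / 2) + ln 2" using assms by (simp add: ln_div)
  also have "\<dots> \<le> (x / 2 - 1) + 1" using ln_le_minus_one[of "x / 2"] ln_le_minus_one[of 2] assms by (intro add_mono) auto
  also have "\<dots> \<le> x * ln 2" using ln2_ge_two_thirds mult_left_mono[of "1/2" "ln 2" x] assms by simp
  finally show ?thesis by (simp add: log_def divide_le_eq)
qed

lemma log2_le_sqrt: assumes "x \<ge> (1::real)" shows "log 2 x \<le> 2 * sqrt x"
proof -
  have "log 2 x = log 2 ((sqrt x) ^ 2)" using assms by simp
  also have "\<dots> = 2 * log 2 (sqrt x)" using assms by (subst log_nat_power) auto
  also have "\<dots> \<le> 2 * sqrt x" using log2_le[of "sqrt x"] assms by simp
  finally show ?thesis .
qed

text \<open>\<open>L / log 2 L\<close> is at least \<open>sqrt L / 2\<close>, so its square is at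
  least \<open>L / 4\<close> and thus at least \<open>log 2 n\<close>: the last factor alone reaches
  n, and the others are at least 1.\<close>

lemma disc_K_bound:
  assumes n: "n \<ge> 2" and W: "W \<ge> (2::nat)" and L: "L \<ge> (2::nat)" "4 * log 2 (real n) \<le> real L" and e: "e \<ge> 0"
  shows "real n \<le> (real W / log 2 (real W) * (real L / log 2 (real L))) powr e * (real L / log 2 (real L)) * 2 powr ((real L / log 2 (real L)) ^ 2)"
proof -
  let ?w = "real W / log 2 (real W)" and ?l = "real L / log 2 (real L)"
  have w1: "1 \<le> ?w" using log2_le[of "real W"] W by simp
  have l1: "1 \<le> ?l" using log2_le[of "real L"] L by simp
  have "sqrt (real L) / 2 = real L / (2 * sqrt (real L))" using real_div_sqrt[of "real L"] by (simp add: field_simps)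
  also have "\<dots> \<le> ?l" using log2_le_sqrt[of "real L"] L by (intro divide_left_mono) auto
  finally have "(sqrt (real L) / 2)\<^sup>2 \<le> ?l\<^sup>2" by (intro power_mono) auto
  then have "real L / 4 \<le> ?l\<^sup>2" by (simp add: power_divide)
  then have "log 2 (real n) \<le> ?l\<^sup>2" using L by linarith
  then have "2 powr (log 2 (real n)) \<le> 2 powr (?l\<^sup>2)" by (intro powr_mono) auto
  then have n2: "real n \<le> 2 powr (?l\<^sup>2)" using n by simp
  have "1 * 1 \<le> ?w * ?l" using w1 l1 by (intro mult_mono) auto
  then have "1 \<le> (?w * ?l) powr e" using e by (intro ge_one_powr_ge_zero) auto
  then have "1 * 1 * real n \<le> (?w * ?l) powr e * ?l * 2 powr (?l\<^sup>2)"
    using l1 n2 by (intro mult_mono mult_nonneg_nonneg) auto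
  then show ?thesis by simp
qed

lemma FS_lip_const_pos: "FS_lip_const s d > 0"
  unfolding FS_lip_const_def using Lam_ge_1[of s d] by (intro mult_pos_pos add_pos_pos) auto

lemma disc_W_ge: "n \<ge> 1 \<Longrightarrow> d > 0 \<Longrightarrow> 2 \<le> disc_W \<beta> d n"
proof -
  assume "n \<ge> 1" "d > 0"
  then have "1 \<le> disc_cells d n ^ d" using disc_cells_bounds(1)[of n d] by (simp add: Suc_leI)
  moreover have "2 \<le> disc_width (holder_s \<beta>) d" by (simp add: disc_width_def)
  ultimately have "2 * 1 \<le> disc_width (holder_s \<beta>) d * disc_cells d n ^ d" by (intro mult_le_mono)
  then show ?thesis by (simp add: disc_W_def)
qed

lemma disc_L_ge: "2 \<le> disc_L \<beta> d n" "4 * log 2 (real n) \<le> real (disc_L \<beta> d n)"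
proof -
  show "2 \<le> disc_L \<beta> d n" by (simp add: disc_L_def disc_depth_def)
  have "4 * log 2 (real n) \<le> real (nat \<lceil>4 * log 2 (real n)\<rceil>)" by linarith
  then show "4 * log 2 (real n) \<le> real (disc_L \<beta> d n)" unfolding disc_L_def by simp
qed

section \<open>Variation, number of levels and latent sample size\<close>

definition var_bound :: "real \<Rightarrow> nat \<Rightarrow> nat \<Rightarrow> real" where
  "var_bound \<beta> d n = disc_K \<beta> d n * (real d * (real (gen_width d n + gen_width d n * (gen_width d n + 1)) + 1))"

text \<open>Chosen so that \<open>2 ^ J\<close> is at least \<open>n powr (2 + \<beta> / d)\<close>,
  which turns a variation of order n squared into \<open>n powr (- \<beta> / d)\<close>.\<close>

definition unif_level :: "real \<Rightarrow> nat \<Rightarrow> nat \<Rightarrow> nat" where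
  "unif_level \<beta> d n = nat \<lceil>(2 + \<beta> / real d) * log 2 (real n)\<rceil>"

lemma var_bound_le:
  assumes "d > 0"
  shows "\<exists>c>0. \<forall>n\<ge>2. 0 < var_bound \<beta> d n \<and> var_bound \<beta> d n \<le> c * (real n)\<^sup>2"
proof -
  define k where "k = 4 * FS_lip_const (holder_s \<beta>) d"
  define a where "a = (2 * (8 * real d + 4))\<^sup>2"
  have k0: "k > 0" unfolding k_def using FS_lip_const_pos by simp
  have "0 < var_bound \<beta> d n \<and> var_bound \<beta> d n \<le> (k * (real d * (2 * a + 2))) * (real n)\<^sup>2" if n: "n \<ge> 2" for n
  proof
    let ?g = "real (gen_width d n)"
    show "0 < var_bound \<beta> d n" unfolding var_bound_def disc_K_def using k0 n assms
      by (intro mult_pos_pos add_nonneg_pos) (auto simp: k_def)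
    have "2 * ?g \<le> ?g\<^sup>2 + 1" using zero_le_power2[of "?g - 1"] by (simp add: power2_eq_square algebra_simps)
    moreover have "real (gen_width d n + gen_width d n * (gen_width d n + 1)) = ?g\<^sup>2 + 2 * ?g"
      by (simp add: power2_eq_square algebra_simps)
    moreover have "?g\<^sup>2 \<le> a * real n" using gen_width_sq[of n d] n unfolding a_def by simp
    ultimately have "real (gen_width d n + gen_width d n * (gen_width d n + 1)) + 1 \<le> 2 * (a * real n) + 2" by linarith
    also have "\<dots> \<le> (2 * a + 2) * real n" using n by (simp add: algebra_simps)
    finally have b: "real (gen_width d n + gen_width d n * (gen_width d n + 1)) + 1 \<le> (2 * a + 2) * real n" .
    have "var_bound \<beta> d n \<le> k * real n * (real d * ((2 * a + 2) * real n))"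
      unfolding var_bound_def disc_K_def k_def[symmetric] using k0 by (intro mult_left_mono b) auto
    then show "var_bound \<beta> d n \<le> (k * (real d * (2 * a + 2))) * (real n)\<^sup>2" by (simp add: power2_eq_square mult_ac)
  qed
  moreover have "k * (real d * (2 * a + 2)) > 0" using k0 assms unfolding a_def by (intro mult_pos_pos add_nonneg_pos) auto
  ultimately show ?thesis by blast
qed

text \<open>\<open>V / m\<close> is at most a constant times
  \<open>n powr (- 2 * \<beta> / d)\<close> over the sixth power of the logarithm. The square root
  leaves three logarithms in the denominator, one of which pays for the number of levels.\<close>

lemma uniform_rate:
  assumes "\<beta> > 0" "d > 0" "cm > 0"
  shows "\<exists>C>0. \<forall>n\<ge>2. \<forall>m::nat. cm * real n powr (2 + 2 * \<beta> / real d) * ln (real n) ^ 6 \<le> real m \<longrightarrow>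
    2 * var_bound \<beta> d n / 2 ^ unif_level \<beta> d n + (3 * real (unif_level \<beta> d n) + 2) * sqrt (var_bound \<beta> d n / real m) \<le> C * rate \<beta> d n"
proof -
  obtain c where c: "c > 0" "\<And>n. n \<ge> 2 \<Longrightarrow> 0 < var_bound \<beta> d n \<and> var_bound \<beta> d n \<le> c * (real n)\<^sup>2"
    using var_bound_le[OF assms(2)] by blast
  define a where "a = 3 * (2 * (2 + \<beta> / real d) + 2) + 4"
  have a0: "a > 0" unfolding a_def using assms by (intro add_nonneg_pos mult_nonneg_nonneg) auto
  have "2 * var_bound \<beta> d n / 2 ^ unif_level \<beta> d n + (3 * real (unif_level \<beta> d n) + 2) * sqrt (var_bound \<beta> d n / real m)
    \<le> (2 * c + 4 * a * sqrt (c / cm)) * rate \<beta> d n"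
    if n: "n \<ge> 2" and m: "cm * real n powr (2 + 2 * \<beta> / real d) * ln (real n) ^ 6 \<le> real m" for n m :: nat
  proof -
    let ?J = "unif_level \<beta> d n" and ?V = "var_bound \<beta> d n" and ?p = "real n powr (- \<beta> / real d)"
    note V = c(2)[OF n]
    have l: "1/2 < ln (real n)" by (rule ln_ge(2)[OF n])
    have "2 powr ((2 + \<beta> / real d) * log 2 (real n)) \<le> 2 powr real ?J"
      unfolding unif_level_def by (intro powr_mono) linarith+
    moreover have "2 powr ((2 + \<beta> / real d) * log 2 (real n)) = real n powr (2 + \<beta> / real d)"
      using n by (simp add: mult.commute flip: powr_powr)
    ultimately have J2: "real n powr (2 + \<beta> / real d) \<le> 2 ^ ?J" by (simp add: powr_realpow)
    have "2 * ?V / 2 ^ ?J \<le> 2 * (c * (real n)\<^sup>2) / real n powr (2 + \<beta> / real d)"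
      using V c(1) J2 n by (intro frac_le) auto
    also have "\<dots> = 2 * c * ?p"
    proof -
      have "real n powr (2 + \<beta> / real d) = (real n)\<^sup>2 * real n powr (\<beta> / real d)" using n by (simp add: powr_add)
      then show ?thesis using n by (simp add: powr_minus divide_inverse)
    qed
    finally have 1: "2 * ?V / 2 ^ ?J \<le> 2 * c * ?p" .
    let ?m = "cm * real n powr (2 + 2 * \<beta> / real d) * ln (real n) ^ 6"
    have m0: "?m > 0" using assms n l by (intro mult_pos_pos zero_less_power) auto
    have "?V / real m \<le> c * (real n)\<^sup>2 / ?m" using V c(1) m m0 by (intro frac_le) auto
    also have "\<dots> = c / cm * (?p / ln (real n) ^ 3)\<^sup>2"
    proof -
      have "real n powr (2 + 2 * \<beta> / real d) = (real n)\<^sup>2 * (real n powr (\<beta> / real d))\<^sup>2"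
        using n by (simp add: powr_add powr_power)
      moreover have "?p = 1 / real n powr (\<beta> / real d)" by (simp add: powr_minus divide_inverse)
      ultimately show ?thesis using n
        by (simp add: power_divide power_mult_distrib flip: power_mult)
    qed
    finally have "sqrt (?V / real m) \<le> sqrt (c / cm * (?p / ln (real n) ^ 3)\<^sup>2)" by (rule real_sqrt_le_mono)
    also have "\<dots> = sqrt (c / cm) * (?p / ln (real n) ^ 3)" using l by (simp only: real_sqrt_mult real_sqrt_abs) simp
    finally have 2: "sqrt (?V / real m) \<le> sqrt (c / cm) * (?p / ln (real n) ^ 3)" .
    have "real ?J \<le> (2 * (2 + \<beta> / real d) + 2) * ln (real n)"
      unfolding unif_level_def using assms by (intro ceil_log_le n) auto
    then have "3 * real ?J + 2 \<le> a * ln (real n)" unfolding a_def using l by (simp add: distrib_right)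
    then have "(3 * real ?J + 2) * sqrt (?V / real m) \<le> (a * ln (real n)) * (sqrt (c / cm) * (?p / ln (real n) ^ 3))"
      using 2 a0 l V by (intro mult_mono) auto
    also have "\<dots> = a * sqrt (c / cm) * ?p * (1 / ln (real n) ^ 2)"
      using l by (simp add: power2_eq_square power3_eq_cube)
    also have "\<dots> \<le> a * sqrt (c / cm) * ?p * 4"
    proof (intro mult_left_mono)
      have "(1/2)\<^sup>2 \<le> ln (real n) ^ 2" using l by (intro power_mono) auto
      then have "1 / ln (real n) ^ 2 \<le> 1 / (1/2)\<^sup>2" using l by (intro divide_left_mono) auto
      then show "1 / ln (real n) ^ 2 \<le> 4" by (simp add: power2_eq_square)
    qed (use a0 c assms in auto)
    finally have "(3 * real ?J + 2) * sqrt (?V / real m) \<le> 4 * a * sqrt (c / cm) * ?p" by (simp add: mult_ac)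
    with 1 have "2 * ?V / 2 ^ ?J + (3 * real ?J + 2) * sqrt (?V / real m) \<le> (2 * c + 4 * a * sqrt (c / cm)) * ?p"
      by (simp add: distrib_right)
    also have "\<dots> \<le> (2 * c + 4 * a * sqrt (c / cm)) * rate \<beta> d n"
      using c a0 assms by (intro mult_left_mono rate_ge n) auto
    finally show ?thesis .
  qed
  moreover have "2 * c + 4 * a * sqrt (c / cm) > 0" using c a0 assms by (intro add_pos_nonneg) auto
  ultimately show ?thesis by blast
qed

section \<open>Risk bounds\<close>

lemma nn_hid_measurable:
  assumes "\<And>j. (\<lambda>x. v x j) \<in> borel_measurable M"
  shows "(\<lambda>x. nn_hid N Ts (v x) j) \<in> borel_measurable M"
  using assms
proof (induction N arbitrary: Ts v)
  case Nil
  then show ?case by simp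
next
  case (Cons k N)
  show ?case
  proof (cases Ts)
    case Nil
    then show ?thesis using Cons.prems by simp
  next
    case T: (Cons Ab Ts')
    obtain A b where Ab: "Ab = (A, b)" by (cases Ab)
    have "(\<lambda>x. relu_vec (\<lambda>j. (\<Sum>i<k. A j i * v x i) + b j) j) \<in> borel_measurable M" for j
      unfolding relu_vec_def relu_def using Cons.prems by measurable
    from Cons.IH[OF this] show ?thesis unfolding T Ab by simp
  qed
qed

lemma nn_class_measurable:
  fixes \<phi> :: "'a::euclidean_space \<Rightarrow> 'b::euclidean_space"
  assumes "\<phi> \<in> nn_class W L" shows "\<phi> \<in> borel_measurable borel"
  using assms unfolding nn_class_def mem_Collect_eq
proof (elim disjE exE conjE)
  fix f e assume f: "linear f" "\<phi> = (\<lambda>x. f x + e)"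
  have "continuous_on UNIV \<phi>" unfolding f(2)
    by (intro continuous_intros linear_continuous_on linear_conv_bounded_linear[THEN iffD1] f(1))
  then show ?thesis by (rule borel_measurable_continuous_onI)
next
  fix N Ts a c w e
  assume \<phi>: "\<phi> = (\<lambda>x. (\<Sum>i<last N. nn_hid N Ts (relu_vec (\<lambda>j. inner (a j) x + c j)) i *\<^sub>R w i) + e)"
  have "(\<lambda>x. relu_vec (\<lambda>j. inner (a j) x + c j) j) \<in> borel_measurable borel" for j
    unfolding relu_vec_def relu_def by measurable
  note [measurable] = nn_hid_measurable[OF this]
  show ?thesis unfolding \<phi> by measurable
qed

lemma nn_class_mono: "W \<le> W' \<Longrightarrow> L \<le> L' \<Longrightarrow> nn_class W L \<subseteq> nn_class W' L'"
  unfolding nn_class_def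
proof (intro subsetI, unfold mem_Collect_eq, elim disjE exE conjE, goal_cases)
  case (1 \<phi> f e)
  then show ?case by blast
next
  case (2 \<phi> N Ts a c w e)
  then show ?case
    by (intro disjI2 exI[of _ N] exI[of _ Ts] exI[of _ a] exI[of _ c] exI[of _ w] exI[of _ e]) auto
qed

lemma lip_class_mono: "K \<le> K' \<Longrightarrow> lip_class K B \<subseteq> lip_class K' B"
  unfolding lip_class_def using mult_right_mono[OF _ zero_le_dist] by (blast intro: order.trans)

lemma lip_class_measurable:
  fixes f :: "'a::metric_space \<Rightarrow> real"
  assumes "f \<in> lip_class K B" "K \<ge> 0" shows "f \<in> borel_measurable borel"
proof (rule borel_measurable_continuous_onI)
  have "K-lipschitz_on UNIV f" using assms unfolding lipschitz_on_def lip_class_def by (simp add: dist_real_def)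
  then show "continuous_on UNIV f" by (rule lipschitz_on_continuous_on)
qed

lemma integral_emp: "n > 0 \<Longrightarrow> (\<integral>x. f x \<partial>emp X n) = (\<Sum>i<n. f (X i)) / real n" for f :: "'a \<Rightarrow> real"
  unfolding emp_def integral_map_pmf by (subst integral_pmf_of_set) (auto simp: atLeast0LessThan)

lemma ipm_le: "(\<And>f. f \<in> F \<Longrightarrow> (\<integral>x. f x \<partial>P) - (\<integral>x. f x \<partial>Q) \<le> b) \<Longrightarrow> ipm F P Q \<le> ereal b"
  unfolding ipm_def by (intro SUP_least) simp

lemma ipm_ge: "f \<in> F \<Longrightarrow> ereal ((\<integral>x. f x \<partial>P) - (\<integral>x. f x \<partial>Q)) \<le> ipm F P Q"
  unfolding ipm_def by (rule SUP_upper)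

text \<open>\<open>Q\<close> is abstract: it is the image of \<nu> for one estimator and the image
  of the latent sample for the other.\<close>

lemma ipm_near_minimizer:
  assumes g: "ipm F P (Q g) \<le> (INF \<phi>\<in>G. ipm F P (Q \<phi>)) + ereal \<epsilon>" and \<phi>: "\<phi> \<in> G"
    and b: "\<And>f. f \<in> F \<Longrightarrow> (\<integral>x. f x \<partial>P) - (\<integral>x. f x \<partial>Q \<phi>) \<le> b" and f: "f \<in> F"
  shows "(\<integral>x. f x \<partial>P) - (\<integral>x. f x \<partial>Q g) \<le> b + \<epsilon>"
proof -
  have "ereal ((\<integral>x. f x \<partial>P) - (\<integral>x. f x \<partial>Q g)) \<le> ipm F P (Q g)" by (rule ipm_ge[OF f])
  also note g
  also have "(INF \<phi>\<in>G. ipm F P (Q \<phi>)) + ereal \<epsilon> \<le> ereal b + ereal \<epsilon>"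
    by (intro add_right_mono INF_lower2[OF \<phi>] ipm_le b)
  finally show ?thesis by simp
qed

lemma outer_exp_le_AE:
  assumes h: "h \<in> borel_measurable M" and ae: "AE x in M. e2ennreal (f x) \<le> h x"
  shows "outer_exp M f \<le> (\<integral>\<^sup>+x. h x \<partial>M)"
proof -
  obtain N where N: "\<And>x. x \<in> space M - N \<Longrightarrow> e2ennreal (f x) \<le> h x" "N \<in> null_sets M" using AE_E3[OF ae] by blast
  \<comment> \<open>The outer expectation wants a majorant that holds everywhere, so it is raised to
    infinity on the exceptional null set, at no cost to the integral.\<close>
  let ?h = "\<lambda>x. if x \<in> N then \<infinity> else h x"
  have "?h \<in> borel_measurable M" using h N(2) by (intro measurable_If_set) auto
  then have "outer_exp M f \<le> (\<integral>\<^sup>+x. ?h x \<partial>M)"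
    unfolding outer_exp_def by (intro INF_lower) (auto simp: N(1))
  also have "\<dots> = (\<integral>\<^sup>+x. h x \<partial>M)" using AE_not_in[OF N(2)] by (intro nn_integral_cong_AE) (auto elim: eventually_mono)
  finally show ?thesis .
qed

lemma outer_exp_le_AE_real:
  assumes "b \<in> borel_measurable M" "AE x in M. f x \<le> ereal (b x)"
  shows "outer_exp M f \<le> (\<integral>\<^sup>+x. ennreal (b x) \<partial>M)"
proof (rule outer_exp_le_AE)
  show "AE x in M. e2ennreal (f x) \<le> ennreal (b x)"
    using assms(2) by (rule eventually_mono) (metis e2ennreal_mono e2ennreal_ereal)
qed (use assms(1) in measurable)

lemma (in prob_space) nn_integral_plus_const:
  fixes f :: "'a \<Rightarrow> real"
  assumes f: "f \<in> borel_measurable M" "\<And>x. 0 \<le> f x" and c: "0 \<le> c"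
  shows "(\<integral>\<^sup>+x. ennreal (f x + c) \<partial>M) = (\<integral>\<^sup>+x. ennreal (f x) \<partial>M) + ennreal c"
proof -
  have "(\<integral>\<^sup>+x. ennreal (f x + c) \<partial>M) = (\<integral>\<^sup>+x. ennreal (f x) + ennreal c \<partial>M)"
    by (intro nn_integral_cong ennreal_plus f c)
  also have "\<dots> = (\<integral>\<^sup>+x. ennreal (f x) \<partial>M) + (\<integral>\<^sup>+x. ennreal c \<partial>M)"
    using f(1) by (intro nn_integral_add) auto
  finally show ?thesis by (simp add: emeasure_space_1)
qed

section \<open>The generator and discriminator classes\<close>

definition disc_class :: "real \<Rightarrow> nat \<Rightarrow> (real^'d::finite \<Rightarrow> real) set" where
  "disc_class \<beta> n = nn_class (disc_W \<beta> CARD('d) n) (disc_L \<beta> CARD('d) n) \<inter> lip_class (disc_K \<beta> CARD('d) n) 1"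

definition gen_class :: "nat \<Rightarrow> (real \<Rightarrow> real^'d::finite) set" where
  "gen_class n = {g \<in> nn_class (gen_width CARD('d) n) 2. \<forall>z. g z \<in> cbox 0 One}"

lemma disc_K_nonneg: "0 \<le> disc_K \<beta> d n"
  unfolding disc_K_def using FS_lip_const_pos[of "holder_s \<beta>" d] by simp

lemma disc_classD:
  fixes f :: "real^'d::finite \<Rightarrow> real"
  assumes "f \<in> disc_class \<beta> n"
  shows "f \<in> borel_measurable borel" "\<bar>f x\<bar> \<le> 1" "\<bar>f x - f y\<bar> \<le> disc_K \<beta> CARD('d) n * dist x y"
proof -
  have f: "f \<in> lip_class (disc_K \<beta> CARD('d) n) 1" using assms unfolding disc_class_def by blast
  show "f \<in> borel_measurable borel" by (rule lip_class_measurable[OF f disc_K_nonneg])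
  show "\<bar>f x\<bar> \<le> 1" "\<bar>f x - f y\<bar> \<le> disc_K \<beta> CARD('d) n * dist x y" using f unfolding lip_class_def by blast+
qed

lemma disc_err_const_nonneg: "0 \<le> disc_err_const \<beta> d"
  unfolding disc_err_const_def using Lam_ge_1[of "holder_s \<beta>" d] by (simp add: le_max_iff_disj)

lemma disc_class_approx:
  fixes h :: "real^'d::finite \<Rightarrow> real"
  assumes \<beta>: "\<beta> > 0" and h: "h \<in> holder_class \<beta>" and n: "n \<ge> 2"
  shows "\<exists>f\<in>disc_class \<beta> n. \<forall>x\<in>cbox 0 One. \<bar>h x - f x\<bar> \<le> 2 * disc_err_const \<beta> CARD('d) * rate \<beta> CARD('d) n"
proof -
  let ?d = "CARD('d)"
  have n1: "n \<ge> 1" using n by simp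
  note dc = disc_cells_bounds[OF n1 zero_less_card_finite[where 'a='d]]
  note de = disc_error_rate[OF \<beta> zero_less_card_finite[where 'a='d] n]
  obtain f where f: "f \<in> nn_class (disc_W \<beta> ?d n) (disc_depth (holder_s \<beta>) ?d (disc_iter \<beta> ?d n))"
     "f \<in> lip_class (FS_lip_const (holder_s \<beta>) ?d * (real (disc_cells ?d n))\<^sup>2) 1"
     "\<And>x. x \<in> cbox 0 One \<Longrightarrow> \<bar>h x - f x\<bar> \<le> disc_err_const \<beta> ?d * ((1 / (real (disc_cells ?d n))\<^sup>2) powr \<beta> + (1/4) ^ disc_iter \<beta> ?d n)"
    using discriminator_exists[OF \<beta> h dc(1), where r = "disc_iter \<beta> ?d n"] unfolding disc_W_def by blast
  have 1: "f \<in> nn_class (disc_W \<beta> ?d n) (disc_L \<beta> ?d n)"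
    using f(1) nn_class_mono[OF order.refl, of "disc_depth (holder_s \<beta>) ?d (disc_iter \<beta> ?d n)" "disc_L \<beta> ?d n"]
    unfolding disc_L_def by auto
  have "FS_lip_const (holder_s \<beta>) ?d * (real (disc_cells ?d n))\<^sup>2 \<le> FS_lip_const (holder_s \<beta>) ?d * (4 * real n)"
    using FS_lip_const_pos[of "holder_s \<beta>" ?d] by (intro mult_left_mono dc(4)) simp
  then have "FS_lip_const (holder_s \<beta>) ?d * (real (disc_cells ?d n))\<^sup>2 \<le> disc_K \<beta> ?d n" by (simp add: disc_K_def)
  from lip_class_mono[OF this] f(2) have 2: "f \<in> lip_class (disc_K \<beta> ?d n) 1" by blast
  have D: "disc_err_const \<beta> ?d \<ge> 0" using disc_err_const_nonneg .
  have "\<bar>h x - f x\<bar> \<le> 2 * disc_err_const \<beta> ?d * rate \<beta> ?d n" if x: "x \<in> cbox 0 One" for x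
  proof -
    have "(1 / (real (disc_cells ?d n))\<^sup>2) powr \<beta> + (1/4) ^ disc_iter \<beta> ?d n \<le> 2 * rate \<beta> ?d n"
      using de rate_ge(1)[OF n, of \<beta> ?d] by linarith
    then have "disc_err_const \<beta> ?d * ((1 / (real (disc_cells ?d n))\<^sup>2) powr \<beta> + (1/4) ^ disc_iter \<beta> ?d n) \<le> disc_err_const \<beta> ?d * (2 * rate \<beta> ?d n)"
      using D by (rule mult_left_mono)
    with f(3)[OF x] show ?thesis by simp
  qed
  with 1 2 show ?thesis unfolding disc_class_def by blast
qed

context
  fixes \<nu> :: "real measure" and \<beta> :: real
  assumes nu_prob: "prob_space \<nu>" and nu_sets: "sets \<nu> = sets borel" and nu_ac: "absolutely_continuous lborel \<nu>"
begin

lemma integral_pushforward: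
  fixes f :: "'b::topological_space \<Rightarrow> real"
  assumes "g \<in> borel_measurable borel" "f \<in> borel_measurable borel"
  shows "(\<integral>x. f x \<partial>distr \<nu> borel g) = (\<integral>z. f (g z) \<partial>\<nu>)"
  using assms by (intro integral_distr) (auto simp: measurable_cong_sets[OF nu_sets refl])

text \<open>The tolerance in \<open>generator_exists\<close> does not affect the size of the
  network, so it can be set to the rate itself.\<close>

lemma gen_class_approx:
  fixes X :: "nat \<Rightarrow> real^'d::finite"
  assumes n: "n \<ge> 2" and X: "\<And>i. i < n \<Longrightarrow> X i \<in> cbox 0 One"
  shows "\<exists>\<phi>\<in>gen_class n. \<forall>f\<in>disc_class \<beta> n.
    (\<Sum>i<n. f (X i)) / real n - (\<integral>z. f (\<phi> z) \<partial>\<nu>) \<le> rate \<beta> CARD('d) n"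
proof -
  have n0: "n > 0" "n \<ge> 1" using n by auto
  obtain \<phi> where \<phi>: "\<phi> \<in> nn_class (gen_width CARD('d) n) 2" "\<And>z. \<phi> z \<in> cbox 0 One"
    "\<And>f. f \<circ> \<phi> \<in> borel_measurable borel \<Longrightarrow> (\<forall>x. \<bar>f x\<bar> \<le> 1) \<Longrightarrow>
      \<bar>(\<Sum>i<n. f (X i)) / n - (\<integral>z. f (\<phi> z) \<partial>\<nu>)\<bar> \<le> rate \<beta> CARD('d) n"
    using generator_exists[where X = X, OF nu_prob nu_sets nu_ac n0(1) X rate_ge(4)[OF n, of \<beta> "CARD('d)"] gen_block_bounds(1)[OF n0(2)]]
    unfolding gen_width_def by blast
  have "(\<Sum>i<n. f (X i)) / real n - (\<integral>z. f (\<phi> z) \<partial>\<nu>) \<le> rate \<beta> CARD('d) n" if f: "f \<in> disc_class \<beta> n" for f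
  proof -
    have "f \<circ> \<phi> \<in> borel_measurable borel"
      using measurable_compose[OF nn_class_measurable[OF \<phi>(1)] disc_classD(1)[OF f]] by (simp add: comp_def)
    from abs_le_D1[OF \<phi>(3)[OF this]] disc_classD(2)[OF f] show ?thesis by blast
  qed
  with \<phi>(1,2) show ?thesis unfolding gen_class_def by blast
qed

lemma gen_class_deviation:
  fixes g :: "real \<Rightarrow> real^'d::finite"
  assumes g: "g \<in> gen_class n" and f: "f \<in> disc_class \<beta> n" and \<tau>: "\<tau> > 0" and m: "m > 0"
  shows "\<bar>(\<integral>z. f (g z) \<partial>\<nu>) - (\<Sum>j<m. f (g (Z j))) / real m\<bar> \<le> uniform_bound \<nu> J (var_bound \<beta> CARD('d) n) \<tau> m Z"
proof -
  have g2: "g \<in> nn_class (gen_width CARD('d) n) 2" "\<And>z i. 0 \<le> g z $ i \<and> g z $ i \<le> 1"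
    using g unfolding gen_class_def mem_unit_cube by auto
  have "var_le (\<lambda>z. f (g z)) (var_bound \<beta> CARD('d) n)"
    unfolding var_bound_def by (rule lip_comp_var[OF g2 disc_classD(3)[OF f] disc_K_nonneg])
  from dev_le_uniform_bound[OF nu_prob nu_sets nu_ac measurable_compose[OF nn_class_measurable[OF g2(1)] disc_classD(1)[OF f]] disc_classD(2)[OF f] this \<tau> m]
  show ?thesis unfolding dev_def .
qed

end

context
  fixes \<beta> :: real and \<mu> :: "(real^'d::finite) measure" and \<nu> :: "real measure"
  assumes beta_pos: "\<beta> > 0"
    and mu_prob: "prob_space \<mu>" and mu_sets: "sets \<mu> = sets borel"
    and mu_supp: "emeasure \<mu> (cbox 0 One) = 1"
    and nu_prob: "prob_space \<nu>" and nu_sets: "sets \<nu> = sets borel"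
    and nu_ac: "absolutely_continuous lborel \<nu>"
begin

text \<open>Replacing \<open>h\<close> by a discriminator costs the approximation error twice, under
  the sample and under the generated law, which both live on the cube; \<open>emp_bound\<close>
  covers the step from \<mu> to the sample.\<close>

lemma ipm_holder_le:
  assumes n: "n \<ge> 2" and X: "\<And>i. i < n \<Longrightarrow> X i \<in> cbox 0 One" and g: "g \<in> gen_class n"
    and b: "\<And>f. f \<in> disc_class \<beta> n \<Longrightarrow> (\<Sum>i<n. f (X i)) / real n - (\<integral>z. f (g z) \<partial>\<nu>) \<le> b"
  shows "ipm (holder_class \<beta>) \<mu> (distr \<nu> borel g) \<le> ereal (emp_bound \<beta> \<mu> (dlevel CARD('d) n) n X + 4 * disc_err_const \<beta> CARD('d) * rate \<beta> CARD('d) n + b)"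
proof (rule ipm_le)
  fix h :: "real^'d \<Rightarrow> real" assume h: "h \<in> holder_class \<beta>"
  interpret \<nu>: prob_space \<nu> by (rule nu_prob)
  let ?e = "2 * disc_err_const \<beta> CARD('d) * rate \<beta> CARD('d) n"
  have n0: "n > 0" using n by simp
  obtain f where f: "f \<in> disc_class \<beta> n" "\<And>x. x \<in> cbox 0 One \<Longrightarrow> \<bar>h x - f x\<bar> \<le> ?e"
    using disc_class_approx[OF beta_pos h n] by blast
  have gm: "g \<in> borel_measurable borel" using g nn_class_measurable unfolding gen_class_def by blast
  have hm: "h \<in> borel_measurable borel" by (intro borel_measurable_continuous_onI holder_class_continuous[OF beta_pos h])
  have I: "integrable \<nu> (\<lambda>z. u (g z))" if "u \<in> borel_measurable borel" "\<And>x. \<bar>u x\<bar> \<le> 1" for u :: "real^'d \<Rightarrow> real"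
    using that measurable_compose[OF gm that(1)]
    by (intro \<nu>.integrable_const_bound[where B = 1]) (auto simp: measurable_cong_sets[OF nu_sets refl])
  have If: "integrable \<nu> (\<lambda>z. f (g z))" by (intro I disc_classD(1,2)[OF f(1)])
  have Ih: "integrable \<nu> (\<lambda>z. h (g z))" by (intro I hm holder_class_bound[OF h])
  have "(\<integral>z. f (g z) \<partial>\<nu>) \<le> (\<integral>z. h (g z) + ?e \<partial>\<nu>)"
  proof (intro integral_mono If Bochner_Integration.integrable_add Ih)
    show "f (g z) \<le> h (g z) + ?e" for z using f(2)[of "g z"] g unfolding gen_class_def by auto
  qed simp
  then have 1: "(\<integral>z. f (g z) \<partial>\<nu>) \<le> (\<integral>z. h (g z) \<partial>\<nu>) + ?e" using Ih by (simp add: \<nu>.prob_space)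
  have "(\<Sum>i<n. h (X i)) \<le> (\<Sum>i<n. f (X i) + ?e)"
  proof (rule sum_mono)
    fix i assume "i \<in> {..<n}"
    then show "h (X i) \<le> f (X i) + ?e" using f(2)[OF X, of i] by auto
  qed
  then have "(\<Sum>i<n. h (X i)) / real n \<le> ((\<Sum>i<n. f (X i)) + real n * ?e) / real n"
    by (intro divide_right_mono) (simp_all add: sum.distrib)
  also have "\<dots> = (\<Sum>i<n. f (X i)) / real n + ?e" using n0 by (simp add: add_divide_distrib)
  finally have 2: "(\<Sum>i<n. h (X i)) / real n \<le> (\<Sum>i<n. f (X i)) / real n + ?e" .
  have "(\<integral>x. h x \<partial>\<mu>) - (\<Sum>i<n. h (X i)) / real n \<le> emp_bound \<beta> \<mu> (dlevel CARD('d) n) n X"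
    using dev_le_emp_bound[where X = X, OF beta_pos mu_prob mu_sets mu_supp h X n0] unfolding dev_def by blast
  with 1 2 b[OF f(1)] show "(\<integral>x. h x \<partial>\<mu>) - (\<integral>x. h x \<partial>distr \<nu> borel g) \<le> emp_bound \<beta> \<mu> (dlevel CARD('d) n) n X + 4 * disc_err_const \<beta> CARD('d) * rate \<beta> CARD('d) n + b"
    unfolding integral_pushforward[OF nu_prob nu_sets nu_ac gm hm] by argo
qed

lemma AE_sample_unit_cube:
  fixes n :: nat
  shows "AE X in PiM {0..<n} (\<lambda>_. \<mu>). \<forall>i<n. X i \<in> cbox 0 One"
proof -
  have "AE X in PiM {0..<n} (\<lambda>_. \<mu>). \<forall>i\<in>{0..<n}. X i \<in> cbox 0 One"
    by (intro eventually_ball_finite ballI AE_PiM_component AE_unit_cube[OF beta_pos mu_prob mu_sets mu_supp] mu_prob finite_atLeastLessThan) auto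
  then show ?thesis by (rule eventually_mono) auto
qed

lemma ennreal_sum_split:
  assumes "0 \<le> a" "0 \<le> b" "0 < r" "0 \<le> e"
  shows "ennreal (a * r) + ennreal (b * r + e) = ennreal e + ennreal ((a + b) * r)"
proof -
  have "0 \<le> a * r" "0 \<le> b * r" using assms by auto
  then show ?thesis using assms(4) unfolding distrib_right by (simp add: ac_simps)
qed

text \<open>The pointwise bound holds for almost every sample whatever rule \<open>est\<close>
  follows; only its measurable right-hand side is integrated.\<close>

lemma risk_population:
  shows "\<exists>C>0. \<forall>n\<ge>2. \<forall>\<epsilon>\<ge>0. \<forall>est.
    (\<forall>X\<in>space (PiM {0..<n} (\<lambda>_. \<mu>)). est X \<in> gen_class n \<and>
       ipm (disc_class \<beta> n) (emp X n) (distr \<nu> borel (est X))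
         \<le> (INF \<phi>\<in>gen_class n. ipm (disc_class \<beta> n) (emp X n) (distr \<nu> borel \<phi>)) + ereal \<epsilon>) \<longrightarrow>
    outer_exp (PiM {0..<n} (\<lambda>_. \<mu>)) (\<lambda>X. ipm (holder_class \<beta>) \<mu> (distr \<nu> borel (est X)))
      \<le> ennreal \<epsilon> + ennreal (C * rate \<beta> CARD('d) n)"
proof -
  obtain C1 where C1: "C1 > 0" "\<And>n. n \<ge> 2 \<Longrightarrow> (\<integral>\<^sup>+X. ennreal (emp_bound \<beta> \<mu> (dlevel CARD('d) n) n X) \<partial>PiM {0..<n} (\<lambda>_. \<mu>)) \<le> ennreal (C1 * rate \<beta> CARD('d) n)"
    using emp_bound_expectation[OF beta_pos mu_prob mu_sets mu_supp] by blast
  let ?D = "4 * disc_err_const \<beta> CARD('d) + 1"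
  have D0: "?D \<ge> 0" using disc_err_const_nonneg[of \<beta> "CARD('d)"] by simp
  have "outer_exp (PiM {0..<n} (\<lambda>_. \<mu>)) (\<lambda>X. ipm (holder_class \<beta>) \<mu> (distr \<nu> borel (est X)))
      \<le> ennreal \<epsilon> + ennreal ((C1 + ?D) * rate \<beta> CARD('d) n)"
    if n: "n \<ge> 2" and e: "\<epsilon> \<ge> 0"
      and est: "\<And>X. X \<in> space (PiM {0..<n} (\<lambda>_. \<mu>)) \<Longrightarrow> est X \<in> gen_class n \<and>
       ipm (disc_class \<beta> n) (emp X n) (distr \<nu> borel (est X))
         \<le> (INF \<phi>\<in>gen_class n. ipm (disc_class \<beta> n) (emp X n) (distr \<nu> borel \<phi>)) + ereal \<epsilon>" for n \<epsilon> est
  proof -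
    let ?P = "PiM {0..<n} (\<lambda>_. \<mu>)" and ?r = "rate \<beta> CARD('d) n" and ?E = "emp_bound \<beta> \<mu> (dlevel CARD('d) n) n"
    interpret P: prob_space ?P by (intro prob_space_PiM mu_prob)
    have n0: "n > 0" using n by simp
    have r0: "?r > 0" by (rule rate_ge(4)[OF n])
    have pt: "ipm (holder_class \<beta>) \<mu> (distr \<nu> borel (est X)) \<le> ereal (?E X + (?D * ?r + \<epsilon>))"
      if XS: "X \<in> space ?P" and X: "\<forall>i<n. X i \<in> cbox 0 One" for X
    proof -
      have X': "\<And>i. i < n \<Longrightarrow> X i \<in> cbox 0 One" using X by blast
      obtain \<phi> where \<phi>: "\<phi> \<in> gen_class n" "\<And>f. f \<in> disc_class \<beta> n \<Longrightarrow>
        (\<Sum>i<n. f (X i)) / real n - (\<integral>z. f (\<phi> z) \<partial>\<nu>) \<le> ?r"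
        using gen_class_approx[where X = X and \<beta> = \<beta>, OF nu_prob nu_sets nu_ac n X'] by blast
      have pf: "(\<integral>x. f x \<partial>distr \<nu> borel g) = (\<integral>z. f (g z) \<partial>\<nu>)" if "g \<in> gen_class n" "f \<in> disc_class \<beta> n" for f :: "real^'d \<Rightarrow> real" and g
        using that unfolding gen_class_def by (intro integral_pushforward[OF nu_prob nu_sets nu_ac] disc_classD(1)[OF that(2)]) (auto intro: nn_class_measurable)
      have "(\<Sum>i<n. f (X i)) / real n - (\<integral>z. f (est X z) \<partial>\<nu>) \<le> ?r + \<epsilon>" if f: "f \<in> disc_class \<beta> n" for f
      proof -
        have "(\<integral>x. f x \<partial>emp X n) - (\<integral>x. f x \<partial>distr \<nu> borel (est X)) \<le> ?r + \<epsilon>"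
        proof (rule ipm_near_minimizer[where Q = "distr \<nu> borel"])
          show "ipm (disc_class \<beta> n) (emp X n) (distr \<nu> borel (est X))
            \<le> (INF \<phi>\<in>gen_class n. ipm (disc_class \<beta> n) (emp X n) (distr \<nu> borel \<phi>)) + ereal \<epsilon>" using est[OF XS] by blast
        qed (use \<phi> f in \<open>auto simp: integral_emp[OF n0] pf\<close>)
        then show ?thesis using est[OF XS] f by (simp add: integral_emp[OF n0] pf)
      qed
      from ipm_holder_le[where X = X and g = "est X", OF n X' _ this] est[OF XS]
      have "ipm (holder_class \<beta>) \<mu> (distr \<nu> borel (est X)) \<le> ereal (?E X + 4 * disc_err_const \<beta> CARD('d) * ?r + (?r + \<epsilon>))" by blast
      then show ?thesis by (simp add: algebra_simps)
    qed
    have Em: "?E \<in> borel_measurable ?P" by (rule emp_bound_measurable[OF beta_pos mu_prob mu_sets mu_supp])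
    have E0: "0 \<le> ?E X" for X by (rule emp_bound_nonneg[OF beta_pos mu_prob mu_sets mu_supp])
    have c0: "0 \<le> ?D * ?r + \<epsilon>" using D0 r0 e by simp
    have "AE X in ?P. ipm (holder_class \<beta>) \<mu> (distr \<nu> borel (est X)) \<le> ereal (?E X + (?D * ?r + \<epsilon>))"
      using AE_sample_unit_cube AE_space by eventually_elim (rule pt)
    from outer_exp_le_AE_real[OF _ this]
    have "outer_exp ?P (\<lambda>X. ipm (holder_class \<beta>) \<mu> (distr \<nu> borel (est X))) \<le> (\<integral>\<^sup>+X. ennreal (?E X + (?D * ?r + \<epsilon>)) \<partial>?P)"
      using Em by measurable
    also have "\<dots> = (\<integral>\<^sup>+X. ennreal (?E X) \<partial>?P) + ennreal (?D * ?r + \<epsilon>)" by (rule P.nn_integral_plus_const[OF Em E0 c0])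
    also have "\<dots> \<le> ennreal (C1 * ?r) + ennreal (?D * ?r + \<epsilon>)" by (intro add_right_mono C1(2) n)
    also have "\<dots> = ennreal \<epsilon> + ennreal ((C1 + ?D) * ?r)" by (rule ennreal_sum_split[OF less_imp_le[OF C1(1)] D0 r0 e])
    finally show ?thesis .
  qed
  moreover have "C1 + ?D > 0" using C1(1) D0 by linarith
  ultimately show ?thesis by blast
qed

text \<open>Compared with \<open>risk_population\<close> the latent deviation is paid twice, for the
  competitor and for the selected generator. The latter depends on the latent sample itself, which
  is why a uniform bound is required.\<close>

lemma risk_sampled:
  fixes cm :: real
  assumes cm: "cm > 0"
  shows "\<exists>C>0. \<forall>n\<ge>2. \<forall>m::nat. real m \<ge> cm * real n powr (2 + 2 * \<beta> / real CARD('d)) * ln (real n) ^ 6 \<longrightarrow>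
    (\<forall>\<epsilon>\<ge>0. \<forall>est.
    (\<forall>XZ\<in>space (PiM {0..<n} (\<lambda>_. \<mu>) \<Otimes>\<^sub>M PiM {0..<m} (\<lambda>_. \<nu>)). est XZ \<in> gen_class n \<and>
       ipm (disc_class \<beta> n) (emp (fst XZ) n) (emp (est XZ \<circ> snd XZ) m)
         \<le> (INF \<phi>\<in>gen_class n. ipm (disc_class \<beta> n) (emp (fst XZ) n) (emp (\<phi> \<circ> snd XZ) m)) + ereal \<epsilon>) \<longrightarrow>
    outer_exp (PiM {0..<n} (\<lambda>_. \<mu>) \<Otimes>\<^sub>M PiM {0..<m} (\<lambda>_. \<nu>)) (\<lambda>XZ. ipm (holder_class \<beta>) \<mu> (distr \<nu> borel (est XZ)))
      \<le> ennreal \<epsilon> + ennreal (C * rate \<beta> CARD('d) n))"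
proof -
  obtain C1 where C1: "C1 > 0" "\<And>n. n \<ge> 2 \<Longrightarrow> (\<integral>\<^sup>+X. ennreal (emp_bound \<beta> \<mu> (dlevel CARD('d) n) n X) \<partial>PiM {0..<n} (\<lambda>_. \<mu>)) \<le> ennreal (C1 * rate \<beta> CARD('d) n)"
    using emp_bound_expectation[OF beta_pos mu_prob mu_sets mu_supp] by blast
  obtain C2 where C2: "C2 > 0" "\<And>n m. n \<ge> 2 \<Longrightarrow> cm * real n powr (2 + 2 * \<beta> / real CARD('d)) * ln (real n) ^ 6 \<le> real m \<Longrightarrow>
    2 * var_bound \<beta> CARD('d) n / 2 ^ unif_level \<beta> CARD('d) n + (3 * real (unif_level \<beta> CARD('d) n) + 2) * sqrt (var_bound \<beta> CARD('d) n / real m) \<le> C2 * rate \<beta> CARD('d) n"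
    using uniform_rate[OF beta_pos zero_less_card_finite[where 'a='d] cm] by blast
  let ?D = "4 * disc_err_const \<beta> CARD('d) + 1"
  have D0: "?D \<ge> 0" using disc_err_const_nonneg[of \<beta> "CARD('d)"] by simp
  have "outer_exp (PiM {0..<n} (\<lambda>_. \<mu>) \<Otimes>\<^sub>M PiM {0..<m} (\<lambda>_. \<nu>)) (\<lambda>XZ. ipm (holder_class \<beta>) \<mu> (distr \<nu> borel (est XZ)))
      \<le> ennreal \<epsilon> + ennreal ((C1 + 2 * C2 + ?D) * rate \<beta> CARD('d) n)"
    if n: "n \<ge> 2" and mn: "real m \<ge> cm * real n powr (2 + 2 * \<beta> / real CARD('d)) * ln (real n) ^ 6" and e: "\<epsilon> \<ge> 0"
      and est: "\<And>XZ. XZ \<in> space (PiM {0..<n} (\<lambda>_. \<mu>) \<Otimes>\<^sub>M PiM {0..<m} (\<lambda>_. \<nu>)) \<Longrightarrow> est XZ \<in> gen_class n \<and>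
       ipm (disc_class \<beta> n) (emp (fst XZ) n) (emp (est XZ \<circ> snd XZ) m)
         \<le> (INF \<phi>\<in>gen_class n. ipm (disc_class \<beta> n) (emp (fst XZ) n) (emp (\<phi> \<circ> snd XZ) m)) + ereal \<epsilon>" for n m \<epsilon> est
  proof -
    let ?P = "PiM {0..<n} (\<lambda>_. \<mu>)" and ?Q = "PiM {0..<m} (\<lambda>_. \<nu>)" and ?r = "rate \<beta> CARD('d) n"
      and ?E = "emp_bound \<beta> \<mu> (dlevel CARD('d) n) n" and ?V = "var_bound \<beta> CARD('d) n"
    define \<tau> where "\<tau> = 1 / sqrt (?V * m)"
    define U where "U = uniform_bound \<nu> (unif_level \<beta> CARD('d) n) ?V \<tau> m"
    interpret P: prob_space ?P by (intro prob_space_PiM mu_prob)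
    interpret Q: prob_space ?Q by (intro prob_space_PiM nu_prob)
    interpret PQ: pair_prob_space ?P ?Q ..
    have n0: "n > 0" using n by simp
    have r0: "?r > 0" by (rule rate_ge(4)[OF n])
    have "0 < cm * real n powr (2 + 2 * \<beta> / real CARD('d)) * ln (real n) ^ 6"
      using cm n by (intro mult_pos_pos zero_less_power) auto
    \<comment> \<open>The lower bound on \<open>m\<close> is positive, which excludes an empty
      latent sample.\<close>
    with mn have m0: "m > 0" by (cases m) auto
    have V0: "?V > 0" using var_bound_le[OF zero_less_card_finite[where 'a='d]] n by blast
    have \<tau>0: "\<tau> > 0" unfolding \<tau>_def using V0 m0 by simp
    have pt: "ipm (holder_class \<beta>) \<mu> (distr \<nu> borel (est XZ)) \<le> ereal (?E (fst XZ) + 2 * U (snd XZ) + (?D * ?r + \<epsilon>))"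
      if XS: "XZ \<in> space (?P \<Otimes>\<^sub>M ?Q)" and X: "\<forall>i<n. fst XZ i \<in> cbox 0 One" for XZ
    proof -
      have X': "\<And>i. i < n \<Longrightarrow> fst XZ i \<in> cbox 0 One" using X by blast
      obtain \<phi> where \<phi>: "\<phi> \<in> gen_class n" "\<And>f. f \<in> disc_class \<beta> n \<Longrightarrow>
        (\<Sum>i<n. f (fst XZ i)) / real n - (\<integral>z. f (\<phi> z) \<partial>\<nu>) \<le> ?r"
        using gen_class_approx[where X = "fst XZ" and \<beta> = \<beta>, OF nu_prob nu_sets nu_ac n X'] by blast
      have dv: "\<bar>(\<integral>z. f (g z) \<partial>\<nu>) - (\<integral>x. f x \<partial>emp (g \<circ> snd XZ) m)\<bar> \<le> U (snd XZ)"
        if "g \<in> gen_class n" "f \<in> disc_class \<beta> n" for f :: "real^'d \<Rightarrow> real" and g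
        using gen_class_deviation[OF nu_prob nu_sets nu_ac that \<tau>0 m0] unfolding U_def integral_emp[OF m0] by simp
      have "(\<Sum>i<n. f (fst XZ i)) / real n - (\<integral>z. f (est XZ z) \<partial>\<nu>) \<le> ?r + 2 * U (snd XZ) + \<epsilon>" if f: "f \<in> disc_class \<beta> n" for f
      proof -
        have "(\<integral>x. f x \<partial>emp (fst XZ) n) - (\<integral>x. f x \<partial>emp (est XZ \<circ> snd XZ) m) \<le> (?r + U (snd XZ)) + \<epsilon>"
        proof (rule ipm_near_minimizer[where Q = "\<lambda>g. emp (g \<circ> snd XZ) m", OF _ \<phi>(1) _ f])
          show "ipm (disc_class \<beta> n) (emp (fst XZ) n) (emp (est XZ \<circ> snd XZ) m)
            \<le> (INF \<phi>\<in>gen_class n. ipm (disc_class \<beta> n) (emp (fst XZ) n) (emp (\<phi> \<circ> snd XZ) m)) + ereal \<epsilon>" using est[OF XS] by blast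
          show "(\<integral>x. f x \<partial>emp (fst XZ) n) - (\<integral>x. f x \<partial>emp (\<phi> \<circ> snd XZ) m) \<le> ?r + U (snd XZ)" if "f \<in> disc_class \<beta> n" for f
            using abs_le_D1[OF dv[OF \<phi>(1) that]] \<phi>(2)[OF that] unfolding integral_emp[OF n0] by linarith
        qed
        moreover have "(\<integral>x. f x \<partial>emp (est XZ \<circ> snd XZ) m) - (\<integral>z. f (est XZ z) \<partial>\<nu>) \<le> U (snd XZ)"
          using abs_le_D2[OF dv[OF _ f, of "est XZ"]] est[OF XS] by simp
        ultimately show ?thesis unfolding integral_emp[OF n0] by linarith
      qed
      from ipm_holder_le[where X = "fst XZ" and g = "est XZ", OF n X' _ this] est[OF XS]
      have "ipm (holder_class \<beta>) \<mu> (distr \<nu> borel (est XZ)) \<le> ereal (?E (fst XZ) + 4 * disc_err_const \<beta> CARD('d) * ?r + (?r + 2 * U (snd XZ) + \<epsilon>))" by blast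
      then show ?thesis by (simp add: algebra_simps)
    qed
    have Em: "?E \<in> borel_measurable ?P" by (rule emp_bound_measurable[OF beta_pos mu_prob mu_sets mu_supp])
    have Um: "U \<in> borel_measurable ?Q" unfolding U_def by (rule uniform_bound_measurable[OF nu_prob nu_sets nu_ac])
    have E0: "0 \<le> ?E X" for X by (rule emp_bound_nonneg[OF beta_pos mu_prob mu_sets mu_supp])
    have U0: "0 \<le> 2 * U Z" for Z unfolding U_def using uniform_bound_nonneg[OF nu_prob nu_sets nu_ac less_imp_le[OF V0] \<tau>0] by simp
    have c0: "0 \<le> ?D * ?r + \<epsilon>" using D0 r0 e by simp
    have Em': "(\<lambda>XZ. ?E (fst XZ)) \<in> borel_measurable (?P \<Otimes>\<^sub>M ?Q)" using Em by (rule measurable_compose[OF measurable_fst])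
    have Um': "(\<lambda>XZ. 2 * U (snd XZ)) \<in> borel_measurable (?P \<Otimes>\<^sub>M ?Q)"
      by (intro borel_measurable_times borel_measurable_const measurable_compose[OF measurable_snd Um])
    \<comment> \<open>The almost sure statement about the first sample is carried over to the
      product through its first marginal.\<close>
    have "AE X in distr (?P \<Otimes>\<^sub>M ?Q) ?P fst. \<forall>i<n. X i \<in> cbox 0 One"
      unfolding Q.distr_pair_fst by (rule AE_sample_unit_cube)
    from AE_distrD[OF measurable_fst this] have ae: "AE XZ in ?P \<Otimes>\<^sub>M ?Q. \<forall>i<n. fst XZ i \<in> cbox 0 One" .
    have "AE XZ in ?P \<Otimes>\<^sub>M ?Q. ipm (holder_class \<beta>) \<mu> (distr \<nu> borel (est XZ)) \<le> ereal (?E (fst XZ) + 2 * U (snd XZ) + (?D * ?r + \<epsilon>))"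
      using ae AE_space by eventually_elim (rule pt)
    from outer_exp_le_AE_real[OF borel_measurable_add[OF borel_measurable_add[OF Em' Um'] borel_measurable_const] this]
    have "outer_exp (?P \<Otimes>\<^sub>M ?Q) (\<lambda>XZ. ipm (holder_class \<beta>) \<mu> (distr \<nu> borel (est XZ)))
      \<le> (\<integral>\<^sup>+XZ. ennreal (?E (fst XZ) + 2 * U (snd XZ) + (?D * ?r + \<epsilon>)) \<partial>(?P \<Otimes>\<^sub>M ?Q))"
      .
    also have "\<dots> = (\<integral>\<^sup>+XZ. ennreal (?E (fst XZ) + 2 * U (snd XZ)) \<partial>(?P \<Otimes>\<^sub>M ?Q)) + ennreal (?D * ?r + \<epsilon>)"
      by (rule PQ.nn_integral_plus_const[OF borel_measurable_add[OF Em' Um'] add_nonneg_nonneg[OF E0 U0] c0])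
    also have "(\<integral>\<^sup>+XZ. ennreal (?E (fst XZ) + 2 * U (snd XZ)) \<partial>(?P \<Otimes>\<^sub>M ?Q))
      = (\<integral>\<^sup>+X. ennreal (?E X) \<partial>?P) + (\<integral>\<^sup>+Z. ennreal (2 * U Z) \<partial>?Q)"
    proof -
      have "(\<integral>\<^sup>+XZ. ennreal (?E (fst XZ) + 2 * U (snd XZ)) \<partial>(?P \<Otimes>\<^sub>M ?Q)) = (\<integral>\<^sup>+X. \<integral>\<^sup>+Z. ennreal (2 * U Z + ?E X) \<partial>?Q \<partial>?P)"
        using borel_measurable_add[OF Em' Um'] by (subst Q.nn_integral_fst[symmetric]) (auto simp: add.commute)
      also have "\<dots> = (\<integral>\<^sup>+X. (\<integral>\<^sup>+Z. ennreal (2 * U Z) \<partial>?Q) + ennreal (?E X) \<partial>?P)"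
        by (intro nn_integral_cong Q.nn_integral_plus_const U0 E0 borel_measurable_times borel_measurable_const Um)
      also have "\<dots> = (\<integral>\<^sup>+Z. ennreal (2 * U Z) \<partial>?Q) + (\<integral>\<^sup>+X. ennreal (?E X) \<partial>?P)"
        using measurable_compose[OF Em measurable_ennreal] by (subst nn_integral_add) (simp_all add: P.emeasure_space_1)
      finally show ?thesis by (simp only: add.commute)
    qed
    also have "(\<integral>\<^sup>+Z. ennreal (2 * U Z) \<partial>?Q) = 2 * (\<integral>\<^sup>+Z. ennreal (U Z) \<partial>?Q)"
      using measurable_compose[OF Um measurable_ennreal] by (subst nn_integral_cmult[symmetric]) (simp_all add: ennreal_mult')
    also have "\<dots> \<le> 2 * ennreal (C2 * ?r)"
    proof (intro mult_left_mono)
      have "(\<integral>\<^sup>+Z. ennreal (U Z) \<partial>?Q) \<le> ennreal (2 * ?V / 2 ^ unif_level \<beta> CARD('d) n + (3 * real (unif_level \<beta> CARD('d) n) + 2) * sqrt (?V / real m))"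
        unfolding U_def \<tau>_def by (rule uniform_bound_expectation[OF nu_prob nu_sets nu_ac V0 m0])
      also have "\<dots> \<le> ennreal (C2 * ?r)" by (rule ennreal_leI[OF C2(2)[OF n mn]])
      finally show "(\<integral>\<^sup>+Z. ennreal (U Z) \<partial>?Q) \<le> ennreal (C2 * ?r)" .
    qed simp
    also have "2 * ennreal (C2 * ?r) = ennreal (2 * C2 * ?r)" using C2(1) r0 by (simp add: ennreal_mult' mult.assoc)
    also have "(\<integral>\<^sup>+X. ennreal (?E X) \<partial>?P) \<le> ennreal (C1 * ?r)" by (rule C1(2)[OF n])
    also have "ennreal (C1 * ?r) + ennreal (2 * C2 * ?r) = ennreal ((C1 + 2 * C2) * ?r)"
      using C1(1) C2(1) r0 by (simp add: distrib_right)
    also have "ennreal ((C1 + 2 * C2) * ?r) + ennreal (?D * ?r + \<epsilon>) = ennreal \<epsilon> + ennreal ((C1 + 2 * C2 + ?D) * ?r)"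
      using C1(1) C2(1) by (intro ennreal_sum_split D0 r0 e) simp
    finally show ?thesis by (simp add: add_mono)
  qed
  moreover have "C1 + 2 * C2 + ?D > 0" using C1(1) C2(1) D0 by linarith
  ultimately show ?thesis by blast
qed

end

lemma class_sizes:
  assumes "\<beta> > 0" "d > 0"
  shows "\<exists>C>0. \<forall>n\<ge>2. (real (gen_width d n))\<^sup>2 * real 2 \<le> C * real n \<and>
    real (disc_W \<beta> d n) * real (disc_L \<beta> d n) \<le> C * sqrt (real n) * ln (real n) ^ 2 \<and>
    disc_K \<beta> d n \<le> C * (real (disc_W \<beta> d n) / log 2 (real (disc_W \<beta> d n)) * (real (disc_L \<beta> d n) / log 2 (real (disc_L \<beta> d n)))) powr (2 + max (4 * \<beta> - 4) 0 / real d)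
      * (real (disc_L \<beta> d n) / log 2 (real (disc_L \<beta> d n))) * 2 powr ((real (disc_L \<beta> d n) / log 2 (real (disc_L \<beta> d n))) ^ 2)"
proof -
  obtain C2 where C2: "C2 > 0" "\<And>n. n \<ge> 2 \<Longrightarrow> real (disc_W \<beta> d n) * real (disc_L \<beta> d n) \<le> C2 * sqrt (real n) * ln (real n) ^ 2"
    using disc_size[OF assms] by blast
  define C1 where "C1 = 2 * (2 * (8 * real d + 4))\<^sup>2"
  define C3 where "C3 = 4 * FS_lip_const (holder_s \<beta>) d"
  have C3: "C3 > 0" unfolding C3_def using FS_lip_const_pos by simp
  have C1: "C1 \<ge> 0" unfolding C1_def by simp
  define C where "C = C1 + C2 + C3"
  have C: "C1 \<le> C" "C2 \<le> C" "C3 \<le> C" "C > 0" unfolding C_def using C1 C2(1) C3 by auto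
  have "(real (gen_width d n))\<^sup>2 * real 2 \<le> C * real n \<and>
    real (disc_W \<beta> d n) * real (disc_L \<beta> d n) \<le> C * sqrt (real n) * ln (real n) ^ 2 \<and>
    disc_K \<beta> d n \<le> C * (real (disc_W \<beta> d n) / log 2 (real (disc_W \<beta> d n)) * (real (disc_L \<beta> d n) / log 2 (real (disc_L \<beta> d n)))) powr (2 + max (4 * \<beta> - 4) 0 / real d)
      * (real (disc_L \<beta> d n) / log 2 (real (disc_L \<beta> d n))) * 2 powr ((real (disc_L \<beta> d n) / log 2 (real (disc_L \<beta> d n))) ^ 2)"
    (is "_ \<and> _ \<and> _ \<le> C * ?x * ?y * ?z") if n: "n \<ge> 2" for n
  proof (intro conjI)
    have n1: "n \<ge> 1" using n by simp
    have "(real (gen_width d n))\<^sup>2 * real 2 \<le> C1 * real n" using gen_width_sq[OF n1, of d] unfolding C1_def by simp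
    also have "\<dots> \<le> C * real n" using C(1) by (intro mult_right_mono) auto
    finally show "(real (gen_width d n))\<^sup>2 * real 2 \<le> C * real n" .
    have "C2 * (sqrt (real n) * ln (real n) ^ 2) \<le> C * (sqrt (real n) * ln (real n) ^ 2)" using C(2) by (intro mult_right_mono) auto
    with C2(2)[OF n] show "real (disc_W \<beta> d n) * real (disc_L \<beta> d n) \<le> C * sqrt (real n) * ln (real n) ^ 2" by (simp add: mult.assoc)
    have "2 + max (4 * \<beta> - 4) 0 / real d \<ge> 0" by simp
    from disc_K_bound[OF n disc_W_ge[OF n1 assms(2)] disc_L_ge this] have k: "real n \<le> ?x * ?y * ?z" .
    have "disc_K \<beta> d n = C3 * real n" unfolding disc_K_def C3_def ..
    also have "\<dots> \<le> C * (?x * ?y * ?z)" using C k by (intro mult_mono) auto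
    finally show "disc_K \<beta> d n \<le> C * ?x * ?y * ?z" by (simp only: mult.assoc)
  qed
  with C(4) show ?thesis by blast
qed

theorem theorem5:
  fixes \<beta> :: real
    and \<mu> :: "(real^'d::finite) measure"
    and \<nu> :: "real measure"
  assumes beta_pos: "\<beta> > 0"
    and mu_prob: "prob_space \<mu>" and mu_sets: "sets \<mu> = sets borel"
    and mu_supp: "emeasure \<mu> (cbox 0 One) = 1"
    and nu_prob: "prob_space \<nu>" and nu_sets: "sets \<nu> = sets borel"
    and nu_ac: "absolutely_continuous lborel \<nu>"
  shows "\<exists>C>0. \<exists>(W1::nat \<Rightarrow> nat) (L1::nat \<Rightarrow> nat) (W2::nat \<Rightarrow> nat) (L2::nat \<Rightarrow> nat) (K::nat \<Rightarrow> real).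
    let d = CARD('d);
        H = (holder_class \<beta> :: (real^'d \<Rightarrow> real) set);
        G = (\<lambda>n. {g \<in> (nn_class (W1 n) (L1 n) :: (real \<Rightarrow> real^'d) set). \<forall>z. g z \<in> cbox 0 One});
        F = (\<lambda>n. (nn_class (W2 n) (L2 n) :: (real^'d \<Rightarrow> real) set) \<inter> lip_class (K n) 1);
        Wt = (\<lambda>n. real (W2 n) / log 2 (real (W2 n)));
        Lt = (\<lambda>n. real (L2 n) / log 2 (real (L2 n)))
    in
    (\<forall>n\<ge>2.
       real (W1 n) ^ 2 * real (L1 n) \<le> C * real n \<and>
       2 \<le> W2 n \<and> 2 \<le> L2 n \<and>
       real (W2 n) * real (L2 n) \<le> C * sqrt (real n) * ln (real n) ^ 2 \<and>
       K n \<le> C * (Wt n * Lt n) powr (2 + max (4 * \<beta> - 4) 0 / real d) * Lt n * 2 powr (Lt n ^ 2) \<and>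
       (\<forall>\<epsilon>\<ge>0. \<forall>est :: (nat \<Rightarrow> real^'d) \<Rightarrow> (real \<Rightarrow> real^'d).
          (\<forall>X\<in>space (PiM {0..<n} (\<lambda>_. \<mu>)).
             est X \<in> G n \<and>
             ipm (F n) (emp X n) (distr \<nu> borel (est X))
               \<le> (INF \<phi>\<in>G n. ipm (F n) (emp X n) (distr \<nu> borel \<phi>)) + ereal \<epsilon>)
          \<longrightarrow> outer_exp (PiM {0..<n} (\<lambda>_. \<mu>)) (\<lambda>X. ipm H \<mu> (distr \<nu> borel (est X)))
                \<le> ennreal \<epsilon> + ennreal (C * rate \<beta> d n))) \<and>
    (\<forall>cm>0. \<exists>Cm>0. \<forall>n\<ge>2. \<forall>m::nat.
       real m \<ge> cm * real n powr (2 + 2 * \<beta> / real d) * ln (real n) ^ 6 \<longrightarrow>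
       (\<forall>\<epsilon>\<ge>0. \<forall>est :: (nat \<Rightarrow> real^'d) \<times> (nat \<Rightarrow> real) \<Rightarrow> (real \<Rightarrow> real^'d).
          (\<forall>XZ\<in>space (PiM {0..<n} (\<lambda>_. \<mu>) \<Otimes>\<^sub>M PiM {0..<m} (\<lambda>_. \<nu>)).
             est XZ \<in> G n \<and>
             ipm (F n) (emp (fst XZ) n) (emp (est XZ \<circ> snd XZ) m)
               \<le> (INF \<phi>\<in>G n. ipm (F n) (emp (fst XZ) n) (emp (\<phi> \<circ> snd XZ) m)) + ereal \<epsilon>)
          \<longrightarrow> outer_exp (PiM {0..<n} (\<lambda>_. \<mu>) \<Otimes>\<^sub>M PiM {0..<m} (\<lambda>_. \<nu>))
                 (\<lambda>XZ. ipm H \<mu> (distr \<nu> borel (est XZ)))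
                \<le> ennreal \<epsilon> + ennreal (Cm * rate \<beta> d n)))"
proof -
  let ?d = "CARD('d)"
  have d: "?d > 0" by simp
  obtain Ca where Ca: "Ca > 0" "\<And>n. n \<ge> 2 \<Longrightarrow> (real (gen_width ?d n))\<^sup>2 * real 2 \<le> Ca * real n"
    "\<And>n. n \<ge> 2 \<Longrightarrow> real (disc_W \<beta> ?d n) * real (disc_L \<beta> ?d n) \<le> Ca * sqrt (real n) * ln (real n) ^ 2"
    "\<And>n. n \<ge> 2 \<Longrightarrow> disc_K \<beta> ?d n \<le> Ca * (real (disc_W \<beta> ?d n) / log 2 (real (disc_W \<beta> ?d n)) * (real (disc_L \<beta> ?d n) / log 2 (real (disc_L \<beta> ?d n)))) powr (2 + max (4 * \<beta> - 4) 0 / real ?d)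
      * (real (disc_L \<beta> ?d n) / log 2 (real (disc_L \<beta> ?d n))) * 2 powr ((real (disc_L \<beta> ?d n) / log 2 (real (disc_L \<beta> ?d n))) ^ 2)"
    using class_sizes[OF beta_pos d] by blast
  note ctx = beta_pos mu_prob mu_sets mu_supp nu_prob nu_sets nu_ac
  obtain Cb where Cb: "Cb > 0" "\<And>n \<epsilon> est. n \<ge> 2 \<Longrightarrow> \<epsilon> \<ge> 0 \<Longrightarrow>
    (\<forall>X\<in>space (PiM {0..<n} (\<lambda>_. \<mu>)). est X \<in> gen_class n \<and>
       ipm (disc_class \<beta> n) (emp X n) (distr \<nu> borel (est X))
         \<le> (INF \<phi>\<in>gen_class n. ipm (disc_class \<beta> n) (emp X n) (distr \<nu> borel \<phi>)) + ereal \<epsilon>) \<Longrightarrow>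
    outer_exp (PiM {0..<n} (\<lambda>_. \<mu>)) (\<lambda>X. ipm (holder_class \<beta>) \<mu> (distr \<nu> borel (est X)))
      \<le> ennreal \<epsilon> + ennreal (Cb * rate \<beta> ?d n)"
    using risk_population[OF ctx] by blast
  \<comment> \<open>One constant for the size bounds and the population risk; the sampled risk gets
    its own constant, which depends on \<open>cm\<close>.\<close>
  define C where "C = max Ca Cb"
  have C: "Ca \<le> C" "Cb \<le> C" "C > 0" unfolding C_def using Ca(1) by auto
  have up: "Ca * a \<le> C * a" if "0 \<le> a" for a using C(1) that by (rule mult_right_mono)
  show ?thesis
    unfolding Let_def
  proof (rule exI[of _ C], rule conjI, rule C(3), rule exI[of _ "gen_width ?d"], rule exI[of _ "\<lambda>_. 2"],
      rule exI[of _ "disc_W \<beta> ?d"], rule exI[of _ "disc_L \<beta> ?d"], rule exI[of _ "disc_K \<beta> ?d"],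
      intro conjI allI impI, goal_cases)
    case (1 n) show ?case using order.trans[OF Ca(2)[OF 1] up[OF of_nat_0_le_iff]] .
  next
    case (2 n) then show ?case using disc_W_ge[of n ?d \<beta>] by simp
  next
    case (3 n) show ?case by (rule disc_L_ge(1))
  next
    case (4 n)
    have "0 \<le> sqrt (real n) * ln (real n) ^ 2" by simp
    from order.trans[OF Ca(3)[OF 4, unfolded mult.assoc] up[OF this]] show ?case by (simp only: mult.assoc)
  next
    case (5 n)
    let ?w = "real (disc_W \<beta> ?d n) / log 2 (real (disc_W \<beta> ?d n))" and ?l = "real (disc_L \<beta> ?d n) / log 2 (real (disc_L \<beta> ?d n))"
    have "0 \<le> (?w * ?l) powr (2 + max (4 * \<beta> - 4) 0 / real ?d) * ?l * 2 powr (?l ^ 2)"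
      using disc_L_ge(1)[of \<beta> ?d n] by (intro mult_nonneg_nonneg divide_nonneg_nonneg) auto
    from order.trans[OF Ca(4)[OF 5(1), unfolded mult.assoc] up[OF this, unfolded mult.assoc]] show ?case by (simp only: mult.assoc)
  next
    case (6 n \<epsilon> est)
    have "ennreal (Cb * rate \<beta> ?d n) \<le> ennreal (C * rate \<beta> ?d n)"
      using rate_ge(4)[OF 6(1), of \<beta> ?d] by (intro ennreal_leI mult_right_mono C(2)) simp
    from order.trans[OF Cb(2)[unfolded disc_class_def gen_class_def, OF 6(1,2,3)] add_left_mono[OF this]] show ?case .
  next
    case (7 cm)
    from risk_sampled[OF ctx 7(1), unfolded disc_class_def gen_class_def] show ?case .
  qed
qed

end
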